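(* Let $\rho_{\rm eq}\in W^{1,\infty}(-H,0)$ be such that $N^2=-g\frac{\rho_{\rm eq}'}{\rho_{\rm eq}}$ is constant and strictly positive on $(-H,0)$. Let $s\ge0$, $T>0$, and let $(U^{\rm lin},\rho^{\rm lin})\in C([0,T];H^{s,0})$, $U^{\rm lin}=(V^{\rm lin},w^{\rm lin})$, with pressure $P^{\rm lin}$, solve the linear equations $$\begin{cases}\partial_tV+\frac1{\rho_{\rm eq}}\nabla P=0,\\ \partial_tw+\frac1{\rho_{\rm eq}}\partial_zP+\frac{\rho}{\rho_{\rm eq}}g=0,\\ \partial_t\rho+w\frac{d}{dz}\rho_{\rm eq}=0,\\ \nabla\cdot V+\partial_zw=0,\end{cases}\qquad w|_{z=-H}=w|_{z=0}=0,$$ with initial data $(U^0,\rho^0)$, $U^0=(V^0,w^0)$, and assume that the vertical component of the vorticity is zero initially, that is, $\nabla^\perp\cdot V^{\rm lin}|_{t=0}=0$. Then the coefficients $(V_n,w_n,\rho_n,P_n)$ of the modal decompositions of $(V^{\rm lin},w^{\rm lin},\rho^{\rm lin},P^{\rm lin})$ defined in the context are found by solving, for all $n\ge1$, the equations $$\begin{cases}\big(1-\frac{c_n^2}{N^2}\Delta\big)\partial_tV_n+c_n\nabla\rho_n=0,\\ \partial_t\rho_n+c_n\nabla\cdot V_n=0,\end{cases}$$ with initial data given by the coefficients of the decompositions of $V^0$ and $\rho^0$, and $w_n$ and $P_n$ are given by $$w_n=-c_n\nabla\cdot V_n\quad\text{and}\quad P_n=c_n\rho_n+\frac{c_n}{N^2}\partial_tw_n,$$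 while for $n=0$ one must have $P_0=0$ and $V_0=0$. Moreover, $$\sum_{n=1}^\infty\big[|\rho_n|_{H^s}^2+|V_n|_{H^s}^2+|w_n|_{H^s}^2\big]<\infty.$$
   Context: $d\in\{1,2\}$, $H>0$, $g>0$, $\mathcal S=\mathbb R^d\times(-H,0)$ with horizontal variable $X\in\mathbb R^d$ and vertical variable $z$. $\nabla$, $\nabla^\perp$ and $\Delta$ act on $X$ only; when $d=1$, functions on $\mathbb R$ are identified with functions on $\mathbb R^2$ independent of the second variable. $V\in\mathbb R^d$ and $w\in\mathbb R$ are the horizontal and vertical components of $U$. The background density $\rho_{\rm eq}$ is bounded below by a positive constant. $\Lambda=(1-\Delta)^{1/2}$ and $H^{s,0}=L^2((-H,0);H^s(\mathbb R^d))$ with norm $\|\Lambda^su\|_{L^2(\mathcal S)}$; $|\cdot|_{H^s}$ is the norm of $H^s(\mathbb R^d)$. Let $(\mathbf f_n)_{n\ge1}$ be the orthonormal basis of $L^2((-H,0),\rho_{\rm eq}N^2dz)$ formed by the eigenfunctions of the Sturm-Liouville problem $$\frac{d}{dz}\Big(\rho_{\rm eq}\frac{d}{dz}\mathbf f_n\Big)+\frac{\rho_{\rm eq}N^2}{c_n^2}\mathbf f_n=0,\qquad\mathbf f_n(-H)=\mathbf f_n(0)=0,$$ with eigenvalues $1/c_n^2$, $c_1>c_2>\dots>0$. Set $\mathbf g_0=\alpha\rho_{\rm eq}^{-1}$ with $\alpha=\big(\int_{-H}^0\rho_{\rm eq}^{-1}\big)^{-1/2}$ and $\mathbf g_n=c_n\mathbf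 f_n'$ for $n\ge1$; $(\mathbf g_n)_{n\ge0}$ is an orthonormal basis of $L^2((-H,0),\rho_{\rm eq}dz)$. The modal decompositions are $$V=\sum_{n\ge0}V_n(t,X)\mathbf g_n(z),\quad w=\sum_{n\ge1}w_n(t,X)\mathbf f_n(z),$$ $$P=\sum_{n\ge0}P_n(t,X)\rho_{\rm eq}(z)\mathbf g_n(z),\quad\rho=\sum_{n\ge1}\frac1g\rho_n(t,X)\rho_{\rm eq}(z)N^2(z)\mathbf f_n(z).$$
   Formalization: The pressure is assumed to be in C([0,T];L²(S)), which fixes the free additive function of time; without this, zero velocity and density with pressure p(t) solve the equations and P_0 is not 0. *)

theory Defs
  imports "HOL-Analysis.Analysis"
begin

definition vert :: "real \<Rightarrow> real measure" where
  "vert H = restrict_space lborel {-H<..<0}"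

definition strip_set :: "real \<Rightarrow> ((real ^ 'd) \<times> real) set" where
  "strip_set H = UNIV \<times> {-H<..<0}"

definition strip :: "real \<Rightarrow> ((real ^ 'd) \<times> real) measure" where
  "strip H = restrict_space lborel (strip_set H)"

text \<open>Elements of Lebesgue spaces are represented by Borel functions; identities between them are
  stated almost everywhere.\<close>

definition L2 :: "'a measure \<Rightarrow> ('a \<Rightarrow> real) \<Rightarrow> bool" where
  "L2 M u \<longleftrightarrow> u \<in> borel_measurable M \<and> integrable M (\<lambda>x. (u x)\<^sup>2)"

definition L2norm :: "'a measure \<Rightarrow> ('a \<Rightarrow> real) \<Rightarrow> real" where
  "L2norm M u = sqrt (LINT x|M. (u x)\<^sup>2)"

definition L2_tendsto :: "'a measure \<Rightarrow> ('i \<Rightarrow> 'a \<Rightarrow> 'b::real_normed_vector) \<Rightarrow> ('a \<Rightarrow> 'b) \<Rightarrow> 'i filter \<Rightarrow> bool" where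
  "L2_tendsto M u v F \<longleftrightarrow> ((\<lambda>i. \<integral>\<^sup>+x. ennreal ((norm (u i x - v x))\<^sup>2) \<partial>M) \<longlongrightarrow> 0) F"

definition pd :: "'a::euclidean_space \<Rightarrow> ('a \<Rightarrow> real) \<Rightarrow> 'a \<Rightarrow> real" where
  "pd b f x = frechet_derivative f (at x) b"

fun Ck :: "nat \<Rightarrow> ('a::euclidean_space \<Rightarrow> real) \<Rightarrow> bool" where
  "Ck 0 f \<longleftrightarrow> continuous_on UNIV f"
| "Ck (Suc k) f \<longleftrightarrow> (\<forall>x. f differentiable (at x)) \<and> (\<forall>b\<in>Basis. Ck k (pd b f))"

definition test_fun :: "'a::euclidean_space set \<Rightarrow> ('a \<Rightarrow> real) \<Rightarrow> bool" where
  "test_fun \<Omega> \<phi> \<longleftrightarrow> (\<forall>k. Ck k \<phi>) \<and> compact (closure {x. \<phi> x \<noteq> 0}) \<and> closure {x. \<phi> x \<noteq> 0} \<subseteq> \<Omega>"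

text \<open>Distributions are represented as functionals on functions; only their values on test functions
  matter. The operations are defined by duality.\<close>

type_synonym 'a dist = "('a \<Rightarrow> real) \<Rightarrow> real"

definition reg :: "'a measure \<Rightarrow> ('a \<Rightarrow> real) \<Rightarrow> 'a dist" where
  "reg M u \<phi> = (LINT x|M. u x * \<phi> x)"

text \<open>A time dependent function \<open>u\<close> is only controlled for each fixed time (as a continuous curve in
  a function space), so that the associated distribution is defined by an iterated integral.\<close>

definition regT :: "real \<Rightarrow> 'a measure \<Rightarrow> (real \<Rightarrow> 'a \<Rightarrow> real) \<Rightarrow> (real \<times> 'a) dist" where
  "regT T M u \<phi> = (LINT t:{0..T}|lborel. (LINT x|M. u t x * \<phi> (t, x)))"

definition D :: "'a::euclidean_space \<Rightarrow> 'a dist \<Rightarrow> 'a dist" where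
  "D b F \<phi> = - F (pd b \<phi>)"

definition mult :: "('a \<Rightarrow> real) \<Rightarrow> 'a dist \<Rightarrow> 'a dist" where
  "mult a F \<phi> = F (\<lambda>x. a x * \<phi> x)"

abbreviation dt :: "real \<times> 'a::real_vector" where "dt \<equiv> (1, 0)"
abbreviation dx :: "'d \<Rightarrow> real \<times> (real ^ 'd)" where "dx i \<equiv> (0, axis i 1)"
abbreviation dX :: "'d \<Rightarrow> real \<times> ((real ^ 'd) \<times> real)" where "dX i \<equiv> (0, (axis i 1, 0))"
abbreviation dZ :: "real \<times> ((real ^ 'd) \<times> real)" where "dZ \<equiv> (0, (0, 1))"

text \<open>\<open>f\<close> belongs to \<open>W\<^sup>1\<^sup>,\<^sup>\<infinity>(a, b)\<close> and has the weak derivative \<open>f'\<close>.\<close>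

definition W1inf :: "real \<Rightarrow> real \<Rightarrow> (real \<Rightarrow> real) \<Rightarrow> (real \<Rightarrow> real) \<Rightarrow> bool" where
  "W1inf a b f f' \<longleftrightarrow>
     (let I = restrict_space lborel {a<..<b} in
       f \<in> borel_measurable I \<and> f' \<in> borel_measurable I \<and>
       (\<exists>C. AE z in I. \<bar>f z\<bar> \<le> C \<and> \<bar>f' z\<bar> \<le> C) \<and>
       (\<forall>\<phi>. test_fun {a<..<b} \<phi> \<longrightarrow> D 1 (reg I f) \<phi> = reg I f' \<phi>))"

text \<open>The Fourier transform on \<open>L\<^sup>2\<close>, as the \<open>L\<^sup>2\<close> limit of the transforms of the truncated functions,
  with the unitary normalization.\<close>

definition fourier_trunc :: "real \<Rightarrow> (real ^ 'd \<Rightarrow> real) \<Rightarrow> real ^ 'd \<Rightarrow> complex" where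
  "fourier_trunc R u \<xi> =
     (2 * pi) powr (- real CARD('d) / 2) *\<^sub>R (LINT X:cball 0 R|lborel. u X *\<^sub>R cis (- (\<xi> \<bullet> X)))"

definition is_fourier :: "(real ^ 'd \<Rightarrow> real) \<Rightarrow> (real ^ 'd \<Rightarrow> complex) \<Rightarrow> bool" where
  "is_fourier u v \<longleftrightarrow> L2 lborel u \<and> v \<in> borel_measurable lborel \<and> integrable lborel (\<lambda>\<xi>. (cmod (v \<xi>))\<^sup>2) \<and>
     L2_tendsto lborel (\<lambda>R. fourier_trunc R u) v at_top"

text \<open>\<open>is_Lambda s u v\<close>: \<open>v = \<Lambda>\<^sup>s u\<close> with \<open>u\<close> and \<open>v\<close> in \<open>L\<^sup>2\<close>, where \<open>\<Lambda>\<^sup>s\<close> is the Fourier multiplier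
  of symbol \<open>(1 + |\<xi>|\<^sup>2)\<^sup>s\<^sup>/\<^sup>2\<close>.\<close>

definition is_Lambda :: "real \<Rightarrow> (real ^ 'd \<Rightarrow> real) \<Rightarrow> (real ^ 'd \<Rightarrow> real) \<Rightarrow> bool" where
  "is_Lambda s u v \<longleftrightarrow>
     (\<exists>h. is_fourier u h \<and> is_fourier v (\<lambda>\<xi>. (1 + (norm \<xi>)\<^sup>2) powr (s / 2) *\<^sub>R h \<xi>))"

definition Hs :: "real \<Rightarrow> (real ^ 'd \<Rightarrow> real) \<Rightarrow> bool" where
  "Hs s u \<longleftrightarrow> (\<exists>v. is_Lambda s u v)"

definition Hs_norm :: "real \<Rightarrow> (real ^ 'd \<Rightarrow> real) \<Rightarrow> real" where
  "Hs_norm s u = L2norm lborel (SOME v. is_Lambda s u v)"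

text \<open>The space \<open>L\<^sup>2((-H, 0); H\<^sup>s)\<close>; here \<open>\<Lambda>\<^sup>s\<close> acts on the horizontal variable only.\<close>

definition is_Lambda_strip ::
  "real \<Rightarrow> real \<Rightarrow> ((real ^ 'd) \<times> real \<Rightarrow> real) \<Rightarrow> ((real ^ 'd) \<times> real \<Rightarrow> real) \<Rightarrow> bool" where
  "is_Lambda_strip H s u v \<longleftrightarrow> L2 (strip H) u \<and> L2 (strip H) v \<and>
     (AE z in vert H. is_Lambda s (\<lambda>X. u (X, z)) (\<lambda>X. v (X, z)))"

definition Hs0 :: "real \<Rightarrow> real \<Rightarrow> ((real ^ 'd) \<times> real \<Rightarrow> real) \<Rightarrow> bool" where
  "Hs0 H s u \<longleftrightarrow> (\<exists>v. is_Lambda_strip H s u v)"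

definition Hs0_norm :: "real \<Rightarrow> real \<Rightarrow> ((real ^ 'd) \<times> real \<Rightarrow> real) \<Rightarrow> real" where
  "Hs0_norm H s u = L2norm (strip H) (SOME v. is_Lambda_strip H s u v)"

text \<open>\<open>C([0,T]; E)\<close>, for a function space \<open>E\<close> given by its membership predicate and its norm.\<close>

definition cont_in ::
  "real \<Rightarrow> (('a \<Rightarrow> real) \<Rightarrow> bool) \<Rightarrow> (('a \<Rightarrow> real) \<Rightarrow> real) \<Rightarrow> (real \<Rightarrow> 'a \<Rightarrow> real) \<Rightarrow> bool" where
  "cont_in T E nrm u \<longleftrightarrow> (\<forall>t\<in>{0..T}. E (u t)) \<and>
     (\<forall>t\<in>{0..T}. ((\<lambda>r. nrm (\<lambda>x. u r x - u t x)) \<longlongrightarrow> 0) (at t within {0..T}))"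

text \<open>Vanishing trace at \<open>z = -H\<close> and \<open>z = 0\<close>: as a function of \<open>z\<close> with values in distributions of the
  horizontal variable, \<open>w\<close> is (weakly) continuous up to the boundary, where it vanishes.\<close>

definition zero_trace :: "real \<Rightarrow> ((real ^ 'd) \<times> real \<Rightarrow> real) \<Rightarrow> bool" where
  "zero_trace H w \<longleftrightarrow> (\<forall>\<phi>. test_fun UNIV \<phi> \<longrightarrow>
     (\<exists>h. continuous_on {-H..0} h \<and> h (-H) = 0 \<and> h 0 = 0 \<and>
          (AE z in vert H. reg lborel (\<lambda>X. w (X, z)) \<phi> = h z)))"

text \<open>The equations hold in the sense of distributions on \<open>(0,T) \<times> S\<close>; \<open>dr\<close> is the derivative of the
  background density \<open>r\<close>.\<close>

definition linear_euler ::
  "real \<Rightarrow> real \<Rightarrow> real \<Rightarrow> (real \<Rightarrow> real) \<Rightarrow> (real \<Rightarrow> real) \<Rightarrow>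
   (real \<Rightarrow> (real ^ 'd) \<times> real \<Rightarrow> real ^ 'd) \<Rightarrow> (real \<Rightarrow> (real ^ 'd) \<times> real \<Rightarrow> real) \<Rightarrow>
   (real \<Rightarrow> (real ^ 'd) \<times> real \<Rightarrow> real) \<Rightarrow> (real \<Rightarrow> (real ^ 'd) \<times> real \<Rightarrow> real) \<Rightarrow> bool" where
  "linear_euler T H g r dr V w \<rho> P \<longleftrightarrow>
     (\<forall>\<phi>. test_fun ({0<..<T} \<times> strip_set H) \<phi> \<longrightarrow>
        (\<forall>i. D dt (regT T (strip H) (\<lambda>t x. V t x $ i)) \<phi>
              + mult (\<lambda>(t, X, z). 1 / r z) (D (dX i) (regT T (strip H) P)) \<phi> = 0) \<and>
        D dt (regT T (strip H) w) \<phi>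
          + mult (\<lambda>(t, X, z). 1 / r z) (D dZ (regT T (strip H) P)) \<phi>
          + regT T (strip H) (\<lambda>t (X, z). \<rho> t (X, z) / r z * g) \<phi> = 0 \<and>
        D dt (regT T (strip H) \<rho>) \<phi> + regT T (strip H) (\<lambda>t (X, z). w t (X, z) * dr z) \<phi> = 0 \<and>
        (\<Sum>i\<in>UNIV. D (dX i) (regT T (strip H) (\<lambda>t x. V t x $ i)) \<phi>)
          + D dZ (regT T (strip H) w) \<phi> = 0) \<and>
     (\<forall>t\<in>{0..T}. zero_trace H (w t))"

text \<open>In dimension two, all the antisymmetric combinations below are \<open>0\<close> or, up to sign,
  \<open>\<nabla>\<^sup>\<bottom> \<cdot> V = \<partial>\<^sub>1 V\<^sub>2 - \<partial>\<^sub>2 V\<^sub>1\<close>. In dimension one the condition is void, as it is for \<open>V = (V\<^sub>1, 0)\<close>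
  independent of the second variable.\<close>

definition curl_free :: "real \<Rightarrow> ((real ^ 'd) \<times> real \<Rightarrow> real ^ 'd) \<Rightarrow> bool" where
  "curl_free H V \<longleftrightarrow> (\<forall>\<phi> i j. test_fun (strip_set H) \<phi> \<longrightarrow>
     D (axis i 1, 0) (reg (strip H) (\<lambda>x. V x $ j)) \<phi>
       - D (axis j 1, 0) (reg (strip H) (\<lambda>x. V x $ i)) \<phi> = 0)"

definition orthonormal_basis :: "'a measure \<Rightarrow> nat set \<Rightarrow> (nat \<Rightarrow> 'a \<Rightarrow> real) \<Rightarrow> bool" where
  "orthonormal_basis M J e \<longleftrightarrow> (\<forall>n\<in>J. L2 M (e n)) \<and>
     (\<forall>m\<in>J. \<forall>n\<in>J. (LINT z|M. e m z * e n z) = (if m = n then 1 else 0)) \<and>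
     (\<forall>u. L2 M u \<longrightarrow> (\<forall>n\<in>J. (LINT z|M. u z * e n z) = 0) \<longrightarrow> (AE z in M. u z = 0))"

definition sturm_liouville :: "real \<Rightarrow> (real \<Rightarrow> real) \<Rightarrow> real \<Rightarrow> real \<Rightarrow> (real \<Rightarrow> real) \<Rightarrow> bool" where
  "sturm_liouville H r N c f \<longleftrightarrow> continuous_on {-H..0} f \<and> f (-H) = 0 \<and> f 0 = 0 \<and>
     (\<forall>z\<in>{-H<..<0}. f differentiable (at z) \<and> (\<lambda>y. r y * deriv f y) differentiable (at z) \<and>
        deriv (\<lambda>y. r y * deriv f y) z + r z * N\<^sup>2 / c\<^sup>2 * f z = 0)"

definition modes :: "real \<Rightarrow> (real \<Rightarrow> real) \<Rightarrow> real \<Rightarrow> (nat \<Rightarrow> real) \<Rightarrow> (nat \<Rightarrow> real \<Rightarrow> real) \<Rightarrow> bool" where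
  "modes H r N c f \<longleftrightarrow> (\<forall>n\<ge>1. 0 < c n \<and> c (Suc n) < c n \<and> sturm_liouville H r N (c n) (f n)) \<and>
     orthonormal_basis (density (vert H) (\<lambda>z. ennreal (r z * N\<^sup>2))) {1..} f"

definition g_mode :: "real \<Rightarrow> (real \<Rightarrow> real) \<Rightarrow> (nat \<Rightarrow> real) \<Rightarrow> (nat \<Rightarrow> real \<Rightarrow> real) \<Rightarrow> nat \<Rightarrow> real \<Rightarrow> real" where
  "g_mode H r c f n z =
     (if n = 0 then (LINT y|vert H. 1 / r y) powr (- 1 / 2) / r z else c n * deriv (f n) z)"

text \<open>\<open>u(X, z) = \<Sum>\<^sub>n\<^sub>\<ge>\<^sub>k a\<^sub>n(X) e\<^sub>n(z)\<close> in \<open>L\<^sup>2\<close>.\<close>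

definition expansion ::
  "real \<Rightarrow> nat \<Rightarrow> (nat \<Rightarrow> real \<Rightarrow> real) \<Rightarrow> ((real ^ 'd) \<times> real \<Rightarrow> real) \<Rightarrow> (nat \<Rightarrow> real ^ 'd \<Rightarrow> real) \<Rightarrow> bool" where
  "expansion H k e u a \<longleftrightarrow> (\<forall>n\<ge>k. L2 lborel (a n)) \<and>
     L2_tendsto (strip H) (\<lambda>m (X, z). \<Sum>n=k..m. a n X * e n z) u sequentially"

text \<open>\<open>(V, \<rho>)\<close> is a solution in \<open>C([0,T]; H\<^sup>s)\<close>, with initial data \<open>(V0, \<rho>0)\<close>, of
  \<open>(1 - (c\<^sup>2/N\<^sup>2) \<Delta>) \<partial>\<^sub>t V + c \<nabla>\<rho> = 0\<close> and \<open>\<partial>\<^sub>t \<rho> + c \<nabla> \<cdot> V = 0\<close>.\<close>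

definition modal_solution ::
  "real \<Rightarrow> real \<Rightarrow> real \<Rightarrow> real \<Rightarrow> (real ^ 'd \<Rightarrow> real ^ 'd) \<Rightarrow> (real ^ 'd \<Rightarrow> real) \<Rightarrow>
   (real \<Rightarrow> real ^ 'd \<Rightarrow> real ^ 'd) \<Rightarrow> (real \<Rightarrow> real ^ 'd \<Rightarrow> real) \<Rightarrow> bool" where
  "modal_solution s T N c V0 \<rho>0 V \<rho> \<longleftrightarrow>
     (\<forall>i. cont_in T (Hs s) (Hs_norm s) (\<lambda>t X. V t X $ i)) \<and> cont_in T (Hs s) (Hs_norm s) \<rho> \<and>
     (\<forall>\<phi>. test_fun ({0<..<T} \<times> UNIV) \<phi> \<longrightarrow>
        (\<forall>i. D dt (regT T lborel (\<lambda>t X. V t X $ i)) \<phi>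
              - c\<^sup>2 / N\<^sup>2 * (\<Sum>j\<in>UNIV. D (dx j) (D (dx j) (D dt (regT T lborel (\<lambda>t X. V t X $ i)))) \<phi>)
              + c * D (dx i) (regT T lborel \<rho>) \<phi> = 0) \<and>
        D dt (regT T lborel \<rho>) \<phi> + c * (\<Sum>i\<in>UNIV. D (dx i) (regT T lborel (\<lambda>t X. V t X $ i)) \<phi>) = 0) \<and>
     (AE X in lborel. V 0 X = V0 X \<and> \<rho> 0 X = \<rho>0 X)"

end

theory Submission
  imports Defs "HOL-Probability.Probability" "HOL-Real_Asymp.Real_Asymp"
begin

text \<open>Testing the equations in \<open>z\<close> against the modes, cut off near the boundary, gives equations for the
  coefficients on \<open>(0,T) \<times> \<real>\<^sup>d\<close>; in the divergence constraint the boundary layer disappears because of the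
  vanishing trace of \<open>w\<close>. By the horizontal momentum equation the curl of each coefficient \<open>V\<^sub>n\<close> is conserved, hence
  zero, so that \<open>\<nabla>(\<nabla> \<cdot> V\<^sub>n) = \<Delta> V\<^sub>n\<close>, and eliminating \<open>P\<^sub>n\<close> and \<open>w\<^sub>n\<close> leaves the modal equations. For \<open>n = 0\<close> the
  pressure and the velocity are harmonic and square integrable, so they vanish.

  Tested against functions whose Fourier transform is supported in a fixed ball, the modal equations become
  linear ordinary differential equations with bounded coefficients. Iterating their integral form bounds the
  difference of two solutions by \<open>M (C t)\<^sup>n / n!\<close> for all \<open>n\<close>, which gives uniqueness.

  As \<open>\<Lambda>\<^sup>s\<close> commutes with integration in \<open>z\<close>, the coefficients of \<open>\<Lambda>\<^sup>s u\<close> are \<open>\<Lambda>\<^sup>s\<close> applied to those of \<open>u\<close>, and the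
  sum of their squared norms is bounded by Bessel's inequality at almost every \<open>X\<close>.\<close>

section \<open>Smooth functions and test functions\<close>

text \<open>Constancy of N enters in two ways. It makes \<open>r\<close> an exact exponential, so
  that a mode solves an equation with constant coefficients, is smooth inside (-H,0), and test
  functions may be multiplied or divided by \<open>r\<close>. It also keeps the vertical momentum
  equation diagonal: after division by \<open>r\<close> the z-derivative falls on N^2
  \<open>f n\<close>, and the result is a multiple of \<open>gm n\<close> because N^2 is not
  differentiated. The modes are not compactly supported, and cutting them off produces a derivative
  of size n on two layers of width 1/n. For \<open>f n\<close>, which vanishes linearly at both
  ends, this term is bounded and disappears by itself. For r times \<open>gm n\<close>, which need
  not vanish there, it is removed by the boundary values of w, and this is the only place where they
  enter. The uniqueness iteration costs one derivative of the test function per step, which no fixed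
  norm of a general test function can pay for; on spectra inside a fixed ball of radius R a
  derivative costs only a factor R.\<close>

lemma pd_eqI: "(f has_derivative f') (at x) \<Longrightarrow> pd b f x = f' b"
  by (drule frechet_derivative_at) (simp add: pd_def)

lemma pd_has_derivative: "f differentiable (at x) \<Longrightarrow> (f has_derivative (\<lambda>b. pd b f x)) (at x)"
  unfolding pd_def by (simp add: frechet_derivative_works[symmetric])

lemma has_derivative_real: "(f has_real_derivative d) (at x) \<Longrightarrow> f differentiable (at x)"
  by (auto simp: has_field_derivative_def differentiable_def)

lemma Ck_Suc_imp: "Ck (Suc k) f \<Longrightarrow> Ck k f"
proof (induction k arbitrary: f)
  case 0
  then have "\<forall>x. f differentiable (at x)" by simp
  then show ?case
    by (auto simp: continuous_on_eq_continuous_at differentiable_imp_continuous_within)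
next
  case (Suc k)
  then show ?case by (metis Ck.simps(2))
qed

lemma Ck_const [simp]: "Ck k (\<lambda>x. a)"
proof (induction k arbitrary: a)
  case (Suc k)
  have "pd b (\<lambda>x. a) = (\<lambda>x. 0)" for b :: 'a
    by (rule ext, rule pd_eqI) (rule derivative_eq_intros refl)+
  with Suc show ?case by simp
qed auto

lemma pd_add:
  assumes "f differentiable (at x)" "g differentiable (at x)"
  shows "pd b (\<lambda>x. f x + g x) x = pd b f x + pd b g x"
  by (rule pd_eqI[OF has_derivative_add[OF assms[THEN pd_has_derivative]]])

lemma pd_cmult:
  assumes "f differentiable (at x)"
  shows "pd b (\<lambda>x. a * f x) x = a * pd b f x"
  by (rule pd_eqI[OF has_derivative_mult_right[OF assms[THEN pd_has_derivative]]])

lemma pd_mult: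
  assumes "f differentiable (at x)" "g differentiable (at x)"
  shows "pd b (\<lambda>x. f x * g x) x = pd b f x * g x + f x * pd b g x"
  by (rule pd_eqI[OF has_derivative_mult[OF assms[THEN pd_has_derivative]], THEN trans]) simp

lemma Ck_add: "Ck k f \<Longrightarrow> Ck k g \<Longrightarrow> Ck k (\<lambda>x. f x + g x)"
proof (induction k arbitrary: f g)
  case 0 then show ?case by (auto intro: continuous_on_add)
next
  case (Suc k)
  then have "pd b (\<lambda>x. f x + g x) = (\<lambda>x. pd b f x + pd b g x)" for b
    by (auto intro!: pd_add)
  with Suc show ?case by (auto intro!: derivative_intros)
qed

lemma Ck_mult: "Ck k f \<Longrightarrow> Ck k g \<Longrightarrow> Ck k (\<lambda>x. f x * g x)"
proof (induction k arbitrary: f g)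
  case 0 then show ?case by (auto intro: continuous_on_mult)
next
  case (Suc k)
  then have *: "pd b (\<lambda>x. f x * g x) = (\<lambda>x. pd b f x * g x + f x * pd b g x)" for b
    by (auto intro!: pd_mult)
  have "Ck k f" "Ck k g" using Suc.prems Ck_Suc_imp by blast+
  with Suc show ?case
    by (auto intro!: derivative_intros Ck_add simp: *)
qed

lemma Ck_cmult: "Ck k f \<Longrightarrow> Ck k (\<lambda>x. a * f x)"
  using Ck_mult[OF Ck_const] .

lemma Ck_minus: "Ck k f \<Longrightarrow> Ck k (\<lambda>x. - f x)"
  using Ck_cmult[of k f "-1"] by simp

lemma Ck_diff: "Ck k f \<Longrightarrow> Ck k g \<Longrightarrow> Ck k (\<lambda>x. f x - g x)"
  using Ck_add[OF _ Ck_minus, of k f g] by simp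

lemma Ck_sum: "(\<And>i. i \<in> I \<Longrightarrow> Ck k (f i)) \<Longrightarrow> Ck k (\<lambda>x. \<Sum>i\<in>I. f i x)"
  by (induction I rule: infinite_finite_induct) (auto intro!: Ck_add)

lemma Ck_linear:
  fixes f :: "'a::euclidean_space \<Rightarrow> real"
  assumes "linear f" shows "Ck k f"
proof (cases k)
  case 0
  then show ?thesis using assms by (simp add: linear_continuous_on linear_conv_bounded_linear)
next
  case (Suc j)
  have "(f has_derivative f) (at x)" for x
    using assms by (simp add: linear_conv_bounded_linear bounded_linear_imp_has_derivative)
  then have "pd b f = (\<lambda>x. f b)" "f differentiable (at x)" for b x
    by (auto intro!: pd_eqI differentiableI)
  then show ?thesis using Suc by simp
qed

text \<open>\<open>Ck\<close> constrains the partial derivatives along \<open>Basis\<close> only,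
  while composition with a linear map produces derivatives along arbitrary vectors; this expands the
  latter.\<close>

lemma pd_sum_Basis:
  assumes "f differentiable (at x)"
  shows "pd v f x = (\<Sum>b\<in>Basis. (v \<bullet> b) * pd b f x)"
proof -
  have l: "linear (frechet_derivative f (at x))"
    using assms by (rule linear_frechet_derivative)
  have "pd v f x = frechet_derivative f (at x) (\<Sum>b\<in>Basis. (v \<bullet> b) *\<^sub>R b)"
    by (simp add: pd_def euclidean_representation)
  also have "\<dots> = (\<Sum>b\<in>Basis. (v \<bullet> b) * pd b f x)"
    using l by (simp add: linear_sum linear_scale pd_def)
  finally show ?thesis .
qed

lemma pd_compose_linear:
  assumes "linear L" "f differentiable (at (L x))"
  shows "pd b (\<lambda>x. f (L x)) x = pd (L b) f (L x)"
proof -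
  have "(L has_derivative L) (at x)"
    using assms by (simp add: linear_conv_bounded_linear bounded_linear_imp_has_derivative)
  then have "((\<lambda>x. f (L x)) has_derivative (\<lambda>h. pd (L h) f (L x))) (at x)"
    using has_derivative_compose[of L L x UNIV f] pd_has_derivative[OF assms(2)] by blast
  then show ?thesis by (rule pd_eqI)
qed

lemma Ck_compose_linear:
  assumes "linear L" "Ck k f" shows "Ck k (\<lambda>x. f (L x))"
  using assms(2)
proof (induction k arbitrary: f)
  case 0
  have "continuous_on UNIV L" using assms(1)
    by (simp add: linear_continuous_on linear_conv_bounded_linear)
  then show ?case using 0 by (auto intro: continuous_on_compose2)
next
  case (Suc k)
  have d: "f differentiable (at x)" for x using Suc.prems by simp
  have "pd b (\<lambda>x. f (L x)) = (\<lambda>x. \<Sum>b'\<in>Basis. (L b \<bullet> b') * pd b' f (L x))" for b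
    using assms(1) d by (auto simp: pd_compose_linear pd_sum_Basis[of f _ "L b"])
  moreover have "Ck k (\<lambda>x. \<Sum>b'\<in>Basis. (L b \<bullet> b') * pd b' f (L x))" for b
    using Suc by (intro Ck_sum Ck_cmult) auto
  moreover have "(\<lambda>x. f (L x)) differentiable (at x)" for x
    using d assms(1)
    by (intro differentiable_compose[where f=f and g=L]) (auto intro: linear_imp_differentiable)
  ultimately show ?case by simp
qed

lemma pd_compose_real:
  fixes g :: "real \<Rightarrow> real"
  assumes "g differentiable (at (f x))" "f differentiable (at x)"
  shows "pd b (\<lambda>x. g (f x)) x = pd 1 g (f x) * pd b f x"
proof -
  have "((\<lambda>x. g (f x)) has_derivative (\<lambda>h. pd (pd h f x) g (f x))) (at x)"
    using has_derivative_compose[OF pd_has_derivative[OF assms(2)] pd_has_derivative[OF assms(1)]] .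
  then have "pd b (\<lambda>x. g (f x)) x = frechet_derivative g (at (f x)) (pd b f x *\<^sub>R 1)"
    by (simp add: pd_eqI) (simp add: pd_def)
  also have "\<dots> = pd b f x *\<^sub>R frechet_derivative g (at (f x)) 1"
    using linear_frechet_derivative[OF assms(1)] by (rule linear_scale)
  finally show ?thesis by (simp add: pd_def)
qed

lemma Ck_compose_real:
  fixes g :: "real \<Rightarrow> real"
  shows "Ck k g \<Longrightarrow> Ck k f \<Longrightarrow> Ck k (\<lambda>x. g (f x))"
proof (induction k arbitrary: f g)
  case 0 then show ?case by (auto intro: continuous_on_compose2)
next
  case (Suc k)
  have d: "f differentiable (at x)" "g differentiable (at y)" for x y using Suc.prems by simp_all
  have "pd b (\<lambda>x. g (f x)) = (\<lambda>x. pd 1 g (f x) * pd b f x)" for b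
    using d by (auto simp: pd_compose_real)
  moreover have "Ck k f" using Suc.prems Ck_Suc_imp by blast
  ultimately show ?case
    using Suc d by (auto intro!: Ck_mult differentiable_compose[where f=g and g=f])
qed

lemma pd_real_deriv: "(f has_real_derivative d) (at x) \<Longrightarrow> pd 1 f x = d"
  using pd_eqI[of f "(*) d" x 1] by (simp add: has_field_derivative_def)

lemma Ck_realI:
  fixes F :: "nat \<Rightarrow> real \<Rightarrow> real"
  assumes "\<And>j x. (F j has_real_derivative F (Suc j) x) (at x)"
  shows "Ck k (F j)"
proof (induction k arbitrary: j)
  case 0
  show ?case using assms by (auto simp: continuous_on_eq_continuous_at intro: DERIV_isCont)
next
  case (Suc k)
  have "pd 1 (F j) = F (Suc j)" using assms pd_real_deriv by blast
  then show ?case using Suc assms by (auto intro: has_derivative_real)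
qed

section \<open>A smooth transition function\<close>

definition flat :: "nat \<Rightarrow> real \<Rightarrow> real" where
  "flat j x = (if x > 0 then inverse x ^ j * exp (- inverse x) else 0)"

text \<open>The weight \<open>inverse x ^ j\<close> closes the family under differentiation, so one
  induction over all \<open>j\<close> gives the smoothness of \<open>flat 0\<close>, the classical
  exp(-1/x). At 0 both one-sided difference quotients tend to 0.\<close>

lemma flat_deriv: "(flat j has_real_derivative flat (j + 2) x - real j * flat (Suc j) x) (at x)"
proof (cases x "0::real" rule: linorder_cases)
  case greater
  have "((\<lambda>x. inverse x ^ j * exp (- inverse x)) has_real_derivative
      inverse x ^ (j + 2) * exp (- inverse x) - real j * (inverse x ^ Suc j * exp (- inverse x))) (at x)"
  proof (rule DERIV_cong)
    show "((\<lambda>x. inverse x ^ j * exp (- inverse x)) has_real_derivative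
      real j * inverse x ^ (j - 1) * - (inverse x * inverse x) * exp (- inverse x)
       + inverse x ^ j * (exp (- inverse x) * (inverse x * inverse x))) (at x)"
      using greater by (auto intro!: derivative_eq_intros)
    \<comment> \<open>For \<open>j = 0\<close> the exponent \<open>j - 1\<close> is truncated to 0,
      but the factor \<open>real j\<close> kills the term.\<close>
    have "real j * inverse x ^ (j - 1) * (inverse x * inverse x) = real j * inverse x ^ Suc j"
      by (cases j) auto
    then show "real j * inverse x ^ (j - 1) * - (inverse x * inverse x) * exp (- inverse x)
       + inverse x ^ j * (exp (- inverse x) * (inverse x * inverse x))
       = inverse x ^ (j + 2) * exp (- inverse x) - real j * (inverse x ^ Suc j * exp (- inverse x))"
      by (simp only: mult_minus_left mult_minus_right mult.assoc power_add power2_eq_square power_Suc) (simp add: ac_simps)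
  qed
  moreover have "\<forall>\<^sub>F y in nhds x. y > 0" using greater by (auto intro: eventually_nhds_in_open[of "{0<..}", simplified])
  then have "\<forall>\<^sub>F y in nhds x. flat j y = inverse y ^ j * exp (- inverse y)"
    by eventually_elim (simp add: flat_def)
  ultimately show ?thesis using greater DERIV_cong_ev[OF refl _ refl, where f = "flat j" and g = "\<lambda>x. inverse x ^ j * exp (- inverse x)"]
    by (simp add: flat_def)
next
  case less
  have "\<forall>\<^sub>F y in nhds x. y < 0" using less by (auto intro: eventually_nhds_in_open[of "{..<0}", simplified])
  then have "\<forall>\<^sub>F y in nhds x. flat j y = 0"
    by eventually_elim (simp add: flat_def)
  then show ?thesis using less DERIV_cong_ev[OF refl _ refl, where f = "flat j" and g = "\<lambda>x. 0"]
    by (simp add: flat_def)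
next
  case equal
  have "((\<lambda>h. flat j h / h) \<longlongrightarrow> 0) (at (0::real))"
  proof (rule filterlim_split_at)
    have "((\<lambda>h::real. inverse h ^ j * exp (- inverse h) / h) \<longlongrightarrow> 0) (at_right 0)"
      by real_asymp
    then show "((\<lambda>h. flat j h / h) \<longlongrightarrow> 0) (at_right (0::real))"
      by (rule Lim_transform_eventually) (auto simp: eventually_at_filter flat_def)
    show "((\<lambda>h. flat j h / h) \<longlongrightarrow> 0) (at_left (0::real))"
      by (rule Lim_transform_eventually[OF tendsto_const]) (auto simp: eventually_at_filter flat_def)
  qed
  then show ?thesis using equal by (simp add: DERIV_def flat_def)
qed

lemma Ck_flat: "Ck k (flat j)"
proof (induction k arbitrary: j)
  case 0
  show ?case using flat_deriv by (auto simp: continuous_on_eq_continuous_at intro: DERIV_isCont)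
next
  case (Suc k)
  have "pd 1 (flat j) = (\<lambda>x. flat (j + 2) x - real j * flat (Suc j) x)"
    using flat_deriv pd_real_deriv by blast
  then show ?case using Suc flat_deriv[of j]
    by (auto intro!: Ck_diff Ck_cmult intro: has_derivative_real simp del: add_2_eq_Suc')
qed

lemma Ck_inverse:
  assumes "\<And>x. f x \<noteq> 0"
  shows "Ck k f \<Longrightarrow> Ck k (\<lambda>x. inverse (f x))"
proof (induction k)
  case 0 then show ?case using assms by (auto intro: continuous_on_inverse)
next
  case (Suc k)
  have d: "f differentiable (at x)" for x using Suc.prems by simp
  have *: "pd b (\<lambda>x. inverse (f x)) = (\<lambda>x. - (pd b f x * (inverse (f x) * inverse (f x))))" for b
  proof
    fix x
    show "pd b (\<lambda>x. inverse (f x)) x = - (pd b f x * (inverse (f x) * inverse (f x)))"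
      by (rule pd_eqI[OF Deriv.has_derivative_inverse[OF assms pd_has_derivative[OF d]], THEN trans]) simp
  qed
  have "Ck k (\<lambda>x. inverse (f x))" using Suc Ck_Suc_imp by blast
  moreover have "Ck k (pd b f)" if "b \<in> Basis" for b using Suc.prems that by simp
  ultimately have "Ck k (pd b (\<lambda>x. inverse (f x)))" if "b \<in> Basis" for b
    unfolding * using that by (intro Ck_minus Ck_mult) auto
  then show ?case using d assms by (auto intro!: derivative_intros)
qed

lemma Ck_id [simp]: "Ck k (\<lambda>x::real. x)"
  by (rule Ck_linear) (simp add: linear_iff)

text \<open>The standard smooth transition from 0 on x \<le> 0 to 1 on x \<ge> 1: the two flat
  functions in the denominator never vanish together. The smooth cutoffs in t, X and z are all built
  from it.\<close>

definition step :: "real \<Rightarrow> real" where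
  "step x = flat 0 x * inverse (flat 0 x + flat 0 (1 - x))"

lemma Ck_step: "Ck k step"
proof -
  have "flat 0 x + flat 0 (1 - x) \<noteq> 0" for x
    using add_pos_pos[of "exp (- inverse x)" "exp (- inverse (1 - x))"]
    by (auto simp: flat_def)
  moreover have "Ck k (\<lambda>x. flat 0 (1 - x))"
    by (rule Ck_compose_real[OF Ck_flat Ck_diff[OF Ck_const Ck_id]])
  ultimately show ?thesis unfolding step_def
    by (intro Ck_mult Ck_inverse Ck_add Ck_flat) auto
qed

lemma flat_nonneg: "0 \<le> flat j x"
  by (simp add: flat_def)

lemma step_0: "x \<le> 0 \<Longrightarrow> step x = 0"
  by (simp add: step_def flat_def)

lemma step_1: "1 \<le> x \<Longrightarrow> step x = 1"
  by (simp add: step_def flat_def)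

lemma step_nonneg: "0 \<le> step x"
  unfolding step_def by (intro mult_nonneg_nonneg) (simp_all add: flat_nonneg)

lemma step_le_1: "step x \<le> 1"
  using flat_nonneg[of 0 x] flat_nonneg[of 0 "1 - x"]
  by (cases "flat 0 x + flat 0 (1 - x) = 0") (simp_all add: step_def divide_inverse[symmetric] divide_le_eq_1)

lemma Ck_step_affine: "Ck k f \<Longrightarrow> Ck k (\<lambda>x. step (f x))"
  by (rule Ck_compose_real[OF Ck_step])

section \<open>Test functions and their supports\<close>

lemma test_funI:
  assumes "\<And>k. Ck k \<phi>" "compact K" "K \<subseteq> \<Omega>" "\<And>x. x \<notin> K \<Longrightarrow> \<phi> x = 0"
  shows "test_fun \<Omega> \<phi>"
proof -
  have "closure {x. \<phi> x \<noteq> 0} \<subseteq> K"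
    using assms(2,4) by (intro closure_minimal) (auto simp: compact_imp_closed)
  then show ?thesis unfolding test_fun_def
    using assms compact_closure bounded_subset compact_imp_bounded closure_subset
    by (metis (no_types, lifting) order_trans)
qed

text \<open>Together with \<open>test_funI\<close> this replaces the closure of the nonvanishing set
  by any compact \<open>K\<close> outside which the function is 0; supports of products, sections
  and linear images are then computed with such sets.\<close>

lemma test_fun_support:
  assumes "test_fun \<Omega> \<phi>"
  shows "\<exists>K. compact K \<and> K \<subseteq> \<Omega> \<and> (\<forall>x. x \<notin> K \<longrightarrow> \<phi> x = 0)"
proof (intro exI[of _ "closure {x. \<phi> x \<noteq> 0}"] conjI allI impI)
  show "\<phi> x = 0" if "x \<notin> closure {x. \<phi> x \<noteq> 0}" for x
    using that closure_subset[of "{x. \<phi> x \<noteq> 0}"] by auto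
qed (use assms in \<open>auto simp: test_fun_def\<close>)

lemma test_fun_Ck: "test_fun \<Omega> \<phi> \<Longrightarrow> Ck k \<phi>"
  by (simp add: test_fun_def)

lemma test_fun_differentiable: "test_fun \<Omega> \<phi> \<Longrightarrow> \<phi> differentiable (at x)"
  using test_fun_Ck[of \<Omega> \<phi> 1] by simp

lemma test_fun_continuous: "test_fun \<Omega> \<phi> \<Longrightarrow> continuous_on UNIV \<phi>"
  using test_fun_Ck[of \<Omega> \<phi> 0] by simp

lemma pd_eq_0_outside:
  assumes "closed K" "\<And>x. x \<notin> K \<Longrightarrow> \<phi> x = 0" "x \<notin> K"
  shows "pd b \<phi> x = 0"
proof -
  have "(\<phi> has_derivative (\<lambda>h. 0)) (at x)"
    by (rule has_derivative_transform_within_open[of "\<lambda>x. 0" _ _ _ "- K"]) (use assms in auto)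
  then show ?thesis by (rule pd_eqI)
qed

lemma test_fun_pd:
  assumes "test_fun \<Omega> \<phi>" "b \<in> Basis"
  shows "test_fun \<Omega> (pd b \<phi>)"
proof -
  obtain K where K: "compact K" "K \<subseteq> \<Omega>" "\<And>x. x \<notin> K \<Longrightarrow> \<phi> x = 0"
    using test_fun_support[OF assms(1)] by blast
  show ?thesis
  proof (rule test_funI[OF _ K(1,2)])
    show "Ck k (pd b \<phi>)" for k
      using test_fun_Ck[OF assms(1), of "Suc k"] assms(2) by simp
    show "pd b \<phi> x = 0" if "x \<notin> K" for x
      using pd_eq_0_outside[OF compact_imp_closed[OF K(1)] K(3) that] .
  qed
qed

lemma test_fun_bounded:
  assumes "test_fun \<Omega> \<phi>"
  obtains B where "B \<ge> 0" "\<And>x. \<bar>\<phi> x\<bar> \<le> B"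
proof -
  obtain K where K: "compact K" "K \<subseteq> \<Omega>" "\<And>x. x \<notin> K \<Longrightarrow> \<phi> x = 0"
    using test_fun_support[OF assms(1)] by blast
  have "compact (\<phi> ` K)" using K(1) test_fun_continuous[OF assms]
    by (intro compact_continuous_image) (auto intro: continuous_on_subset)
  then obtain B where "\<forall>y\<in>\<phi> ` K. norm y \<le> B" using compact_imp_bounded bounded_iff by metis
  then have "\<bar>\<phi> x\<bar> \<le> max 0 B" for x using K(3)[of x] by (cases "x \<in> K") auto
  then show ?thesis using that[of "max 0 B"] by auto
qed

lemma test_fun_mult_Ck:
  assumes "test_fun \<Omega> \<phi>" "\<And>k. Ck k \<psi>"
  shows "test_fun \<Omega> (\<lambda>x. \<phi> x * \<psi> x)"
proof -
  obtain K where K: "compact K" "K \<subseteq> \<Omega>" "\<And>x. x \<notin> K \<Longrightarrow> \<phi> x = 0"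
    using test_fun_support[OF assms(1)] by blast
  show ?thesis using assms K by (intro test_funI[OF _ K(1,2)]) (auto intro!: Ck_mult simp: test_fun_Ck)
qed

text \<open>\<open>F\<close> lists the successive derivatives of a function that is only smooth on an open interval.\<close>

lemma Ck_mult_local:
  fixes F :: "nat \<Rightarrow> real \<Rightarrow> real"
  assumes F: "\<And>j z. z \<in> {a<..<b} \<Longrightarrow> (F j has_real_derivative F (Suc j) z) (at z)"
    and \<eta>: "test_fun {a<..<b} \<eta>"
  shows "Ck k (\<lambda>z. \<eta> z * F j z)"
  using \<eta>
proof (induction k arbitrary: j \<eta>)
  case (0 j \<eta>)
  obtain K where K: "compact K" "K \<subseteq> {a<..<b}" "\<And>x. x \<notin> K \<Longrightarrow> \<eta> x = 0"
    using test_fun_support[OF 0] by blast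
  have "isCont (\<lambda>z. \<eta> z * F j z) x" for x
  proof (cases "x \<in> K")
    case True
    have "isCont \<eta> x" using test_fun_continuous[OF 0] by (simp add: continuous_on_eq_continuous_at)
    moreover have "isCont (F j) x" using F True K(2) DERIV_isCont by blast
    ultimately show ?thesis by (auto intro: continuous_intros)
  next
    case False
    have "\<forall>\<^sub>F y in nhds x. y \<in> - K"
      using False K(1) compact_imp_closed by (intro eventually_nhds_in_open) auto
    then have "\<forall>\<^sub>F y in nhds x. 0 = \<eta> y * F j y" by eventually_elim (use K(3) in auto)
    then have "((\<lambda>y. \<eta> y * F j y) \<longlongrightarrow> 0) (nhds x)" by (rule Lim_transform_eventually[OF tendsto_const])
    then have "((\<lambda>y. \<eta> y * F j y) \<longlongrightarrow> 0) (at x)" by (rule tendsto_mono[rotated]) (simp add: at_within_def)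
    then show ?thesis using False K(3) by (simp add: isCont_def)
  qed
  then show ?case by (auto simp: continuous_on_eq_continuous_at)
next
  case (Suc k j \<eta>)
  obtain K where K: "compact K" "K \<subseteq> {a<..<b}" "\<And>x. x \<notin> K \<Longrightarrow> \<eta> x = 0"
    using test_fun_support[OF Suc.prems] by blast
  have t: "test_fun {a<..<b} (pd 1 \<eta>)" using test_fun_pd[OF Suc.prems] by simp
  have *: "((\<lambda>z. \<eta> z * F j z) has_real_derivative pd 1 \<eta> x * F j x + \<eta> x * F (Suc j) x) (at x)" for x
  proof (cases "x \<in> K")
    case True
    have "\<eta> differentiable (at x)" by (rule test_fun_differentiable[OF Suc.prems])
    then have "(\<eta> has_real_derivative pd 1 \<eta> x) (at x)"
      using real_differentiable_def pd_real_deriv by metis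
    moreover have "(F j has_real_derivative F (Suc j) x) (at x)" using F True K(2) by blast
    ultimately show ?thesis by (auto intro!: derivative_eq_intros)
  next
    case False
    have "((\<lambda>z. \<eta> z * F j z) has_real_derivative 0) (at x)"
      by (rule has_field_derivative_transform_within_open[of "\<lambda>x. 0" _ _ "- K"]) (use False K compact_imp_closed in auto)
    then show ?thesis using False K(3) pd_eq_0_outside[OF compact_imp_closed[OF K(1)] K(3) False] by simp
  qed
  have "pd 1 (\<lambda>z. \<eta> z * F j z) = (\<lambda>x. pd 1 \<eta> x * F j x + \<eta> x * F (Suc j) x)"
    using * pd_real_deriv by blast
  moreover have "Ck k (\<lambda>x. pd 1 \<eta> x * F j x + \<eta> x * F (Suc j) x)"
    using Suc.IH t Suc.prems by (intro Ck_add) auto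
  ultimately show ?case using * by (auto intro: has_derivative_real)
qed

lemma test_fun_mult_local:
  fixes F :: "nat \<Rightarrow> real \<Rightarrow> real"
  assumes F: "\<And>j z. z \<in> {a<..<b} \<Longrightarrow> (F j has_real_derivative F (Suc j) z) (at z)"
    and \<eta>: "test_fun {a<..<b} \<eta>"
  shows "test_fun {a<..<b} (\<lambda>z. \<eta> z * F j z)"
proof -
  obtain K where K: "compact K" "K \<subseteq> {a<..<b}" "\<And>x. x \<notin> K \<Longrightarrow> \<eta> x = 0"
    using test_fun_support[OF \<eta>] by blast
  show ?thesis using Ck_mult_local[of a b F \<eta>, OF F \<eta>] K by (intro test_funI[OF _ K(1,2)]) auto
qed

text \<open>Both mixed derivatives are limits of the same second difference quotient.\<close>

lemma second_difference_mvt: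
  fixes f :: "'a::euclidean_space \<Rightarrow> real"
  assumes d: "\<And>x. f differentiable (at x)" "\<And>x. pd a f differentiable (at x)" and s: "0 < s"
  shows "\<exists>\<sigma> \<tau>. 0 < \<sigma> \<and> \<sigma> < s \<and> 0 < \<tau> \<and> \<tau> < s \<and>
     f (x + s *\<^sub>R a + s *\<^sub>R b) - f (x + s *\<^sub>R a) - f (x + s *\<^sub>R b) + f x
       = s * s * pd b (pd a f) (x + \<sigma> *\<^sub>R a + \<tau> *\<^sub>R b)"
proof -
  have D: "((\<lambda>u. h (y + u *\<^sub>R v)) has_real_derivative pd v h (y + u *\<^sub>R v)) (at u)"
    if "\<And>x. h differentiable (at x)" for h :: "'a \<Rightarrow> real" and y v u
  proof -
    have "((\<lambda>u. y + u *\<^sub>R v) has_derivative (\<lambda>k. k *\<^sub>R v)) (at u)"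
      by (auto intro!: derivative_eq_intros)
    from has_derivative_compose[OF this, of h "frechet_derivative h (at (y + u *\<^sub>R v))"]
    have "((\<lambda>u. h (y + u *\<^sub>R v)) has_derivative (\<lambda>k. frechet_derivative h (at (y + u *\<^sub>R v)) (k *\<^sub>R v))) (at u)"
      using that frechet_derivative_works by blast
    moreover have "(\<lambda>k. frechet_derivative h (at (y + u *\<^sub>R v)) (k *\<^sub>R v)) = (*) (pd v h (y + u *\<^sub>R v))"
      using linear_scale[OF linear_frechet_derivative[OF that]] by (auto simp: pd_def mult.commute)
    ultimately show ?thesis by (simp add: has_field_derivative_def)
  qed
  define g where "g = (\<lambda>u. f (x + s *\<^sub>R b + u *\<^sub>R a) - f (x + u *\<^sub>R a))"
  have "(g has_real_derivative pd a f (x + s *\<^sub>R b + u *\<^sub>R a) - pd a f (x + u *\<^sub>R a)) (at u)" for u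
    unfolding g_def by (intro DERIV_diff D d)
  from MVT2[OF s this] obtain \<sigma> where \<sigma>: "0 < \<sigma>" "\<sigma> < s"
    "g s - g 0 = s * (pd a f (x + s *\<^sub>R b + \<sigma> *\<^sub>R a) - pd a f (x + \<sigma> *\<^sub>R a))" by auto
  have "((\<lambda>u. pd a f (x + \<sigma> *\<^sub>R a + u *\<^sub>R b)) has_real_derivative pd b (pd a f) (x + \<sigma> *\<^sub>R a + u *\<^sub>R b)) (at u)" for u
    by (intro D d)
  from MVT2[OF s this] obtain \<tau> where \<tau>: "0 < \<tau>" "\<tau> < s"
    "pd a f (x + \<sigma> *\<^sub>R a + s *\<^sub>R b) - pd a f (x + \<sigma> *\<^sub>R a) = s * pd b (pd a f) (x + \<sigma> *\<^sub>R a + \<tau> *\<^sub>R b)" by auto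
  have "g s - g 0 = s * s * pd b (pd a f) (x + \<sigma> *\<^sub>R a + \<tau> *\<^sub>R b)"
    using \<sigma>(3) \<tau>(3) by (simp add: algebra_simps)
  then show ?thesis using \<sigma> \<tau> by (auto simp: g_def algebra_simps)
qed

lemma pd_commute:
  fixes f :: "'a::euclidean_space \<Rightarrow> real"
  assumes "Ck 2 f" "a \<in> Basis" "b \<in> Basis"
  shows "pd a (pd b f) = pd b (pd a f)"
proof
  fix x
  have C: "Ck (Suc (Suc 0)) f" using assms(1) by (simp add: numeral_2_eq_2)
  then have d: "f differentiable (at x)" "pd a f differentiable (at x)" "pd b f differentiable (at x)"
    "isCont (pd b (pd a f)) x" "isCont (pd a (pd b f)) x" for x
    using assms(2,3) by (auto simp: continuous_on_eq_continuous_at)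
  show "pd a (pd b f) x = pd b (pd a f) x"
  proof (rule ccontr)
    assume ne: "\<not> ?thesis"
    define e where "e = \<bar>pd a (pd b f) x - pd b (pd a f) x\<bar> / 2"
    have e: "e > 0" using ne by (auto simp: e_def)
    obtain \<delta>1 where \<delta>1: "\<delta>1 > 0" "\<And>y. dist y x < \<delta>1 \<Longrightarrow> dist (pd b (pd a f) y) (pd b (pd a f) x) < e"
      using d(4) e unfolding continuous_at by (metis Lim_at dist_self zero_less_dist_iff)
    obtain \<delta>2 where \<delta>2: "\<delta>2 > 0" "\<And>y. dist y x < \<delta>2 \<Longrightarrow> dist (pd a (pd b f) y) (pd a (pd b f) x) < e"
      using d(5) e unfolding continuous_at by (metis Lim_at dist_self zero_less_dist_iff)
    \<comment> \<open>A third of the smaller radius: the intermediate points lie within 2 s of x,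
      hence in the range of both continuity estimates.\<close>
    define s where "s = min \<delta>1 \<delta>2 / 3"
    have s: "s > 0" using \<delta>1 \<delta>2 by (simp add: s_def)
    have small: "dist (x + \<sigma> *\<^sub>R u + \<tau> *\<^sub>R v) x < min \<delta>1 \<delta>2"
      if "0 < \<sigma>" "\<sigma> < s" "0 < \<tau>" "\<tau> < s" "u \<in> Basis" "v \<in> Basis" for \<sigma> \<tau> and u v :: 'a
    proof -
      have "dist (x + \<sigma> *\<^sub>R u + \<tau> *\<^sub>R v) x = norm (\<sigma> *\<^sub>R u + \<tau> *\<^sub>R v)"
        by (simp add: dist_norm)
      also have "\<dots> \<le> \<sigma> + \<tau>" using norm_triangle_ineq[of "\<sigma> *\<^sub>R u" "\<tau> *\<^sub>R v"] that by simp
      also have "\<dots> < min \<delta>1 \<delta>2" using that s by (simp add: s_def min_def split: if_splits)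
      finally show ?thesis .
    qed
    obtain \<sigma> \<tau> where 1: "0 < \<sigma>" "\<sigma> < s" "0 < \<tau>" "\<tau> < s"
     "f (x + s *\<^sub>R a + s *\<^sub>R b) - f (x + s *\<^sub>R a) - f (x + s *\<^sub>R b) + f x
       = s * s * pd b (pd a f) (x + \<sigma> *\<^sub>R a + \<tau> *\<^sub>R b)"
      using second_difference_mvt[of f a s x b] d s by blast
    obtain \<sigma>' \<tau>' where 2: "0 < \<sigma>'" "\<sigma>' < s" "0 < \<tau>'" "\<tau>' < s"
     "f (x + s *\<^sub>R b + s *\<^sub>R a) - f (x + s *\<^sub>R b) - f (x + s *\<^sub>R a) + f x
       = s * s * pd a (pd b f) (x + \<sigma>' *\<^sub>R b + \<tau>' *\<^sub>R a)"
      using second_difference_mvt[of f b s x a] d s by blast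
    have "s * s * pd b (pd a f) (x + \<sigma> *\<^sub>R a + \<tau> *\<^sub>R b) = s * s * pd a (pd b f) (x + \<sigma>' *\<^sub>R b + \<tau>' *\<^sub>R a)"
      using 1(5) 2(5) by (simp add: algebra_simps)
    then have "pd b (pd a f) (x + \<sigma> *\<^sub>R a + \<tau> *\<^sub>R b) = pd a (pd b f) (x + \<sigma>' *\<^sub>R b + \<tau>' *\<^sub>R a)"
      using s by simp
    then show False
      using \<delta>1(2)[of "x + \<sigma> *\<^sub>R a + \<tau> *\<^sub>R b"] \<delta>2(2)[of "x + \<sigma>' *\<^sub>R b + \<tau>' *\<^sub>R a"]
        small[OF 1(1-4) assms(2,3)] small[OF 2(1-4) assms(3,2)] e
      by (auto simp: dist_real_def e_def abs_if split: if_splits)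
  qed
qed

section \<open>Square integrable functions\<close>

lemmas LINT_cong = Bochner_Integration.integral_cong[OF refl]

text \<open>Values in any Euclidean space, so that one notion serves real functions and their
  complex transforms; on real functions it coincides with \<open>L2\<close>.\<close>

definition sqint :: "'a measure \<Rightarrow> ('a \<Rightarrow> 'b::euclidean_space) \<Rightarrow> bool" where
  "sqint M u \<longleftrightarrow> u \<in> borel_measurable M \<and> integrable M (\<lambda>x. (norm (u x))\<^sup>2)"

text \<open>On complex functions this is the real part of the Hermitian product. Testing loses
  nothing by this, as the test function may be multiplied by the imaginary unit.\<close>

definition ip :: "'a measure \<Rightarrow> ('a \<Rightarrow> 'b::euclidean_space) \<Rightarrow> ('a \<Rightarrow> 'b) \<Rightarrow> real" where
  "ip M u v = (LINT x|M. u x \<bullet> v x)"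

definition nrm :: "'a measure \<Rightarrow> ('a \<Rightarrow> 'b::euclidean_space) \<Rightarrow> real" where
  "nrm M u = sqrt (LINT x|M. (norm (u x))\<^sup>2)"

lemma L2_iff_sqint: "L2 M u \<longleftrightarrow> sqint M u"
  by (simp add: L2_def sqint_def)

lemma L2norm_eq_nrm: "L2norm M u = nrm M u"
  by (simp add: L2norm_def nrm_def)

lemma sqint_measurable [measurable_dest]: "sqint M u \<Longrightarrow> u \<in> borel_measurable M"
  by (simp add: sqint_def)

lemma nrm_nonneg [simp]: "0 \<le> nrm M u"
  by (simp add: nrm_def)

lemma nrm_power2: "(nrm M u)\<^sup>2 = (LINT x|M. (norm (u x))\<^sup>2)"
  by (simp add: nrm_def)

lemma nn_integral_nrm:
  assumes "sqint M u"
  shows "(\<integral>\<^sup>+x. ennreal ((norm (u x))\<^sup>2) \<partial>M) = ennreal ((nrm M u)\<^sup>2)"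
  using assms by (simp add: nn_integral_eq_integral sqint_def nrm_power2)

lemma sqint_nn:
  assumes [measurable]: "u \<in> borel_measurable M" and "(\<integral>\<^sup>+x. ennreal ((norm (u x))\<^sup>2) \<partial>M) < \<infinity>"
  shows "sqint M u"
  unfolding sqint_def using assms by (auto intro!: integrableI_bounded)

text \<open>Fatou's lemma bounds a nonnegative integral before integrability is known; this turns
  such a bound into membership and a norm estimate at once.\<close>

lemma nrm_le_nn:
  assumes [measurable]: "u \<in> borel_measurable M"
    and "(\<integral>\<^sup>+x. ennreal ((norm (u x))\<^sup>2) \<partial>M) \<le> ennreal (a\<^sup>2)" "0 \<le> a"
  shows "sqint M u" "nrm M u \<le> a"
proof -
  show s: "sqint M u" using assms by (intro sqint_nn) (auto simp: less_top[symmetric] top_unique)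
  have "(nrm M u)\<^sup>2 \<le> a\<^sup>2" using assms(2) by (simp add: nn_integral_nrm[OF s])
  then show "nrm M u \<le> a" using assms(3) by (rule power2_le_imp_le)
qed

lemma sqint_bound:
  assumes "sqint M v" "u \<in> borel_measurable M" "AE x in M. norm (u x) \<le> norm (v x)"
  shows "sqint M u"
  unfolding sqint_def
proof
  show "integrable M (\<lambda>x. (norm (u x))\<^sup>2)"
    by (rule Bochner_Integration.integrable_bound[of _ "\<lambda>x. (norm (v x))\<^sup>2"])
       (use assms in \<open>auto simp: sqint_def power_mono elim!: eventually_mono\<close>)
qed fact

lemma nrm_mono:
  assumes "sqint M v" "u \<in> borel_measurable M" "AE x in M. norm (u x) \<le> norm (v x)"
  shows "nrm M u \<le> nrm M v"
  unfolding nrm_def using assms sqint_bound[OF assms]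
  by (intro real_sqrt_le_mono integral_mono_AE) (auto simp: sqint_def power_mono elim!: eventually_mono)

lemma sqint_cong_AE:
  assumes "sqint M v" "u \<in> borel_measurable M" "AE x in M. u x = v x"
  shows "sqint M u"
  by (rule sqint_bound[OF assms(1,2)]) (use assms(3) in \<open>auto elim!: eventually_mono\<close>)

lemma nrm_cong_AE:
  assumes "u \<in> borel_measurable M" "v \<in> borel_measurable M" "AE x in M. u x = v x"
  shows "nrm M u = nrm M v"
  unfolding nrm_def using assms by (intro arg_cong[of _ _ sqrt] integral_cong_AE) auto

lemma sqint_scaleR: "sqint M u \<Longrightarrow> sqint M (\<lambda>x. c *\<^sub>R u x)"
  by (auto simp: sqint_def power_mult_distrib)

lemma nrm_scaleR: "nrm M (\<lambda>x. c *\<^sub>R u x) = \<bar>c\<bar> * nrm M u"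
  by (simp add: nrm_def power_mult_distrib real_sqrt_mult)

lemma sqint_0 [simp]: "sqint M (\<lambda>x. 0)" and nrm_0 [simp]: "nrm M (\<lambda>x. 0) = 0"
  by (simp_all add: sqint_def nrm_def)

lemma sqint_indicator:
  assumes "A \<in> sets M" "emeasure M A < \<infinity>"
  shows "sqint M (indicator A :: 'a \<Rightarrow> real)"
proof -
  have "(\<lambda>x. (norm (indicator A x :: real))\<^sup>2) = indicator A" by (auto simp: indicator_def)
  then show ?thesis using assms by (simp add: sqint_def)
qed

lemma sqint_add:
  assumes "sqint M u" "sqint M v"
  shows "sqint M (\<lambda>x. u x + v x)"
  unfolding sqint_def
proof
  show "integrable M (\<lambda>x. (norm (u x + v x))\<^sup>2)"
  proof (rule Bochner_Integration.integrable_bound)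
    show "integrable M (\<lambda>x. 2 * (norm (u x))\<^sup>2 + 2 * (norm (v x))\<^sup>2)"
      using assms by (auto simp: sqint_def)
    have "(norm (u x + v x))\<^sup>2 \<le> 2 * (norm (u x))\<^sup>2 + 2 * (norm (v x))\<^sup>2" for x
    proof -
      have "(norm (u x + v x))\<^sup>2 \<le> (norm (u x) + norm (v x))\<^sup>2"
        by (intro power_mono norm_triangle_ineq) auto
      also have "\<dots> \<le> 2 * (norm (u x))\<^sup>2 + 2 * (norm (v x))\<^sup>2"
        using sum_squares_bound[of "norm (u x)" "norm (v x)"] by (simp add: power2_sum)
      finally show ?thesis .
    qed
    then show "AE x in M. norm ((norm (u x + v x))\<^sup>2) \<le> norm (2 * (norm (u x))\<^sup>2 + 2 * (norm (v x))\<^sup>2)"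
      by simp
  qed (use assms in \<open>auto simp: sqint_def\<close>)
qed (use assms in \<open>auto simp: sqint_def\<close>)

lemma sqint_minus: "sqint M u \<Longrightarrow> sqint M (\<lambda>x. - u x)"
  by (auto simp: sqint_def)

lemma sqint_diff: "sqint M u \<Longrightarrow> sqint M v \<Longrightarrow> sqint M (\<lambda>x. u x - v x)"
  using sqint_add[OF _ sqint_minus, of M u v] by simp

lemma sqint_sum: "(\<And>i. i \<in> I \<Longrightarrow> sqint M (u i)) \<Longrightarrow> sqint M (\<lambda>x. \<Sum>i\<in>I. u i x)"
  by (induction I rule: infinite_finite_induct) (auto intro!: sqint_add)

lemma sqint_cmult: "sqint M u \<Longrightarrow> sqint M (\<lambda>x. c * u x :: real)"
  using sqint_scaleR[of M u c] by simp

lemma sqint_bounded_mult: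
  fixes b :: "'a \<Rightarrow> real"
  assumes "sqint M u" "b \<in> borel_measurable M" "AE x in M. \<bar>b x\<bar> \<le> C"
  shows "sqint M (\<lambda>x. b x *\<^sub>R u x)" "nrm M (\<lambda>x. b x *\<^sub>R u x) \<le> \<bar>C\<bar> * nrm M u"
proof -
  have "AE x in M. norm (b x *\<^sub>R u x) \<le> norm (C *\<^sub>R u x)"
    using assms(3) by eventually_elim (auto intro!: mult_right_mono)
  moreover have "(\<lambda>x. b x *\<^sub>R u x) \<in> borel_measurable M"
    using assms by (auto simp: sqint_def)
  ultimately show "sqint M (\<lambda>x. b x *\<^sub>R u x)" "nrm M (\<lambda>x. b x *\<^sub>R u x) \<le> \<bar>C\<bar> * nrm M u"
    using sqint_bound[OF sqint_scaleR[OF assms(1), of C], of "\<lambda>x. b x *\<^sub>R u x"]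
      nrm_mono[OF sqint_scaleR[OF assms(1), of C], of "\<lambda>x. b x *\<^sub>R u x"]
    unfolding nrm_scaleR by blast+
qed

lemma Cauchy_Schwarz_norm:
  assumes u: "sqint M u" and v: "sqint M v"
  shows "integrable M (\<lambda>x. norm (u x) * norm (v x))"
    and "(LINT x|M. norm (u x) * norm (v x)) \<le> nrm M u * nrm M v"
proof -
  have [measurable]: "u \<in> borel_measurable M" "v \<in> borel_measurable M"
    using u v by (auto simp: sqint_def)
  have CS: "(\<integral>\<^sup>+x. ennreal (norm (u x)) * ennreal (norm (v x)) \<partial>M)\<^sup>2
    \<le> ennreal ((nrm M u)\<^sup>2) * ennreal ((nrm M v)\<^sup>2)"
    using Cauchy_Schwarz_nn_integral[of "\<lambda>x. ennreal (norm (u x))" M "\<lambda>x. ennreal (norm (v x))"]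
    by (simp add: ennreal_power nn_integral_nrm u v)
  then have CS': "(\<integral>\<^sup>+x. ennreal (norm (u x) * norm (v x)) \<partial>M)\<^sup>2 \<le> ennreal ((nrm M u * nrm M v)\<^sup>2)"
    by (simp add: ennreal_mult power_mult_distrib)
  show i: "integrable M (\<lambda>x. norm (u x) * norm (v x))"
  proof (rule integrableI_bounded)
    have "(\<integral>\<^sup>+x. ennreal (norm (u x) * norm (v x)) \<partial>M) \<noteq> \<infinity>"
      using CS' by (auto simp: top_unique)
    then show "(\<integral>\<^sup>+x. ennreal (norm (norm (u x) * norm (v x))) \<partial>M) < \<infinity>"
      by (simp add: less_top)
  qed measurable
  have "ennreal ((LINT x|M. norm (u x) * norm (v x))\<^sup>2) \<le> ennreal ((nrm M u * nrm M v)\<^sup>2)"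
    using CS' i by (simp add: nn_integral_eq_integral ennreal_power)
  then have "(LINT x|M. norm (u x) * norm (v x))\<^sup>2 \<le> (nrm M u * nrm M v)\<^sup>2"
    by simp
  then show "(LINT x|M. norm (u x) * norm (v x)) \<le> nrm M u * nrm M v"
    by (rule power2_le_imp_le) simp
qed

lemma ip_integrable:
  assumes u: "sqint M u" and v: "sqint M v"
  shows "integrable M (\<lambda>x. u x \<bullet> v x)"
  by (rule Bochner_Integration.integrable_bound[OF Cauchy_Schwarz_norm(1)[OF u v]])
     (use u v in \<open>auto simp: sqint_def Cauchy_Schwarz_ineq2\<close>)

lemma ip_Cauchy_Schwarz:
  assumes u: "sqint M u" and v: "sqint M v"
  shows "\<bar>ip M u v\<bar> \<le> nrm M u * nrm M v"
proof -
  have "\<bar>ip M u v\<bar> \<le> (LINT x|M. \<bar>u x \<bullet> v x\<bar>)"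
    unfolding ip_def by (rule integral_abs_bound)
  also have "\<dots> \<le> (LINT x|M. norm (u x) * norm (v x))"
    using ip_integrable[OF u v] Cauchy_Schwarz_norm(1)[OF u v]
    by (intro integral_mono) (auto simp: Cauchy_Schwarz_ineq2)
  also note Cauchy_Schwarz_norm(2)[OF u v]
  finally show ?thesis .
qed

lemma ip_self: "ip M u u = (nrm M u)\<^sup>2"
  by (simp add: ip_def nrm_power2 power2_norm_eq_inner)

lemma ip_commute: "ip M u v = ip M v u"
  by (simp add: ip_def inner_commute)

lemma ip_add_left: "sqint M u \<Longrightarrow> sqint M v \<Longrightarrow> sqint M w \<Longrightarrow> ip M (\<lambda>x. u x + v x) w = ip M u w + ip M v w"
  by (simp add: ip_def inner_add_left ip_integrable)

lemma ip_diff_left: "sqint M u \<Longrightarrow> sqint M v \<Longrightarrow> sqint M w \<Longrightarrow> ip M (\<lambda>x. u x - v x) w = ip M u w - ip M v w"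
  by (simp add: ip_def inner_diff_left ip_integrable)

lemma ip_add_right: "sqint M u \<Longrightarrow> sqint M v \<Longrightarrow> sqint M w \<Longrightarrow> ip M w (\<lambda>x. u x + v x) = ip M w u + ip M w v"
  by (simp add: ip_def inner_add_right ip_integrable)

lemma ip_diff_right: "sqint M u \<Longrightarrow> sqint M v \<Longrightarrow> sqint M w \<Longrightarrow> ip M w (\<lambda>x. u x - v x) = ip M w u - ip M w v"
  by (simp add: ip_def inner_diff_right ip_integrable)

lemma ip_scaleR_left: "ip M (\<lambda>x. c *\<^sub>R u x) v = c * ip M u v"
  by (simp add: ip_def)

lemma ip_scaleR_right: "ip M u (\<lambda>x. c *\<^sub>R v x) = c * ip M u v"
  by (simp add: ip_def)

lemma ip_cmult_right: "ip M u (\<lambda>x. c * v x :: real) = c * ip M u v"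
  using ip_scaleR_right[of M u c v] by simp

lemma ip_sum_right:
  assumes "finite I" "\<And>i. i \<in> I \<Longrightarrow> sqint M (v i)" "sqint M u"
  shows "ip M u (\<lambda>x. \<Sum>i\<in>I. v i x) = (\<Sum>i\<in>I. ip M u (v i))"
  using assms by (simp add: ip_def inner_sum_right ip_integrable)

lemma ip_cong_AE:
  assumes "u \<in> borel_measurable M" "u' \<in> borel_measurable M" "v \<in> borel_measurable M" "AE x in M. u x = u' x"
  shows "ip M u v = ip M u' v"
  unfolding ip_def using assms by (intro integral_cong_AE) auto

lemma nrm_triangle:
  assumes u: "sqint M u" and v: "sqint M v"
  shows "nrm M (\<lambda>x. u x + v x) \<le> nrm M u + nrm M v"
proof (rule power2_le_imp_le)
  have "(nrm M (\<lambda>x. u x + v x))\<^sup>2 = (nrm M u)\<^sup>2 + 2 * ip M u v + (nrm M v)\<^sup>2"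
    using u v by (simp add: ip_self[symmetric] ip_add_left ip_add_right sqint_add ip_commute)
  also have "\<dots> \<le> (nrm M u + nrm M v)\<^sup>2"
    using ip_Cauchy_Schwarz[OF u v] by (simp add: power2_sum)
  finally show "(nrm M (\<lambda>x. u x + v x))\<^sup>2 \<le> (nrm M u + nrm M v)\<^sup>2" .
qed simp

lemma nrm_minus_commute: "nrm M (\<lambda>x. u x - v x) = nrm M (\<lambda>x. v x - u x)"
  by (simp add: nrm_def norm_minus_commute)

lemma nrm_triangle_diff:
  assumes "sqint M u" "sqint M v" "sqint M w"
  shows "nrm M (\<lambda>x. u x - w x) \<le> nrm M (\<lambda>x. u x - v x) + nrm M (\<lambda>x. v x - w x)"
  using nrm_triangle[OF sqint_diff[OF assms(1,2)] sqint_diff[OF assms(2,3)]] by simp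

lemma nrm_diff_ge:
  assumes "sqint M u" "sqint M v"
  shows "\<bar>nrm M u - nrm M v\<bar> \<le> nrm M (\<lambda>x. u x - v x)"
  using nrm_triangle[OF sqint_diff[OF assms] assms(2)] nrm_triangle[OF sqint_diff[OF assms(2,1)] assms(1)]
  by (simp add: nrm_minus_commute[of M u v])

lemma nrm_eq_0:
  assumes "sqint M u" shows "nrm M u = 0 \<longleftrightarrow> (AE x in M. u x = 0)"
  using assms integral_nonneg_eq_0_iff_AE[of M "\<lambda>x. (norm (u x))\<^sup>2"] by (simp add: sqint_def nrm_def)

lemma nrm_tendsto:
  assumes "\<And>i. sqint M (f i)" "sqint M g" "((\<lambda>i. nrm M (\<lambda>x. f i x - g x)) \<longlongrightarrow> 0) F"
  shows "((\<lambda>i. nrm M (f i)) \<longlongrightarrow> nrm M g) F"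
proof (rule Lim_null[THEN iffD2], rule Lim_null_comparison[OF _ assms(3)])
  show "\<forall>\<^sub>F i in F. norm (nrm M (f i) - nrm M g) \<le> nrm M (\<lambda>x. f i x - g x)"
    using nrm_diff_ge[OF assms(1,2)] by simp
qed

lemma ip_tendsto:
  assumes "\<And>i. sqint M (f i)" "sqint M g" "sqint M u" "((\<lambda>i. nrm M (\<lambda>x. f i x - g x)) \<longlongrightarrow> 0) F"
  shows "((\<lambda>i. ip M (f i) u) \<longlongrightarrow> ip M g u) F"
proof (rule Lim_null[THEN iffD2], rule Lim_null_comparison)
  show "\<forall>\<^sub>F i in F. norm (ip M (f i) u - ip M g u) \<le> nrm M (\<lambda>x. f i x - g x) * nrm M u"
    using ip_Cauchy_Schwarz[OF sqint_diff[OF assms(1,2)] assms(3)] assms(1-3) by (simp add: ip_diff_left)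
  show "((\<lambda>i. nrm M (\<lambda>x. f i x - g x) * nrm M u) \<longlongrightarrow> 0) F"
    using assms(4) by (rule tendsto_mult_left_zero)
qed

lemma L2_tendsto_iff:
  assumes "\<And>i. sqint M (f i)" "sqint M g"
  shows "L2_tendsto M f g F \<longleftrightarrow> ((\<lambda>i. nrm M (\<lambda>x. f i x - g x)) \<longlongrightarrow> 0) F"
proof -
  have "L2_tendsto M f g F \<longleftrightarrow> ((\<lambda>i. ennreal ((nrm M (\<lambda>x. f i x - g x))\<^sup>2)) \<longlongrightarrow> ennreal 0) F"
    unfolding L2_tendsto_def using nn_integral_nrm[OF sqint_diff[OF assms]] by simp
  also have "\<dots> \<longleftrightarrow> ((\<lambda>i. (nrm M (\<lambda>x. f i x - g x))\<^sup>2) \<longlongrightarrow> 0) F"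
    by (rule tendsto_ennreal_iff) auto
  also have "\<dots> \<longleftrightarrow> ((\<lambda>i. nrm M (\<lambda>x. f i x - g x)) \<longlongrightarrow> 0) F"
    using tendsto_power[of "\<lambda>i. nrm M (\<lambda>x. f i x - g x)" 0 F 2]
      tendsto_real_sqrt[of "\<lambda>i. (nrm M (\<lambda>x. f i x - g x))\<^sup>2" 0 F] by auto
  finally show ?thesis .
qed

lemma nrm_dominated_convergence:
  fixes w :: "'a \<Rightarrow> real"
  assumes f: "\<And>i. f i \<in> borel_measurable M" and g: "g \<in> borel_measurable M" and w: "sqint M w"
    and lim: "AE x in M. (\<lambda>i. f i x) \<longlonglongrightarrow> g x" and bound: "\<And>i. AE x in M. norm (f i x) \<le> w x"
  shows "\<And>i. sqint M (f i)" "sqint M g" "(\<lambda>i. nrm M (\<lambda>x. f i x - g x)) \<longlonglongrightarrow> 0"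
proof -
  have [measurable]: "f i \<in> borel_measurable M" "g \<in> borel_measurable M" "w \<in> borel_measurable M" for i
    using f g w by (auto simp: sqint_def)
  show "sqint M (f i)" for i
    by (rule sqint_bound[OF w]) (use bound[of i] in \<open>auto elim!: eventually_mono\<close>)
  have "AE x in M. \<forall>i. norm (f i x) \<le> w x" using bound by (simp add: AE_all_countable)
  with lim have gw: "AE x in M. norm (g x) \<le> w x"
    by eventually_elim (rule Lim_bounded[OF tendsto_norm, where M=0], auto)
  then show "sqint M g" by (intro sqint_bound[OF w g]) (auto elim!: eventually_mono)
  have "(\<lambda>i. LINT x|M. (norm (f i x - g x))\<^sup>2) \<longlonglongrightarrow> (LINT x|M. 0)"
  \<comment> \<open>The terms and their limit are all bounded by \<open>w\<close>, so the squared
    difference is at most (2 w)^2.\<close>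
  proof (rule integral_dominated_convergence[where w="\<lambda>x. 4 * (w x)\<^sup>2"])
    show "integrable M (\<lambda>x. 4 * (w x)\<^sup>2)" using w by (simp add: sqint_def)
    show "AE x in M. (\<lambda>i. (norm (f i x - g x))\<^sup>2) \<longlonglongrightarrow> 0"
      using lim
    proof eventually_elim
      case (elim x)
      then have "(\<lambda>i. (norm (f i x - g x))\<^sup>2) \<longlonglongrightarrow> (norm (g x - g x))\<^sup>2"
        by (intro tendsto_intros)
      then show ?case by simp
    qed
    show "AE x in M. norm ((norm (f i x - g x))\<^sup>2) \<le> 4 * (w x)\<^sup>2" for i
      using gw bound[of i]
    proof eventually_elim
      case (elim x)
      then have "norm (f i x - g x) \<le> 2 * w x" using norm_triangle_ineq4[of "f i x" "g x"] by simp
      then have "(norm (f i x - g x))\<^sup>2 \<le> (2 * w x)\<^sup>2" by (rule power_mono) simp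
      then show ?case by (simp add: power_mult_distrib)
    qed
  qed measurable
  then have "(\<lambda>i. sqrt (LINT x|M. (norm (f i x - g x))\<^sup>2)) \<longlonglongrightarrow> sqrt 0"
    by (intro tendsto_real_sqrt) simp
  then show "(\<lambda>i. nrm M (\<lambda>x. f i x - g x)) \<longlonglongrightarrow> 0" by (simp add: nrm_def)
qed

lemma ennreal_finite: "x \<noteq> \<infinity> \<Longrightarrow> \<exists>C\<ge>0. x = ennreal C"
  by (cases x) auto

lemma ennreal_le_suminf: "f k \<le> (\<Sum>k. f k :: ennreal)"
  using sum_le_suminf[of f "{k}"] by simp

text \<open>The rate (1/4)^k leaves room for a weight: the integrals of 4^k |f (k+1) - f k|^2 are
  still summable. Hence almost everywhere the increments are bounded by a constant times (1/2)^k and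
  telescope to a convergent series.\<close>

lemma nrm_fast_convergent:
  fixes f :: "nat \<Rightarrow> 'a \<Rightarrow> 'b::euclidean_space"
  assumes f: "\<And>n. sqint M (f n)" and fast: "\<And>k. nrm M (\<lambda>x. f (Suc k) x - f k x) \<le> (1/4) ^ k"
  shows "AE x in M. convergent (\<lambda>k. f k x)"
proof -
  have [measurable]: "f n \<in> borel_measurable M" for n using f by (simp add: sqint_def)
  define d where "d k x = norm (f (Suc k) x - f k x)" for k x
  have [measurable]: "d k \<in> borel_measurable M" for k unfolding d_def by measurable
  have "(\<integral>\<^sup>+x. ennreal (4 ^ k * (d k x)\<^sup>2) \<partial>M) \<le> ennreal ((1/4) ^ k)" for k
  proof -
    have "(\<integral>\<^sup>+x. ennreal (4 ^ k * (d k x)\<^sup>2) \<partial>M) = ennreal (4 ^ k) * ennreal ((nrm M (\<lambda>x. f (Suc k) x - f k x))\<^sup>2)"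
      using nn_integral_nrm[OF sqint_diff[OF f f, of "Suc k" k]]
      by (simp add: ennreal_mult nn_integral_cmult d_def)
    also have "\<dots> = ennreal (4 ^ k * (nrm M (\<lambda>x. f (Suc k) x - f k x))\<^sup>2)"
      by (simp add: ennreal_mult)
    also have "\<dots> \<le> ennreal (4 ^ k * ((1/4) ^ k)\<^sup>2)"
      by (intro ennreal_leI mult_left_mono power_mono fast) auto
    also have "4 ^ k * ((1/4::real) ^ k)\<^sup>2 = (1/4) ^ k"
      by (simp add: power2_eq_square power_one_over)
    finally show ?thesis .
  qed
  then have "(\<Sum>k. \<integral>\<^sup>+x. ennreal (4 ^ k * (d k x)\<^sup>2) \<partial>M) \<le> (\<Sum>k. ennreal ((1/4) ^ k))"
    by (intro suminf_le) auto
  also have "\<dots> = ennreal (\<Sum>k. (1/4) ^ k)"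
    by (intro suminf_ennreal_eq) (auto intro!: summable_sums summable_geometric)
  finally have "(\<integral>\<^sup>+x. (\<Sum>k. ennreal (4 ^ k * (d k x)\<^sup>2)) \<partial>M) \<noteq> \<infinity>"
    by (subst nn_integral_suminf) (auto simp: top_unique)
  then have "AE x in M. (\<Sum>k. ennreal (4 ^ k * (d k x)\<^sup>2)) \<noteq> \<infinity>"
    by (rule nn_integral_PInf_AE[rotated]) measurable
  then show ?thesis
  proof eventually_elim
    case (elim x)
    from ennreal_finite[OF elim]
    obtain C where C: "(\<Sum>k. ennreal (4 ^ k * (d k x)\<^sup>2)) = ennreal C" "0 \<le> C" by blast
    have "norm (f (Suc k) x - f k x) \<le> sqrt C * (1/2) ^ k" for k
    proof -
      have "ennreal (4 ^ k * (d k x)\<^sup>2) \<le> ennreal C"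
        unfolding C(1)[symmetric] by (rule ennreal_le_suminf)
      then have "4 ^ k * (d k x)\<^sup>2 \<le> C" using C(2) by simp
      then have "sqrt (4 ^ k * (d k x)\<^sup>2) \<le> sqrt C" by (rule real_sqrt_le_mono)
      also have "sqrt (4 ^ k * (d k x)\<^sup>2) = 2 ^ k * d k x"
        by (simp add: real_sqrt_mult real_sqrt_power d_def)
      finally show ?thesis by (simp add: d_def power_one_over field_simps)
    qed
    note le = this
    have "summable (\<lambda>k. sqrt C * (1/2) ^ k)" by (intro summable_mult summable_geometric) simp
    then have "summable (\<lambda>k. f (Suc k) x - f k x)"
      by (rule summable_comparison_test'[where N=0]) (rule le)
    then have "convergent (\<lambda>n. \<Sum>k<n. f (Suc k) x - f k x)" by (simp add: summable_iff_convergent)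
    then have "convergent (\<lambda>n. f n x - f 0 x)" by (simp add: sum_lessThan_telescope[of "\<lambda>k. f k x"])
    then show ?case using convergent_add[OF _ convergent_const, of "\<lambda>n. f n x - f 0 x" "f 0 x"] by simp
  qed
qed

text \<open>The Riesz-Fischer argument: a subsequence with fast decreasing increments converges
  almost everywhere, and Fatou's lemma along it turns the Cauchy bound into a bound for the distance
  to the limit.\<close>

theorem L2_complete:
  fixes f :: "nat \<Rightarrow> 'a \<Rightarrow> 'b::euclidean_space"
  assumes f: "\<And>n. sqint M (f n)"
    and Cauchy: "\<And>e. e > 0 \<Longrightarrow> \<exists>N. \<forall>m\<ge>N. \<forall>n\<ge>N. nrm M (\<lambda>x. f m x - f n x) < e"
  shows "\<exists>h. sqint M h \<and> (\<lambda>n. nrm M (\<lambda>x. f n x - h x)) \<longlonglongrightarrow> 0"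
proof -
  have [measurable]: "f n \<in> borel_measurable M" for n using f by (simp add: sqint_def)
  obtain N where N: "\<And>k m n. m \<ge> N k \<Longrightarrow> n \<ge> N k \<Longrightarrow> nrm M (\<lambda>x. f m x - f n x) < (1/4) ^ k"
    using Cauchy[of "(1/4) ^ _"] by (metis zero_less_power zero_less_divide_1_iff zero_less_numeral)
  \<comment> \<open>Strictly increasing and above \<open>N k\<close>: consecutive terms are then
    closer than (1/4)^k, and \<open>r k\<close> passes every index.\<close>
  define r where "r = rec_nat (N 0) (\<lambda>k m. max (Suc m) (N (Suc k)))"
  have r: "r 0 = N 0" "r (Suc k) = max (Suc (r k)) (N (Suc k))" for k by (auto simp: r_def)
  have rN: "r k \<ge> N k" for k by (cases k) (auto simp: r)
  have rk: "r k \<ge> k" for k by (induction k) (auto simp: r)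
  have conv: "AE x in M. convergent (\<lambda>k. f (r k) x)"
  proof (rule nrm_fast_convergent)
    show "nrm M (\<lambda>x. f (r (Suc k)) x - f (r k) x) \<le> (1/4) ^ k" for k
    proof -
      have "r (Suc k) \<ge> N k" using rN[of k] r(2)[of k] by linarith
      then show ?thesis using N[OF _ rN, of k "r (Suc k)"] by simp
    qed
  qed (rule f)
  \<comment> \<open>Where the subsequence diverges, \<open>lim\<close> has some default value;
    \<open>h\<close> is measurable in any case, and those points form a null set.\<close>
  define h where "h x = lim (\<lambda>k. f (r k) x)" for x
  have [measurable]: "h \<in> borel_measurable M" unfolding h_def by measurable
  have lim: "AE x in M. (\<lambda>k. f (r k) x) \<longlonglongrightarrow> h x"
    using conv by eventually_elim (simp add: h_def convergent_LIMSEQ_iff)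
  have close: "sqint M (\<lambda>x. f n x - h x) \<and> nrm M (\<lambda>x. f n x - h x) \<le> e"
    if e: "e > 0" and n: "\<And>m. m \<ge> K \<Longrightarrow> nrm M (\<lambda>x. f n x - f m x) \<le> e" for e n K
  proof -
    have "(\<integral>\<^sup>+x. ennreal ((norm (f n x - h x))\<^sup>2) \<partial>M) = (\<integral>\<^sup>+x. liminf (\<lambda>k. ennreal ((norm (f n x - f (r k) x))\<^sup>2)) \<partial>M)"
    proof (rule nn_integral_cong_AE)
      show "AE x in M. ennreal ((norm (f n x - h x))\<^sup>2) = liminf (\<lambda>k. ennreal ((norm (f n x - f (r k) x))\<^sup>2))"
        using lim
      proof eventually_elim
        case (elim x)
        then have "(\<lambda>k. ennreal ((norm (f n x - f (r k) x))\<^sup>2)) \<longlonglongrightarrow> ennreal ((norm (f n x - h x))\<^sup>2)"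
          by (intro tendsto_intros)
        from lim_imp_Liminf[OF _ this] show ?case by simp
      qed
    qed
    also have "\<dots> \<le> liminf (\<lambda>k. \<integral>\<^sup>+x. ennreal ((norm (f n x - f (r k) x))\<^sup>2) \<partial>M)"
      by (rule nn_integral_liminf) measurable
    also have "\<dots> \<le> ennreal (e\<^sup>2)"
    proof (rule Liminf_le)
      show "\<forall>\<^sub>F k in sequentially. (\<integral>\<^sup>+x. ennreal ((norm (f n x - f (r k) x))\<^sup>2) \<partial>M) \<le> ennreal (e\<^sup>2)"
        using eventually_ge_at_top[of K]
      proof eventually_elim
        case (elim k)
        then have "nrm M (\<lambda>x. f n x - f (r k) x) \<le> e" using n[of "r k"] rk[of k] by simp
        then show ?case by (simp add: nn_integral_nrm[OF sqint_diff[OF f f]] power_mono)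
      qed
    qed simp
    finally show ?thesis using nrm_le_nn[of "\<lambda>x. f n x - h x" M e] e by auto
  qed
  have "\<exists>K. \<forall>n\<ge>K. sqint M (\<lambda>x. f n x - h x) \<and> nrm M (\<lambda>x. f n x - h x) \<le> e" if "e > 0" for e
    using Cauchy[OF that] close[OF that] by (metis less_imp_le)
  note * = this
  from *[of 1] obtain K where "sqint M (\<lambda>x. f K x - h x)" by auto
  from sqint_diff[OF f[of K] this] have "sqint M h" by simp
  moreover have "(\<lambda>n. nrm M (\<lambda>x. f n x - h x)) \<longlonglongrightarrow> 0"
  proof (rule LIMSEQ_I)
    fix e :: real assume "e > 0"
    then obtain K where "\<forall>n\<ge>K. nrm M (\<lambda>x. f n x - h x) \<le> e / 2" using *[of "e/2"] by auto
    then show "\<exists>K. \<forall>n\<ge>K. norm (nrm M (\<lambda>x. f n x - h x) - 0) < e"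
      using \<open>e > 0\<close> by (intro exI[of _ K]) fastforce
  qed
  ultimately show ?thesis by blast
qed

text \<open>Cut off in space and in size at once, so the result is bounded with bounded support. In
  this form it also serves later as an admissible kernel for testing a function against
  itself.\<close>

definition trunc :: "nat \<Rightarrow> ('a::euclidean_space \<Rightarrow> 'b::euclidean_space) \<Rightarrow> 'a \<Rightarrow> 'b" where
  "trunc n u x = (if norm x \<le> real n \<and> norm (u x) \<le> real n then u x else 0)"

lemma trunc_measurable [measurable]:
  assumes [measurable]: "u \<in> borel_measurable borel" shows "trunc n u \<in> borel_measurable borel"
  unfolding trunc_def by measurable

lemma nrm_trunc:
  assumes "sqint lborel u"
  shows "\<And>n. sqint lborel (trunc n u)" "(\<lambda>n. nrm lborel (\<lambda>x. trunc n u x - u x)) \<longlonglongrightarrow> 0"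
proof -
  have [measurable]: "u \<in> borel_measurable borel" using assms by (simp add: sqint_def)
  have "(\<lambda>n. trunc n u x) \<longlonglongrightarrow> u x" for x
  proof (rule tendsto_eventually)
    obtain n where "norm x \<le> real n" "norm (u x) \<le> real n"
      by (meson le_cases order_trans real_arch_simple)
    then show "\<forall>\<^sub>F n in sequentially. trunc n u x = u x"
      by (intro eventually_sequentiallyI[of n]) (auto simp: trunc_def)
  qed
  moreover have "sqint lborel (\<lambda>x. norm (u x))" using assms by (auto simp: sqint_def)
  ultimately show "\<And>n. sqint lborel (trunc n u)" "(\<lambda>n. nrm lborel (\<lambda>x. trunc n u x - u x)) \<longlonglongrightarrow> 0"
    using nrm_dominated_convergence[where f="\<lambda>n. trunc n u" and M=lborel and g=u and w="\<lambda>x. norm (u x)"]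
    by (auto simp: trunc_def)
qed

text \<open>\<open>measurable_on\<close> supplies continuous functions that converge off a
  negligible set. Clipping them radially at \<open>C\<close> and multiplying by a continuous cutoff
  gives a common dominating function and leaves the limit unchanged.\<close>

lemma bounded_continuous_approx:
  fixes u :: "'a::euclidean_space \<Rightarrow> 'b::euclidean_space"
  assumes [measurable]: "u \<in> borel_measurable borel"
    and bound: "\<And>x. norm (u x) \<le> B" and supp: "\<And>x. norm x > R \<Longrightarrow> u x = 0"
  shows "\<exists>\<phi> C R'. (\<forall>n. continuous_on UNIV (\<phi> n)) \<and> (\<forall>n x. norm (\<phi> n x) \<le> C) \<and>
     (\<forall>n x. norm x > R' \<longrightarrow> \<phi> n x = 0) \<and> (\<forall>n. sqint lborel (\<phi> n)) \<and> sqint lborel u \<and>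
     (\<lambda>n. nrm lborel (\<lambda>x. \<phi> n x - u x)) \<longlonglongrightarrow> 0"
proof -
  have "u measurable_on UNIV"
    by (rule lebesgue_measurable_imp_measurable_on) (auto intro: measurable_completion)
  then obtain N g where N: "negligible N" and g: "\<And>n. continuous_on UNIV (g n)"
    and lim: "\<And>x. x \<notin> N \<Longrightarrow> (\<lambda>n. g n x) \<longlonglongrightarrow> u x"
    unfolding measurable_on_def by auto
  \<comment> \<open>The lower bound 1 keeps \<open>C\<close> positive, so the clipping factor
    \<open>C / max C (norm (g n x))\<close> is continuous.\<close>
  define C where "C = max B 1"
  have C: "C > 0" "norm (u x) \<le> C" for x using bound[of x] by (auto simp: C_def)
  define \<kappa> where "\<kappa> x = max 0 (min 1 (\<bar>R\<bar> + 1 - norm x))" for x :: 'a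
  have \<kappa>: "0 \<le> \<kappa> x" "\<kappa> x \<le> 1" "norm x > \<bar>R\<bar> + 1 \<Longrightarrow> \<kappa> x = 0" "norm x \<le> \<bar>R\<bar> \<Longrightarrow> \<kappa> x = 1" for x
    by (auto simp: \<kappa>_def)
  have c\<kappa>: "continuous_on UNIV \<kappa>" unfolding \<kappa>_def by (intro continuous_intros)
  define \<phi> where "\<phi> n x = (\<kappa> x * (C / max C (norm (g n x)))) *\<^sub>R g n x" for n x
  have c\<phi>: "continuous_on UNIV (\<phi> n)" for n
    unfolding \<phi>_def using C(1) by (intro continuous_intros g c\<kappa>) (auto simp: max_def)
  have b\<phi>: "norm (\<phi> n x) \<le> C * indicator (cball 0 (\<bar>R\<bar> + 1)) x" for n x
  proof (cases "norm x > \<bar>R\<bar> + 1")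
    case False
    have "norm (\<phi> n x) = \<kappa> x * (C / max C (norm (g n x)) * norm (g n x))"
      using C \<kappa> by (simp add: \<phi>_def abs_mult)
    also have "\<dots> \<le> 1 * C"
    proof (rule mult_mono)
      show "C / max C (norm (g n x)) * norm (g n x) \<le> C"
        using C(1) by (simp add: divide_le_eq max_def mult_left_mono)
    qed (use \<kappa> C(1) in auto)
    finally show ?thesis using False by (simp add: indicator_def)
  qed (simp add: \<phi>_def \<kappa> indicator_def)
  have l\<phi>: "(\<lambda>n. \<phi> n x) \<longlonglongrightarrow> u x" if "x \<notin> N" for x
  proof -
    have "(\<lambda>n. \<phi> n x) \<longlonglongrightarrow> (\<kappa> x * (C / max C (norm (u x)))) *\<^sub>R u x"
      unfolding \<phi>_def using C(1) lim[OF that] by (intro tendsto_intros) (auto simp: max_def)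
    moreover have "(\<kappa> x * (C / max C (norm (u x)))) *\<^sub>R u x = u x"
      using C(1) C(2)[of x] supp[of x] \<kappa>(4)[of x] by (cases "norm x > R") (auto simp: max_def)
    ultimately show ?thesis by simp
  qed
  have sw: "sqint lborel (\<lambda>x::'a. C * indicator (cball 0 (\<bar>R\<bar> + 1)) x :: real)"
    using sqint_scaleR[OF sqint_indicator[of "cball (0::'a) (\<bar>R\<bar> + 1)" lborel, OF _ emeasure_lborel_cball_finite], of C]
    by simp
  have ae: "AE x in lborel. (\<lambda>n. \<phi> n x) \<longlonglongrightarrow> u x"
  proof -
    have "AE x in lebesgue. x \<notin> N" using N by (simp add: AE_not_in negligible_iff_null_sets)
    then have "AE x in lborel. x \<notin> N" by (simp add: AE_completion_iff)
    then show ?thesis by eventually_elim (rule l\<phi>)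
  qed
  have m: "\<phi> n \<in> borel_measurable lborel" for n using c\<phi> by (simp add: borel_measurable_continuous_onI)
  note dc = nrm_dominated_convergence[OF m _ sw ae]
  have "\<forall>n. sqint lborel (\<phi> n)" "sqint lborel u" "(\<lambda>n. nrm lborel (\<lambda>x. \<phi> n x - u x)) \<longlonglongrightarrow> 0"
    using dc b\<phi> by auto
  moreover have "norm (\<phi> n x) \<le> C" for n x using b\<phi>[of n x] C(1) by (cases "norm x \<le> \<bar>R\<bar> + 1") (auto simp: indicator_def)
  moreover have "norm x > \<bar>R\<bar> + 1 \<Longrightarrow> \<phi> n x = 0" for n x by (simp add: \<phi>_def \<kappa>)
  ultimately show ?thesis using c\<phi> by (intro exI[of _ \<phi>] exI[of _ C] exI[of _ "\<bar>R\<bar> + 1"]) auto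
qed

section \<open>The Fourier transform\<close>

text \<open>Unnormalised and with a plus sign in the exponent, as in the inversion formula. For a
  real function restricted to a ball, the conjugate divided by \<open>fnorm\<close> is
  \<open>fourier_trunc\<close>.\<close>

definition FT :: "('a::euclidean_space \<Rightarrow> complex) \<Rightarrow> 'a \<Rightarrow> complex" where
  "FT k x = (LINT y|lborel. k y * cis (y \<bullet> x))"

lemma borel_measurable_cis [measurable (raw)]:
  "f \<in> borel_measurable M \<Longrightarrow> (\<lambda>x. cis (f x)) \<in> borel_measurable M"
  using measurable_compose[OF _ borel_measurable_continuous_onI[of cis]]
  by (simp add: continuous_on_cis)

lemma borel_measurable_cnj [measurable (raw)]:
  "f \<in> borel_measurable M \<Longrightarrow> (\<lambda>x. cnj (f x)) \<in> borel_measurable M"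
  using measurable_compose[OF _ borel_measurable_continuous_onI[of cnj]]
  by (simp add: continuous_on_cnj)

lemma pair_sigma_finite_lborel: "pair_sigma_finite lborel lborel"
  ..

lemma integrable_tensor:
  fixes f :: "'a \<Rightarrow> 'c::{real_normed_field, banach, second_countable_topology}"
  assumes "pair_sigma_finite M N" "integrable M f" "integrable N g"
  shows "integrable (M \<Otimes>\<^sub>M N) (\<lambda>(x, y). f x * g y)"
proof -
  interpret pair_sigma_finite M N by fact
  have [measurable]: "f \<in> borel_measurable M" "g \<in> borel_measurable N" using assms by auto
  show ?thesis
  proof (rule Fubini_integrable)
    show "integrable M (\<lambda>x. LINT y|N. norm (case (x, y) of (x, y) \<Rightarrow> f x * g y))"
      using assms by (simp add: norm_mult)
  qed (use assms in auto)
qed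

lemma integrable_FT_kernel:
  fixes k m :: "'a::euclidean_space \<Rightarrow> complex"
  assumes "integrable lborel k" "integrable lborel m"
  shows "integrable (lborel \<Otimes>\<^sub>M lborel) (\<lambda>(x, y). m x * (k y * cis (y \<bullet> x)))"
proof (rule Bochner_Integration.integrable_bound[OF integrable_tensor[OF pair_sigma_finite_lborel assms(2,1)]])
  have [measurable]: "k \<in> borel_measurable borel" "m \<in> borel_measurable borel" using assms by auto
  show "(\<lambda>(x, y). m x * (k y * cis (y \<bullet> x))) \<in> borel_measurable (lborel \<Otimes>\<^sub>M lborel)"
    by measurable
qed (auto simp: norm_mult)

text \<open>Fubini for a kernel that is symmetric in the two variables. Both the Plancherel identity
  and the pairing with \<open>E k\<close> come from it.\<close>

lemma FT_multiplication_formula: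
  fixes k m :: "'a::euclidean_space \<Rightarrow> complex"
  assumes "integrable lborel k" "integrable lborel m"
  shows "(LINT x|lborel. m x * FT k x) = (LINT y|lborel. k y * FT m y)"
proof -
  have "(LINT x|lborel. m x * FT k x) = (LINT x|lborel. LINT y|lborel. m x * (k y * cis (y \<bullet> x)))"
    by (simp add: FT_def)
  also have "\<dots> = (LINT y|lborel. LINT x|lborel. m x * (k y * cis (y \<bullet> x)))"
    using lborel_pair.Fubini_integral[OF integrable_FT_kernel[OF assms]] by simp
  also have "\<dots> = (LINT y|lborel. LINT x|lborel. k y * (m x * cis (x \<bullet> y)))"
    by (simp add: mult_ac inner_commute)
  finally show ?thesis by (simp add: FT_def)
qed

lemma FT_measurable [measurable]:
  assumes [measurable]: "k \<in> borel_measurable borel" shows "FT k \<in> borel_measurable borel"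
  unfolding FT_def[abs_def] by measurable

lemma integrable_mult_cis:
  fixes k :: "'a::euclidean_space \<Rightarrow> complex"
  assumes "integrable lborel k" shows "integrable lborel (\<lambda>y. k y * cis (y \<bullet> x))"
proof (rule Bochner_Integration.integrable_bound[OF assms])
  have [measurable]: "k \<in> borel_measurable borel" using assms by auto
  show "(\<lambda>y. k y * cis (y \<bullet> x)) \<in> borel_measurable lborel" by measurable
qed (auto simp: norm_mult)

lemma norm_FT_le:
  assumes "integrable lborel k"
  shows "cmod (FT k x) \<le> (LINT y|lborel. cmod (k y))"
  unfolding FT_def using integral_norm_bound[of lborel "\<lambda>y. k y * cis (y \<bullet> x)"] by (simp add: norm_mult)

lemma FT_diff:
  assumes "integrable lborel k" "integrable lborel m"
  shows "FT (\<lambda>y. k y - m y) x = FT k x - FT m x"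
  using integrable_mult_cis[OF assms(1)] integrable_mult_cis[OF assms(2)]
  by (simp add: FT_def left_diff_distrib)

lemma lborel_integral_affine:
  fixes f :: "'a::euclidean_space \<Rightarrow> 'b::{banach, second_countable_topology}"
  assumes [measurable]: "f \<in> borel_measurable borel" and c: "c \<noteq> 0"
  shows "(LINT x|lborel. f x) = \<bar>c\<bar> ^ DIM('a) *\<^sub>R (LINT x|lborel. f (t + c *\<^sub>R x))"
proof -
  have "(LINT x|lborel. f x) = (LINT x|density (distr lborel borel (\<lambda>x. t + c *\<^sub>R x)) (\<lambda>_. ennreal (\<bar>c\<bar> ^ DIM('a))). f x)"
    using lborel_affine[OF c, of t] by (simp add: ennreal_power)
  also have "\<dots> = \<bar>c\<bar> ^ DIM('a) *\<^sub>R (LINT x|lborel. f (t + c *\<^sub>R x))"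
    by (subst integral_density) (auto simp: integral_distr)
  finally show ?thesis .
qed

lemma
  fixes u :: "'a::euclidean_space \<Rightarrow> 'b::euclidean_space"
  assumes u: "sqint lborel u"
  shows sqint_translate: "sqint lborel (\<lambda>x. u (x + a))"
    and nrm_translate: "nrm lborel (\<lambda>x. u (x + a)) = nrm lborel u"
proof -
  have [measurable]: "u \<in> borel_measurable borel" using u by (simp add: sqint_def)
  have "(\<integral>\<^sup>+x. ennreal ((norm (u x))\<^sup>2) \<partial>lborel) = (\<integral>\<^sup>+x. ennreal ((norm (u (x + a)))\<^sup>2) \<partial>lborel)"
    by (subst lborel_distr_plus[of a, symmetric]) (simp add: nn_integral_distr add.commute)
  then have "(\<integral>\<^sup>+x. ennreal ((norm (u (x + a)))\<^sup>2) \<partial>lborel) < \<infinity>"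
    unfolding nn_integral_nrm[OF u] by (metis ennreal_less_top infinity_ennreal_def)
  then show "sqint lborel (\<lambda>x. u (x + a))"
    by (rule sqint_nn[rotated]) simp
  show "nrm lborel (\<lambda>x. u (x + a)) = nrm lborel u"
    using lborel_integral_affine[of "\<lambda>x. (norm (u x))\<^sup>2" 1 a] by (simp add: nrm_def add.commute)
qed

text \<open>Lebesgue measure is the image of a product of one-dimensional Lebesgue measures; this
  reduces the Gaussian integrals to dimension one.\<close>

lemma
  fixes f :: "'a::euclidean_space \<Rightarrow> real \<Rightarrow> complex"
  assumes f: "\<And>b. b \<in> Basis \<Longrightarrow> integrable lborel (f b)"
  shows integrable_prod_Basis: "integrable lborel (\<lambda>x::'a. \<Prod>b\<in>Basis. f b (x \<bullet> b))"
    and integral_prod_Basis: "(LINT x|lborel. (\<Prod>b\<in>Basis. f b ((x::'a) \<bullet> b))) = (\<Prod>b\<in>Basis. LINT t|lborel. f b t)"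
proof -
  interpret product_sigma_finite "\<lambda>_::'a. lborel :: real measure" ..
  define T where "T p = (\<Sum>b\<in>Basis. p b *\<^sub>R b)" for p :: "'a \<Rightarrow> real"
  have lb: "lborel = distr (\<Pi>\<^sub>M b\<in>Basis. lborel) borel T"
    unfolding T_def by (rule lborel_eq)
  have [measurable]: "T \<in> measurable (\<Pi>\<^sub>M b\<in>Basis. lborel) borel"
    unfolding T_def by measurable
  have fm [measurable]: "b \<in> Basis \<Longrightarrow> f b \<in> borel_measurable borel" for b using f[of b] by auto
  have F [measurable]: "(\<lambda>x::'a. \<Prod>b\<in>Basis. f b (x \<bullet> b)) \<in> borel_measurable borel"
    by (intro borel_measurable_prod measurable_compose[OF _ fm]) auto
  have T: "(\<Prod>b\<in>Basis. f b (T p \<bullet> b)) = (\<Prod>b\<in>Basis. f b (p b))" for p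
    by (intro prod.cong refl) (simp add: T_def inner_sum_left_Basis)
  have "integrable (\<Pi>\<^sub>M b\<in>Basis. lborel) (\<lambda>p. \<Prod>b\<in>Basis. f b (p b))"
    by (rule product_integrable_prod) (use f in auto)
  then have "integrable (distr (\<Pi>\<^sub>M b\<in>Basis. lborel) borel T) (\<lambda>x::'a. \<Prod>b\<in>Basis. f b (x \<bullet> b))"
    by (subst integrable_distr_eq) (auto simp: T)
  then show "integrable lborel (\<lambda>x::'a. \<Prod>b\<in>Basis. f b (x \<bullet> b))"
    using lb by simp
  have "(LINT x|lborel. (\<Prod>b\<in>Basis. f b ((x::'a) \<bullet> b))) = (LINT x|distr (\<Pi>\<^sub>M b\<in>Basis. lborel) borel T. (\<Prod>b\<in>Basis. f b (x \<bullet> b)))"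
    using lb by simp
  also have "\<dots> = (LINT p|(\<Pi>\<^sub>M b\<in>Basis. lborel). (\<Prod>b\<in>Basis. f b (p b)))"
    by (subst integral_distr) (auto simp: T)
  also have "\<dots> = (\<Prod>b\<in>Basis. LINT t|lborel. f b t)"
    by (rule product_integral_prod) (use f in auto)
  finally show "(LINT x|lborel. (\<Prod>b\<in>Basis. f b ((x::'a) \<bullet> b))) = (\<Prod>b\<in>Basis. LINT t|lborel. f b t)" .
qed

text \<open>The value is the characteristic function of the standard normal distribution, rescaled
  by \<open>n\<close>.\<close>

lemma
  fixes n a :: real
  assumes n: "0 < n"
  shows gauss_integrable: "integrable lborel (\<lambda>x. complex_of_real (exp (- (x / n)\<^sup>2 / 2)) * cis (a * x))"
    and gauss_integral: "(LINT x|lborel. complex_of_real (exp (- (x / n)\<^sup>2 / 2)) * cis (a * x))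
      = complex_of_real (n * sqrt (2 * pi) * exp (- (n * a)\<^sup>2 / 2))"
proof -
  have i0: "integrable lborel (\<lambda>x::real. exp (- x\<^sup>2 / 2))"
  proof -
    have "integrable lborel (\<lambda>x. sqrt (2 * pi) * std_normal_density x)" by simp
    then show ?thesis by (simp add: std_normal_density_def)
  qed
  have "integrable lborel (\<lambda>x. exp (- (0 + (1 / n) * x)\<^sup>2 / 2))"
    by (rule lborel_integrable_real_affine[OF i0]) (use n in auto)
  then have i1: "integrable lborel (\<lambda>x. exp (- (x / n)\<^sup>2 / 2))" by simp
  show "integrable lborel (\<lambda>x. complex_of_real (exp (- (x / n)\<^sup>2 / 2)) * cis (a * x))"
    by (rule Bochner_Integration.integrable_bound[OF i1]) (auto simp: norm_mult)
  have c: "(LINT x|lborel. complex_of_real (exp (- x\<^sup>2 / 2)) * cis (t * x)) = complex_of_real (sqrt (2 * pi) * exp (- t\<^sup>2 / 2))" for t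
  proof -
    have "complex_of_real (exp (- t\<^sup>2 / 2)) = (LINT x|std_normal_distribution. cis (t * x))"
      using char_std_normal_distribution by (simp add: char_def fun_eq_iff cis_conv_exp)
    also have "\<dots> = (LINT x|lborel. std_normal_density x *\<^sub>R cis (t * x))"
      by (subst integral_density) auto
    also have "\<dots> = (LINT x|lborel. (1 / sqrt (2 * pi)) *\<^sub>R (complex_of_real (exp (- x\<^sup>2 / 2)) * cis (t * x)))"
      by (simp add: std_normal_density_def scaleR_conv_of_real mult_ac)
    also have "\<dots> = (1 / sqrt (2 * pi)) *\<^sub>R (LINT x|lborel. complex_of_real (exp (- x\<^sup>2 / 2)) * cis (t * x))"
      by (rule integral_scaleR_right)
    finally show ?thesis by (simp add: scaleR_conv_of_real field_simps)
  qed
  have "(LINT x|lborel. complex_of_real (exp (- (x / n)\<^sup>2 / 2)) * cis (a * x))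
    = n *\<^sub>R (LINT x|lborel. complex_of_real (exp (- x\<^sup>2 / 2)) * cis ((n * a) * x))"
    using n by (subst lborel_integral_real_affine[of n _ 0]) (auto simp: mult_ac)
  then show "(LINT x|lborel. complex_of_real (exp (- (x / n)\<^sup>2 / 2)) * cis (a * x))
      = complex_of_real (n * sqrt (2 * pi) * exp (- (n * a)\<^sup>2 / 2))"
    by (simp only: c) (simp add: scaleR_conv_of_real)
qed

text \<open>A summability factor of width \<open>n\<close>, increasing to 1 with \<open>n\<close>;
  by \<open>FT_gau\<close> its transform is a multiple of \<open>heat\<close> squeezed to width
  1/n.\<close>

definition gau :: "real \<Rightarrow> 'a::euclidean_space \<Rightarrow> real" where
  "gau n x = exp (- (norm x / n)\<^sup>2 / 2)"

text \<open>The standard normal density, of total mass 1 by \<open>integral_heat\<close>; it is the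
  weight in the average of the correlations.\<close>

definition heat :: "'a::euclidean_space \<Rightarrow> real" where
  "heat x = exp (- (norm x)\<^sup>2 / 2) / sqrt (2 * pi) ^ DIM('a)"

lemma gau_prod:
  "complex_of_real (gau n x) * cis (x \<bullet> a)
    = (\<Prod>b\<in>Basis. complex_of_real (exp (- ((x \<bullet> b) / n)\<^sup>2 / 2)) * cis ((a \<bullet> b) * (x \<bullet> b)))"
proof -
  have "(norm x / n)\<^sup>2 = (\<Sum>b\<in>Basis. ((x \<bullet> b) / n)\<^sup>2)"
    unfolding power_divide power2_norm_eq_inner euclidean_inner[of x x] sum_divide_distrib
    by (simp add: power2_eq_square)
  then have 1: "gau n x = (\<Prod>b\<in>Basis. exp (- ((x \<bullet> b) / n)\<^sup>2 / 2))"
    by (simp add: gau_def exp_sum[symmetric] sum_negf sum_divide_distrib)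
  have "cis (x \<bullet> a) = (\<Prod>b\<in>Basis. cis ((a \<bullet> b) * (x \<bullet> b)))"
    by (simp add: cis_conv_exp exp_sum[symmetric] sum_distrib_left[symmetric] euclidean_inner[of x a] mult.commute)
  with 1 show ?thesis by (simp add: prod.distrib)
qed

lemma integrable_gau:
  assumes "0 < n" shows "integrable lborel (gau n :: 'a::euclidean_space \<Rightarrow> real)"
proof -
  have "integrable lborel (\<lambda>x::'a. \<Prod>b\<in>Basis. complex_of_real (exp (- ((x \<bullet> b) / n)\<^sup>2 / 2)) * cis ((0 \<bullet> b) * (x \<bullet> b)))"
    by (rule integrable_prod_Basis) (rule gauss_integrable[OF assms])
  then have "integrable lborel (\<lambda>x::'a. complex_of_real (gau n x))"
    using gau_prod[of n _ "0::'a"] by simp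
  then show ?thesis by (simp add: complex_of_real_integrable_eq)
qed

lemma two_pi_power: "(2 * pi) ^ n = sqrt (2 * pi) ^ n * sqrt (2 * pi) ^ n"
  unfolding power_mult_distrib[symmetric] by simp

lemma FT_gau:
  fixes a :: "'a::euclidean_space"
  assumes "0 < n"
  shows "FT (\<lambda>x. complex_of_real (gau n x)) a = complex_of_real ((2 * pi) ^ DIM('a) * n ^ DIM('a) * heat (n *\<^sub>R a))"
proof -
  have "FT (\<lambda>x. complex_of_real (gau n x)) a
     = (\<Prod>b\<in>Basis. complex_of_real (n * sqrt (2 * pi) * exp (- (n * (a \<bullet> b))\<^sup>2 / 2)))"
    unfolding FT_def gau_prod gauss_integral[OF assms, symmetric]
    by (rule integral_prod_Basis) (rule gauss_integrable[OF assms])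
  also have "\<dots> = complex_of_real ((n * sqrt (2 * pi)) ^ DIM('a) * (\<Prod>b\<in>Basis. exp (- (n * (a \<bullet> b))\<^sup>2 / 2)))"
    by (simp add: prod.distrib)
  also have "(\<Prod>b\<in>Basis. exp (- (n * (a \<bullet> b))\<^sup>2 / 2)) = exp (- (norm (n *\<^sub>R a))\<^sup>2 / 2)"
    by (simp add: exp_sum[symmetric] power_mult_distrib power2_norm_eq_inner euclidean_inner[of a a]
        sum_negf sum_divide_distrib sum_distrib_left power2_eq_square[of "_ \<bullet> _"])
  also have "(n * sqrt (2 * pi)) ^ DIM('a) * exp (- (norm (n *\<^sub>R a))\<^sup>2 / 2)
     = (2 * pi) ^ DIM('a) * n ^ DIM('a) * heat (n *\<^sub>R a)"
    unfolding two_pi_power heat_def power_mult_distrib[of n] by simp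
  finally show ?thesis .
qed

lemma gau_nonneg: "0 \<le> gau n x"
  by (simp add: gau_def)

lemma heat_nonneg: "0 \<le> heat x"
  by (simp add: heat_def)

lemma gau_measurable [measurable]: "gau n \<in> borel_measurable borel"
  unfolding gau_def[abs_def] by measurable

lemma heat_measurable [measurable]: "heat \<in> borel_measurable borel"
  unfolding heat_def[abs_def] by measurable

lemma heat_eq_gau: "heat x = gau 1 x / sqrt (2 * pi) ^ DIM('a)" for x :: "'a::euclidean_space"
  by (simp add: heat_def gau_def)

lemma integrable_heat: "integrable lborel (heat :: 'a::euclidean_space \<Rightarrow> real)"
  unfolding heat_eq_gau[abs_def] by (rule integrable_divide_zero) (rule integrable_gau, simp)

lemma integral_heat: "(LINT x|lborel. heat (x::'a::euclidean_space)) = 1"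
proof -
  have "complex_of_real (LINT x|lborel. gau 1 (x::'a)) = FT (\<lambda>x. complex_of_real (gau 1 x)) (0::'a)"
    by (simp add: FT_def)
  also have "\<dots> = complex_of_real ((2 * pi) ^ DIM('a) * heat (0::'a))"
    using FT_gau[of 1 "0::'a"] by simp
  finally have "(LINT x|lborel. gau 1 (x::'a)) = (2 * pi) ^ DIM('a) * heat (0::'a)"
    by (simp only: of_real_eq_iff)
  then have "(LINT x|lborel. gau 1 (x::'a)) = sqrt (2 * pi) ^ DIM('a)"
    unfolding two_pi_power by (simp add: heat_def)
  then show ?thesis unfolding heat_eq_gau[abs_def] by simp
qed

text \<open>Regularising with a Gaussian turns \<open>\<parallel>FT k\<parallel>\<^sup>2\<close> into an average of the correlations
  \<open>\<langle>k, k(\<cdot> + v / n)\<rangle>\<close>.\<close>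

definition corr :: "('a::euclidean_space \<Rightarrow> complex) \<Rightarrow> 'a \<Rightarrow> real" where
  "corr k v = ip lborel k (\<lambda>y. k (y + v))"

lemma corr_le:
  assumes "sqint lborel k" shows "\<bar>corr k v\<bar> \<le> (nrm lborel k)\<^sup>2"
  using ip_Cauchy_Schwarz[OF assms sqint_translate[OF assms, of v]] nrm_translate[OF assms, of v]
  by (simp add: corr_def power2_eq_square)

lemma corr_measurable [measurable]:
  assumes [measurable]: "k \<in> borel_measurable borel" shows "corr k \<in> borel_measurable borel"
  unfolding corr_def[abs_def] ip_def by measurable

lemma integrable_heat_corr:
  fixes k :: "'a::euclidean_space \<Rightarrow> complex"
  assumes "sqint lborel k"
  shows "integrable lborel (\<lambda>v. heat v * corr k (v /\<^sub>R n))"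
proof (rule Bochner_Integration.integrable_bound)
  have [measurable]: "k \<in> borel_measurable borel" using assms by (simp add: sqint_def)
  show "integrable lborel (\<lambda>v::'a. heat v * (nrm lborel k)\<^sup>2)"
    using integrable_heat[where 'a='a] by simp
  show "(\<lambda>v. heat v * corr k (v /\<^sub>R n)) \<in> borel_measurable lborel" by measurable
qed (use corr_le[OF assms] in \<open>auto simp: abs_mult heat_nonneg intro!: mult_left_mono\<close>)

text \<open>The integrand is \<open>m x * FT k x\<close> with m the Gaussian times the conjugate of
  \<open>FT k\<close>. Since m is integrable, the multiplication formula moves the transform onto m,
  where it becomes a Gaussian average of translates of k.\<close>

lemma gau_plancherel:
  fixes k :: "'a::euclidean_space \<Rightarrow> complex"
  assumes k: "integrable lborel k" "sqint lborel k" and n: "0 < n"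
  shows "integrable lborel (\<lambda>x. gau n x * (cmod (FT k x))\<^sup>2)"
    and "(LINT x|lborel. gau n x * (cmod (FT k x))\<^sup>2)
    = (2 * pi) ^ DIM('a) * (LINT v|lborel. heat v * corr k (v /\<^sub>R n))"
proof -
  have [measurable]: "k \<in> borel_measurable borel" using k by auto
  define C where "C = (LINT y|lborel. cmod (k y))"
  have C: "cmod (FT k x) \<le> C" for x using norm_FT_le[OF k(1)] by (simp add: C_def)
  define m where "m x = complex_of_real (gau n x) * cnj (FT k x)" for x
  have [measurable]: "m \<in> borel_measurable borel" unfolding m_def by measurable
  have m: "integrable lborel m"
  proof (rule Bochner_Integration.integrable_bound[where f="\<lambda>x. gau n x * C"])
    show "AE x in lborel. norm (m x) \<le> norm (gau n x * C)"
      using C order_trans[OF C abs_ge_self] by (auto simp: m_def norm_mult gau_nonneg abs_mult intro!: mult_left_mono)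
  qed (use integrable_gau[OF n, where 'a='a] in auto)
  have mm: "m x * FT k x = complex_of_real (gau n x * (cmod (FT k x))\<^sup>2)" for x
    using complex_norm_square[of "FT k x"] by (simp add: m_def mult_ac)
  have "integrable lborel (\<lambda>x. m x * FT k x)"
    by (rule Bochner_Integration.integrable_bound[where f="\<lambda>x. m x * C"])
       (use m order_trans[OF C abs_ge_self] in \<open>auto simp: norm_mult intro!: mult_left_mono\<close>)
  then show "integrable lborel (\<lambda>x. gau n x * (cmod (FT k x))\<^sup>2)"
    unfolding mm complex_of_real_integrable_eq .
  have FTm: "FT m y = complex_of_real ((2 * pi) ^ DIM('a)) * cnj (LINT v|lborel. k (y + v /\<^sub>R n) * complex_of_real (heat v))" for y
  proof -
    \<comment> \<open>A modulated Gaussian: up to conjugation the transform of \<open>m\<close> is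
      the integral of \<open>p * FT k\<close>, and a second use of the multiplication formula leaves
      the transform of a Gaussian translated by \<open>y\<close>.\<close>
    define p where "p x = complex_of_real (gau n x) * cis (- (x \<bullet> y))" for x
    have [measurable]: "p \<in> borel_measurable borel" unfolding p_def by measurable
    have p: "integrable lborel p"
      by (rule Bochner_Integration.integrable_bound[OF integrable_gau[OF n]]) (auto simp: p_def norm_mult)
    have "FT m y = (LINT x|lborel. cnj (p x * FT k x))"
      by (simp add: FT_def[of m] m_def p_def cis_cnj mult_ac)
    also have "\<dots> = cnj (LINT x|lborel. p x * FT k x)" by (rule Bochner_Integration.integral_cnj)
    also have "(LINT x|lborel. p x * FT k x) = (LINT z|lborel. k z * FT p z)"
      by (rule FT_multiplication_formula[OF k(1) p])
    also have "(\<lambda>z. FT p z) = (\<lambda>z. FT (\<lambda>x. complex_of_real (gau n x)) (z - y))"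
      by (auto simp: FT_def p_def mult.assoc cis_mult inner_diff_right intro!: Bochner_Integration.integral_cong)
    also have "(LINT z|lborel. k z * \<dots> z) = (LINT z|lborel. k z * complex_of_real ((2 * pi) ^ DIM('a) * n ^ DIM('a) * heat (n *\<^sub>R (z - y))))"
      by (simp only: FT_gau[OF n])
    \<comment> \<open>Substitution z = y + v / n; its Jacobian cancels the factor
      \<open>n ^ DIM('a)\<close>.\<close>
    also have "\<dots> = \<bar>1 / n\<bar> ^ DIM('a) *\<^sub>R (LINT v|lborel. k (y + (1 / n) *\<^sub>R v) * complex_of_real ((2 * pi) ^ DIM('a) * n ^ DIM('a) * heat (n *\<^sub>R ((y + (1 / n) *\<^sub>R v) - y))))"
      by (rule lborel_integral_affine) (use n in auto)
    also have "\<dots> = (LINT v|lborel. (\<bar>1 / n\<bar> ^ DIM('a)) *\<^sub>R (k (y + (1 / n) *\<^sub>R v) * complex_of_real ((2 * pi) ^ DIM('a) * n ^ DIM('a) * heat v)))"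
      using n by simp
    also have "\<dots> = (LINT v|lborel. complex_of_real ((2 * pi) ^ DIM('a)) * (k (y + v /\<^sub>R n) * complex_of_real (heat v)))"
    proof (rule LINT_cong)
      fix v
      have 1: "\<bar>1 / n\<bar> ^ DIM('a) * n ^ DIM('a) = 1"
        unfolding power_mult_distrib[symmetric] using n by simp
      have "(\<bar>1 / n\<bar> ^ DIM('a)) *\<^sub>R (k (y + (1 / n) *\<^sub>R v) * complex_of_real ((2 * pi) ^ DIM('a) * n ^ DIM('a) * heat v))
        = complex_of_real (\<bar>1 / n\<bar> ^ DIM('a) * n ^ DIM('a)) * (complex_of_real ((2 * pi) ^ DIM('a)) * (k (y + (1 / n) *\<^sub>R v) * complex_of_real (heat v)))"
        by (simp only: scaleR_conv_of_real of_real_mult mult_ac)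
      then show "(\<bar>1 / n\<bar> ^ DIM('a)) *\<^sub>R (k (y + (1 / n) *\<^sub>R v) * complex_of_real ((2 * pi) ^ DIM('a) * n ^ DIM('a) * heat v))
        = complex_of_real ((2 * pi) ^ DIM('a)) * (k (y + v /\<^sub>R n) * complex_of_real (heat v))"
        unfolding 1 by (simp only: of_real_1 mult_1_left inverse_eq_divide)
    qed
    also have "\<dots> = complex_of_real ((2 * pi) ^ DIM('a)) * (LINT v|lborel. k (y + v /\<^sub>R n) * complex_of_real (heat v))"
      by (rule integral_mult_right_zero)
    finally show ?thesis by (simp only: complex_cnj_mult complex_cnj_complex_of_real)
  qed
  \<comment> \<open>The majorant for Fubini: for each v, Cauchy-Schwarz and translation invariance
    bound the y-integral by the squared norm of k, and \<open>heat\<close> is integrable in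
    v.\<close>
  have int: "integrable (lborel \<Otimes>\<^sub>M lborel) (\<lambda>(v, y). heat v * (k y \<bullet> k (y + v /\<^sub>R n)))"
  proof (rule lborel_pair.Fubini_integrable)
    have 1: "integrable lborel (\<lambda>y. norm (k y) * norm (k (y + v /\<^sub>R n)))"
      "(LINT y|lborel. norm (k y) * norm (k (y + v /\<^sub>R n))) \<le> (nrm lborel k)\<^sup>2" for v
      using Cauchy_Schwarz_norm[OF k(2) sqint_translate[OF k(2), of "v /\<^sub>R n"]] nrm_translate[OF k(2)]
      by (auto simp: power2_eq_square)
    have 2: "integrable lborel (\<lambda>y. k y \<bullet> k (y + v /\<^sub>R n))" for v
      by (rule ip_integrable[OF k(2) sqint_translate[OF k(2)]])
    then show "AE v in lborel. integrable lborel (\<lambda>y. case (v, y) of (v, y) \<Rightarrow> heat v * (k y \<bullet> k (y + v /\<^sub>R n)))"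
      by simp
    show "integrable lborel (\<lambda>v. LINT y|lborel. norm (case (v, y) of (v, y) \<Rightarrow> heat v * (k y \<bullet> k (y + v /\<^sub>R n))))"
    proof (rule Bochner_Integration.integrable_bound)
      show "integrable lborel (\<lambda>v::'a. heat v * (nrm lborel k)\<^sup>2)" using integrable_heat[where 'a='a] by simp
      have "(LINT y|lborel. \<bar>k y \<bullet> k (y + v /\<^sub>R n)\<bar>) \<le> (nrm lborel k)\<^sup>2" for v
        by (rule order_trans[OF integral_mono 1(2)[of v]]) (use 1(1) 2 in \<open>auto simp: Cauchy_Schwarz_ineq2\<close>)
      then show "AE v in lborel. norm (LINT y|lborel. norm (case (v, y) of (v, y) \<Rightarrow> heat v * (k y \<bullet> k (y + v /\<^sub>R n))))
          \<le> norm (heat v * (nrm lborel k)\<^sup>2)"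
        by (auto simp: abs_mult heat_nonneg intro!: mult_left_mono)
    qed measurable
  qed measurable
  have kh: "integrable lborel (\<lambda>v. k (y + v /\<^sub>R n) * complex_of_real (heat v))" for y
  proof (rule Bochner_Integration.integrable_bound)
    have "integrable (distr lborel borel (\<lambda>x. y + (1/n) *\<^sub>R x)) k"
    proof -
      have "integrable (density (distr lborel borel (\<lambda>x. y + (1/n) *\<^sub>R x)) (\<lambda>_. ennreal (\<bar>1/n\<bar> ^ DIM('a)))) k"
        using lborel_affine[of "1/n" y] n k(1) by (simp add: ennreal_power)
      then have "integrable (distr lborel borel (\<lambda>x. y + (1/n) *\<^sub>R x)) (\<lambda>x. (1 / n) ^ DIM('a) *\<^sub>R k x)"
        using n by (subst (asm) integrable_density) auto
      from integrable_scaleR_right[OF this, of "n ^ DIM('a)"] show ?thesis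
        using n by (simp add: power_mult_distrib[symmetric])
    qed
    then have "integrable lborel (\<lambda>v. k (y + (1/n) *\<^sub>R v))" by (subst (asm) integrable_distr_eq) auto
    then show "integrable lborel (\<lambda>v. k (y + v /\<^sub>R n))" by (simp add: inverse_eq_divide)
    have "heat v \<le> 1" for v :: 'a
    proof -
      have "1 \<le> sqrt (2 * pi) ^ DIM('a)" using pi_ge_two by (intro one_le_power real_le_rsqrt) auto
      then have "exp (- (norm v)\<^sup>2 / 2) \<le> sqrt (2 * pi) ^ DIM('a)"
        by (rule order_trans[rotated]) simp
      then show ?thesis by (simp add: heat_def divide_le_eq_1_pos)
    qed
    then show "AE v in lborel. norm (k (y + v /\<^sub>R n) * complex_of_real (heat v)) \<le> norm (k (y + v /\<^sub>R n))"
      by (auto simp: norm_mult heat_nonneg intro!: mult_left_le)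
  qed measurable
  have "complex_of_real (LINT x|lborel. gau n x * (cmod (FT k x))\<^sup>2) = (LINT x|lborel. m x * FT k x)"
    by (simp only: mm integral_complex_of_real)
  also have "\<dots> = (LINT y|lborel. k y * FT m y)" by (rule FT_multiplication_formula[OF k(1) m])
  finally have "(LINT x|lborel. gau n x * (cmod (FT k x))\<^sup>2) = Re (LINT y|lborel. k y * FT m y)"
    by (metis Re_complex_of_real)
  also have "\<dots> = (LINT y|lborel. Re (k y * FT m y))"
  proof (rule integral_Re[symmetric])
    have "cmod (FT m y) \<le> (LINT y|lborel. cmod (m y))" for y by (rule norm_FT_le[OF m])
    then show "integrable lborel (\<lambda>y. k y * FT m y)"
      by (intro Bochner_Integration.integrable_bound[of lborel "\<lambda>y. k y * complex_of_real (LINT y|lborel. cmod (m y))" "\<lambda>y. k y * FT m y"])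
         (use k(1) in \<open>auto simp: norm_mult intro!: mult_left_mono\<close>)
  qed
  also have "\<dots> = (LINT y|lborel. (2 * pi) ^ DIM('a) * (LINT v|lborel. heat v * (k y \<bullet> k (y + v /\<^sub>R n))))"
  proof (intro Bochner_Integration.integral_cong refl)
    fix y
    have "Re (k y * FT m y) = (2 * pi) ^ DIM('a) * Re (k y * cnj (LINT v|lborel. k (y + v /\<^sub>R n) * complex_of_real (heat v)))"
      unfolding FTm by (subst mult.left_commute) (simp only: times_complex.sel(1) Re_complex_of_real Im_complex_of_real mult_zero_left diff_0_right)
    also have "Re (k y * cnj (LINT v|lborel. k (y + v /\<^sub>R n) * complex_of_real (heat v))) = k y \<bullet> (LINT v|lborel. k (y + v /\<^sub>R n) * complex_of_real (heat v))"
      by (simp add: inner_complex_def)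
    also have "\<dots> = (LINT v|lborel. k y \<bullet> (k (y + v /\<^sub>R n) * complex_of_real (heat v)))"
      by (rule integral_inner_right[symmetric]) (rule kh)
    also have "\<dots> = (LINT v|lborel. heat v * (k y \<bullet> k (y + v /\<^sub>R n)))"
      by (simp add: inner_complex_def algebra_simps)
    finally show "Re (k y * FT m y) = (2 * pi) ^ DIM('a) * (LINT v|lborel. heat v * (k y \<bullet> k (y + v /\<^sub>R n)))" .
  qed
  also have "\<dots> = (2 * pi) ^ DIM('a) * (LINT y|lborel. LINT v|lborel. heat v * (k y \<bullet> k (y + v /\<^sub>R n)))"
    by simp
  also have "(LINT y|lborel. LINT v|lborel. heat v * (k y \<bullet> k (y + v /\<^sub>R n)))
     = (LINT v|lborel. LINT y|lborel. heat v * (k y \<bullet> k (y + v /\<^sub>R n)))"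
    using lborel_pair.Fubini_integral[OF int] by simp
  also have "\<dots> = (LINT v|lborel. heat v * corr k (v /\<^sub>R n))"
    by (simp add: corr_def ip_def)
  finally show "(LINT x|lborel. gau n x * (cmod (FT k x))\<^sup>2)
    = (2 * pi) ^ DIM('a) * (LINT v|lborel. heat v * corr k (v /\<^sub>R n))" .
qed

lemma sqint_supported_integrable:
  fixes k :: "'a::euclidean_space \<Rightarrow> 'b::euclidean_space"
  assumes k: "sqint lborel k" and supp: "\<And>x. norm x > R \<Longrightarrow> k x = 0"
  shows "integrable lborel k"
proof -
  have [measurable]: "k \<in> borel_measurable borel" using k by (simp add: sqint_def)
  have "sqint lborel (indicator (cball (0::'a) R) :: 'a \<Rightarrow> real)"
    by (rule sqint_indicator[OF _ emeasure_lborel_cball_finite]) simp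
  from Cauchy_Schwarz_norm(1)[OF k this]
  have "integrable lborel (\<lambda>x. norm (k x) * norm (indicator (cball 0 R) x :: real))" .
  then show ?thesis
    by (rule Bochner_Integration.integrable_bound) (use supp in \<open>auto simp: indicator_def not_le\<close>)
qed

text \<open>Continuity of translations, for the bounded continuous functions on which dominated
  convergence gives it directly; the general case is reached afterwards by density.\<close>

lemma corr_tendsto:
  fixes \<phi> :: "'a::euclidean_space \<Rightarrow> complex"
  assumes c: "continuous_on UNIV \<phi>" and B: "\<And>x. norm (\<phi> x) \<le> B"
    and s: "sqint lborel \<phi>" and i: "integrable lborel \<phi>"
  shows "(\<lambda>n. corr \<phi> (v /\<^sub>R real (Suc n))) \<longlonglongrightarrow> (nrm lborel \<phi>)\<^sup>2"
  unfolding corr_def ip_def nrm_power2 power2_norm_eq_inner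
proof (rule integral_dominated_convergence[where w="\<lambda>y. norm (\<phi> y) * B"])
  have [measurable]: "\<phi> \<in> borel_measurable borel" using s by (simp add: sqint_def)
  show "(\<lambda>y. \<phi> y \<bullet> \<phi> (y + v /\<^sub>R real (Suc n))) \<in> borel_measurable lborel" for n by measurable
  show "(\<lambda>y. \<phi> y \<bullet> \<phi> y) \<in> borel_measurable lborel" by measurable
  show "integrable lborel (\<lambda>y. norm (\<phi> y) * B)" using i by simp
  have "(\<lambda>n. \<phi> y \<bullet> \<phi> (y + v /\<^sub>R real (Suc n))) \<longlonglongrightarrow> \<phi> y \<bullet> \<phi> (y + 0 *\<^sub>R v)" for y
  proof (intro tendsto_intros continuous_on_tendsto_compose[OF c])
    show "(\<lambda>n. inverse (real (Suc n))) \<longlonglongrightarrow> 0" by (rule LIMSEQ_inverse_real_of_nat)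
  qed auto
  then show "AE y in lborel. (\<lambda>n. \<phi> y \<bullet> \<phi> (y + v /\<^sub>R real (Suc n))) \<longlonglongrightarrow> \<phi> y \<bullet> \<phi> y" by simp
  show "AE y in lborel. norm (\<phi> y \<bullet> \<phi> (y + v /\<^sub>R real (Suc n))) \<le> norm (\<phi> y) * B" for n
    using B order_trans[OF Cauchy_Schwarz_ineq2 mult_left_mono] by fastforce
qed

lemma gau_tendsto: "(\<lambda>n. gau (real (Suc n)) x) \<longlonglongrightarrow> 1"
proof -
  have 1: "(\<lambda>n. norm x / real (Suc n)) \<longlonglongrightarrow> 0"
    by (rule LIMSEQ_Suc[OF lim_const_over_n])
  have "(\<lambda>n. exp (- (norm x / real (Suc n))\<^sup>2 / 2)) \<longlonglongrightarrow> exp (- 0\<^sup>2 / 2)"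
    by (intro tendsto_intros 1) auto
  then show ?thesis by (simp add: gau_def)
qed

lemma gau_le_1: "gau n x \<le> 1"
  by (simp add: gau_def)

text \<open>(2 \<pi>)^(d/2), the factor by which \<open>FT\<close> differs from an isometry; the
  type argument carries the dimension.\<close>

definition fnorm :: "'a::euclidean_space itself \<Rightarrow> real" where
  "fnorm _ = sqrt ((2 * pi) ^ DIM('a))"

lemma fnorm_pos: "0 < fnorm TYPE('a::euclidean_space)" and fnorm_power2: "(fnorm TYPE('a))\<^sup>2 = (2 * pi) ^ DIM('a)"
  by (simp_all add: fnorm_def)

text \<open>Every correlation is at most the squared norm and \<open>heat\<close> has mass 1, which
  bounds the Gaussian means uniformly; Fatou's lemma removes the Gaussian. This inequality already
  makes \<open>FT\<close> continuous in L^2, as the density argument for equality requires.\<close>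

lemma FT_Bessel:
  fixes k :: "'a::euclidean_space \<Rightarrow> complex"
  assumes k: "integrable lborel k" "sqint lborel k"
  shows "sqint lborel (FT k)" "nrm lborel (FT k) \<le> fnorm TYPE('a) * nrm lborel k"
proof -
  have [measurable]: "k \<in> borel_measurable borel" using k by (simp add: sqint_def)
  have le: "(LINT x|lborel. gau (real (Suc n)) x * (cmod (FT k x))\<^sup>2) \<le> (fnorm TYPE('a) * nrm lborel k)\<^sup>2" for n
  proof -
    have "(LINT v|lborel. heat v * corr k (v /\<^sub>R real (Suc n))) \<le> (LINT v|lborel. heat (v::'a) * (nrm lborel k)\<^sup>2)"
      using integrable_heat[where 'a='a] corr_le[OF k(2), THEN abs_le_D1]
      by (intro integral_mono integrable_heat_corr[OF k(2)] mult_left_mono heat_nonneg) auto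
    also have "\<dots> = (nrm lborel k)\<^sup>2" using integral_heat[where 'a='a] by simp
    finally show ?thesis
      using gau_plancherel(2)[OF k, of "real (Suc n)"]
      by (simp add: power_mult_distrib fnorm_power2 mult_left_mono del: of_nat_Suc)
  qed
  have "(\<integral>\<^sup>+x. ennreal ((norm (FT k x))\<^sup>2) \<partial>lborel) = (\<integral>\<^sup>+x. liminf (\<lambda>n. ennreal (gau (real (Suc n)) x * (norm (FT k x))\<^sup>2)) \<partial>lborel)"
  proof (rule nn_integral_cong)
    fix x
    have "(\<lambda>n. ennreal (gau (real (Suc n)) x * (norm (FT k x))\<^sup>2)) \<longlonglongrightarrow> ennreal (1 * (norm (FT k x))\<^sup>2)"
      by (intro tendsto_intros gau_tendsto)
    from lim_imp_Liminf[OF _ this]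
    show "ennreal ((norm (FT k x))\<^sup>2) = liminf (\<lambda>n. ennreal (gau (real (Suc n)) x * (norm (FT k x))\<^sup>2))" by simp
  qed
  also have "\<dots> \<le> liminf (\<lambda>n. \<integral>\<^sup>+x. ennreal (gau (real (Suc n)) x * (norm (FT k x))\<^sup>2) \<partial>lborel)"
    by (rule nn_integral_liminf) measurable
  also have "\<dots> \<le> ennreal ((fnorm TYPE('a) * nrm lborel k)\<^sup>2)"
  proof (rule Liminf_le)
    have "(\<integral>\<^sup>+x. ennreal (gau (real (Suc n)) x * (norm (FT k x))\<^sup>2) \<partial>lborel) \<le> ennreal ((fnorm TYPE('a) * nrm lborel k)\<^sup>2)" for n
    proof -
      have "(\<integral>\<^sup>+x. ennreal (gau (real (Suc n)) x * (norm (FT k x))\<^sup>2) \<partial>lborel)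
        = ennreal (LINT x|lborel. gau (real (Suc n)) x * (cmod (FT k x))\<^sup>2)"
        using gau_plancherel(1)[OF k, of "real (Suc n)"] by (intro nn_integral_eq_integral) (auto simp: gau_nonneg)
      with le[of n] show ?thesis by (simp add: ennreal_leI del: of_nat_Suc)
    qed
    then show "\<forall>\<^sub>F n in sequentially. (\<integral>\<^sup>+x. ennreal (gau (real (Suc n)) x * (norm (FT k x))\<^sup>2) \<partial>lborel) \<le> ennreal ((fnorm TYPE('a) * nrm lborel k)\<^sup>2)"
      by simp
  qed simp
  finally show "sqint lborel (FT k)" "nrm lborel (FT k) \<le> fnorm TYPE('a) * nrm lborel k"
    using nrm_le_nn[of "FT k" lborel "fnorm TYPE('a) * nrm lborel k"] fnorm_pos[where 'a='a] by auto
qed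

text \<open>For the inequality missing from \<open>FT_Bessel\<close>, the Gaussian means are bounded
  by the full integral because \<open>gau\<close> is at most 1, while the averaged correlations tend
  to the squared norm.\<close>

lemma FT_isometry_continuous:
  fixes \<phi> :: "'a::euclidean_space \<Rightarrow> complex"
  assumes c: "continuous_on UNIV \<phi>" and B: "\<And>x. norm (\<phi> x) \<le> B"
    and s: "sqint lborel \<phi>" and i: "integrable lborel \<phi>"
  shows "nrm lborel (FT \<phi>) = fnorm TYPE('a) * nrm lborel \<phi>"
proof (rule antisym)
  have [measurable]: "\<phi> \<in> borel_measurable borel" using s by (simp add: sqint_def)
  have "(\<lambda>n. LINT v|lborel. heat v * corr \<phi> (v /\<^sub>R real (Suc n))) \<longlonglongrightarrow> (LINT v|lborel. heat (v::'a) * (nrm lborel \<phi>)\<^sup>2)"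
  proof (rule integral_dominated_convergence[where w="\<lambda>v. heat v * (nrm lborel \<phi>)\<^sup>2"])
    show "integrable lborel (\<lambda>v::'a. heat v * (nrm lborel \<phi>)\<^sup>2)" using integrable_heat[where 'a='a] by simp
    show "AE v in lborel. (\<lambda>n. heat v * corr \<phi> (v /\<^sub>R real (Suc n))) \<longlonglongrightarrow> heat v * (nrm lborel \<phi>)\<^sup>2"
      by (intro AE_I2 tendsto_mult tendsto_const corr_tendsto[OF assms])
    show "AE v in lborel. norm (heat v * corr \<phi> (v /\<^sub>R real (Suc n))) \<le> heat v * (nrm lborel \<phi>)\<^sup>2" for n
      using corr_le[OF s] by (auto simp: abs_mult heat_nonneg intro!: mult_left_mono)
  qed measurable
  then have lim: "(\<lambda>n. (2 * pi) ^ DIM('a) * (LINT v|lborel. heat v * corr \<phi> (v /\<^sub>R real (Suc n)))) \<longlonglongrightarrow> (2 * pi) ^ DIM('a) * (nrm lborel \<phi>)\<^sup>2"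
    using integral_heat[where 'a='a] by (intro tendsto_mult tendsto_const) simp
  have "(2 * pi) ^ DIM('a) * (nrm lborel \<phi>)\<^sup>2 \<le> (nrm lborel (FT \<phi>))\<^sup>2"
  proof (rule Lim_bounded[OF lim, where M=0], intro allI impI)
    fix n
    have "(LINT x|lborel. gau (real (Suc n)) x * (cmod (FT \<phi> x))\<^sup>2) \<le> (LINT x|lborel. (cmod (FT \<phi> x))\<^sup>2)"
    proof (rule integral_mono)
      show "integrable lborel (\<lambda>x. gau (real (Suc n)) x * (cmod (FT \<phi> x))\<^sup>2)"
        by (rule gau_plancherel(1)[OF i s]) simp
      show "integrable lborel (\<lambda>x. (cmod (FT \<phi> x))\<^sup>2)" using FT_Bessel(1)[OF i s] by (simp add: sqint_def)
    qed (simp add: mult_left_le_one_le gau_nonneg gau_le_1)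
    then show "(2 * pi) ^ DIM('a) * (LINT v|lborel. heat v * corr \<phi> (v /\<^sub>R real (Suc n))) \<le> (nrm lborel (FT \<phi>))\<^sup>2"
      using gau_plancherel(2)[OF i s, of "real (Suc n)"] by (simp add: nrm_power2 del: of_nat_Suc)
  qed
  then have "(fnorm TYPE('a) * nrm lborel \<phi>)\<^sup>2 \<le> (nrm lborel (FT \<phi>))\<^sup>2"
    by (simp add: power_mult_distrib fnorm_power2)
  then show "fnorm TYPE('a) * nrm lborel \<phi> \<le> nrm lborel (FT \<phi>)" by (rule power2_le_imp_le) simp
qed (rule FT_Bessel(2)[OF i s])

lemma FT_isometry_limit:
  fixes k :: "'a::euclidean_space \<Rightarrow> complex"
  assumes k: "sqint lborel k" "integrable lborel k"
    and f: "\<And>n. sqint lborel (f n)" "\<And>n. integrable lborel (f n)"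
    and iso: "\<And>n. nrm lborel (FT (f n)) = fnorm TYPE('a) * nrm lborel (f n)"
    and lim: "(\<lambda>n. nrm lborel (\<lambda>x. f n x - k x)) \<longlonglongrightarrow> 0"
  shows "nrm lborel (FT k) = fnorm TYPE('a) * nrm lborel k"
proof (rule LIMSEQ_unique)
  show "(\<lambda>n. nrm lborel (FT (f n))) \<longlonglongrightarrow> fnorm TYPE('a) * nrm lborel k"
    unfolding iso by (intro tendsto_mult tendsto_const nrm_tendsto[OF f(1) k(1) lim])
  have "nrm lborel (\<lambda>x. FT (f n) x - FT k x) \<le> fnorm TYPE('a) * nrm lborel (\<lambda>x. f n x - k x)" for n
    using FT_Bessel(2)[OF Bochner_Integration.integrable_diff[OF f(2) k(2)] sqint_diff[OF f(1) k(1)], of n]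
    unfolding FT_diff[OF f(2) k(2), abs_def] .
  then have "(\<lambda>n. nrm lborel (\<lambda>x. FT (f n) x - FT k x)) \<longlonglongrightarrow> 0"
    by (intro Lim_null_comparison[OF _ tendsto_mult_right_zero[OF lim, of "fnorm TYPE('a)"]]) simp
  then show "(\<lambda>n. nrm lborel (FT (f n))) \<longlonglongrightarrow> nrm lborel (FT k)"
    by (intro nrm_tendsto FT_Bessel f k)
qed

text \<open>Two density steps: continuous functions approximate bounded ones of bounded support, and
  truncations approximate the given function. Bounded support keeps every approximant integrable, so
  that \<open>FT\<close> is an absolutely convergent integral throughout.\<close>

theorem FT_isometry:
  fixes k :: "'a::euclidean_space \<Rightarrow> complex"
  assumes k: "sqint lborel k" and supp: "\<And>x. norm x > R \<Longrightarrow> k x = 0"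
  shows "nrm lborel (FT k) = fnorm TYPE('a) * nrm lborel k"
proof -
  have bounded_case: "nrm lborel (FT k) = fnorm TYPE('a) * nrm lborel k"
    if m: "k \<in> borel_measurable borel" and b: "\<And>x. norm (k x) \<le> B" and supp: "\<And>x. norm x > R \<Longrightarrow> k x = 0"
    for k :: "'a \<Rightarrow> complex" and B R
  proof -
    obtain \<phi> C R' where \<phi>: "\<And>n. continuous_on UNIV (\<phi> n)" "\<And>n x. norm (\<phi> n x) \<le> C"
      "\<And>n x. norm x > R' \<Longrightarrow> \<phi> n x = 0" "\<And>n. sqint lborel (\<phi> n)" "sqint lborel k"
      "(\<lambda>n. nrm lborel (\<lambda>x. \<phi> n x - k x)) \<longlonglongrightarrow> 0"
      using bounded_continuous_approx[OF m b supp] by blast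
    have i: "integrable lborel (\<phi> n)" for n by (rule sqint_supported_integrable[OF \<phi>(4,3)])
    show ?thesis
      by (rule FT_isometry_limit[OF \<phi>(5) sqint_supported_integrable[OF \<phi>(5) supp] \<phi>(4) i FT_isometry_continuous[OF \<phi>(1,2,4) i] \<phi>(6)])
  qed
  have [measurable]: "k \<in> borel_measurable borel" using k by (simp add: sqint_def)
  have tr: "norm x > R \<Longrightarrow> trunc n k x = 0" "norm (trunc n k x) \<le> real n" for n x using supp by (auto simp: trunc_def)
  show ?thesis
  proof (rule FT_isometry_limit[OF k sqint_supported_integrable[OF k supp] nrm_trunc(1)[OF k] _ _ nrm_trunc(2)[OF k]])
    show "integrable lborel (trunc n k)" for n by (rule sqint_supported_integrable[OF nrm_trunc(1)[OF k] tr(1)])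
    show "nrm lborel (FT (trunc n k)) = fnorm TYPE('a) * nrm lborel (trunc n k)" for n
      by (rule bounded_case[OF _ tr(2) tr(1)]) measurable
  qed
qed

section \<open>Band-limited functions\<close>

text \<open>The functions \<open>E k\<close> with \<open>kern k\<close> have a bounded compactly supported Fourier transform. They replace
  test functions where Fourier multipliers occur, being stable under them.\<close>

definition kern :: "('a::euclidean_space \<Rightarrow> complex) \<Rightarrow> bool" where
  "kern k \<longleftrightarrow> k \<in> borel_measurable borel \<and> (\<exists>B. \<forall>x. norm (k x) \<le> B \<and> (norm x > B \<longrightarrow> k x = 0))"

text \<open>The unknowns are real, hence the real part. Nothing is lost, because kernels may be
  multiplied by the imaginary unit.\<close>

definition E :: "('a::euclidean_space \<Rightarrow> complex) \<Rightarrow> 'a \<Rightarrow> real" where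
  "E k x = Re (FT k x)"

lemma kern_measurable [measurable_dest]: "kern k \<Longrightarrow> k \<in> borel_measurable borel"
  by (simp add: kern_def)

lemma kernE:
  assumes "kern k"
  shows "\<exists>B\<ge>0. (\<forall>x. norm (k x) \<le> B) \<and> (\<forall>x. norm x > B \<longrightarrow> k x = 0)"
proof -
  obtain B where B: "\<And>x. norm (k x) \<le> B \<and> (norm x > B \<longrightarrow> k x = 0)"
    using assms by (auto simp: kern_def)
  then have "B \<ge> 0" using norm_ge_zero order_trans by blast
  with B show ?thesis by blast
qed

lemma kernI:
  assumes "k \<in> borel_measurable borel" "\<And>x. norm (k x) \<le> B" "\<And>x. norm x > R \<Longrightarrow> k x = 0"
  shows "kern k"
  unfolding kern_def
proof (intro conjI exI[of _ "max B R"] allI impI)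
  show "norm (k x) \<le> max B R" for x using assms(2)[of x] by simp
  show "norm x > max B R \<Longrightarrow> k x = 0" for x using assms(3)[of x] by simp
qed fact

lemma kern_sqint:
  assumes "kern k" shows "sqint lborel k"
proof -
  obtain B where B: "B \<ge> 0" "\<And>x. norm (k x) \<le> B" "\<And>x. norm x > B \<Longrightarrow> k x = 0"
    using kernE[OF assms] by blast
  have "sqint lborel (\<lambda>x::'a. B *\<^sub>R indicator (cball 0 B) x :: real)"
    by (intro sqint_scaleR sqint_indicator[OF _ emeasure_lborel_cball_finite]) simp
  then show ?thesis
  proof (rule sqint_bound)
    show "AE x in lborel. norm (k x) \<le> norm (B *\<^sub>R indicator (cball 0 B) x :: real)"
      using B by (auto simp: indicator_def not_le)
  qed (use assms in \<open>auto simp: kern_def\<close>)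
qed

lemma kern_integrable:
  assumes "kern k" shows "integrable lborel k"
  using kernE[OF assms] sqint_supported_integrable[OF kern_sqint[OF assms]] by blast

lemma kern_trunc:
  assumes "u \<in> borel_measurable borel" shows "kern (trunc n u)"
  by (rule kernI[of _ "real n" "real n"]) (use assms in \<open>auto simp: trunc_def\<close>)

lemma kern_mult:
  assumes k: "kern k" and g: "continuous_on UNIV g" shows "kern (\<lambda>x. g x * k x)"
proof -
  obtain B where B: "B \<ge> 0" "\<And>x. norm (k x) \<le> B" "\<And>x. norm x > B \<Longrightarrow> k x = 0"
    using kernE[OF assms(1)] by blast
  have "compact (g ` cball 0 B)" by (intro compact_continuous_image continuous_on_subset[OF g]) auto
  then obtain C where "\<forall>y\<in>g ` cball 0 B. norm y \<le> C" using compact_imp_bounded bounded_iff by metis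
  then have C: "norm x \<le> B \<Longrightarrow> norm (g x) \<le> C" for x by simp
  have [measurable]: "g \<in> borel_measurable borel" using g by (rule borel_measurable_continuous_onI)
  have "C \<ge> 0" using order_trans[OF norm_ge_zero C[of 0]] B(1) by simp
  show ?thesis
  proof (rule kernI)
    show "norm (g x * k x) \<le> C * B" for x
      using C[of x] B(2)[of x] B(3)[of x] B(1) \<open>C \<ge> 0\<close>
      by (cases "norm x \<le> B") (auto simp: norm_mult intro!: mult_mono)
    show "norm x > B \<Longrightarrow> g x * k x = 0" for x using B(3) by simp
  qed (use k in measurable)
qed

lemma kern_add:
  assumes "kern k" "kern m" shows "kern (\<lambda>x. k x + m x)"
proof -
  obtain B where B: "B \<ge> 0" "\<And>x. norm (k x) \<le> B" "\<And>x. norm x > B \<Longrightarrow> k x = 0"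
    using kernE[OF assms(1)] by blast
  obtain C where C: "C \<ge> 0" "\<And>x. norm (m x) \<le> C" "\<And>x. norm x > C \<Longrightarrow> m x = 0"
    using kernE[OF assms(2)] by blast
  show ?thesis
  proof (rule kernI)
    show "norm (k x + m x) \<le> B + C" for x by (rule norm_triangle_le) (use B(2) C(2) in \<open>simp add: add_mono\<close>)
    show "norm x > max B C \<Longrightarrow> k x + m x = 0" for x using B(3) C(3) by simp
  qed (use assms in measurable)
qed

lemma kern_0: "kern (\<lambda>x. 0)"
  by (rule kernI[of _ 0 0]) auto

lemma kern_sum: "(\<And>i. i \<in> I \<Longrightarrow> kern (k i)) \<Longrightarrow> kern (\<lambda>x. \<Sum>i\<in>I. k i x)"
  by (induction I rule: infinite_finite_induct) (auto intro!: kern_add kern_0)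

lemma kern_bounded_mult:
  assumes k: "kern k" and g: "g \<in> borel_measurable borel" "\<And>x. norm (g x) \<le> C"
  shows "kern (\<lambda>x. g x * k x)"
proof -
  obtain B where B: "B \<ge> 0" "\<And>x. norm (k x) \<le> B" "\<And>x. norm x > B \<Longrightarrow> k x = 0"
    using kernE[OF assms(1)] by blast
  show ?thesis
  proof (rule kernI)
    show "norm (g x * k x) \<le> \<bar>C\<bar> * B" for x
      using order_trans[OF g(2)[of x] abs_ge_self] B(1,2) by (auto simp: norm_mult intro!: mult_mono)
    show "norm x > B \<Longrightarrow> g x * k x = 0" for x using B(3) by simp
  qed (use k g in measurable)
qed

lemma E_measurable [measurable]: "k \<in> borel_measurable borel \<Longrightarrow> E k \<in> borel_measurable borel"
  unfolding E_def[abs_def] by measurable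

lemma
  fixes k :: "'a::euclidean_space \<Rightarrow> complex"
  assumes "kern k"
  shows E_sqint: "sqint lborel (E k)" and nrm_E_le: "nrm lborel (E k) \<le> fnorm TYPE('a) * nrm lborel k"
proof -
  note FT = FT_Bessel[OF kern_integrable[OF assms] kern_sqint[OF assms]]
  have [measurable]: "k \<in> borel_measurable borel" using assms by (simp add: kern_def)
  have *: "AE x in lborel. norm (E k x) \<le> norm (FT k x)" by (simp add: E_def abs_Re_le_cmod)
  show "sqint lborel (E k)" by (rule sqint_bound[OF FT(1) _ *]) measurable
  show "nrm lborel (E k) \<le> fnorm TYPE('a) * nrm lborel k"
    by (rule order_trans[OF nrm_mono[OF FT(1) _ *] FT(2)]) measurable
qed

lemma E_add: "kern k \<Longrightarrow> kern m \<Longrightarrow> E (\<lambda>y. k y + m y) x = E k x + E m x"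
  using integrable_mult_cis[OF kern_integrable, of k x] integrable_mult_cis[OF kern_integrable, of m x]
  by (simp add: E_def FT_def distrib_right)

lemma E_diff: "kern k \<Longrightarrow> kern m \<Longrightarrow> E (\<lambda>y. k y - m y) x = E k x - E m x"
  by (simp add: E_def FT_diff kern_integrable)

lemma E_scaleR: "E (\<lambda>y. c *\<^sub>R k y) x = c * E k x"
  by (simp add: E_def FT_def)

lemma E_0: "E (\<lambda>y. 0) x = 0"
  by (simp add: E_def FT_def)

lemma E_sum: "(\<And>i. i \<in> I \<Longrightarrow> kern (k i)) \<Longrightarrow> E (\<lambda>y. \<Sum>i\<in>I. k i y) x = (\<Sum>i\<in>I. E (k i) x)"
proof (induction I rule: infinite_finite_induct)
  case (insert i I)
  then show ?case using E_add[OF insert.prems(1)[of i] kern_sum[of I k], of x] by simp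
qed (simp_all add: E_0)

lemma sqint_abs: "sqint M u \<Longrightarrow> sqint M (\<lambda>x. c * \<bar>u x\<bar> :: real)"
proof -
  assume "sqint M u"
  then have "sqint M (\<lambda>x. \<bar>u x\<bar>)" by (auto simp: sqint_def)
  from sqint_scaleR[OF this, of c] show ?thesis by simp
qed

text \<open>The symbol of the derivative along \<open>b\<close>: by \<open>pd_E\<close>,
  differentiating \<open>E k\<close> amounts to this multiplication of the kernel.\<close>

definition dk :: "'a::euclidean_space \<Rightarrow> ('a \<Rightarrow> complex) \<Rightarrow> 'a \<Rightarrow> complex" where
  "dk b k y = \<i> * complex_of_real (y \<bullet> b) * k y"

lemma kern_dk: "kern k \<Longrightarrow> kern (dk b k)"
  unfolding dk_def[abs_def] by (rule kern_mult) (auto intro!: continuous_intros)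

lemma cis_approx: "cmod (cis t - 1 - \<i> * complex_of_real t) \<le> t\<^sup>2"
proof -
  have "cmod (cis t - 1 - \<i> * complex_of_real t) \<le> \<bar>t\<bar>\<^sup>2 / 2"
    using iexp_approx1[of t 1] by (simp add: cis_conv_exp numeral_2_eq_2 diff_diff_eq)
  then show ?thesis by (rule order_trans) simp
qed

text \<open>The Taylor remainder of \<open>cis\<close> is quadratic, and on the support of the
  kernel the phase increment is at most B |h|. So the remainder of \<open>E k\<close> is bounded by
  |h|^2 times the constant \<open>C\<close>, uniformly in x.\<close>

lemma E_has_derivative:
  fixes k :: "'a::euclidean_space \<Rightarrow> complex"
  assumes k: "kern k"
  shows "(E k has_derivative (\<lambda>h. E (dk h k) x)) (at x)"
proof -
  obtain B where B: "B \<ge> 0" "\<And>x. norm (k x) \<le> B" "\<And>x. norm x > B \<Longrightarrow> k x = 0"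
    using kernE[OF k] by blast
  define C where "C = (LINT y|lborel. B\<^sup>2 * cmod (k y))"
  have [measurable]: "k \<in> borel_measurable borel" using k by (simp add: kern_def)
  have lin: "linear (\<lambda>h. E (dk h k) x)"
  proof (rule linearI)
    show "E (dk (g + h) k) x = E (dk g k) x + E (dk h k) x" for g h
      using E_add[OF kern_dk[OF k, of g] kern_dk[OF k, of h], of x]
      by (simp add: dk_def[abs_def] inner_add_right algebra_simps)
    show "E (dk (c *\<^sub>R h) k) x = c *\<^sub>R E (dk h k) x" for c h
      using E_scaleR[of c "dk h k" x] by (simp add: dk_def[abs_def] scaleR_conv_of_real mult_ac)
  qed
  have est: "\<bar>E k y - E k x - E (dk (y - x) k) x\<bar> \<le> (norm (y - x))\<^sup>2 * C" for y
  proof -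
    define h where "h = y - x"
    note i = integrable_mult_cis[OF kern_integrable[OF k], of y] integrable_mult_cis[OF kern_integrable[OF k], of x]
      integrable_mult_cis[OF kern_integrable[OF kern_dk[OF k]], of h x]
    define F where "F z = k z * cis (z \<bullet> y) - k z * cis (z \<bullet> x) - dk h k z * cis (z \<bullet> x)" for z
    have F: "F z = k z * cis (z \<bullet> x) * (cis (z \<bullet> h) - 1 - \<i> * complex_of_real (z \<bullet> h))" for z
    proof -
      have "cis (z \<bullet> y) = cis (z \<bullet> x) * cis (z \<bullet> h)"
        by (simp add: cis_mult inner_add_right[symmetric] h_def)
      then show ?thesis by (simp add: F_def dk_def algebra_simps)
    qed
    have bF: "cmod (F z) \<le> (norm h)\<^sup>2 * (B\<^sup>2 * cmod (k z))" for z
    proof (cases "norm z > B")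
      case False
      have 1: "cmod (F z) \<le> cmod (k z) * (z \<bullet> h)\<^sup>2"
        unfolding F norm_mult using cis_approx[of "z \<bullet> h"] by (simp add: mult_left_mono)
      have 2: "(z \<bullet> h)\<^sup>2 \<le> (B * norm h)\<^sup>2"
      proof (rule power2_le_iff_abs_le[THEN iffD2])
        have "\<bar>z \<bullet> h\<bar> \<le> norm z * norm h" by (rule Cauchy_Schwarz_ineq2)
        also have "\<dots> \<le> B * norm h" using False by (intro mult_right_mono) auto
        finally show "\<bar>z \<bullet> h\<bar> \<le> B * norm h" .
      qed (use B(1) in simp)
      show ?thesis using order_trans[OF 1 mult_left_mono[OF 2 norm_ge_zero]]
        by (simp add: power_mult_distrib mult_ac)
    qed (simp add: F B(3))
    have "E k y - E k x - E (dk h k) x = Re (LINT z|lborel. F z)"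
      unfolding E_def FT_def F_def using i by simp
    then have "\<bar>E k y - E k x - E (dk h k) x\<bar> \<le> cmod (LINT z|lborel. F z)" by (simp add: abs_Re_le_cmod)
    also have "\<dots> \<le> (LINT z|lborel. cmod (F z))" by (rule integral_norm_bound)
    also have "\<dots> \<le> (LINT z|lborel. (norm h)\<^sup>2 * (B\<^sup>2 * cmod (k z)))"
    proof (rule integral_mono)
      show "integrable lborel (\<lambda>z. cmod (F z))" unfolding F_def using i by (intro integrable_norm Bochner_Integration.integrable_diff)
      show "integrable lborel (\<lambda>z. (norm h)\<^sup>2 * (B\<^sup>2 * cmod (k z)))" using kern_integrable[OF k] by simp
    qed (rule bF)
    also have "\<dots> = (norm h)\<^sup>2 * C" by (simp add: C_def)
    finally show ?thesis by (simp add: h_def)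
  qed
  show ?thesis
  proof (rule has_derivativeI_sandwich[where e=1 and H="\<lambda>y. norm (y - x) * C"])
    show "bounded_linear (\<lambda>h. E (dk h k) x)" using lin by (simp add: linear_conv_bounded_linear)
    show "norm ((E k y - E k x) - E (dk (y - x) k) x) / norm (y - x) \<le> norm (y - x) * C" if "y \<noteq> x" for y
      using est[of y] that by (simp add: divide_le_eq power2_eq_square mult_ac)
    have "((\<lambda>y. norm (y - x) * C) \<longlongrightarrow> norm (x - x) * C) (at x)" by (intro tendsto_intros)
    then show "((\<lambda>y. norm (y - x) * C) \<longlongrightarrow> 0) (at x)" by simp
  qed simp
qed

lemma pd_E: "kern k \<Longrightarrow> pd b (E k) = E (dk b k)"
  using E_has_derivative pd_eqI by blast

lemma Ck_E: "kern k \<Longrightarrow> Ck j (E k)"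
proof (induction j arbitrary: k)
  case 0
  have "isCont (E k) x" for x using E_has_derivative[OF 0] has_derivative_continuous by blast
  then show ?case by (simp add: continuous_on_eq_continuous_at)
next
  case (Suc j)
  then show ?case using E_has_derivative[OF Suc.prems] kern_dk[OF Suc.prems]
    by (auto simp: pd_E differentiable_def)
qed

lemma Ck_inner_self: "Ck k (\<lambda>x::'a::euclidean_space. x \<bullet> x)"
proof -
  have "(\<lambda>x::'a. x \<bullet> x) = (\<lambda>x. \<Sum>b\<in>Basis. (x \<bullet> b) * (x \<bullet> b))" using euclidean_inner by auto
  moreover have "linear (\<lambda>x::'a. x \<bullet> b)" for b by (simp add: linear_iff inner_add_left)
  ultimately show ?thesis by (simp add: Ck_sum Ck_mult Ck_linear)
qed

text \<open>Built on \<open>x \<bullet> x\<close> because the norm is not smooth at 0. The function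
  is 1 on the unit ball and vanishes once |x|^2 \<ge> 2.\<close>

lemma test_fun_cutoff_0: "test_fun UNIV (\<lambda>x::'a::euclidean_space. step (2 - x \<bullet> x))"
proof (rule test_funI[where K="cball 0 2"])
  show "Ck k (\<lambda>x::'a. step (2 - x \<bullet> x))" for k
    by (rule Ck_step_affine[OF Ck_diff[OF Ck_const Ck_inner_self]])
  show "step (2 - x \<bullet> x) = 0" if "x \<notin> cball 0 2" for x :: 'a
  proof (rule step_0)
    have "2 * 2 \<le> norm x * norm x" using that by (intro mult_mono) auto
    then show "2 - x \<bullet> x \<le> 0" by (simp add: power2_norm_eq_inner[symmetric] power2_eq_square)
  qed
qed auto

lemma test_fun_scale:
  fixes \<phi> :: "'a::euclidean_space \<Rightarrow> real"
  assumes "test_fun UNIV \<phi>" "0 < c"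
  shows "test_fun UNIV (\<lambda>x. \<phi> (c *\<^sub>R x))"
proof -
  obtain K where K: "compact K" "\<And>x. x \<notin> K \<Longrightarrow> \<phi> x = 0"
    using test_fun_support[OF assms(1)] by blast
  show ?thesis
  proof (rule test_funI[where K="(\<lambda>x. x /\<^sub>R c) ` K"])
    show "Ck k (\<lambda>x. \<phi> (c *\<^sub>R x))" for k
      by (rule Ck_compose_linear[OF _ test_fun_Ck[OF assms(1)]]) (simp add: linear_iff scaleR_add_right)
    show "compact ((\<lambda>x. x /\<^sub>R c) ` K)" by (rule compact_scaling[OF K(1)])
    show "\<phi> (c *\<^sub>R x) = 0" if "x \<notin> (\<lambda>x. x /\<^sub>R c) ` K" for x
    proof (rule K(2))
      show "c *\<^sub>R x \<notin> K"
      proof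
        assume "c *\<^sub>R x \<in> K"
        then have "(c *\<^sub>R x) /\<^sub>R c \<in> (\<lambda>x. x /\<^sub>R c) ` K" by (rule imageI)
        with that assms(2) show False by simp
      qed
    qed
  qed auto
qed

lemma pd_scale:
  fixes \<phi> :: "'a::euclidean_space \<Rightarrow> real"
  assumes "\<phi> differentiable (at (c *\<^sub>R x))"
  shows "pd b (\<lambda>x. \<phi> (c *\<^sub>R x)) x = c * pd b \<phi> (c *\<^sub>R x)"
proof -
  have "pd b (\<lambda>x. \<phi> (c *\<^sub>R x)) x = pd (c *\<^sub>R b) \<phi> (c *\<^sub>R x)"
    using assms by (intro pd_compose_linear) (simp_all add: linear_iff scaleR_add_right)
  then show ?thesis using linear_scale[OF linear_frechet_derivative[OF assms]] by (simp add: pd_def)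
qed

text \<open>Identities that hold for test functions extend to the functions \<open>E k\<close>.\<close>

lemma E_approx:
  fixes k :: "'a::euclidean_space \<Rightarrow> complex"
  assumes k: "kern k"
  shows "\<exists>\<psi>. (\<forall>n. test_fun UNIV (\<psi> n)) \<and>
    (\<forall>n. sqint lborel (\<psi> n)) \<and> (\<lambda>n. nrm lborel (\<lambda>x. \<psi> n x - E k x)) \<longlonglongrightarrow> 0 \<and>
    (\<forall>b\<in>Basis. (\<forall>n. sqint lborel (pd b (\<psi> n))) \<and> (\<lambda>n. nrm lborel (\<lambda>x. pd b (\<psi> n) x - E (dk b k) x)) \<longlonglongrightarrow> 0 \<and>
      (\<forall>n. sqint lborel (pd b (pd b (\<psi> n)))) \<and>
      (\<lambda>n. nrm lborel (\<lambda>x. pd b (pd b (\<psi> n)) x - E (dk b (dk b k)) x)) \<longlonglongrightarrow> 0)"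
proof -
  define \<kappa> where "\<kappa> x = step (2 - x \<bullet> x)" for x :: 'a
  have t: "test_fun UNIV \<kappa>" unfolding \<kappa>_def by (rule test_fun_cutoff_0)
  define e where "e n = 1 / real (Suc n)" for n
  have e: "0 < e n" "e n \<le> 1" for n by (auto simp: e_def)
  have e0: "e \<longlonglongrightarrow> 0" unfolding e_def using LIMSEQ_inverse_real_of_nat by (simp add: inverse_eq_divide)
  \<comment> \<open>Dilated cutoffs: a derivative falling on \<mu> brings out a factor
    \<open>e n\<close>, so in the limit only the derivatives of \<open>E k\<close> survive. Since e
    n \<le> 1, the bounds on \<kappa> and its derivatives dominate all n at once.\<close>
  define \<mu> where "\<mu> n x = \<kappa> (e n *\<^sub>R x)" for n and x :: 'a
  have t\<chi>: "test_fun UNIV (\<mu> n)" for n unfolding \<mu>_def by (rule test_fun_scale[OF t e(1)])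
  define \<psi> where "\<psi> n x = \<mu> n x * E k x" for n x
  have t\<psi>: "test_fun UNIV (\<psi> n)" for n unfolding \<psi>_def by (rule test_fun_mult_Ck[OF t\<chi> Ck_E[OF k]])
  have dE: "E m differentiable (at x)" if "kern m" for m :: "'a \<Rightarrow> complex" and x
    using E_has_derivative[OF that] by (auto simp: differentiable_def)
  have p1: "pd b (\<mu> n) x = e n * pd b \<kappa> (e n *\<^sub>R x)" for b n x
    unfolding \<mu>_def by (rule pd_scale[OF test_fun_differentiable[OF t]])
  have p2: "pd b (pd b (\<mu> n)) x = (e n)\<^sup>2 * pd b (pd b \<kappa>) (e n *\<^sub>R x)" if "b \<in> Basis" for b n x
  proof -
    have tb: "test_fun UNIV (pd b \<kappa>)" by (rule test_fun_pd[OF t that])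
    have "pd b (pd b (\<mu> n)) x = pd b (\<lambda>x. e n * pd b \<kappa> (e n *\<^sub>R x)) x" using p1 by presburger
    also have "\<dots> = e n * pd b (\<lambda>x. pd b \<kappa> (e n *\<^sub>R x)) x"
      by (rule pd_cmult[OF test_fun_differentiable[OF test_fun_scale[OF tb e(1)]]])
    also have "pd b (\<lambda>x. pd b \<kappa> (e n *\<^sub>R x)) x = e n * pd b (pd b \<kappa>) (e n *\<^sub>R x)"
      by (rule pd_scale[OF test_fun_differentiable[OF tb]])
    finally show ?thesis by (simp add: power2_eq_square)
  qed
  have q1: "pd b (\<psi> n) x = pd b (\<mu> n) x * E k x + \<mu> n x * E (dk b k) x" for b n x
    unfolding \<psi>_def by (subst pd_mult[OF test_fun_differentiable[OF t\<chi>] dE[OF k]]) (simp add: pd_E[OF k])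
  have q2: "pd b (pd b (\<psi> n)) x = pd b (pd b (\<mu> n)) x * E k x + 2 * (pd b (\<mu> n) x * E (dk b k) x) + \<mu> n x * E (dk b (dk b k)) x"
    if "b \<in> Basis" for b n x
  proof -
    note tb = test_fun_pd[OF t\<chi> that]
    note kb = kern_dk[OF k, of b]
    have "pd b (pd b (\<psi> n)) x = pd b (\<lambda>x. pd b (\<mu> n) x * E k x + \<mu> n x * E (dk b k) x) x" using q1 by presburger
    also have "\<dots> = pd b (\<lambda>x. pd b (\<mu> n) x * E k x) x + pd b (\<lambda>x. \<mu> n x * E (dk b k) x) x"
      by (rule pd_add; rule test_fun_differentiable, rule test_fun_mult_Ck)
         (auto intro: tb t\<chi> Ck_E k kb)
    also have "pd b (\<lambda>x. pd b (\<mu> n) x * E k x) x = pd b (pd b (\<mu> n)) x * E k x + pd b (\<mu> n) x * E (dk b k) x"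
      by (subst pd_mult[OF test_fun_differentiable[OF tb] dE[OF k]]) (simp add: pd_E[OF k])
    also have "pd b (\<lambda>x. \<mu> n x * E (dk b k) x) x = pd b (\<mu> n) x * E (dk b k) x + \<mu> n x * E (dk b (dk b k)) x"
      by (subst pd_mult[OF test_fun_differentiable[OF t\<chi>] dE[OF kb]]) (simp add: pd_E[OF kb])
    finally show ?thesis by simp
  qed
  have lim0: "(\<lambda>n. e n *\<^sub>R x) \<longlonglongrightarrow> 0" for x :: 'a
    using tendsto_scaleR[OF e0 tendsto_const[of x]] by simp
  have l0: "(\<lambda>n. \<mu> n x) \<longlonglongrightarrow> 1" for x
    using continuous_on_tendsto_compose[OF test_fun_continuous[OF t] lim0] by (simp add: \<mu>_def \<kappa>_def step_1)
  have l1: "(\<lambda>n. pd b (\<mu> n) x) \<longlonglongrightarrow> 0" if "b \<in> Basis" for b x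
    using tendsto_mult[OF e0 continuous_on_tendsto_compose[OF test_fun_continuous[OF test_fun_pd[OF t that]] lim0[of x]]]
    by (simp add: p1)
  have l2: "(\<lambda>n. pd b (pd b (\<mu> n)) x) \<longlonglongrightarrow> 0" if "b \<in> Basis" for b x
    using tendsto_mult[OF tendsto_power[OF e0, of 2] continuous_on_tendsto_compose[OF test_fun_continuous[OF test_fun_pd[OF test_fun_pd[OF t that] that]] lim0[of x]]]
    by (simp add: p2[OF that])
  obtain A0 where A0: "A0 \<ge> 0" "\<And>x. \<bar>\<kappa> x\<bar> \<le> A0" using test_fun_bounded[OF t] by blast
  have meas: "test_fun UNIV \<phi> \<Longrightarrow> \<phi> \<in> borel_measurable lborel" for \<phi> :: "'a \<Rightarrow> real"
    using test_fun_continuous borel_measurable_continuous_onI by auto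
  have w0: "sqint lborel (\<lambda>x. A0 * \<bar>E k x\<bar>)"
    by (rule sqint_abs[OF E_sqint[OF k]])
  have r0: "sqint lborel (\<psi> n)" "(\<lambda>n. nrm lborel (\<lambda>x. \<psi> n x - E k x)) \<longlonglongrightarrow> 0" for n
  proof -
    have "AE x in lborel. (\<lambda>n. \<psi> n x) \<longlonglongrightarrow> E k x"
      unfolding \<psi>_def using tendsto_mult[OF l0 tendsto_const] by simp
    moreover have "AE x in lborel. norm (\<psi> n x) \<le> A0 * \<bar>E k x\<bar>" for n
      using A0 by (auto simp: \<psi>_def \<mu>_def abs_mult intro!: mult_right_mono)
    moreover have "E k \<in> borel_measurable lborel" using E_sqint[OF k] by (simp add: sqint_def)
    ultimately show "sqint lborel (\<psi> n)" "(\<lambda>n. nrm lborel (\<lambda>x. \<psi> n x - E k x)) \<longlonglongrightarrow> 0"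
      using nrm_dominated_convergence[where f=\<psi> and g="E k", OF meas[OF t\<psi>] _ w0] by blast+
  qed
  have r1: "sqint lborel (pd b (\<psi> n))" "(\<lambda>n. nrm lborel (\<lambda>x. pd b (\<psi> n) x - E (dk b k) x)) \<longlonglongrightarrow> 0"
    and r2: "sqint lborel (pd b (pd b (\<psi> n)))" "(\<lambda>n. nrm lborel (\<lambda>x. pd b (pd b (\<psi> n)) x - E (dk b (dk b k)) x)) \<longlonglongrightarrow> 0"
    if b: "b \<in> Basis" for b n
  proof -
    note kb = kern_dk[OF k, of b]
    note kbb = kern_dk[OF kb, of b]
    obtain A1 where A1: "A1 \<ge> 0" "\<And>x. \<bar>pd b \<kappa> x\<bar> \<le> A1" using test_fun_bounded[OF test_fun_pd[OF t b]] by blast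
    obtain A2 where A2: "A2 \<ge> 0" "\<And>x. \<bar>pd b (pd b \<kappa>) x\<bar> \<le> A2"
      using test_fun_bounded[OF test_fun_pd[OF test_fun_pd[OF t b] b]] by blast
    have b0: "\<bar>\<mu> n x\<bar> \<le> A0" for n x using A0 by (simp add: \<mu>_def)
    have b1: "\<bar>pd b (\<mu> n) x\<bar> \<le> A1" for n x
      using mult_mono[OF e(2)[of n] A1(2)[of "e n *\<^sub>R x"]] e(1)[of n] A1(1) by (simp add: p1 abs_mult)
    have b2: "\<bar>pd b (pd b (\<mu> n)) x\<bar> \<le> A2" for n x
      using mult_mono[OF power_le_one[OF less_imp_le[OF e(1)] e(2), of n 2] A2(2)[of "e n *\<^sub>R x"]] A2(1)
      by (simp add: p2[OF b] abs_mult)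
    have w1: "sqint lborel (\<lambda>x. A1 * \<bar>E k x\<bar> + A0 * \<bar>E (dk b k) x\<bar>)"
      by (intro sqint_add sqint_abs E_sqint k kb)
    have w2: "sqint lborel (\<lambda>x. A2 * \<bar>E k x\<bar> + 2 * A1 * \<bar>E (dk b k) x\<bar> + A0 * \<bar>E (dk b (dk b k)) x\<bar>)"
      by (intro sqint_add sqint_abs E_sqint k kb kbb)
    have "AE x in lborel. (\<lambda>n. pd b (\<psi> n) x) \<longlonglongrightarrow> E (dk b k) x"
      unfolding q1 using tendsto_add[OF tendsto_mult[OF l1[OF b] tendsto_const] tendsto_mult[OF l0 tendsto_const]] by simp
    moreover have "\<bar>pd b (\<psi> n) x\<bar> \<le> A1 * \<bar>E k x\<bar> + A0 * \<bar>E (dk b k) x\<bar>" for n x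
      unfolding q1 by (rule order_trans[OF abs_triangle_ineq]) (use b0 b1 in \<open>auto simp: abs_mult intro!: add_mono mult_right_mono\<close>)
    moreover have "E (dk b k) \<in> borel_measurable lborel" using E_sqint[OF kb] by (simp add: sqint_def)
    ultimately show "sqint lborel (pd b (\<psi> n))" "(\<lambda>n. nrm lborel (\<lambda>x. pd b (\<psi> n) x - E (dk b k) x)) \<longlonglongrightarrow> 0"
      using nrm_dominated_convergence[where f="\<lambda>n. pd b (\<psi> n)" and g="E (dk b k)", OF meas[OF test_fun_pd[OF t\<psi> b]] _ w1]
      by (simp_all add: real_norm_def)
    have "AE x in lborel. (\<lambda>n. pd b (pd b (\<psi> n)) x) \<longlonglongrightarrow> E (dk b (dk b k)) x"
      unfolding q2[OF b]
      using tendsto_add[OF tendsto_add[OF tendsto_mult[OF l2[OF b] tendsto_const] tendsto_mult[OF tendsto_const tendsto_mult[OF l1[OF b] tendsto_const]]] tendsto_mult[OF l0 tendsto_const]]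
      by simp
    moreover have "\<bar>pd b (pd b (\<psi> n)) x\<bar> \<le> A2 * \<bar>E k x\<bar> + 2 * A1 * \<bar>E (dk b k) x\<bar> + A0 * \<bar>E (dk b (dk b k)) x\<bar>" for n x
    proof -
      have "\<bar>pd b (pd b (\<psi> n)) x\<bar> \<le> \<bar>pd b (pd b (\<mu> n)) x * E k x\<bar> + \<bar>2 * (pd b (\<mu> n) x * E (dk b k) x)\<bar> + \<bar>\<mu> n x * E (dk b (dk b k)) x\<bar>"
        unfolding q2[OF b] by linarith
      also have "\<dots> \<le> A2 * \<bar>E k x\<bar> + 2 * A1 * \<bar>E (dk b k) x\<bar> + A0 * \<bar>E (dk b (dk b k)) x\<bar>"
        unfolding abs_mult mult.assoc using b0 b1 b2
        by (intro add_mono mult_right_mono mult_left_mono) (auto intro!: mult_right_mono)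
      finally show ?thesis .
    qed
    moreover have "E (dk b (dk b k)) \<in> borel_measurable lborel" using E_sqint[OF kbb] by (simp add: sqint_def)
    ultimately show "sqint lborel (pd b (pd b (\<psi> n)))" "(\<lambda>n. nrm lborel (\<lambda>x. pd b (pd b (\<psi> n)) x - E (dk b (dk b k)) x)) \<longlonglongrightarrow> 0"
      using nrm_dominated_convergence[where f="\<lambda>n. pd b (pd b (\<psi> n))" and g="E (dk b (dk b k))", OF meas[OF test_fun_pd[OF test_fun_pd[OF t\<psi> b] b]] _ w2]
      by (simp_all add: real_norm_def)
  qed
  show ?thesis using t\<psi> r0 r1 r2 by (intro exI[of _ \<psi>]) auto
qed

section \<open>The operator \<open>\<Lambda>\<^sup>s\<close>\<close>

lemma inner_trunc: "u x \<bullet> trunc n u x = (norm (trunc n u x))\<^sup>2"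
  by (simp add: trunc_def power2_norm_eq_inner)

text \<open>A function paired with its own truncation gives the squared norm of the truncation, so
  every truncation vanishes; each point is reached by some \<open>n\<close>.\<close>

lemma AE_eq_0_if_trunc:
  fixes D :: "'a::euclidean_space \<Rightarrow> complex"
  assumes [measurable]: "D \<in> borel_measurable borel"
    and 0: "\<And>n. (LINT x|lborel. D x \<bullet> trunc n D x) = 0"
  shows "AE x in lborel. D x = 0"
proof -
  have "AE x in lborel. trunc n D x = 0" for n
  proof -
    have s: "sqint lborel (trunc n D)" by (rule kern_sqint[OF kern_trunc]) measurable
    have "nrm lborel (trunc n D) = 0" using 0[of n] by (simp add: nrm_def inner_trunc)
    then show ?thesis using nrm_eq_0[OF s] by simp
  qed
  then have "AE x in lborel. \<forall>n. trunc n D x = 0" by (simp add: AE_all_countable)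
  then show ?thesis
  proof eventually_elim
    case (elim x)
    obtain n where "norm x \<le> real n" "norm (D x) \<le> real n"
      by (meson le_cases order_trans real_arch_simple)
    then show ?case using elim[rule_format, of n] by (simp add: trunc_def)
  qed
qed

definition ball_restr :: "real \<Rightarrow> ('a::euclidean_space \<Rightarrow> real) \<Rightarrow> 'a \<Rightarrow> real" where
  "ball_restr R u x = indicator (cball 0 R) x * u x"

lemma ball_restr_measurable [measurable]:
  "u \<in> borel_measurable borel \<Longrightarrow> ball_restr R u \<in> borel_measurable borel"
  unfolding ball_restr_def[abs_def] by (intro borel_measurable_times borel_measurable_indicator) auto

lemma sqint_ball_restr: "sqint lborel u \<Longrightarrow> sqint lborel (ball_restr R u)"
  by (rule sqint_bound[of lborel u]) (auto simp: ball_restr_def indicator_def sqint_def)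

lemma ball_restr_tendsto:
  assumes u: "sqint lborel u"
  shows "((\<lambda>R. nrm lborel (\<lambda>x. ball_restr R u x - u x)) \<longlongrightarrow> 0) at_top"
proof (rule tendsto_at_topI_sequentially)
  fix X :: "nat \<Rightarrow> real" assume X: "filterlim X at_top sequentially"
  show "(\<lambda>n. nrm lborel (\<lambda>x. ball_restr (X n) u x - u x)) \<longlonglongrightarrow> 0"
  proof (rule nrm_dominated_convergence(3)[where w="\<lambda>x. norm (u x)"])
    show "ball_restr (X n) u \<in> borel_measurable lborel" for n using sqint_ball_restr[OF u] by (simp add: sqint_def)
    show "u \<in> borel_measurable lborel" "sqint lborel (\<lambda>x. norm (u x))" using u by (auto simp: sqint_def)
    have "(\<lambda>n. ball_restr (X n) u x) \<longlonglongrightarrow> u x" for x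
    proof (rule tendsto_eventually)
      have "\<forall>\<^sub>F n in sequentially. norm x \<le> X n" using X by (simp add: filterlim_at_top)
      then show "\<forall>\<^sub>F n in sequentially. ball_restr (X n) u x = u x"
        by eventually_elim (simp add: ball_restr_def indicator_def)
    qed
    then show "AE x in lborel. (\<lambda>n. ball_restr (X n) u x) \<longlonglongrightarrow> u x" by simp
    show "AE x in lborel. norm (ball_restr (X n) u x) \<le> norm (u x)" for n
      by (auto simp: ball_restr_def indicator_def)
  qed
qed

lemma complex_sqint:
  fixes v :: "'a::euclidean_space \<Rightarrow> real"
  shows "sqint lborel v \<Longrightarrow> sqint lborel (\<lambda>x. complex_of_real (v x))" "nrm lborel (\<lambda>x. complex_of_real (v x)) = nrm lborel v"
  by (auto simp: sqint_def nrm_def intro: borel_measurable_of_real)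

lemma complex_ball_restr:
  fixes u :: "'a::euclidean_space \<Rightarrow> real"
  assumes "sqint lborel u"
  shows "integrable lborel (\<lambda>x. complex_of_real (ball_restr R u x))"
  by (rule sqint_supported_integrable[OF complex_sqint(1)[OF sqint_ball_restr[OF assms]], of R])
     (simp add: ball_restr_def indicator_def)

lemma fourier_trunc_eq:
  fixes u :: "real ^ 'd \<Rightarrow> real"
  shows "fourier_trunc R u \<xi> = (1 / fnorm TYPE(real ^ 'd)) *\<^sub>R cnj (FT (\<lambda>x. complex_of_real (ball_restr R u x)) \<xi>)"
proof -
  have "(2 * pi) powr (- real CARD('d) / 2) = 1 / fnorm TYPE(real ^ 'd)"
  proof -
    have "fnorm TYPE(real ^ 'd) = ((2 * pi) powr real CARD('d)) powr (1 / 2)"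
      using powr_realpow[of "2 * pi" "CARD('d)"] powr_half_sqrt[of "(2 * pi) ^ CARD('d)"] by (simp add: fnorm_def)
    also have "\<dots> = (2 * pi) powr (real CARD('d) / 2)" by (simp only: powr_powr) simp
    finally show ?thesis using powr_minus_divide[of "2 * pi" "real CARD('d) / 2"] by simp
  qed
  moreover have "cnj (FT (\<lambda>x. complex_of_real (ball_restr R u x)) \<xi>) = (LINT X:cball 0 R|lborel. u X *\<^sub>R cis (- (\<xi> \<bullet> X)))"
  proof -
    have "cnj (FT (\<lambda>x. complex_of_real (ball_restr R u x)) \<xi>)
      = (LINT X|lborel. cnj (complex_of_real (ball_restr R u X) * cis (X \<bullet> \<xi>)))"
      unfolding FT_def by (rule Bochner_Integration.integral_cnj[symmetric])
    then show ?thesis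
      by (simp add: set_lebesgue_integral_def ball_restr_def cis_cnj scaleR_conv_of_real inner_commute mult_ac)
  qed
  ultimately show ?thesis by (simp add: fourier_trunc_def)
qed

lemma FT_ball_restr:
  fixes u :: "'a::euclidean_space \<Rightarrow> real"
  assumes "sqint lborel u"
  shows "sqint lborel (FT (\<lambda>x. complex_of_real (ball_restr R u x)))"
  by (rule FT_Bessel[OF complex_ball_restr[OF assms] complex_sqint(1)[OF sqint_ball_restr[OF assms]]])

lemma sqint_fourier_trunc:
  fixes u :: "real ^ 'd \<Rightarrow> real"
  assumes u: "sqint lborel u"
  shows "sqint lborel (fourier_trunc R u)"
proof -
  have "sqint lborel (\<lambda>\<xi>. cnj (FT (\<lambda>x. complex_of_real (ball_restr R u x)) \<xi>))"
    using FT_ball_restr[OF u, of R] by (auto simp: sqint_def)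
  from sqint_scaleR[OF this] show ?thesis unfolding fourier_trunc_eq[abs_def] .
qed

text \<open>The difference of two restrictions still has bounded support, so the isometry applies to
  it. This reduces every convergence question for the truncated transforms to one for the
  restrictions.\<close>

lemma nrm_fourier_trunc_diff:
  fixes u :: "real ^ 'd \<Rightarrow> real"
  assumes u: "sqint lborel u"
  shows "nrm lborel (\<lambda>\<xi>. fourier_trunc R u \<xi> - fourier_trunc S u \<xi>) = nrm lborel (\<lambda>x. ball_restr R u x - ball_restr S u x)"
proof -
  let ?f = "\<lambda>R x. complex_of_real (ball_restr R u x)"
  let ?g = "\<lambda>x. complex_of_real (ball_restr R u x - ball_restr S u x)"
  have eq: "fourier_trunc R u \<xi> - fourier_trunc S u \<xi> = (1 / fnorm TYPE(real ^ 'd)) *\<^sub>R cnj (FT ?g \<xi>)" for \<xi>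
    using FT_diff[OF complex_ball_restr[OF u, of R] complex_ball_restr[OF u, of S], of \<xi>]
    by (simp add: fourier_trunc_eq scaleR_diff_right)
  have "nrm lborel (FT ?g) = fnorm TYPE(real ^ 'd) * nrm lborel ?g"
    by (rule FT_isometry[OF complex_sqint(1)[OF sqint_diff[OF sqint_ball_restr[OF u] sqint_ball_restr[OF u]]], of "max R S"])
       (simp add: ball_restr_def indicator_def)
  moreover have "nrm lborel (\<lambda>\<xi>. cnj (FT ?g \<xi>)) = nrm lborel (FT ?g)" by (simp add: nrm_def)
  ultimately show ?thesis unfolding eq nrm_scaleR
    using fnorm_pos[where 'a="real ^ 'd"] by (simp only: complex_sqint(2)) simp
qed

lemma nrm_fourier_trunc:
  fixes u :: "real ^ 'd \<Rightarrow> real"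
  assumes u: "sqint lborel u"
  shows "nrm lborel (fourier_trunc R u) = nrm lborel (ball_restr R u)"
proof -
  \<comment> \<open>The ball of radius -1 is empty, which turns the formula for differences into one
    for a single truncation.\<close>
  have *: "AE x in lborel. ball_restr (- 1) u x = 0" "ball_restr (- 1) u = (\<lambda>x. 0)" by (auto simp: ball_restr_def)
  have "fourier_trunc (- 1) u \<xi> = 0" for \<xi> by (simp add: fourier_trunc_eq * FT_def)
  then show ?thesis using nrm_fourier_trunc_diff[OF u, of R "- 1"] by (simp add: *(2))
qed

lemma is_fourier_iff:
  "is_fourier u h \<longleftrightarrow> sqint lborel u \<and> sqint lborel h \<and>
     ((\<lambda>R. nrm lborel (\<lambda>\<xi>. fourier_trunc R u \<xi> - h \<xi>)) \<longlongrightarrow> 0) at_top"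
proof (cases "sqint lborel u \<and> sqint lborel h")
  case True
  then show ?thesis unfolding is_fourier_def L2_iff_sqint
    using L2_tendsto_iff[of lborel "\<lambda>R. fourier_trunc R u" h at_top] sqint_fourier_trunc[of u] by (auto simp: sqint_def)
qed (auto simp: is_fourier_def L2_iff_sqint sqint_def)

text \<open>The truncated transforms at integer radii form a Cauchy sequence. The same isometry
  compares an arbitrary real radius with large integers, which gives the limit along all real
  R.\<close>

lemma fourier_exists:
  fixes u :: "real ^ 'd \<Rightarrow> real"
  assumes u: "sqint lborel u"
  shows "\<exists>h. is_fourier u h"
proof -
  let ?f = "\<lambda>n. fourier_trunc (real n) u"
  let ?r = "\<lambda>R x. ball_restr R u x"
  have lim: "(\<lambda>n. nrm lborel (\<lambda>x. ?r (real n) x - u x)) \<longlonglongrightarrow> 0"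
    using filterlim_compose[OF ball_restr_tendsto[OF u] filterlim_real_sequentially] .
  have "\<exists>h. sqint lborel h \<and> (\<lambda>n. nrm lborel (\<lambda>x. ?f n x - h x)) \<longlonglongrightarrow> 0"
  proof (rule L2_complete)
    show "sqint lborel (?f n)" for n by (rule sqint_fourier_trunc[OF u])
    fix e :: real assume "e > 0"
    then obtain N where N: "\<And>n. n \<ge> N \<Longrightarrow> nrm lborel (\<lambda>x. ?r (real n) x - u x) < e / 2"
      using LIMSEQ_D[OF lim, of "e/2"] by auto
    show "\<exists>N. \<forall>m\<ge>N. \<forall>n\<ge>N. nrm lborel (\<lambda>x. ?f m x - ?f n x) < e"
    proof (intro exI[of _ N] allI impI)
      fix m n assume "m \<ge> N" "n \<ge> N"
      then show "nrm lborel (\<lambda>x. ?f m x - ?f n x) < e"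
        unfolding nrm_fourier_trunc_diff[OF u]
        using nrm_triangle_diff[OF sqint_ball_restr[OF u] u sqint_ball_restr[OF u], of "real m" "real n"] N[of m] N[of n]
        by (simp add: nrm_minus_commute[of lborel u])
    qed
  qed
  then obtain h where h: "sqint lborel h" "(\<lambda>n. nrm lborel (\<lambda>x. ?f n x - h x)) \<longlonglongrightarrow> 0" by blast
  have le: "nrm lborel (\<lambda>x. fourier_trunc R u x - h x) \<le> nrm lborel (\<lambda>x. ?r R x - u x)" for R
  proof (rule Lim_bounded2)
    show "(\<lambda>n. nrm lborel (\<lambda>x. ?r R x - u x) + (nrm lborel (\<lambda>x. ?r (real n) x - u x) + nrm lborel (\<lambda>x. ?f n x - h x)))
       \<longlonglongrightarrow> nrm lborel (\<lambda>x. ?r R x - u x)"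
      using tendsto_add[OF tendsto_const tendsto_add[OF lim h(2)]] by simp
    show "\<forall>n\<ge>0. nrm lborel (\<lambda>x. fourier_trunc R u x - h x)
      \<le> nrm lborel (\<lambda>x. ?r R x - u x) + (nrm lborel (\<lambda>x. ?r (real n) x - u x) + nrm lborel (\<lambda>x. ?f n x - h x))"
    proof (intro allI impI)
      fix n :: nat
      have "nrm lborel (\<lambda>x. fourier_trunc R u x - h x) \<le> nrm lborel (\<lambda>x. ?r R x - ?r (real n) x) + nrm lborel (\<lambda>x. ?f n x - h x)"
        using nrm_triangle_diff[OF sqint_fourier_trunc[OF u] sqint_fourier_trunc[OF u] h(1), of R "real n"]
        by (simp only: nrm_fourier_trunc_diff[OF u])
      moreover have "nrm lborel (\<lambda>x. ?r R x - ?r (real n) x) \<le> nrm lborel (\<lambda>x. ?r R x - u x) + nrm lborel (\<lambda>x. ?r (real n) x - u x)"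
        using nrm_triangle_diff[OF sqint_ball_restr[OF u] u sqint_ball_restr[OF u], of R "real n"]
        by (simp add: nrm_minus_commute[of lborel u])
      ultimately show "nrm lborel (\<lambda>x. fourier_trunc R u x - h x)
        \<le> nrm lborel (\<lambda>x. ?r R x - u x) + (nrm lborel (\<lambda>x. ?r (real n) x - u x) + nrm lborel (\<lambda>x. ?f n x - h x))" by simp
    qed
  qed
  have "((\<lambda>R. nrm lborel (\<lambda>x. fourier_trunc R u x - h x)) \<longlongrightarrow> 0) at_top"
    by (rule Lim_null_comparison[OF _ ball_restr_tendsto[OF u]]) (simp add: le)
  then show ?thesis using u h(1) is_fourier_iff by blast
qed

lemma is_fourier_nrm:
  assumes "is_fourier u h" shows "nrm lborel h = nrm lborel u"
proof -
  have u: "sqint lborel u" and h: "sqint lborel h" and lim: "((\<lambda>R. nrm lborel (\<lambda>\<xi>. fourier_trunc R u \<xi> - h \<xi>)) \<longlongrightarrow> 0) at_top"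
    using assms by (auto simp: is_fourier_iff)
  have "((\<lambda>R. nrm lborel (fourier_trunc R u)) \<longlongrightarrow> nrm lborel h) at_top"
    by (rule nrm_tendsto[OF sqint_fourier_trunc[OF u] h lim])
  moreover have "((\<lambda>R. nrm lborel (fourier_trunc R u)) \<longlongrightarrow> nrm lborel u) at_top"
    unfolding nrm_fourier_trunc[OF u] by (rule nrm_tendsto[OF sqint_ball_restr[OF u] u ball_restr_tendsto[OF u]])
  ultimately show ?thesis by (rule tendsto_unique[rotated]) simp
qed

lemma ip_fourier_trunc:
  fixes u :: "real ^ 'd \<Rightarrow> real"
  assumes u: "sqint lborel u" and k: "kern k"
  shows "ip lborel (ball_restr R u) (E k) = fnorm TYPE(real ^ 'd) * ip lborel (fourier_trunc R u) k"
proof -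
  let ?m = "\<lambda>x. complex_of_real (ball_restr R u x)"
  note m = complex_ball_restr[OF u, of R] and sm = complex_sqint(1)[OF sqint_ball_restr[OF u], of R]
  have [measurable]: "k \<in> borel_measurable borel" "ball_restr R u \<in> borel_measurable borel"
    using k sqint_ball_restr[OF u, of R] by (auto simp: kern_def sqint_def)
  have prod: "integrable lborel (\<lambda>x. a x * b x)" if "sqint lborel a" "sqint lborel b" for a b :: "real ^ 'd \<Rightarrow> complex"
    by (rule Bochner_Integration.integrable_bound[OF Cauchy_Schwarz_norm(1)[OF that]])
       (use that in \<open>auto simp: norm_mult sqint_def\<close>)
  have "ip lborel (ball_restr R u) (E k) = (LINT x|lborel. Re (?m x * FT k x))"
    by (simp add: ip_def E_def)
  also have "\<dots> = Re (LINT x|lborel. ?m x * FT k x)"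
    by (rule integral_Re[OF prod[OF sm FT_Bessel(1)[OF kern_integrable[OF k] kern_sqint[OF k]]]])
  also have "(LINT x|lborel. ?m x * FT k x) = (LINT y|lborel. k y * FT ?m y)"
    by (rule FT_multiplication_formula[OF kern_integrable[OF k] m])
  also have "Re \<dots> = (LINT y|lborel. Re (k y * FT ?m y))"
    by (rule integral_Re[symmetric, OF prod[OF kern_sqint[OF k] FT_ball_restr[OF u]]])
  also have "\<dots> = (LINT y|lborel. fnorm TYPE(real ^ 'd) * (fourier_trunc R u y \<bullet> k y))"
    using fnorm_pos[where 'a="real ^ 'd"]
    by (intro Bochner_Integration.integral_cong refl) (simp add: fourier_trunc_eq inner_complex_def algebra_simps)
  finally show ?thesis by (simp add: ip_def)
qed

text \<open>Parseval's relation in which the test function is given through its transform; it is the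
  multiplication formula for the truncations, passed to the limit.\<close>

lemma is_fourier_E:
  fixes u :: "real ^ 'd \<Rightarrow> real"
  assumes "is_fourier u h" and k: "kern k"
  shows "ip lborel u (E k) = fnorm TYPE(real ^ 'd) * ip lborel h k"
proof -
  have u: "sqint lborel u" and h: "sqint lborel h" and lim: "((\<lambda>R. nrm lborel (\<lambda>\<xi>. fourier_trunc R u \<xi> - h \<xi>)) \<longlongrightarrow> 0) at_top"
    using assms by (auto simp: is_fourier_iff)
  have "((\<lambda>R. ip lborel (ball_restr R u) (E k)) \<longlongrightarrow> ip lborel u (E k)) at_top"
    by (rule ip_tendsto[OF sqint_ball_restr[OF u] u E_sqint[OF k] ball_restr_tendsto[OF u]])
  moreover have "((\<lambda>R. ip lborel (ball_restr R u) (E k)) \<longlongrightarrow> fnorm TYPE(real ^ 'd) * ip lborel h k) at_top"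
    unfolding ip_fourier_trunc[OF u k]
    by (intro tendsto_mult tendsto_const ip_tendsto[OF sqint_fourier_trunc[OF u] h kern_sqint[OF k] lim])
  ultimately show ?thesis by (rule tendsto_unique[rotated]) simp
qed

text \<open>If h is the transform of u, the truncations of h are admissible kernels; testing with
  them shows h = 0, and the isometry gives u = 0.\<close>

lemma E_total:
  fixes u :: "real ^ 'd \<Rightarrow> real"
  assumes u: "sqint lborel u" and 0: "\<And>k. kern k \<Longrightarrow> ip lborel u (E k) = 0"
  shows "AE x in lborel. u x = 0"
proof -
  obtain h where h: "is_fourier u h" using fourier_exists[OF u] by blast
  then have sh: "sqint lborel h" by (simp add: is_fourier_iff)
  have [measurable]: "h \<in> borel_measurable borel" using sh by (simp add: sqint_def)
  have "AE x in lborel. h x = 0"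
  proof (rule AE_eq_0_if_trunc)
    show "(LINT x|lborel. h x \<bullet> trunc n h x) = 0" for n
      using is_fourier_E[OF h kern_trunc, of h n] 0[OF kern_trunc, of h n] fnorm_pos[where 'a="real ^ 'd"]
      by (simp add: ip_def)
  qed measurable
  then have "nrm lborel u = 0" using nrm_eq_0[OF sh] is_fourier_nrm[OF h] by simp
  then show ?thesis using nrm_eq_0[OF u] by simp
qed

definition bessel :: "real \<Rightarrow> 'a::euclidean_space \<Rightarrow> real" where
  "bessel s \<xi> = (1 + (norm \<xi>)\<^sup>2) powr (s / 2)"

lemma kern_bessel: "kern k \<Longrightarrow> kern (\<lambda>\<xi>. bessel s \<xi> *\<^sub>R k \<xi>)"
  unfolding scaleR_conv_of_real bessel_def
  by (rule kern_mult) (auto intro!: continuous_intros simp: add_nonneg_eq_0_iff)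

lemma bessel_measurable [measurable]: "bessel s \<in> borel_measurable borel"
  unfolding bessel_def[abs_def] by measurable

text \<open>Testing with the functions \<open>E k\<close> turns \<open>v = \<Lambda>\<^sup>s u\<close> into a family of linear equations.\<close>

lemma is_Lambda_iff:
  fixes u v :: "real ^ 'd \<Rightarrow> real"
  shows "is_Lambda s u v \<longleftrightarrow> sqint lborel u \<and> sqint lborel v \<and>
    (\<forall>k. kern k \<longrightarrow> ip lborel v (E k) = ip lborel u (E (\<lambda>\<xi>. bessel s \<xi> *\<^sub>R k \<xi>)))"
proof
  assume "is_Lambda s u v"
  then obtain h where h: "is_fourier u h" and j: "is_fourier v (\<lambda>\<xi>. bessel s \<xi> *\<^sub>R h \<xi>)"
    by (auto simp: is_Lambda_def bessel_def)
  then have "sqint lborel u" "sqint lborel v" by (auto simp: is_fourier_iff)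
  moreover have "ip lborel v (E k) = ip lborel u (E (\<lambda>\<xi>. bessel s \<xi> *\<^sub>R k \<xi>))" if "kern k" for k
    unfolding is_fourier_E[OF h kern_bessel[OF that]] is_fourier_E[OF j that] by (simp add: ip_def)
  ultimately show "sqint lborel u \<and> sqint lborel v \<and>
    (\<forall>k. kern k \<longrightarrow> ip lborel v (E k) = ip lborel u (E (\<lambda>\<xi>. bessel s \<xi> *\<^sub>R k \<xi>)))" by blast
next
  assume "sqint lborel u \<and> sqint lborel v \<and>
    (\<forall>k. kern k \<longrightarrow> ip lborel v (E k) = ip lborel u (E (\<lambda>\<xi>. bessel s \<xi> *\<^sub>R k \<xi>)))"
  then have u: "sqint lborel u" and v: "sqint lborel v"
    and eq: "\<And>k. kern k \<Longrightarrow> ip lborel v (E k) = ip lborel u (E (\<lambda>\<xi>. bessel s \<xi> *\<^sub>R k \<xi>))" by auto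
  obtain h j where h: "is_fourier u h" and j: "is_fourier v j" using fourier_exists u v by meson
  have sh: "sqint lborel h" and sj: "sqint lborel j" using h j by (auto simp: is_fourier_iff)
  have [measurable]: "h \<in> borel_measurable borel" "j \<in> borel_measurable borel" using sh sj by (auto simp: sqint_def)
  define m where "m \<xi> = bessel s \<xi> *\<^sub>R h \<xi>" for \<xi>
  have [measurable]: "m \<in> borel_measurable borel" unfolding m_def[abs_def] by measurable
  \<comment> \<open>\<open>m\<close> is not known to be square integrable at this point, since the
    symbol \<open>bessel s\<close> is unbounded for s > 0. Truncated kernels keep the pairing with
    \<open>m\<close> integrable; square integrability follows once \<open>m\<close> agrees with
    \<open>j\<close>.\<close>
  have "AE x in lborel. j x - m x = 0"
  proof (rule AE_eq_0_if_trunc)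
    fix n
    let ?k = "trunc n (\<lambda>x. j x - m x)"
    have k: "kern ?k" by (rule kern_trunc) measurable
    have "ip lborel j ?k = ip lborel h (\<lambda>\<xi>. bessel s \<xi> *\<^sub>R ?k \<xi>)"
      using eq[OF k] fnorm_pos[where 'a="real ^ 'd"] unfolding is_fourier_E[OF h kern_bessel[OF k]] is_fourier_E[OF j k] by simp
    then have "(LINT x|lborel. j x \<bullet> ?k x) = (LINT x|lborel. m x \<bullet> ?k x)" by (simp add: ip_def m_def)
    moreover have "integrable lborel (\<lambda>x. j x \<bullet> ?k x)" by (rule ip_integrable[OF sj kern_sqint[OF k]])
    moreover have "integrable lborel (\<lambda>x. m x \<bullet> ?k x)"
      using ip_integrable[OF sh kern_sqint[OF kern_bessel[OF k, of s]]] by (simp add: m_def)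
    ultimately show "(LINT x|lborel. (j x - m x) \<bullet> ?k x) = 0" by (simp add: inner_diff_left)
  qed measurable
  then have ae: "AE x in lborel. m x = j x" by eventually_elim simp
  have sm: "sqint lborel m" by (rule sqint_cong_AE[OF sj _ ae]) measurable
  have "nrm lborel (\<lambda>\<xi>. fourier_trunc R v \<xi> - m \<xi>) = nrm lborel (\<lambda>\<xi>. fourier_trunc R v \<xi> - j \<xi>)" for R
  proof (rule nrm_cong_AE)
    have [measurable]: "fourier_trunc R v \<in> borel_measurable borel" using sqint_fourier_trunc[OF v, of R] by (simp add: sqint_def)
    show "(\<lambda>\<xi>. fourier_trunc R v \<xi> - m \<xi>) \<in> borel_measurable lborel" "(\<lambda>\<xi>. fourier_trunc R v \<xi> - j \<xi>) \<in> borel_measurable lborel"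
      by measurable
    show "AE x in lborel. fourier_trunc R v x - m x = fourier_trunc R v x - j x" using ae by eventually_elim simp
  qed
  then have "is_fourier v m" using j sm by (simp add: is_fourier_iff)
  then show "is_Lambda s u v" using h unfolding is_Lambda_def m_def[abs_def] bessel_def by blast
qed

lemma is_Lambda_sqint: "is_Lambda s u v \<Longrightarrow> sqint lborel u" "is_Lambda s u v \<Longrightarrow> sqint lborel v"
  by (auto simp: is_Lambda_iff)

lemma is_Lambda_diff:
  assumes "is_Lambda s u v" "is_Lambda s u' v'"
  shows "is_Lambda s (\<lambda>x. u x - u' x) (\<lambda>x. v x - v' x)"
  using assms by (auto simp: is_Lambda_iff sqint_diff ip_diff_left E_sqint kern_bessel)

lemma is_Lambda_cong_AE:
  assumes "is_Lambda s u v" "u' \<in> borel_measurable lborel" "AE x in lborel. u' x = u x"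
  shows "is_Lambda s u' v"
proof -
  have "ip lborel u' (E k) = ip lborel u (E k)" if "kern k" for k
    using assms E_sqint[OF that] is_Lambda_sqint[OF assms(1)] by (intro ip_cong_AE) (auto simp: sqint_def)
  then show ?thesis using assms sqint_cong_AE[OF is_Lambda_sqint(1)[OF assms(1)] assms(2,3)]
    by (auto simp: is_Lambda_iff kern_bessel)
qed

lemma is_Lambda_unique:
  assumes "is_Lambda s u v" "is_Lambda s u v'"
  shows "AE x in lborel. v x = v' x"
proof -
  have "AE x in lborel. v x - v' x = 0"
    by (rule E_total) (use assms in \<open>auto simp: is_Lambda_iff sqint_diff ip_diff_left E_sqint\<close>)
  then show ?thesis by eventually_elim simp
qed

text \<open>The symbol is at least 1 for s \<ge> 0. This is what lets continuity in H^s be used as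
  continuity in L^2, the only regularity that the weak equations see.\<close>

lemma nrm_le_is_Lambda:
  assumes "is_Lambda s u v" "0 \<le> s"
  shows "nrm lborel u \<le> nrm lborel v"
proof -
  obtain h where h: "is_fourier u h" and j: "is_fourier v (\<lambda>\<xi>. bessel s \<xi> *\<^sub>R h \<xi>)"
    using assms(1) by (auto simp: is_Lambda_def bessel_def)
  have "1 \<le> bessel s \<xi>" for \<xi> :: "real ^ 'a" unfolding bessel_def using assms(2) by (intro ge_one_powr_ge_zero) auto
  then have "norm (h \<xi>) \<le> norm (bessel s \<xi> *\<^sub>R h \<xi>)" for \<xi>
    using mult_right_mono[of 1 "bessel s \<xi>" "norm (h \<xi>)"] order_trans[of 0 1 "bessel s \<xi>"] by simp
  then have "nrm lborel h \<le> nrm lborel (\<lambda>\<xi>. bessel s \<xi> *\<^sub>R h \<xi>)"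
    using h j by (intro nrm_mono) (auto simp: is_fourier_iff sqint_def)
  then show ?thesis using is_fourier_nrm[OF h] is_fourier_nrm[OF j] by simp
qed

text \<open>\<Lambda>^s u is unique almost everywhere, so the choice made by \<open>SOME\<close>
  does not affect the norm.\<close>

lemma Hs_norm_eq:
  assumes "is_Lambda s u v" shows "Hs_norm s u = nrm lborel v"
proof -
  have "is_Lambda s u (SOME v. is_Lambda s u v)" by (rule someI[of "is_Lambda s u" v, OF assms])
  from is_Lambda_unique[OF this assms] show ?thesis
    unfolding Hs_norm_def L2norm_eq_nrm using is_Lambda_sqint[OF assms] is_Lambda_sqint[OF \<open>is_Lambda s u (SOME v. is_Lambda s u v)\<close>]
    by (intro nrm_cong_AE) (auto simp: sqint_def)
qed

text \<open>On the Fourier side u is orthogonal to all kernels of the form |y|^2 k. Division by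
  |y|^2 is possible away from the origin, and the origin is a null set.\<close>

theorem L2_Laplace_eq_0:
  fixes u :: "real ^ 'd \<Rightarrow> real"
  assumes u: "sqint lborel u"
    and 0: "\<And>\<psi>. test_fun UNIV \<psi> \<Longrightarrow> (\<Sum>b\<in>Basis. ip lborel u (pd b (pd b \<psi>))) = 0"
  shows "AE x in lborel. u x = 0"
proof (rule E_total[OF u])
  fix k :: "real ^ 'd \<Rightarrow> complex" assume k: "kern k"
  have E0: "ip lborel u (E (\<lambda>y. - complex_of_real ((norm y)\<^sup>2) * k y)) = 0" if k: "kern k" for k
  proof -
    obtain \<psi> where \<psi>: "\<And>n. test_fun UNIV (\<psi> n)"
      "\<And>b n. b \<in> Basis \<Longrightarrow> sqint lborel (pd b (pd b (\<psi> n)))"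
      "\<And>b. b \<in> Basis \<Longrightarrow> (\<lambda>n. nrm lborel (\<lambda>x. pd b (pd b (\<psi> n)) x - E (dk b (dk b k)) x)) \<longlonglongrightarrow> 0"
      using E_approx[OF k] by blast
    have kk: "kern (dk b (dk b k))" for b by (rule kern_dk[OF kern_dk[OF k]])
    have "(\<lambda>n. \<Sum>b\<in>Basis. ip lborel u (pd b (pd b (\<psi> n)))) \<longlonglongrightarrow> (\<Sum>b\<in>Basis. ip lborel u (E (dk b (dk b k))))"
      unfolding ip_commute[of lborel u] by (intro tendsto_sum ip_tendsto \<psi> u E_sqint kk)
    then have "(\<Sum>b\<in>Basis. ip lborel u (E (dk b (dk b k)))) = 0"
      using 0[OF \<psi>(1)] by (simp add: LIMSEQ_const_iff)
    moreover have "(\<Sum>b\<in>Basis. ip lborel u (E (dk b (dk b k)))) = ip lborel u (\<lambda>x. \<Sum>b\<in>Basis. E (dk b (dk b k)) x)"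
      by (rule ip_sum_right[symmetric]) (auto intro: E_sqint kk u)
    moreover have "(\<Sum>b\<in>Basis. E (dk b (dk b k)) x) = E (\<lambda>y. \<Sum>b\<in>Basis. dk b (dk b k) y) x" for x
      by (rule E_sum[symmetric, OF kk])
    moreover have "(\<Sum>b\<in>Basis. dk b (dk b k) y) = - complex_of_real ((norm y)\<^sup>2) * k y" for y
    proof -
      have "(\<Sum>b\<in>Basis. dk b (dk b k) y) = (\<Sum>b\<in>Basis. - complex_of_real ((y \<bullet> b) * (y \<bullet> b)) * k y)"
        by (simp add: dk_def mult_ac)
      also have "\<dots> = - complex_of_real (y \<bullet> y) * k y"
        by (simp add: sum_distrib_right[symmetric] sum_negf euclidean_inner[of y y])
      finally show ?thesis by (simp add: power2_norm_eq_inner)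
    qed
    ultimately show ?thesis by simp
  qed
  \<comment> \<open>A shrinking ball about the origin is excised, so that the symbol can be
    inverted; in L^2 these kernels converge to k.\<close>
  define kn where "kn n y = (if 1 / real (Suc n) \<le> norm y then k y else 0)" for n y
  have [measurable]: "k \<in> borel_measurable borel" using k by (simp add: kern_def)
  have kkn: "kern (kn n)" for n
  proof -
    have "kern (\<lambda>y. (if 1 / real (Suc n) \<le> norm y then 1 else 0) * k y)"
      by (rule kern_bounded_mult[OF k, of _ 1]) auto
    moreover have "(\<lambda>y. (if 1 / real (Suc n) \<le> norm y then 1 else 0) * k y) = kn n" by (auto simp: kn_def)
    ultimately show ?thesis by simp
  qed
  have z: "ip lborel u (E (kn n)) = 0" for n
  proof -
    \<comment> \<open>The inverse of the symbol -|y|^2 off the excised ball. It is bounded by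
      (n+1)^2, so its product with k is again a kernel.\<close>
    define g where "g y = (if 1 / real (Suc n) \<le> norm y then - complex_of_real (1 / (norm y)\<^sup>2) else 0)" for y :: "real ^ 'd"
    have "kern (\<lambda>y. g y * k y)"
    proof (rule kern_bounded_mult[OF k])
      show "g \<in> borel_measurable borel" unfolding g_def by measurable
      show "norm (g y) \<le> (real (Suc n))\<^sup>2" for y
      proof (cases "1 / real (Suc n) \<le> norm y")
        case True
        then have "1 / norm y \<le> real (Suc n)" using zero_less_norm_iff[of y]
          by (cases "y = 0") (auto simp: field_simps)
        then have "(1 / norm y)\<^sup>2 \<le> (real (Suc n))\<^sup>2" by (intro power_mono) auto
        then show ?thesis using True by (simp add: g_def power_divide norm_divide norm_power)
      qed (simp add: g_def)
    qed
    from E0[OF this] have "ip lborel u (E (\<lambda>y. - complex_of_real ((norm y)\<^sup>2) * (g y * k y))) = 0" .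
    moreover have "- complex_of_real ((norm y)\<^sup>2) * (g y * k y) = kn n y" for y
    proof (cases "1 / real (Suc n) \<le> norm y")
      case True
      then have "norm y \<noteq> 0" using divide_pos_pos[of 1 "real (Suc n)"] by linarith
      then show ?thesis using True by (simp add: g_def kn_def)
    qed (simp add: g_def kn_def)
    ultimately show ?thesis by simp
  qed
  have lim: "(\<lambda>n. nrm lborel (\<lambda>x. kn n x - k x)) \<longlonglongrightarrow> 0"
  proof (rule nrm_dominated_convergence(3)[where w="\<lambda>x. norm (k x)"])
    show "kn n \<in> borel_measurable lborel" for n using kkn by (simp add: kern_def)
    show "sqint lborel (\<lambda>x. norm (k x))" using kern_sqint[OF k] by (auto simp: sqint_def)
    have "AE y in lborel. y \<noteq> (0::real ^ 'd)" by (rule AE_lborel_singleton)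
    then show "AE y in lborel. (\<lambda>n. kn n y) \<longlonglongrightarrow> k y"
    proof eventually_elim
      case (elim y)
      show ?case
      proof (rule tendsto_eventually)
        have "(\<lambda>n. 1 / real (Suc n)) \<longlonglongrightarrow> 0" using LIMSEQ_inverse_real_of_nat by (simp add: inverse_eq_divide)
        then have "\<forall>\<^sub>F n in sequentially. 1 / real (Suc n) < norm y" using elim by (intro order_tendstoD) auto
        then show "\<forall>\<^sub>F n in sequentially. kn n y = k y" by eventually_elim (simp add: kn_def)
      qed
    qed
    show "AE y in lborel. norm (kn n y) \<le> norm (k y)" for n by (simp add: kn_def)
  qed measurable
  have "\<bar>ip lborel u (E k)\<bar> \<le> nrm lborel u * (fnorm TYPE(real ^ 'd) * nrm lborel (\<lambda>x. kn n x - k x))" for n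
  proof -
    have kd: "kern (\<lambda>y. kn n y + (-1) * k y)" by (intro kern_add kkn kern_mult k) auto
    then have kd: "kern (\<lambda>y. kn n y - k y)" by simp
    have "ip lborel u (E (\<lambda>y. kn n y - k y)) = ip lborel u (E (kn n)) - ip lborel u (E k)"
      unfolding E_diff[OF kkn k, abs_def] by (rule ip_diff_right[OF E_sqint[OF kkn] E_sqint[OF k] u])
    then have "\<bar>ip lborel u (E k)\<bar> = \<bar>ip lborel u (E (\<lambda>y. kn n y - k y))\<bar>" using z by simp
    also have "\<dots> \<le> nrm lborel u * nrm lborel (E (\<lambda>y. kn n y - k y))"
      by (rule ip_Cauchy_Schwarz[OF u E_sqint[OF kd]])
    also have "\<dots> \<le> nrm lborel u * (fnorm TYPE(real ^ 'd) * nrm lborel (\<lambda>x. kn n x - k x))"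
      by (intro mult_left_mono nrm_E_le[OF kd]) simp
    finally show ?thesis .
  qed
  moreover have "(\<lambda>n. nrm lborel u * (fnorm TYPE(real ^ 'd) * nrm lborel (\<lambda>x. kn n x - k x))) \<longlonglongrightarrow> 0"
    using tendsto_mult_right_zero[OF tendsto_mult_right_zero[OF lim]] .
  ultimately have "\<bar>ip lborel u (E k)\<bar> \<le> 0"
    by (intro Lim_bounded2[where N=0]) auto
  then show "ip lborel u (E k) = 0" by simp
qed

section \<open>Integration in the vertical variable\<close>

lemma finite_measure_vert: "finite_measure (vert H)"
proof (rule finite_measureI)
  have "emeasure (vert H) (space (vert H)) = emeasure lborel {-H<..<0}"
    unfolding vert_def by (subst emeasure_restrict_space) (auto simp: space_restrict_space)
  then show "emeasure (vert H) (space (vert H)) \<noteq> \<infinity>"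
    by (cases "H \<ge> 0") auto
qed

lemma sigma_finite_vert: "sigma_finite_measure (vert H)"
  using finite_measure_vert by (rule finite_measure.sigma_finite_measure)

lemma pair_sigma_finite_strip: "pair_sigma_finite lborel (vert H)"
  using sigma_finite_vert by (simp add: pair_sigma_finite_def sigma_finite_lborel)

text \<open>The strip carries a restriction of Lebesgue measure on the product space; seen as a
  product measure it is open to Fubini. The two sigma-algebras are compared through the
  measurability of the identity in either direction.\<close>

lemma strip_eq_pair: "(strip H :: ((real ^ 'd) \<times> real) measure) = lborel \<Otimes>\<^sub>M vert H"
proof (rule pair_measure_eqI[symmetric])
  show "sigma_finite_measure (lborel :: (real ^ 'd) measure)" "sigma_finite_measure (vert H)"
    by (simp_all add: sigma_finite_lborel sigma_finite_vert)
  let ?S = "strip H :: ((real ^ 'd) \<times> real) measure"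
  let ?P = "(lborel :: (real ^ 'd) measure) \<Otimes>\<^sub>M vert H"
  have sp: "space ?P = strip_set H" "space ?S = strip_set H"
    by (simp_all add: space_pair_measure vert_def strip_def strip_set_def space_restrict_space)
  have [measurable]: "strip_set H \<in> sets (borel :: ((real ^ 'd) \<times> real) measure)"
    unfolding strip_set_def by (intro borel_open open_Times) auto
  have "(\<lambda>x. x) \<in> measurable ?S ?P"
  proof (subst prod.collapse[symmetric], rule measurable_Pair)
    show "fst \<in> measurable ?S lborel" unfolding strip_def
      by (simp add: measurable_restrict_space1 borel_measurable_continuous_onI continuous_on_fst)
    show "snd \<in> measurable ?S (vert H)" unfolding vert_def strip_def
      by (intro measurable_restrict_space2 measurable_restrict_space1)
         (auto simp: space_restrict_space strip_set_def borel_measurable_continuous_onI continuous_on_snd)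
  qed
  then have 1: "A \<in> sets ?S" if "A \<in> sets ?P" for A
    using measurable_sets[OF _ that, of "\<lambda>x. x" ?S] sets.sets_into_space[OF that] sp by (simp add: Int_absorb2)
  have "(\<lambda>x. x) \<in> measurable ?P (lborel \<Otimes>\<^sub>M lborel)"
  proof (subst prod.collapse[symmetric], rule measurable_Pair)
    have "(\<lambda>z. z) \<in> measurable (vert H) lborel" unfolding vert_def by (rule measurable_restrict_space1) simp
    from measurable_compose[OF measurable_snd this] show "snd \<in> measurable ?P lborel" .
  qed simp
  then have m: "(\<lambda>x. x) \<in> measurable ?P (lborel :: ((real ^ 'd) \<times> real) measure)" by (simp add: lborel_prod)
  have 2: "A \<in> sets ?P" if "A \<in> sets ?S" for A
  proof -
    have "A \<in> (\<inter>) (strip_set H) ` sets lborel"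
      using that by (simp only: strip_def sets_restrict_space)
    then show ?thesis
    proof (rule imageE)
      fix B assume B: "A = strip_set H \<inter> B" "B \<in> sets (lborel :: ((real ^ 'd) \<times> real) measure)"
      show ?thesis using measurable_sets[OF m B(2)] by (simp add: sp B(1) Int_commute)
    qed
  qed
  show "sets ?P = sets ?S" using 1 2 by blast
  fix A :: "(real ^ 'd) set" and B assume A: "A \<in> sets lborel" and B: "B \<in> sets (vert H)"
  have B': "B \<in> sets lborel" "B \<subseteq> {-H<..<0}" using B by (auto simp: vert_def sets_restrict_space)
  have "emeasure ?S (A \<times> B) = emeasure lborel (A \<times> B)"
    unfolding strip_def
  proof (rule emeasure_restrict_space)
    show "A \<times> B \<subseteq> strip_set H" using B' by (auto simp: strip_set_def)
  qed simp
  also have "\<dots> = emeasure (lborel \<Otimes>\<^sub>M lborel) (A \<times> B)" by (simp add: lborel_prod)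
  also have "\<dots> = emeasure lborel A * emeasure lborel B"
    using A B'(1) by (intro lborel.emeasure_pair_measure_Times)
  also have "emeasure lborel B = emeasure (vert H) B"
    unfolding vert_def using B' by (intro emeasure_restrict_space[symmetric]) auto
  finally show "emeasure lborel A * emeasure (vert H) B = emeasure ?S (A \<times> B)" by simp
qed

text \<open>A coefficient in the second variable: when \<open>b\<close> is dual to the n-th member
  of an expansion system, this is the n-th coefficient of \<open>u\<close>.\<close>

definition slice :: "'b measure \<Rightarrow> ('b \<Rightarrow> real) \<Rightarrow> ('a \<times> 'b \<Rightarrow> real) \<Rightarrow> 'a \<Rightarrow> real" where
  "slice N b u x = (LINT z|N. u (x, z) * b z)"

definition tensor :: "('a \<Rightarrow> real) \<Rightarrow> ('b \<Rightarrow> real) \<Rightarrow> 'a \<times> 'b \<Rightarrow> real" where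
  "tensor \<psi> b = (\<lambda>(x, z). \<psi> x * b z)"

context pair_sigma_finite
begin

lemma sqint_section:
  assumes u: "sqint (M1 \<Otimes>\<^sub>M M2) (u :: _ \<Rightarrow> real)"
  shows "AE x in M1. sqint M2 (\<lambda>z. u (x, z))"
    and "integrable M1 (\<lambda>x. (nrm M2 (\<lambda>z. u (x, z)))\<^sup>2)"
    and "(LINT x|M1. (nrm M2 (\<lambda>z. u (x, z)))\<^sup>2) = (nrm (M1 \<Otimes>\<^sub>M M2) u)\<^sup>2"
proof -
  have [measurable]: "u \<in> borel_measurable (M1 \<Otimes>\<^sub>M M2)" using u by (simp add: sqint_def)
  have i: "integrable (M1 \<Otimes>\<^sub>M M2) (\<lambda>p. (norm (u p))\<^sup>2)" using u by (simp add: sqint_def)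
  show "AE x in M1. sqint M2 (\<lambda>z. u (x, z))"
    using AE_integrable_fst'[OF i] AE_space
  proof eventually_elim
    case (elim x)
    then show ?case unfolding sqint_def by (intro conjI measurable_Pair2[of u]) auto
  qed
  show "integrable M1 (\<lambda>x. (nrm M2 (\<lambda>z. u (x, z)))\<^sup>2)"
    unfolding nrm_power2 by (rule integrable_fst'[OF i])
  show "(LINT x|M1. (nrm M2 (\<lambda>z. u (x, z)))\<^sup>2) = (nrm (M1 \<Otimes>\<^sub>M M2) u)\<^sup>2"
    unfolding nrm_power2 by (rule integral_fst'[OF i])
qed

lemma slice_measurable [measurable]:
  assumes [measurable]: "u \<in> borel_measurable (M1 \<Otimes>\<^sub>M M2)" "b \<in> borel_measurable M2"
  shows "slice M2 b u \<in> borel_measurable M1"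
  unfolding slice_def[abs_def] by measurable

lemma
  assumes u: "sqint (M1 \<Otimes>\<^sub>M M2) u" and b: "sqint M2 b"
  shows sqint_slice: "sqint M1 (slice M2 b u)"
    and nrm_slice_le: "nrm M1 (slice M2 b u) \<le> nrm (M1 \<Otimes>\<^sub>M M2) u * nrm M2 b"
proof -
  have [measurable]: "u \<in> borel_measurable (M1 \<Otimes>\<^sub>M M2)" "b \<in> borel_measurable M2" using u b by (auto simp: sqint_def)
  have le: "AE x in M1. norm (slice M2 b u x) \<le> norm (nrm M2 b * nrm M2 (\<lambda>z. u (x, z)))"
    using sqint_section(1)[OF u]
  proof eventually_elim
    case (elim x)
    then show ?case using ip_Cauchy_Schwarz[OF elim b] by (simp add: slice_def ip_def abs_mult mult_ac)
  qed
  have "(\<lambda>x. (nrm M2 (\<lambda>z. u (x, z)))) \<in> borel_measurable M1" unfolding nrm_def by measurable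
  then have s: "sqint M1 (\<lambda>x. nrm M2 (\<lambda>z. u (x, z)))"
    using sqint_section(2)[OF u] by (simp add: sqint_def)
  then have s': "sqint M1 (\<lambda>x. nrm M2 b * nrm M2 (\<lambda>z. u (x, z)))"
    by (rule sqint_cmult)
  show "sqint M1 (slice M2 b u)" by (rule sqint_bound[OF s' _ le]) measurable
  have "nrm M1 (slice M2 b u) \<le> nrm M1 (\<lambda>x. nrm M2 b * nrm M2 (\<lambda>z. u (x, z)))"
    by (rule nrm_mono[OF s' _ le]) measurable
  also have "\<dots> = nrm M2 b * nrm M1 (\<lambda>x. nrm M2 (\<lambda>z. u (x, z)))"
    using nrm_scaleR[of M1 "nrm M2 b" "\<lambda>x. nrm M2 (\<lambda>z. u (x, z))"] by simp
  also have "nrm M1 (\<lambda>x. nrm M2 (\<lambda>z. u (x, z))) = nrm (M1 \<Otimes>\<^sub>M M2) u"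
    using sqint_section(3)[OF u] by (subst (1) nrm_def) simp
  finally show "nrm M1 (slice M2 b u) \<le> nrm (M1 \<Otimes>\<^sub>M M2) u * nrm M2 b" by (simp add: mult.commute)
qed

lemma sqint_tensor:
  assumes "sqint M1 \<psi>" "sqint M2 b"
  shows "sqint (M1 \<Otimes>\<^sub>M M2) (tensor \<psi> b)"
proof -
  have [measurable]: "\<psi> \<in> borel_measurable M1" "b \<in> borel_measurable M2" using assms by (auto simp: sqint_def)
  have "integrable (M1 \<Otimes>\<^sub>M M2) (\<lambda>(x, z). (\<psi> x)\<^sup>2 * (b z)\<^sup>2)"
    by (rule integrable_tensor) (use assms pair_sigma_finite_axioms in \<open>auto simp: sqint_def\<close>)
  then show ?thesis unfolding sqint_def tensor_def
    by (auto simp: case_prod_beta' power_mult_distrib)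
qed

text \<open>\<open>slice\<close> and \<open>tensor\<close> are adjoint. The second form integrates
  in the other order, so that what is known at almost every height z can be integrated against
  \<open>b\<close>.\<close>

lemma
  assumes u: "sqint (M1 \<Otimes>\<^sub>M M2) u" and b: "sqint M2 b" and \<psi>: "sqint M1 \<psi>"
  shows ip_slice: "ip M1 (slice M2 b u) \<psi> = ip (M1 \<Otimes>\<^sub>M M2) u (tensor \<psi> b)"
    and ip_slice': "ip M1 (slice M2 b u) \<psi> = (LINT z|M2. b z * ip M1 (\<lambda>x. u (x, z)) \<psi>)"
    and integrable_slice': "integrable M2 (\<lambda>z. b z * ip M1 (\<lambda>x. u (x, z)) \<psi>)"
proof -
  note i = ip_integrable[OF u sqint_tensor[OF \<psi> b]]
  have "ip (M1 \<Otimes>\<^sub>M M2) u (tensor \<psi> b) = (LINT x|M1. LINT z|M2. u (x, z) * (\<psi> x * b z))"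
    unfolding ip_def using integral_fst'[OF i] by (simp add: tensor_def)
  also have "\<dots> = (LINT x|M1. (LINT z|M2. u (x, z) * b z) * \<psi> x)"
  proof (rule LINT_cong)
    fix x
    have "(LINT z|M2. u (x, z) * (\<psi> x * b z)) = (LINT z|M2. (u (x, z) * b z) * \<psi> x)" by (simp only: mult_ac)
    also have "\<dots> = (LINT z|M2. u (x, z) * b z) * \<psi> x" by (rule integral_mult_left_zero)
    finally show "(LINT z|M2. u (x, z) * (\<psi> x * b z)) = (LINT z|M2. u (x, z) * b z) * \<psi> x" .
  qed
  finally show *: "ip M1 (slice M2 b u) \<psi> = ip (M1 \<Otimes>\<^sub>M M2) u (tensor \<psi> b)"
    by (simp add: ip_def slice_def)
  have i': "integrable (M1 \<Otimes>\<^sub>M M2) (case_prod (\<lambda>x z. u (x, z) * (\<psi> x * b z)))"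
    using i by (simp add: tensor_def case_prod_beta')
  have eq: "(LINT x|M1. u (x, z) * (\<psi> x * b z)) = b z * ip M1 (\<lambda>x. u (x, z)) \<psi>" for z
  proof -
    have "(LINT x|M1. u (x, z) * (\<psi> x * b z)) = (LINT x|M1. b z * (u (x, z) * \<psi> x))" by (simp only: mult_ac)
    also have "\<dots> = b z * (LINT x|M1. u (x, z) * \<psi> x)" by (rule integral_mult_right_zero)
    finally show ?thesis by (simp add: ip_def)
  qed
  have "ip (M1 \<Otimes>\<^sub>M M2) u (tensor \<psi> b) = (LINT z|M2. LINT x|M1. u (x, z) * (\<psi> x * b z))"
    unfolding integral_snd[OF i'] by (simp add: ip_def tensor_def case_prod_beta')
  with * eq show "ip M1 (slice M2 b u) \<psi> = (LINT z|M2. b z * ip M1 (\<lambda>x. u (x, z)) \<psi>)" by simp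
  show "integrable M2 (\<lambda>z. b z * ip M1 (\<lambda>x. u (x, z)) \<psi>)"
    using integrable_snd[OF i'] by (simp only: eq)
qed

lemma nrm_tensor:
  assumes "sqint M1 \<psi>" "sqint M2 b"
  shows "nrm (M1 \<Otimes>\<^sub>M M2) (tensor \<psi> b) = nrm M1 \<psi> * nrm M2 b"
proof -
  have "integrable (M1 \<Otimes>\<^sub>M M2) (\<lambda>p. (norm (tensor \<psi> b p))\<^sup>2)"
    using sqint_tensor[OF assms] by (simp add: sqint_def)
  from integral_fst'[OF this] show ?thesis
    by (simp add: nrm_def tensor_def power_mult_distrib real_sqrt_mult[symmetric])
qed

lemma slice_AE_eqI:
  assumes u: "sqint (M1 \<Otimes>\<^sub>M M2) u" and b: "sqint M2 b" and a: "sqint M1 a"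
    and eq: "\<And>\<psi>. sqint M1 \<psi> \<Longrightarrow> ip M1 a \<psi> = ip (M1 \<Otimes>\<^sub>M M2) u (tensor \<psi> b)"
  shows "AE x in M1. a x = slice M2 b u x"
proof -
  note s = sqint_slice[OF u b]
  note d = sqint_diff[OF a s]
  have "ip M1 (\<lambda>x. a x - slice M2 b u x) (\<lambda>x. a x - slice M2 b u x) = 0"
    using eq[OF d] ip_slice[OF u b d] by (simp add: ip_diff_left[OF a s d])
  then have "nrm M1 (\<lambda>x. a x - slice M2 b u x) = 0" by (simp add: ip_self)
  then show ?thesis using nrm_eq_0[OF d] by simp
qed

end

text \<open>By biorthogonality all partial sums from index n on have the same pairing with a product
  of \<psi> and \<open>b\<close>, namely that of \<open>a n\<close> with \<psi>; convergence in L^2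
  transfers it to \<open>u\<close>. Keeping the system, its dual and the first index general covers
  all the modal decompositions.\<close>

lemma expansion_coefficient:
  fixes u :: "(real ^ 'd) \<times> real \<Rightarrow> real"
  assumes ex: "expansion H k e u a" and u: "sqint (strip H) u" and e: "\<And>j. j \<ge> k \<Longrightarrow> sqint (vert H) (e j)"
    and b: "sqint (vert H) b" and n: "n \<ge> k"
    and dual: "\<And>j. j \<ge> k \<Longrightarrow> (LINT z|vert H. e j z * b z) = (if j = n then 1 else 0)"
  shows "AE x in lborel. a n x = slice (vert H) b u x" "sqint lborel (a n)"
proof -
  interpret pair_sigma_finite "lborel :: (real ^ 'd) measure" "vert H" by (rule pair_sigma_finite_strip)
  have a: "sqint lborel (a j)" if "j \<ge> k" for j using ex that by (simp add: expansion_def L2_iff_sqint)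
  then show "sqint lborel (a n)" using n by simp
  note u' = u[unfolded strip_eq_pair]
  define S where "S m = (\<lambda>p. \<Sum>j=k..m. tensor (a j) (e j) p)" for m
  have S: "sqint (lborel \<Otimes>\<^sub>M vert H) (S m)" for m unfolding S_def by (intro sqint_sum sqint_tensor a e) auto
  have "S = (\<lambda>m (X, z). \<Sum>j=k..m. a j X * e j z)" by (auto simp: S_def tensor_def fun_eq_iff)
  then have "L2_tendsto (strip H) S u sequentially"
    using ex by (simp add: expansion_def)
  then have lim: "(\<lambda>m. nrm (lborel \<Otimes>\<^sub>M vert H) (\<lambda>p. S m p - u p)) \<longlonglongrightarrow> 0"
    unfolding strip_eq_pair by (subst (asm) L2_tendsto_iff[OF S u'])
  show "AE x in lborel. a n x = slice (vert H) b u x"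
  proof (rule slice_AE_eqI[OF u' b a[OF n]])
    fix \<psi> :: "real ^ 'd \<Rightarrow> real" assume \<psi>: "sqint lborel \<psi>"
    note t = sqint_tensor[OF \<psi> b]
    have ev: "ip (lborel \<Otimes>\<^sub>M vert H) (S m) (tensor \<psi> b) = ip lborel (a n) \<psi>" if "m \<ge> n" for m
    proof -
      have "ip (lborel \<Otimes>\<^sub>M vert H) (S m) (tensor \<psi> b) = (\<Sum>j=k..m. ip (lborel \<Otimes>\<^sub>M vert H) (tensor (a j) (e j)) (tensor \<psi> b))"
        unfolding S_def ip_commute[of _ _ "tensor \<psi> b"] by (rule ip_sum_right) (auto intro!: sqint_tensor a e \<psi> b)
      also have "\<dots> = (\<Sum>j=k..m. ip lborel (a j) \<psi> * (if j = n then 1 else 0))"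
      proof (rule sum.cong[OF refl])
        fix j assume "j \<in> {k..m}"
        then have j: "j \<ge> k" by simp
        have "slice (vert H) b (tensor (a j) (e j)) = (\<lambda>x. (if j = n then 1 else 0) *\<^sub>R a j x)"
        proof
          fix x
          have "slice (vert H) b (tensor (a j) (e j)) x = (LINT z|vert H. a j x * (e j z * b z))"
            by (simp add: slice_def tensor_def mult.assoc)
          also have "\<dots> = a j x * (if j = n then 1 else 0)" unfolding dual[OF j, symmetric] by (rule integral_mult_right_zero)
          finally show "slice (vert H) b (tensor (a j) (e j)) x = (if j = n then 1 else 0) *\<^sub>R a j x" by simp
        qed
        then have "ip (lborel \<Otimes>\<^sub>M vert H) (tensor (a j) (e j)) (tensor \<psi> b) = ip lborel (\<lambda>x. (if j = n then 1 else 0) *\<^sub>R a j x) \<psi>"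
          unfolding ip_slice[OF sqint_tensor[OF a[OF j] e[OF j]] b \<psi>, symmetric] by (rule arg_cong)
        also have "\<dots> = (if j = n then 1 else 0) * ip lborel (a j) \<psi>" by (rule ip_scaleR_left)
        finally show "ip (lborel \<Otimes>\<^sub>M vert H) (tensor (a j) (e j)) (tensor \<psi> b) = ip lborel (a j) \<psi> * (if j = n then 1 else 0)"
          by (simp only: mult.commute)
      qed
      also have "\<dots> = ip lborel (a n) \<psi>" using n that by (simp add: if_distrib[of "\<lambda>c. _ * c"] cong: if_cong)
      finally show ?thesis .
    qed
    have "(\<lambda>m. ip (lborel \<Otimes>\<^sub>M vert H) (S m) (tensor \<psi> b)) \<longlonglongrightarrow> ip (lborel \<Otimes>\<^sub>M vert H) u (tensor \<psi> b)"
      by (rule ip_tendsto[OF S u' t lim])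
    moreover have "(\<lambda>m. ip (lborel \<Otimes>\<^sub>M vert H) (S m) (tensor \<psi> b)) \<longlonglongrightarrow> ip lborel (a n) \<psi>"
      by (rule tendsto_eventually) (use ev in \<open>auto simp: eventually_sequentially\<close>)
    ultimately show "ip lborel (a n) \<psi> = ip (lborel \<Otimes>\<^sub>M vert H) u (tensor \<psi> b)"
      by (rule LIMSEQ_unique[symmetric])
  qed
qed

text \<open>The characterisation of \<Lambda>^s by the functions \<open>E k\<close> is linear and
  holds at almost every height, hence may be multiplied by \<open>b\<close> and integrated.\<close>

lemma is_Lambda_slice:
  fixes u v :: "(real ^ 'd) \<times> real \<Rightarrow> real"
  assumes L: "is_Lambda_strip H s u v" and b: "sqint (vert H) b"
  shows "is_Lambda s (slice (vert H) b u) (slice (vert H) b v)"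
proof -
  interpret pair_sigma_finite "lborel :: (real ^ 'd) measure" "vert H" by (rule pair_sigma_finite_strip)
  have u: "sqint (lborel \<Otimes>\<^sub>M vert H) u" and v: "sqint (lborel \<Otimes>\<^sub>M vert H) v"
    and ae: "AE z in vert H. is_Lambda s (\<lambda>X. u (X, z)) (\<lambda>X. v (X, z))"
    using L by (auto simp: is_Lambda_strip_def L2_iff_sqint strip_eq_pair)
  have "ip lborel (slice (vert H) b v) (E k) = ip lborel (slice (vert H) b u) (E (\<lambda>\<xi>. bessel s \<xi> *\<^sub>R k \<xi>))"
    if k: "kern k" for k
  proof -
    note E = E_sqint[OF k] E_sqint[OF kern_bessel[OF k, of s]]
    have "(LINT z|vert H. b z * ip lborel (\<lambda>x. v (x, z)) (E k))
      = (LINT z|vert H. b z * ip lborel (\<lambda>x. u (x, z)) (E (\<lambda>\<xi>. bessel s \<xi> *\<^sub>R k \<xi>)))"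
    proof (rule integral_cong_AE)
      show "(\<lambda>z. b z * ip lborel (\<lambda>x. v (x, z)) (E k)) \<in> borel_measurable (vert H)"
        using integrable_slice'[OF v b E(1)] by (rule borel_measurable_integrable)
      show "(\<lambda>z. b z * ip lborel (\<lambda>x. u (x, z)) (E (\<lambda>\<xi>. bessel s \<xi> *\<^sub>R k \<xi>))) \<in> borel_measurable (vert H)"
        using integrable_slice'[OF u b E(2)] by (rule borel_measurable_integrable)
      show "AE z in vert H. b z * ip lborel (\<lambda>x. v (x, z)) (E k) = b z * ip lborel (\<lambda>x. u (x, z)) (E (\<lambda>\<xi>. bessel s \<xi> *\<^sub>R k \<xi>))"
        using ae by eventually_elim (use k in \<open>simp add: is_Lambda_iff\<close>)
    qed
    then show ?thesis by (simp only: ip_slice'[OF v b E(1)] ip_slice'[OF u b E(2)])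
  qed
  then show ?thesis using sqint_slice[OF u b] sqint_slice[OF v b] by (simp add: is_Lambda_iff)
qed

lemma nrm_le_is_Lambda_strip:
  fixes u v :: "(real ^ 'd) \<times> real \<Rightarrow> real"
  assumes L: "is_Lambda_strip H s u v" and s: "0 \<le> s"
  shows "sqint (strip H) u" "sqint (strip H) v" "nrm (strip H) u \<le> nrm (strip H) v"
proof -
  interpret pair_sigma_finite "lborel :: (real ^ 'd) measure" "vert H" by (rule pair_sigma_finite_strip)
  interpret Q: pair_sigma_finite "vert H" "lborel :: (real ^ 'd) measure" ..
  have u: "sqint (lborel \<Otimes>\<^sub>M vert H) u" and v: "sqint (lborel \<Otimes>\<^sub>M vert H) v"
    and ae: "AE z in vert H. is_Lambda s (\<lambda>X. u (X, z)) (\<lambda>X. v (X, z))"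
    using L by (auto simp: is_Lambda_strip_def L2_iff_sqint strip_eq_pair)
  then show "sqint (strip H) u" "sqint (strip H) v" by (simp_all add: strip_eq_pair)
  have sn: "integrable (vert H) (\<lambda>z. (nrm lborel (\<lambda>x. p (x, z)))\<^sup>2)"
    "(LINT z|vert H. (nrm lborel (\<lambda>x. p (x, z)))\<^sup>2) = (nrm (lborel \<Otimes>\<^sub>M vert H) p)\<^sup>2"
    if "sqint (lborel \<Otimes>\<^sub>M vert H) p" for p :: "(real ^ 'd) \<times> real \<Rightarrow> real"
  proof -
    have i: "integrable (lborel \<Otimes>\<^sub>M vert H) (case_prod (\<lambda>x z. (norm (p (x, z)))\<^sup>2))"
      using that by (simp add: sqint_def case_prod_beta')
    show "integrable (vert H) (\<lambda>z. (nrm lborel (\<lambda>x. p (x, z)))\<^sup>2)"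
      unfolding nrm_power2 by (rule integrable_snd[OF i])
    show "(LINT z|vert H. (nrm lborel (\<lambda>x. p (x, z)))\<^sup>2) = (nrm (lborel \<Otimes>\<^sub>M vert H) p)\<^sup>2"
      unfolding nrm_power2 integral_snd[OF i] by (simp add: case_prod_beta')
  qed
  have "(nrm (lborel \<Otimes>\<^sub>M vert H) u)\<^sup>2 \<le> (nrm (lborel \<Otimes>\<^sub>M vert H) v)\<^sup>2"
    unfolding sn(2)[OF u, symmetric] sn(2)[OF v, symmetric]
  proof (rule integral_mono_AE[OF sn(1)[OF u] sn(1)[OF v]])
    show "AE z in vert H. (nrm lborel (\<lambda>x. u (x, z)))\<^sup>2 \<le> (nrm lborel (\<lambda>x. v (x, z)))\<^sup>2"
      using ae by eventually_elim (use nrm_le_is_Lambda s in \<open>auto intro!: power_mono\<close>)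
  qed
  then show "nrm (strip H) u \<le> nrm (strip H) v"
    unfolding strip_eq_pair by (rule power2_le_imp_le) simp
qed

section \<open>Sobolev regularity of the coefficients and continuity in time\<close>

lemma Hs0_SOME:
  assumes "Hs0 H s u"
  shows "is_Lambda_strip H s u (SOME v. is_Lambda_strip H s u v)"
    "Hs0_norm H s u = nrm (strip H) (SOME v. is_Lambda_strip H s u v)"
  using someI_ex[OF assms[unfolded Hs0_def]] by (simp_all add: Hs0_norm_def L2norm_eq_nrm)

lemma Hs0_diff:
  assumes "Hs0 H s u" "Hs0 H s u'"
  shows "Hs0 H s (\<lambda>x. u x - u' x)"
proof -
  obtain v v' where "is_Lambda_strip H s u v" "is_Lambda_strip H s u' v'" using assms by (auto simp: Hs0_def)
  then have "is_Lambda_strip H s (\<lambda>x. u x - u' x) (\<lambda>x. v x - v' x)"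
    unfolding is_Lambda_strip_def L2_iff_sqint
    by (auto intro!: sqint_diff elim!: eventually_elim2 intro: is_Lambda_diff)
  then show ?thesis by (auto simp: Hs0_def)
qed

lemma Hs0_slice:
  fixes u :: "(real ^ 'd) \<times> real \<Rightarrow> real"
  assumes u: "Hs0 H s u" and b: "sqint (vert H) b"
    and a: "a \<in> borel_measurable lborel" "AE x in lborel. a x = slice (vert H) b u x"
  shows "Hs s a" "Hs_norm s a \<le> nrm (vert H) b * Hs0_norm H s u"
    "\<exists>v. is_Lambda_strip H s u v \<and> Hs_norm s a = nrm lborel (slice (vert H) b v)
       \<and> Hs0_norm H s u = nrm (strip H) v \<and> sqint (strip H) v"
proof -
  interpret pair_sigma_finite "lborel :: (real ^ 'd) measure" "vert H" by (rule pair_sigma_finite_strip)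
  define v where "v = (SOME v. is_Lambda_strip H s u v)"
  have v: "is_Lambda_strip H s u v" "Hs0_norm H s u = nrm (strip H) v" using Hs0_SOME[OF u] by (simp_all add: v_def)
  have sv: "sqint (strip H) v" using v(1) by (simp add: is_Lambda_strip_def L2_iff_sqint)
  have L: "is_Lambda s a (slice (vert H) b v)" by (rule is_Lambda_cong_AE[OF is_Lambda_slice[OF v(1) b] a])
  then show "Hs s a" by (auto simp: Hs_def)
  show "Hs_norm s a \<le> nrm (vert H) b * Hs0_norm H s u"
    unfolding Hs_norm_eq[OF L] v(2) using nrm_slice_le[OF sv[unfolded strip_eq_pair] b] by (simp add: strip_eq_pair mult.commute)
  show "\<exists>v. is_Lambda_strip H s u v \<and> Hs_norm s a = nrm lborel (slice (vert H) b v) \<and> Hs0_norm H s u = nrm (strip H) v \<and> sqint (strip H) v"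
    using v sv Hs_norm_eq[OF L] by blast
qed

text \<open>The form in which regularity in time enters the weak equations: pairings of such curves
  with fixed functions are continuous in t.\<close>

definition contL2 :: "real \<Rightarrow> 'a measure \<Rightarrow> (real \<Rightarrow> 'a \<Rightarrow> real) \<Rightarrow> bool" where
  "contL2 T M u \<longleftrightarrow> (\<forall>t\<in>{0..T}. sqint M (u t)) \<and>
     (\<forall>t\<in>{0..T}. ((\<lambda>r. nrm M (\<lambda>x. u r x - u t x)) \<longlongrightarrow> 0) (at t within {0..T}))"

lemma contL2_sqint: "contL2 T M u \<Longrightarrow> t \<in> {0..T} \<Longrightarrow> sqint M (u t)"
  by (simp add: contL2_def)

lemma cont_in_L2: "cont_in T (L2 M) (L2norm M) u \<Longrightarrow> contL2 T M u"
  by (simp add: cont_in_def contL2_def L2_iff_sqint L2norm_eq_nrm)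

lemma cont_in_Hs0:
  fixes u :: "real \<Rightarrow> (real ^ 'd) \<times> real \<Rightarrow> real"
  assumes u: "cont_in T (Hs0 H s) (Hs0_norm H s) u" and s: "0 \<le> s"
  shows "contL2 T (strip H) u"
  unfolding contL2_def
proof (intro conjI ballI)
  have Hs: "Hs0 H s (u t)" if "t \<in> {0..T}" for t using u that by (simp add: cont_in_def)
  show "sqint (strip H) (u t)" if "t \<in> {0..T}" for t
    using nrm_le_is_Lambda_strip(1)[OF Hs0_SOME(1)[OF Hs[OF that]] s] .
  fix t assume t: "t \<in> {0..T}"
  show "((\<lambda>r. nrm (strip H) (\<lambda>x. u r x - u t x)) \<longlongrightarrow> 0) (at t within {0..T})"
  proof (rule Lim_null_comparison)
    show "((\<lambda>r. Hs0_norm H s (\<lambda>x. u r x - u t x)) \<longlongrightarrow> 0) (at t within {0..T})"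
      using u t by (simp add: cont_in_def)
    show "\<forall>\<^sub>F r in at t within {0..T}. norm (nrm (strip H) (\<lambda>x. u r x - u t x)) \<le> Hs0_norm H s (\<lambda>x. u r x - u t x)"
      unfolding eventually_at_filter
    proof (intro always_eventually allI impI)
      fix r assume "r \<noteq> t" "r \<in> {0..T}"
      then have d: "Hs0 H s (\<lambda>x. u r x - u t x)" using Hs t by (intro Hs0_diff) auto
      show "norm (nrm (strip H) (\<lambda>x. u r x - u t x)) \<le> Hs0_norm H s (\<lambda>x. u r x - u t x)"
        using nrm_le_is_Lambda_strip(3)[OF Hs0_SOME(1)[OF d] s] Hs0_SOME(2)[OF d] by simp
    qed
  qed
qed

lemma Hs_diff: "Hs s u \<Longrightarrow> Hs s u' \<Longrightarrow> Hs s (\<lambda>x. u x - u' x)"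
  unfolding Hs_def using is_Lambda_diff by blast

lemma cont_in_Hs:
  fixes u :: "real \<Rightarrow> real ^ 'd \<Rightarrow> real"
  assumes u: "cont_in T (Hs s) (Hs_norm s) u" and s: "0 \<le> s"
  shows "contL2 T lborel u"
  unfolding contL2_def
proof (intro conjI ballI)
  have Hs: "Hs s (u t)" if "t \<in> {0..T}" for t using u that by (simp add: cont_in_def)
  show "sqint lborel (u t)" if "t \<in> {0..T}" for t using Hs[OF that] is_Lambda_sqint(1) by (auto simp: Hs_def)
  fix t assume t: "t \<in> {0..T}"
  show "((\<lambda>r. nrm lborel (\<lambda>x. u r x - u t x)) \<longlongrightarrow> 0) (at t within {0..T})"
  proof (rule Lim_null_comparison)
    show "((\<lambda>r. Hs_norm s (\<lambda>x. u r x - u t x)) \<longlongrightarrow> 0) (at t within {0..T})"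
      using u t by (simp add: cont_in_def)
    show "\<forall>\<^sub>F r in at t within {0..T}. norm (nrm lborel (\<lambda>x. u r x - u t x)) \<le> Hs_norm s (\<lambda>x. u r x - u t x)"
      unfolding eventually_at_filter
    proof (intro always_eventually allI impI)
      fix r assume "r \<noteq> t" "r \<in> {0..T}"
      then have "Hs s (\<lambda>x. u r x - u t x)" using Hs t by (intro Hs_diff) auto
      then obtain v where "is_Lambda s (\<lambda>x. u r x - u t x) v" by (auto simp: Hs_def)
      then show "norm (nrm lborel (\<lambda>x. u r x - u t x)) \<le> Hs_norm s (\<lambda>x. u r x - u t x)"
        using nrm_le_is_Lambda s Hs_norm_eq by fastforce
    qed
  qed
qed

text \<open>The bound of a slice by the norm of \<open>b\<close>, applied to differences of two
  times. The curve \<open>a\<close> represents the slices only almost everywhere, so the difference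
  is identified with a slice off a null set.\<close>

lemma cont_in_slice:
  fixes u :: "real \<Rightarrow> (real ^ 'd) \<times> real \<Rightarrow> real"
  assumes u: "cont_in T (Hs0 H s) (Hs0_norm H s) u" and b: "sqint (vert H) b" and s: "0 \<le> s"
    and a: "\<And>t. t \<in> {0..T} \<Longrightarrow> sqint lborel (a t)"
      "\<And>t. t \<in> {0..T} \<Longrightarrow> AE x in lborel. a t x = slice (vert H) b (u t) x"
  shows "cont_in T (Hs s) (Hs_norm s) a"
  unfolding cont_in_def
proof (intro conjI ballI)
  interpret pair_sigma_finite "lborel :: (real ^ 'd) measure" "vert H" by (rule pair_sigma_finite_strip)
  have Hs: "Hs0 H s (u t)" if "t \<in> {0..T}" for t using u that by (simp add: cont_in_def)
  have am: "a t \<in> borel_measurable lborel" if "t \<in> {0..T}" for t using a(1)[OF that] by (simp add: sqint_def)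
  show "Hs s (a t)" if "t \<in> {0..T}" for t
    by (rule Hs0_slice(1)[OF Hs[OF that] b am[OF that] a(2)[OF that]])
  fix t assume t: "t \<in> {0..T}"
  show "((\<lambda>r. Hs_norm s (\<lambda>x. a r x - a t x)) \<longlongrightarrow> 0) (at t within {0..T})"
  proof (rule Lim_null_comparison)
    show "((\<lambda>r. nrm (vert H) b * Hs0_norm H s (\<lambda>x. u r x - u t x)) \<longlongrightarrow> 0) (at t within {0..T})"
      using u t by (intro tendsto_mult_right_zero) (simp add: cont_in_def)
    show "\<forall>\<^sub>F r in at t within {0..T}. norm (Hs_norm s (\<lambda>x. a r x - a t x)) \<le> nrm (vert H) b * Hs0_norm H s (\<lambda>x. u r x - u t x)"
      unfolding eventually_at_filter
    proof (intro always_eventually allI impI)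
      fix r assume "r \<noteq> t" and r: "r \<in> {0..T}"
      have d: "Hs0 H s (\<lambda>x. u r x - u t x)" using Hs r t by (intro Hs0_diff) auto
      have su: "sqint (lborel \<Otimes>\<^sub>M vert H) (u q)" if "q \<in> {0..T}" for q
        using nrm_le_is_Lambda_strip(1)[OF Hs0_SOME(1)[OF Hs[OF that]] s] by (simp add: strip_eq_pair)
      have ae: "AE x in lborel. a r x - a t x = slice (vert H) b (\<lambda>x. u r x - u t x) x"
        using a(2)[OF r] a(2)[OF t] sqint_section(1)[OF su[OF r]] sqint_section(1)[OF su[OF t]]
      proof eventually_elim
        case (elim x)
        show ?case using ip_integrable[OF elim(3) b] ip_integrable[OF elim(4) b]
          by (simp add: elim(1,2) slice_def left_diff_distrib)
      qed
      have m: "(\<lambda>x. a r x - a t x) \<in> borel_measurable lborel" using am[OF r] am[OF t] by measurable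
      obtain v where "is_Lambda s (\<lambda>x. a r x - a t x) v" using Hs0_slice(1)[OF d b m ae] by (auto simp: Hs_def)
      then have "0 \<le> Hs_norm s (\<lambda>x. a r x - a t x)" using Hs_norm_eq by fastforce
      then show "norm (Hs_norm s (\<lambda>x. a r x - a t x)) \<le> nrm (vert H) b * Hs0_norm H s (\<lambda>x. u r x - u t x)"
        using Hs0_slice(2)[OF d b m ae] by simp
    qed
  qed
qed

section \<open>Weak equations on an interval\<close>

lemma pd_real_has_derivative:
  "f differentiable (at x) \<Longrightarrow> (f has_real_derivative pd 1 f x) (at x)"
  using real_differentiable_def pd_real_deriv by metis

lemma step_differentiable: "(step has_real_derivative pd 1 step x) (at x)"
  using Ck_step[of 1] by (intro pd_real_has_derivative) simp

lemma step_deriv_continuous: "continuous_on UNIV (pd 1 step)"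
  using Ck_step[of 1] by simp

lemma step_deriv_0: "x < 0 \<or> 1 < x \<Longrightarrow> pd 1 step x = 0"
proof -
  assume "x < 0 \<or> 1 < x"
  then have "(step has_real_derivative 0) (at x)"
  proof
    assume "x < 0"
    then show ?thesis
      by (intro has_field_derivative_transform_within_open[of "\<lambda>x. 0" 0 x "{..<0}" step]) (auto simp: step_0)
  next
    assume "1 < x"
    then show ?thesis
      by (intro has_field_derivative_transform_within_open[of "\<lambda>x. 1" 0 x "{1<..}" step]) (auto simp: step_1)
  qed
  then show ?thesis by (rule pd_real_deriv)
qed

lemma step_deriv_bounded: "\<exists>B\<ge>0. \<forall>x. \<bar>pd 1 step x\<bar> \<le> B"
proof -
  have "compact (pd 1 step ` {0..1})"
    by (intro compact_continuous_image continuous_on_subset[OF step_deriv_continuous]) auto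
  then obtain C where C: "\<forall>y\<in>pd 1 step ` {0..1}. norm y \<le> C" using compact_imp_bounded bounded_iff by metis
  have "\<bar>pd 1 step x\<bar> \<le> max 0 C" for x
    using C step_deriv_0[of x] by (cases "x < 0 \<or> 1 < x") (auto simp: le_max_iff_disj)
  then show ?thesis by (intro exI[of _ "max 0 C"]) auto
qed

lemma step_deriv_integral: "(LINT x|lborel. indicator {0..1} x *\<^sub>R pd 1 step x) = 1"
proof -
  have "(LINT x|lborel. indicator {0..1} x *\<^sub>R pd 1 step x) = step 1 - step 0"
    by (rule integral_FTC_atLeastAtMost)
       (auto intro!: continuous_on_subset[OF step_deriv_continuous] has_field_derivative_at_within step_differentiable
          simp: has_real_derivative_iff_has_vector_derivative[symmetric])
  then show ?thesis by (simp add: step_0 step_1)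
qed

lemma step_deriv_affine: "((\<lambda>t. step (a * (t - x))) has_real_derivative a * pd 1 step (a * (t - x))) (at t)"
  by (rule DERIV_cong[OF DERIV_chain2[OF step_differentiable]]) (auto intro!: derivative_eq_intros)

lemma Ck_step_shift: "Ck k (\<lambda>t. step (a * (t - x)))"
  by (rule Ck_step_affine[OF Ck_cmult[OF Ck_diff[OF Ck_id Ck_const]]])

text \<open>The derivatives of the steepened steps have mass 1 and are supported in
  [x, x + 1/(n+1)]; after rescaling to the unit interval, dominated convergence applies.\<close>

lemma step_approx_identity:
  assumes h: "continuous_on {a..b} h" and x: "a < x" "x < b"
  shows "(\<lambda>n. LINT t:{a..b}|lborel. h t * (real (Suc n) * pd 1 step (real (Suc n) * (t - x)))) \<longlonglongrightarrow> h x"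
proof -
  let ?N = "\<lambda>n. real (Suc n)"
  obtain B where B: "B \<ge> 0" "\<And>x. \<bar>pd 1 step x\<bar> \<le> B" using step_deriv_bounded by blast
  have "compact (h ` {a..b})" by (rule compact_continuous_image[OF h]) simp
  then obtain C where C: "\<forall>y\<in>h ` {a..b}. norm y \<le> C" using compact_imp_bounded bounded_iff by metis
  have hm: "(\<lambda>t. indicator {a..b} t *\<^sub>R h t) \<in> borel_measurable borel"
    by (rule borel_measurable_continuous_on_indicator) (use h in auto)
  have sm [measurable]: "pd 1 step \<in> borel_measurable borel"
    by (rule borel_measurable_continuous_onI[OF step_deriv_continuous])
  define g where "g t = indicator {a..b} t *\<^sub>R h t" for t
  have [measurable]: "g \<in> borel_measurable borel" using hm by (simp add: g_def[abs_def])
  have eq: "(LINT t:{a..b}|lborel. h t * (?N n * pd 1 step (?N n * (t - x)))) = (LINT u|lborel. g (x + u / ?N n) * pd 1 step u)" for n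
  proof -
    have "(LINT t:{a..b}|lborel. h t * (?N n * pd 1 step (?N n * (t - x)))) = (LINT t|lborel. g t * (?N n * pd 1 step (?N n * (t - x))))"
      by (simp add: set_lebesgue_integral_def g_def mult.assoc)
    also have "\<dots> = \<bar>1 / ?N n\<bar> *\<^sub>R (LINT u|lborel. g (x + (1 / ?N n) * u) * (?N n * pd 1 step (?N n * ((x + (1 / ?N n) * u) - x))))"
      by (rule lborel_integral_real_affine) simp
    also have "\<dots> = (LINT u|lborel. \<bar>1 / ?N n\<bar> *\<^sub>R (g (x + (1 / ?N n) * u) * (?N n * pd 1 step (?N n * ((x + (1 / ?N n) * u) - x)))))"
      by (rule integral_scaleR_right[symmetric])
    also have "\<dots> = (LINT u|lborel. g (x + u / ?N n) * pd 1 step u)"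
      by (rule LINT_cong) (simp add: field_simps del: of_nat_Suc)
    finally show ?thesis .
  qed
  have lim: "(\<lambda>n. LINT u|lborel. g (x + u / ?N n) * pd 1 step u) \<longlonglongrightarrow> (LINT u|lborel. h x * (indicator {0..1} u *\<^sub>R pd 1 step u))"
  proof (rule integral_dominated_convergence[where w="\<lambda>u. (\<bar>C\<bar> * B) * indicator {0..1} u"])
    show "integrable lborel (\<lambda>u. (\<bar>C\<bar> * B) * indicator {0..1::real} u)" by simp
    show "AE u in lborel. (\<lambda>n. g (x + u / ?N n) * pd 1 step u) \<longlonglongrightarrow> h x * (indicator {0..1} u *\<^sub>R pd 1 step u)"
    proof (rule AE_I2)
      fix u
      have 1: "(\<lambda>n. x + u / ?N n) \<longlonglongrightarrow> x"
        using tendsto_add[OF tendsto_const[of x] LIMSEQ_Suc[OF lim_const_over_n[of u]]] by simp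
      have ev: "\<forall>\<^sub>F n in sequentially. x + u / ?N n \<in> {a..b}"
        using eventually_conj[OF order_tendstoD(1)[OF 1 x(1)] order_tendstoD(2)[OF 1 x(2)]]
        by eventually_elim auto
      have "(\<lambda>n. h (x + u / ?N n)) \<longlonglongrightarrow> h x"
        using continuous_on_tendsto_compose[OF h 1 _ ev] x by simp
      then have "(\<lambda>n. g (x + u / ?N n)) \<longlonglongrightarrow> h x"
        by (rule Lim_transform_eventually) (use ev in \<open>auto simp: g_def elim!: eventually_mono\<close>)
      then have "(\<lambda>n. g (x + u / ?N n) * pd 1 step u) \<longlonglongrightarrow> h x * pd 1 step u" by (intro tendsto_intros)
      moreover have "pd 1 step u = indicator {0..1} u *\<^sub>R pd 1 step u" using step_deriv_0[of u] by (cases "u \<in> {0..1}") auto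
      ultimately show "(\<lambda>n. g (x + u / ?N n) * pd 1 step u) \<longlonglongrightarrow> h x * (indicator {0..1} u *\<^sub>R pd 1 step u)" by metis
    qed
    show "AE u in lborel. norm (g (x + u / ?N n) * pd 1 step u) \<le> (\<bar>C\<bar> * B) * indicator {0..1} u" for n
    proof (rule AE_I2)
      fix u
      have "\<bar>g (x + u / ?N n)\<bar> \<le> \<bar>C\<bar>"
      proof (cases "x + u / ?N n \<in> {a..b}")
        case True
        then have "norm (h (x + u / ?N n)) \<le> C" using C by blast
        then show ?thesis using True by (simp add: g_def)
      qed (simp add: g_def)
      then have "\<bar>g (x + u / ?N n)\<bar> * \<bar>pd 1 step u\<bar> \<le> \<bar>C\<bar> * B" using B by (intro mult_mono) auto
      then show "norm (g (x + u / ?N n) * pd 1 step u) \<le> (\<bar>C\<bar> * B) * indicator {0..1} u"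
        using step_deriv_0[of u] by (cases "u \<in> {0..1}") (auto simp: abs_mult indicator_def)
    qed
  qed measurable
  have L: "(LINT u|lborel. h x * (indicator {0..1} u *\<^sub>R pd 1 step u)) = h x"
    unfolding integral_mult_right_zero step_deriv_integral by simp
  show ?thesis using lim unfolding eq L .
qed

text \<open>The difference of two steep steps placed at x and y has compact support, so it may be
  used as a test function; its derivative is a difference of two approximate identities, which
  evaluate \<open>h\<close> at x and at y. The end points follow by continuity.\<close>

lemma du_Bois_Reymond:
  fixes h :: "real \<Rightarrow> real"
  assumes h: "continuous_on {a..b} h"
    and 0: "\<And>\<theta>. test_fun {a<..<b} \<theta> \<Longrightarrow> (LINT t:{a..b}|lborel. h t * pd 1 \<theta> t) = 0"
    and x: "x \<in> {a..b}" and y: "y \<in> {a..b}"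
  shows "h x = h y"
proof -
  have interior: "h x = h y" if x: "a < x" "x < b" and y: "a < y" "y < b" for x y
  proof (rule LIMSEQ_unique)
    let ?N = "\<lambda>n. real (Suc n)"
    let ?A = "\<lambda>x n. LINT t:{a..b}|lborel. h t * (?N n * pd 1 step (?N n * (t - x)))"
    show "?A y \<longlonglongrightarrow> h y" by (rule step_approx_identity[OF h y])
    have "\<forall>\<^sub>F n in sequentially. ?A x n = ?A y n"
    proof -
      \<comment> \<open>From m + 1/(n+1) on both steps are 1 and their difference vanishes; this
        point must therefore lie before b.\<close>
      define m where "m = max x y"
      have "(\<lambda>n. m + 1 / ?N n) \<longlonglongrightarrow> m"
        using tendsto_add[OF tendsto_const[of m] LIMSEQ_Suc[OF lim_const_over_n[of 1]]] by simp
      then have "\<forall>\<^sub>F n in sequentially. m + 1 / ?N n < b" by (rule order_tendstoD(2)) (use x y in \<open>auto simp: m_def\<close>)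
      then show ?thesis
      proof eventually_elim
        case (elim n)
        define \<theta> where "\<theta> t = step (?N n * (t - x)) - step (?N n * (t - y))" for t
        have t: "test_fun {a<..<b} \<theta>"
        proof (rule test_funI[where K="{min x y..m + 1 / ?N n}"])
          show "Ck k \<theta>" for k unfolding \<theta>_def by (intro Ck_diff Ck_step_shift)
          show "\<theta> t = 0" if "t \<notin> {min x y..m + 1 / ?N n}" for t
          proof (cases "t < min x y")
            case True
            then have "?N n * (t - x) \<le> 0" "?N n * (t - y) \<le> 0" by (auto intro!: mult_nonneg_nonpos)
            then show ?thesis by (simp add: \<theta>_def step_0)
          next
            case False
            then have "1 / ?N n \<le> t - x" "1 / ?N n \<le> t - y" using that by (auto simp: m_def)
            then have "1 \<le> ?N n * (t - x)" "1 \<le> ?N n * (t - y)" by (simp_all add: field_simps del: of_nat_Suc)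
            then show ?thesis by (simp add: \<theta>_def step_1)
          qed
        qed (use elim x y in \<open>auto simp: m_def\<close>)
        have p: "pd 1 \<theta> t = ?N n * pd 1 step (?N n * (t - x)) - ?N n * pd 1 step (?N n * (t - y))" for t
          unfolding \<theta>_def by (intro pd_real_deriv DERIV_diff step_deriv_affine)
        have i: "set_integrable lborel {a..b} (\<lambda>t. h t * (?N n * pd 1 step (?N n * (t - x))))" for x
          by (intro borel_integrable_atLeastAtMost' continuous_intros h continuous_on_compose2[OF step_deriv_continuous]) auto
        have "0 = (LINT t:{a..b}|lborel. h t * (?N n * pd 1 step (?N n * (t - x))) - h t * (?N n * pd 1 step (?N n * (t - y))))"
          using 0[OF t] by (simp only: p right_diff_distrib)
        also have "\<dots> = ?A x n - ?A y n" by (rule set_integral_diff(2)[OF i i])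
        finally show ?case by simp
      qed
    qed
    then show "?A y \<longlonglongrightarrow> h x" by (rule Lim_transform_eventually[OF step_approx_identity[OF h x]])
  qed
  show ?thesis
  proof (cases "a < b")
    case True
    define m where "m = (a + b) / 2"
    have m: "a < m" "m < b" using True by (auto simp: m_def)
    have cl: "closure {a<..<b} = {a..b}" using True by simp
    have "h z = h m" if z: "z \<in> {a..b}" for z
    proof (rule continuous_constant_on_closure[of "{a<..<b}" h "h m" z])
      show "continuous_on (closure {a<..<b}) h" "z \<in> closure {a<..<b}" unfolding cl by (fact h, fact z)
      show "h u = h m" if "u \<in> {a<..<b}" for u using interior[OF _ _ m, of u] that by simp
    qed
    from this[OF x] this[OF y] show ?thesis by simp
  next
    case False
    then have "x = y" using x y by simp
    then show ?thesis by simp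
  qed
qed

text \<open>Derivatives of test functions are test functions, so \<open>h\<close> is constant by the
  previous result; a bump then shows that the constant is 0.\<close>

lemma du_Bois_Reymond_0:
  fixes h :: "real \<Rightarrow> real"
  assumes h: "continuous_on {a..b} h" and ab: "a < b"
    and 0: "\<And>\<theta>. test_fun {a<..<b} \<theta> \<Longrightarrow> (LINT t:{a..b}|lborel. h t * \<theta> t) = 0"
    and x: "x \<in> {a..b}"
  shows "h x = 0"
proof -
  have cst: "h x = h y" if "x \<in> {a..b}" "y \<in> {a..b}" for x y
    by (rule du_Bois_Reymond[OF h _ that]) (use 0 test_fun_pd[of _ _ "1::real"] in auto)
  define m where "m = (a + b) / 2"
  \<comment> \<open>A bump supported in the middle half of the interval and equal to 1 at the
    midpoint, where both affine arguments are exactly 1. As \<open>h\<close> is constant, the factor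
    \<open>h m\<close> makes the integrand nonnegative, so its vanishing integral forces it to
    vanish.\<close>
  define \<theta> where "\<theta> t = (h m) * (step ((4 / (b - a)) * (t - (a + (b - a) / 4))) * step ((4 / (b - a)) * ((b - (b - a) / 4) - t)))" for t
  have t: "test_fun {a<..<b} \<theta>"
  proof (rule test_funI[where K="{a + (b - a) / 4..b - (b - a) / 4}"])
    have "Ck k (\<lambda>t. step ((4 / (b - a)) * ((b - (b - a) / 4) - t)))" for k
      by (rule Ck_step_affine[OF Ck_cmult[OF Ck_diff[OF Ck_const Ck_id]]])
    then show "Ck k \<theta>" for k unfolding \<theta>_def by (intro Ck_cmult Ck_mult Ck_step_shift)
    show "\<theta> t = 0" if "t \<notin> {a + (b - a) / 4..b - (b - a) / 4}" for t
    proof (cases "t < a + (b - a) / 4")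
      case True
      then have "(4 / (b - a)) * (t - (a + (b - a) / 4)) \<le> 0" using ab by (intro mult_nonneg_nonpos) auto
      then show ?thesis by (simp add: \<theta>_def step_0)
    next
      case False
      then have "(4 / (b - a)) * ((b - (b - a) / 4) - t) \<le> 0" using ab that by (intro mult_nonneg_nonpos) auto
      then show ?thesis by (simp add: \<theta>_def step_0)
    qed
  qed (use ab in \<open>auto simp: field_simps\<close>)
  let ?k = "\<lambda>t. step ((4 / (b - a)) * (t - (a + (b - a) / 4))) * step ((4 / (b - a)) * ((b - (b - a) / 4) - t))"
  have c: "continuous_on {a..b} (\<lambda>t. h t * \<theta> t)"
    by (intro continuous_on_mult h continuous_on_subset[OF test_fun_continuous[OF t]]) auto
  have ge: "0 \<le> h t * \<theta> t" if "t \<in> {a..b}" for t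
  proof -
    have "h t = h m" using cst[OF that, of m] ab by (simp add: m_def)
    then have "h t * \<theta> t = (h m * h m) * ?k t" by (simp only: \<theta>_def mult.assoc)
    moreover have "0 \<le> (h m * h m) * ?k t" by (intro mult_nonneg_nonneg zero_le_square step_nonneg)
    ultimately show ?thesis by simp
  qed
  have i: "set_integrable lborel {a..b} (\<lambda>t. h t * \<theta> t)" by (rule borel_integrable_atLeastAtMost'[OF c])
  have "integral {a..b} (\<lambda>t. h t * \<theta> t) = 0"
    using set_borel_integral_eq_integral(2)[OF i] 0[OF t] by simp
  then have "\<forall>t\<in>{a..b}. h t * \<theta> t = 0"
    using integral_eq_0_iff[OF c ab ge] by simp
  then have "h m * \<theta> m = 0" using ab by (auto simp: m_def)
  moreover have a1: "(4 / (b - a)) * (m - (a + (b - a) / 4)) = 1" and a2: "(4 / (b - a)) * ((b - (b - a) / 4) - m) = 1"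
    using ab by (simp_all add: m_def field_simps)
  moreover have "\<theta> m = h m" unfolding \<theta>_def a1 a2 by (simp add: step_1)
  ultimately have "h m = 0" by simp
  then show ?thesis using cst[OF x, of m] ab by (simp add: m_def)
qed

section \<open>Calculus and cutoffs on the vertical interval\<close>

lemma vert_space: "z \<in> space (vert H) \<longleftrightarrow> z \<in> {-H<..<0}"
  by (simp add: vert_def space_restrict_space)

lemma vert_measurable_continuous:
  assumes "continuous_on {-H<..<0} b" shows "b \<in> borel_measurable (vert H)"
  using borel_measurable_continuous_on_restrict[OF assms] by (simp add: vert_def borel_measurable_restrict_space_iff cong: measurable_cong_sets)

lemma LINT_vert: "(LINT z|vert H. F z) = (LINT z:{-H<..<0}|lborel. F z)" for F :: "real \<Rightarrow> real"
  unfolding vert_def set_lebesgue_integral_def by (rule integral_restrict_space) simp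

lemma integrable_vert: "integrable (vert H) F \<longleftrightarrow> set_integrable lborel {-H<..<0} F" for F :: "real \<Rightarrow> real"
  unfolding vert_def set_integrable_def by (rule integrable_restrict_space) simp

lemma sqint_vert_bounded:
  fixes b :: "real \<Rightarrow> real"
  assumes "b \<in> borel_measurable (vert H)" "\<And>z. z \<in> {-H<..<0} \<Longrightarrow> \<bar>b z\<bar> \<le> B"
  shows "sqint (vert H) b"
proof -
  interpret finite_measure "vert H" by (rule finite_measure_vert)
  have "sqint (vert H) (\<lambda>z. B)" by (simp add: sqint_def)
  then show ?thesis
  proof (rule sqint_bound)
    show "AE x in vert H. norm (b x) \<le> norm B" using assms(2) order_trans[OF assms(2) abs_ge_self]
      by (intro AE_I2) (simp add: vert_space)
  qed fact
qed

text \<open>The modes are differentiable only inside the interval; continuity of the primitive up to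
  the ends takes the place of derivatives there.\<close>

lemma vert_FTC:
  assumes H: "0 < H"
    and d: "\<And>z. z \<in> {-H<..<0} \<Longrightarrow> (G has_real_derivative G' z) (at z)"
    and c: "continuous_on {-H..0} G"
    and m: "G' \<in> borel_measurable (vert H)" and B: "\<And>z. z \<in> {-H<..<0} \<Longrightarrow> \<bar>G' z\<bar> \<le> B"
  shows "(LINT z|vert H. G' z) = G 0 - G (-H)"
proof -
  interpret finite_measure "vert H" by (rule finite_measure_vert)
  have "integrable (vert H) G'"
    by (rule integrable_const_bound[of _ B]) (use B m in \<open>auto simp: vert_space\<close>)
  then have i: "set_integrable lborel {-H<..<0} G'" by (simp add: integrable_vert)
  have "(G' has_integral G 0 - G (-H)) {-H..0}"
    by (rule fundamental_theorem_of_calculus_interior[OF _ c])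
       (use H d in \<open>auto simp: has_real_derivative_iff_has_vector_derivative\<close>)
  then have "(G' has_integral G 0 - G (-H)) {-H<..<0}"
    by (simp add: has_integral_Icc_iff_Ioo)
  then show ?thesis unfolding LINT_vert set_borel_integral_eq_integral(2)[OF i] by (rule integral_unique)
qed

text \<open>0 within 1/(n+1) of either end, which keeps the support compact in the open interval,
  and 1 at distance at least 2/(n+1) from both ends.\<close>

definition layer :: "real \<Rightarrow> nat \<Rightarrow> real \<Rightarrow> real" where
  "layer H n z = step (real (Suc n) * (z - (-H + 1 / real (Suc n)))) * step ((- real (Suc n)) * (z - (- 1 / real (Suc n))))"

lemma Ck_layer: "Ck k (layer H n)"
  unfolding layer_def by (intro Ck_mult Ck_step_shift)

lemma test_fun_layer: "test_fun {-H<..<0} (layer H n)"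
proof (rule test_funI[where K="{-H + 1 / real (Suc n)..- 1 / real (Suc n)}"])
  show "layer H n z = 0" if "z \<notin> {-H + 1 / real (Suc n)..- 1 / real (Suc n)}" for z
  proof (cases "z < -H + 1 / real (Suc n)")
    case True
    then have "real (Suc n) * (z - (-H + 1 / real (Suc n))) \<le> 0" by (intro mult_nonneg_nonpos) auto
    then show ?thesis by (simp add: layer_def step_0)
  next
    case False
    then have "(- real (Suc n)) * (z - (- 1 / real (Suc n))) \<le> 0" using that by (intro mult_nonpos_nonneg) auto
    then show ?thesis by (simp add: layer_def step_0)
  qed
  have "0 < 1 / real (Suc n)" by simp
  then show "{-H + 1 / real (Suc n)..- 1 / real (Suc n)} \<subseteq> {-H<..<0}"
    by - (rule subsetI, simp only: atLeastAtMost_iff greaterThanLessThan_iff minus_divide_left[symmetric], linarith)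
qed (auto intro: Ck_layer)

lemma layer_bounds: "0 \<le> layer H n z" "layer H n z \<le> 1"
  unfolding layer_def using step_nonneg step_le_1 by (auto intro: mult_le_one)

lemma layer_deriv: "(layer H n has_real_derivative pd 1 (layer H n) z) (at z)"
  using Ck_layer[of 1 H n] by (intro pd_real_has_derivative) simp

lemma layer_deriv_support:
  assumes z: "z \<in> {-H<..<0}" and d: "2 / real (Suc n) < z + H" "2 / real (Suc n) < - z"
  shows "pd 1 (layer H n) z = 0"
proof (rule pd_real_deriv, rule has_field_derivative_transform_within_open[of "\<lambda>z. 1"])
  let ?S = "{-H + 2 / real (Suc n)<..<- 2 / real (Suc n)}"
  show "z \<in> ?S" using d by auto
  fix y assume y: "y \<in> ?S"
  have "1 / real (Suc n) \<le> y - (-H + 1 / real (Suc n))" "1 / real (Suc n) \<le> - (y - (- 1 / real (Suc n)))"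
    using y by (auto simp del: of_nat_Suc)
  then have a: "1 \<le> real (Suc n) * (y - (-H + 1 / real (Suc n)))" and "1 \<le> real (Suc n) * (- (y - (- 1 / real (Suc n))))"
    by (simp_all only: pos_divide_le_eq[OF of_nat_0_less_iff[THEN iffD2, OF zero_less_Suc]] mult.commute)
  then have b: "1 \<le> (- real (Suc n)) * (y - (- 1 / real (Suc n)))" by (simp only: mult_minus_left mult_minus_right)
  show "1 = layer H n y" by (simp only: layer_def step_1[OF a] step_1[OF b] mult_1_left)
qed auto

lemma layer_deriv_bound: "\<exists>B\<ge>0. \<forall>H n z. \<bar>pd 1 (layer H n) z\<bar> \<le> B * real (Suc n)"
proof -
  obtain B where B: "B \<ge> 0" "\<And>x. \<bar>pd 1 step x\<bar> \<le> B" using step_deriv_bounded by blast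
  have "\<bar>pd 1 (layer H n) z\<bar> \<le> (2 * B) * real (Suc n)" for H n z
  proof -
    let ?a = "real (Suc n) * (z - (-H + 1 / real (Suc n)))" and ?b = "(- real (Suc n)) * (z - (- 1 / real (Suc n)))"
    have "pd 1 (layer H n) z = (real (Suc n) * pd 1 step ?a) * step ?b + ((- real (Suc n)) * pd 1 step ?b) * step ?a"
      unfolding layer_def by (intro pd_real_deriv DERIV_mult step_deriv_affine)
    then have "\<bar>pd 1 (layer H n) z\<bar> \<le> \<bar>(real (Suc n) * pd 1 step ?a) * step ?b\<bar> + \<bar>((- real (Suc n)) * pd 1 step ?b) * step ?a\<bar>"
      by (simp only: abs_triangle_ineq)
    also have "\<dots> \<le> (real (Suc n) * B) * 1 + (real (Suc n) * B) * 1"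
      unfolding abs_mult abs_minus_cancel using B step_nonneg step_le_1
      by (intro add_mono mult_mono) (auto simp: abs_of_nonneg)
    finally show ?thesis by (simp add: algebra_simps)
  qed
  then show ?thesis using B(1) by (intro exI[of _ "2 * B"]) auto
qed

lemma layer_measurable [measurable]: "layer H n \<in> borel_measurable (vert H')" "pd 1 (layer H n) \<in> borel_measurable (vert H')"
  using test_fun_continuous[OF test_fun_layer[of H n]] test_fun_continuous[OF test_fun_pd[OF test_fun_layer[of H n], of 1]]
  by (auto intro!: vert_measurable_continuous intro: continuous_on_subset)

lemma eventually_layer_interior:
  assumes "z \<in> {-H<..<0}"
  shows "\<forall>\<^sub>F n in sequentially. 2 / real (Suc n) < z + H \<and> 2 / real (Suc n) < - z"
proof -
  have "(\<lambda>n. 2 / real (Suc n)) \<longlonglongrightarrow> 0" by (rule LIMSEQ_Suc[OF lim_const_over_n])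
  then show ?thesis using assms by (intro eventually_conj order_tendstoD) auto
qed

lemma layer_tendsto: assumes "z \<in> {-H<..<0}" shows "(\<lambda>n. layer H n z) \<longlonglongrightarrow> 1"
proof (rule tendsto_eventually)
  show "\<forall>\<^sub>F n in sequentially. layer H n z = 1"
    using eventually_layer_interior[OF assms]
  proof eventually_elim
    case (elim n)
    have "1 / real (Suc n) \<le> z - (-H + 1 / real (Suc n))" "1 / real (Suc n) \<le> - (z - (- 1 / real (Suc n)))"
      using elim by (auto simp del: of_nat_Suc)
    then have a: "1 \<le> real (Suc n) * (z - (-H + 1 / real (Suc n)))" and "1 \<le> real (Suc n) * (- (z - (- 1 / real (Suc n))))"
      by (simp_all only: pos_divide_le_eq[OF of_nat_0_less_iff[THEN iffD2, OF zero_less_Suc]] mult.commute)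
    then have b: "1 \<le> (- real (Suc n)) * (z - (- 1 / real (Suc n)))" by (simp only: mult_minus_left mult_minus_right)
    show ?case by (simp only: layer_def step_1[OF a] step_1[OF b] mult_1_left)
  qed
qed

lemma nrm_layer:
  fixes b :: "real \<Rightarrow> real"
  assumes b: "sqint (vert H) b"
  shows "sqint (vert H) (\<lambda>z. layer H n z * b z)" "(\<lambda>n. nrm (vert H) (\<lambda>z. layer H n z * b z - b z)) \<longlonglongrightarrow> 0"
proof -
  have bm [measurable]: "b \<in> borel_measurable (vert H)" using b by (simp add: sqint_def)
  have w: "sqint (vert H) (\<lambda>z. norm (b z))" using b by (auto simp: sqint_def)
  have m: "(\<lambda>z. layer H n z * b z) \<in> borel_measurable (vert H)" for n by measurable
  have lim: "AE z in vert H. (\<lambda>n. layer H n z * b z) \<longlonglongrightarrow> b z"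
    by (rule AE_I2) (use tendsto_mult[OF layer_tendsto tendsto_const] in \<open>fastforce simp: vert_space\<close>)
  have bd: "AE z in vert H. norm (layer H n z * b z) \<le> norm (b z)" for n
    using layer_bounds by (auto simp: abs_mult intro!: mult_left_le_one_le)
  note dc = nrm_dominated_convergence[where f="\<lambda>n z. layer H n z * b z" and g=b, OF m bm w lim bd]
  show "sqint (vert H) (\<lambda>z. layer H n z * b z)" by (rule dc(1))
  show "(\<lambda>n. nrm (vert H) (\<lambda>z. layer H n z * b z - b z)) \<longlonglongrightarrow> 0" by (rule dc(3))
qed

text \<open>The derivative of the cutoff is at most B (n+1) and lives within 2/(n+1) of the ends,
  where F is at most |C| times 2/(n+1). The product is therefore bounded uniformly in n and
  eventually 0 at each z, so it tends to 0 in L^2.\<close>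

lemma nrm_layer_deriv:
  fixes F :: "real \<Rightarrow> real"
  assumes m: "F \<in> borel_measurable (vert H)"
    and F: "\<And>z. z \<in> {-H<..<0} \<Longrightarrow> \<bar>F z\<bar> \<le> C * (z + H) \<and> \<bar>F z\<bar> \<le> C * (- z)"
  shows "sqint (vert H) (\<lambda>z. pd 1 (layer H n) z * F z)" "(\<lambda>n. nrm (vert H) (\<lambda>z. pd 1 (layer H n) z * F z)) \<longlonglongrightarrow> 0"
proof -
  interpret finite_measure "vert H" by (rule finite_measure_vert)
  note [measurable] = m
  obtain B where B: "B \<ge> 0" "\<And>H n z. \<bar>pd 1 (layer H n) z\<bar> \<le> B * real (Suc n)" using layer_deriv_bound by blast
  have le: "\<bar>pd 1 (layer H n) z * F z\<bar> \<le> B * \<bar>C\<bar> * 2" if z: "z \<in> {-H<..<0}" for n z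
  proof (cases "2 / real (Suc n) < z + H \<and> 2 / real (Suc n) < - z")
    case True
    then have "pd 1 (layer H n) z = 0" using layer_deriv_support[OF z] by blast
    then show ?thesis using B(1) by simp
  next
    case False
    have "\<bar>F z\<bar> \<le> \<bar>C\<bar> * (2 / real (Suc n))"
    proof (cases "z + H \<le> 2 / real (Suc n)")
      case True
      have "\<bar>F z\<bar> \<le> C * (z + H)" using F[OF z] by blast
      also have "\<dots> \<le> \<bar>C\<bar> * (z + H)" using z by (intro mult_right_mono) auto
      also have "\<dots> \<le> \<bar>C\<bar> * (2 / real (Suc n))" using True by (intro mult_left_mono) auto
      finally show ?thesis .
    next
      case False2: False
      have "\<bar>F z\<bar> \<le> C * (- z)" using F[OF z] by blast
      also have "\<dots> \<le> \<bar>C\<bar> * (- z)" using z by (intro mult_right_mono) auto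
      also have "\<dots> \<le> \<bar>C\<bar> * (2 / real (Suc n))" using False False2 by (intro mult_left_mono) auto
      finally show ?thesis .
    qed
    then have "\<bar>pd 1 (layer H n) z\<bar> * \<bar>F z\<bar> \<le> (B * real (Suc n)) * (\<bar>C\<bar> * (2 / real (Suc n)))"
      by (intro mult_mono B) (auto simp: B(1))
    then show ?thesis by (simp add: abs_mult del: of_nat_Suc)
  qed
  have w: "sqint (vert H) (\<lambda>z. B * \<bar>C\<bar> * 2)" by (simp add: sqint_def)
  have m': "(\<lambda>z. pd 1 (layer H n) z * F z) \<in> borel_measurable (vert H)" for n by measurable
  have lim: "AE z in vert H. (\<lambda>n. pd 1 (layer H n) z * F z) \<longlonglongrightarrow> 0"
  proof (rule AE_I2, rule tendsto_eventually)
    fix z assume "z \<in> space (vert H)"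
    then have z: "z \<in> {-H<..<0}" by (simp add: vert_space)
    show "\<forall>\<^sub>F n in sequentially. pd 1 (layer H n) z * F z = 0"
      using eventually_layer_interior[OF z] by eventually_elim (simp add: layer_deriv_support[OF z] del: of_nat_Suc)
  qed
  have bd: "AE z in vert H. norm (pd 1 (layer H n) z * F z) \<le> B * \<bar>C\<bar> * 2" for n
    by (rule AE_I2) (use le in \<open>simp add: vert_space\<close>)
  note dc = nrm_dominated_convergence[where f="\<lambda>n z. pd 1 (layer H n) z * F z" and g="\<lambda>z. 0", OF m' borel_measurable_const w lim bd]
  show "sqint (vert H) (\<lambda>z. pd 1 (layer H n) z * F z)" by (rule dc(1))
  show "(\<lambda>n. nrm (vert H) (\<lambda>z. pd 1 (layer H n) z * F z)) \<longlonglongrightarrow> 0" using dc(3) by simp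
qed

text \<open>This is where the boundary values of the vertical velocity enter.\<close>

lemma layer_deriv_boundary:
  fixes h b :: "real \<Rightarrow> real"
  assumes H: "0 < H" and h: "continuous_on {-H..0} h" "h (-H) = 0" "h 0 = 0"
    and b: "b \<in> borel_measurable (vert H)" "\<And>z. z \<in> {-H<..<0} \<Longrightarrow> \<bar>b z\<bar> \<le> C"
  shows "(\<lambda>n. LINT z|vert H. pd 1 (layer H n) z * b z * h z) \<longlonglongrightarrow> 0"
proof (rule LIMSEQ_I)
  fix e :: real assume e: "0 < e"
  interpret finite_measure "vert H" by (rule finite_measure_vert)
  obtain B where B: "B \<ge> 0" "\<And>H n z. \<bar>pd 1 (layer H n) z\<bar> \<le> B * real (Suc n)" using layer_deriv_bound by blast
  have hm [measurable]: "h \<in> borel_measurable (vert H)"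
    by (rule vert_measurable_continuous, rule continuous_on_subset[OF h(1)]) auto
  note [measurable] = b(1)
  \<comment> \<open>The 4 is the total width of the two layers in units of 1/(n+1); the added 1
    keeps \<open>A\<close> positive for the division below.\<close>
  define A where "A = B * \<bar>C\<bar> * 4 + 1"
  have A: "A > 0" using B(1) by (simp add: A_def add_nonneg_pos)
  define e' where "e' = e / (2 * A)"
  have e': "e' > 0" using e A by (simp add: e'_def)
  obtain \<delta>1 where \<delta>1: "\<delta>1 > 0" "\<And>z. z \<in> {-H..0} \<Longrightarrow> dist z (-H) < \<delta>1 \<Longrightarrow> dist (h z) (h (-H)) < e'"
    using h(1) e' H unfolding continuous_on_iff by (metis atLeastAtMost_iff less_eq_real_def neg_le_0_iff_le order_refl)
  obtain \<delta>2 where \<delta>2: "\<delta>2 > 0" "\<And>z. z \<in> {-H..0} \<Longrightarrow> dist z 0 < \<delta>2 \<Longrightarrow> dist (h z) (h 0) < e'"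
    using h(1) e' H unfolding continuous_on_iff by (metis atLeastAtMost_iff less_eq_real_def neg_le_0_iff_le order_refl)
  have "(\<lambda>n. 2 / real (Suc n)) \<longlonglongrightarrow> 0" by (rule LIMSEQ_Suc[OF lim_const_over_n])
  then have "\<forall>\<^sub>F n in sequentially. 2 / real (Suc n) < min \<delta>1 \<delta>2" using \<delta>1 \<delta>2 by (intro order_tendstoD) auto
  then obtain n0 where n0: "\<And>n. n \<ge> n0 \<Longrightarrow> 2 / real (Suc n) < min \<delta>1 \<delta>2" by (auto simp: eventually_sequentially)
  show "\<exists>n0. \<forall>n\<ge>n0. norm ((LINT z|vert H. pd 1 (layer H n) z * b z * h z) - 0) < e"
  proof (intro exI[of _ n0] allI impI)
    fix n assume n: "n \<ge> n0"
    let ?N = "real (Suc n)"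
    \<comment> \<open>The total length 4/(n+1) of the layers cancels the factor n+1 from the
      derivative of the cutoff. What remains is the smallness \<open>e'\<close> of h near the
      ends.\<close>
    let ?L = "{-H..-H + 2 / ?N} \<union> {- 2 / ?N..0}"
    have bd: "\<bar>pd 1 (layer H n) z * b z * h z\<bar> \<le> (B * ?N * \<bar>C\<bar> * e') * indicator ?L z" if z: "z \<in> {-H<..<0}" for z
    proof (cases "2 / ?N < z + H \<and> 2 / ?N < - z")
      case True
      then have "pd 1 (layer H n) z = 0" using layer_deriv_support[OF z] by blast
      then show ?thesis using B(1) e' by simp
    next
      case False
      then have zL: "z \<in> ?L" using z by auto
      have "\<bar>h z\<bar> \<le> e'"
      proof (cases "z + H \<le> 2 / ?N")
        case True
        then have "dist z (-H) < \<delta>1" using n0[OF n] z by (auto simp: dist_real_def)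
        then show ?thesis using \<delta>1(2)[of z] z h(2) by (auto simp: dist_real_def)
      next
        case False2: False
        then have "dist z 0 < \<delta>2" using n0[OF n] z False by (auto simp: dist_real_def)
        then show ?thesis using \<delta>2(2)[of z] z h(3) by (auto simp: dist_real_def)
      qed
      then have "\<bar>pd 1 (layer H n) z\<bar> * \<bar>b z\<bar> * \<bar>h z\<bar> \<le> (B * ?N) * \<bar>C\<bar> * e'"
        using b(2)[OF z] B(1) by (intro mult_mono B) (auto simp del: of_nat_Suc)
      then show ?thesis using zL by (simp add: abs_mult mult_ac)
    qed
    let ?L' = "?L \<inter> {-H<..<0}"
    have mL': "measure (vert H) ?L' \<le> 4 / ?N" and sL': "?L' \<in> sets (vert H)"
    proof -
      show "?L' \<in> sets (vert H)" by (auto simp: vert_def sets_restrict_space_iff)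
      have "measure (vert H) ?L' = measure lborel ?L'"
        unfolding vert_def by (rule measure_restrict_space) auto
      also have "\<dots> \<le> measure lborel ?L"
        by (rule measure_mono_fmeasurable) (auto intro!: fmeasurableI emeasure_bounded_finite)
      also have "\<dots> \<le> measure lborel {-H..-H + 2 / ?N} + measure lborel {- 2 / ?N..0}"
        by (rule measure_Un_le) auto
      also have "\<dots> = 4 / ?N" by simp
      finally show "measure (vert H) ?L' \<le> 4 / ?N" .
    qed
    have iL: "integrable (vert H) (\<lambda>z. (B * ?N * \<bar>C\<bar> * e') * indicator ?L' z)"
      using sL' by (intro integrable_mult_right) (simp add: integrable_indicator_iff emeasure_eq_measure)
    have bd': "AE z in vert H. norm (pd 1 (layer H n) z * b z * h z) \<le> (B * ?N * \<bar>C\<bar> * e') * indicator ?L' z"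
      by (rule AE_I2) (use bd in \<open>simp add: vert_space indicator_def\<close>)
    have "norm (LINT z|vert H. pd 1 (layer H n) z * b z * h z) \<le> (LINT z|vert H. (B * ?N * \<bar>C\<bar> * e') * indicator ?L' z)"
    proof (rule order_trans[OF integral_norm_bound integral_mono_AE[OF _ iL bd']])
      show "integrable (vert H) (\<lambda>z. norm (pd 1 (layer H n) z * b z * h z))"
        by (rule Bochner_Integration.integrable_bound[OF iL]) (use bd' in \<open>auto elim!: eventually_mono intro: order_trans[OF _ abs_ge_self]\<close>)
    qed
    also have "\<dots> = (B * ?N * \<bar>C\<bar> * e') * measure (vert H) ?L'"
      using sL' sets.sets_into_space[OF sL'] by (simp add: Int_absorb2 del: of_nat_Suc)
    also have "\<dots> \<le> (B * ?N * \<bar>C\<bar> * e') * (4 / ?N)" using B(1) e' by (intro mult_left_mono mL') (auto simp del: of_nat_Suc)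
    also have "\<dots> = B * \<bar>C\<bar> * 4 * e'" by (simp add: field_simps del: of_nat_Suc)
    also have "\<dots> \<le> A * e'" using e' by (simp add: A_def algebra_simps)
    also have "\<dots> = e / 2" using A by (simp add: e'_def)
    also have "\<dots> < e" using e by simp
    finally show "norm ((LINT z|vert H. pd 1 (layer H n) z * b z * h z) - 0) < e" by simp
  qed
qed

section \<open>Vertical modes\<close>

locale stratification =
  fixes H g N :: real and r dr :: "real \<Rightarrow> real" and c :: "nat \<Rightarrow> real" and f :: "nat \<Rightarrow> real \<Rightarrow> real"
  assumes pos: "0 < H" "0 < g" "0 < N"
    and density: "continuous_on {-H..0} r" "W1inf (-H) 0 r dr" "\<exists>m>0. \<forall>z\<in>{-H<..<0}. m \<le> r z"
    and buoyancy: "AE z in vert H. - g * dr z / r z = N\<^sup>2"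
    and modes: "modes H r N c f"
begin

text \<open>The rate of decay of the density with height: r' = - \<beta> r almost everywhere, by
  \<open>dr_eq\<close>.\<close>

definition \<beta> where "\<beta> = N\<^sup>2 / g"

lemma r_pos: "z \<in> {-H<..<0} \<Longrightarrow> 0 < r z"
  using density(3) less_le_trans by blast

lemma dr_eq: "AE z in vert H. dr z = - \<beta> * r z"
  using buoyancy AE_space
proof eventually_elim
  case (elim z)
  then have "0 < r z" using r_pos by (simp add: vert_space)
  then show ?case using elim(1) pos(2) by (simp add: \<beta>_def field_simps)
qed

lemma Ck_exp: "Ck k (\<lambda>z::real. exp (a * z))"
proof -
  have "((\<lambda>z. a ^ j * exp (a * z)) has_real_derivative a ^ Suc j * exp (a * x)) (at x)" for j x
    by (rule derivative_eq_intros refl)+ (simp add: mult_ac)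
  from Ck_realI[of "\<lambda>j z. a ^ j * exp (a * z)", OF this, of k 0] show ?thesis by simp
qed

lemma r_measurable [measurable]: "r \<in> borel_measurable (vert H)"
  by (rule vert_measurable_continuous, rule continuous_on_subset[OF density(1)]) auto

lemma LINT_vert_closed:
  assumes "\<And>z. z \<notin> {-H<..<0} \<Longrightarrow> F z = 0"
  shows "(LINT z:{-H..0}|lborel. F z) = (LINT z|vert H. F z :: real)"
  unfolding LINT_vert set_lebesgue_integral_def
  by (rule LINT_cong) (use assms in \<open>auto simp: indicator_def\<close>)

text \<open>exp(\<beta> z) is an integrating factor for the weak equation r' = - \<beta> r: testing
  with \<theta>(z) exp(\<beta> z), the derivative of the exponential cancels the right-hand side,
  and du Bois-Reymond applies to the product. So \<open>r\<close> is an exponential, hence smooth,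
  although only one bounded weak derivative was assumed.\<close>

lemma r_exp_const: "z \<in> {-H..0} \<Longrightarrow> r z * exp (\<beta> * z) = r 0"
proof -
  assume z: "z \<in> {-H..0}"
  let ?h = "\<lambda>z. r z * exp (\<beta> * z)"
  have "?h z = ?h 0"
  proof (rule du_Bois_Reymond[where a="-H" and b=0 and h="?h" and x=z and y=0])
    show "continuous_on {-H..0} ?h" by (intro continuous_intros density(1))
    fix \<theta> assume \<theta>: "test_fun {-H<..<0} \<theta>"
    define \<phi> where "\<phi> z = \<theta> z * exp (\<beta> * z)" for z
    have \<phi>: "test_fun {-H<..<0} \<phi>" unfolding \<phi>_def by (rule test_fun_mult_Ck[OF \<theta> Ck_exp])
    have de: "((\<lambda>z. exp (\<beta> * z)) has_real_derivative \<beta> * exp (\<beta> * z)) (at z)" for z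
      by (auto intro!: derivative_eq_intros)
    have "(\<phi> has_real_derivative pd 1 \<theta> z * exp (\<beta> * z) + (\<beta> * exp (\<beta> * z)) * \<theta> z) (at z)" for z
      unfolding \<phi>_def by (rule DERIV_mult[OF pd_real_has_derivative[OF test_fun_differentiable[OF \<theta>]] de])
    from pd_real_deriv[OF this] have p: "pd 1 \<phi> z = pd 1 \<theta> z * exp (\<beta> * z) + \<beta> * \<phi> z" for z
      by (simp add: \<phi>_def)
    obtain K where K: "compact K" "K \<subseteq> {-H<..<0}" "\<And>z. z \<notin> K \<Longrightarrow> \<theta> z = 0" using test_fun_support[OF \<theta>] by blast
    have p0: "pd 1 \<theta> z = 0" if "z \<notin> {-H<..<0}" for z
      by (rule pd_eq_0_outside[OF compact_imp_closed[OF K(1)] K(3)]) (use K(2) that in auto)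
    have W: "- (LINT z|vert H. r z * pd 1 \<phi> z) = (LINT z|vert H. dr z * \<phi> z)"
      using density(2) \<phi> by (simp add: W1inf_def Let_def D_def reg_def vert_def)
    have drm: "dr \<in> borel_measurable (vert H)" using density(2) by (simp add: W1inf_def Let_def vert_def)
    have \<phi>m [measurable]: "\<phi> \<in> borel_measurable (vert H)" "pd 1 \<theta> \<in> borel_measurable (vert H)"
      using test_fun_continuous[OF \<phi>] test_fun_continuous[OF test_fun_pd[OF \<theta>, of 1]]
      by (auto intro!: vert_measurable_continuous intro: continuous_on_subset)
    have "(LINT z|vert H. dr z * \<phi> z) = (LINT z|vert H. - \<beta> * (r z * \<phi> z))"
      by (rule integral_cong_AE) (use drm dr_eq in \<open>auto elim!: eventually_mono\<close>)
    also have "\<dots> = - \<beta> * (LINT z|vert H. r z * \<phi> z)" by (rule integral_mult_right_zero)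
    finally have 1: "(LINT z|vert H. r z * pd 1 \<phi> z) = \<beta> * (LINT z|vert H. r z * \<phi> z)" using W by simp
    have bdd: "integrable (vert H) (\<lambda>z. r z * k z)" if "continuous_on UNIV k" for k
    proof -
      have "set_integrable lborel {-H..0} (\<lambda>z. r z * k z)"
        by (intro borel_integrable_atLeastAtMost' continuous_on_mult density(1) continuous_on_subset[OF that]) auto
      then have "set_integrable lborel {-H<..<0} (\<lambda>z. r z * k z)" by (rule set_integrable_subset) auto
      then show ?thesis by (simp add: integrable_vert)
    qed
    have ce: "continuous_on UNIV (\<lambda>z. pd 1 \<theta> z * exp (\<beta> * z))"
      by (intro continuous_intros test_fun_continuous[OF test_fun_pd[OF \<theta>]]) auto
    have "(LINT z|vert H. r z * pd 1 \<phi> z) = (LINT z|vert H. r z * (pd 1 \<theta> z * exp (\<beta> * z)) + \<beta> * (r z * \<phi> z))"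
      by (simp only: p distrib_left mult_ac)
    also have "\<dots> = (LINT z|vert H. r z * (pd 1 \<theta> z * exp (\<beta> * z))) + \<beta> * (LINT z|vert H. r z * \<phi> z)"
      using bdd[OF ce] bdd[OF test_fun_continuous[OF \<phi>]] by simp
    finally have 2: "(LINT z|vert H. r z * (pd 1 \<theta> z * exp (\<beta> * z))) = 0" using 1 by simp
    have "(LINT z:{-H..0}|lborel. ?h z * pd 1 \<theta> z) = (LINT z|vert H. ?h z * pd 1 \<theta> z)"
      by (rule LINT_vert_closed) (simp add: p0)
    also have "\<dots> = (LINT z|vert H. r z * (pd 1 \<theta> z * exp (\<beta> * z)))" by (simp only: mult_ac)
    finally show "(LINT z:{-H..0}|lborel. ?h z * pd 1 \<theta> z) = 0" using 2 by simp
  qed (use z pos in auto)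
  then show ?thesis by simp
qed

lemma r_eq: "z \<in> {-H..0} \<Longrightarrow> r z = r 0 * exp (- \<beta> * z)"
  using r_exp_const[of z] by (simp add: exp_minus field_simps)

lemma r_deriv: "z \<in> {-H<..<0} \<Longrightarrow> (r has_real_derivative - \<beta> * r z) (at z)"
proof -
  assume z: "z \<in> {-H<..<0}"
  have "((\<lambda>z. r 0 * exp (- \<beta> * z)) has_real_derivative r 0 * (- \<beta> * exp (- \<beta> * z))) (at z)"
    by (rule derivative_eq_intros refl | simp)+
  then have "(r has_real_derivative r 0 * (- \<beta> * exp (- \<beta> * z))) (at z)"
  proof (rule has_field_derivative_transform_within_open[of _ _ _ "{-H<..<0}"])
    show "r 0 * exp (- \<beta> * y) = r y" if "y \<in> {-H<..<0}" for y
      by (rule r_eq[symmetric]) (use that in auto)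
  qed (use z in auto)
  then show ?thesis using r_eq[of z] z by (simp add: mult_ac)
qed

lemma r_powers_deriv:
  "z \<in> {-H<..<0} \<Longrightarrow> ((\<lambda>z. (- \<beta>) ^ j * r z) has_real_derivative (- \<beta>) ^ Suc j * r z) (at z)"
  by (rule DERIV_cong[OF DERIV_cmult[OF r_deriv]]) auto

lemma r_bounds: "\<exists>m M. 0 < m \<and> (\<forall>z\<in>{-H<..<0}. m \<le> r z \<and> r z \<le> M)"
proof -
  obtain m where m: "m > 0" "\<forall>z\<in>{-H<..<0}. m \<le> r z" using density(3) by blast
  have "compact (r ` {-H..0})" by (rule compact_continuous_image[OF density(1)]) simp
  then obtain M where M: "\<forall>y\<in>r ` {-H..0}. norm y \<le> M" using compact_imp_bounded bounded_iff by metis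
  have "r z \<le> M" if "z \<in> {-H<..<0}" for z
  proof -
    have "r z \<in> r ` {-H..0}" using that by (intro imageI) auto
    with M have "norm (r z) \<le> M" by blast
    then show ?thesis by simp
  qed
  with m show ?thesis by blast
qed

lemma c_pos: "1 \<le> n \<Longrightarrow> 0 < c n"
  using modes by (simp add: modes_def)

lemma SL: "1 \<le> n \<Longrightarrow> sturm_liouville H r N (c n) (f n)"
  using modes by (simp add: modes_def)

lemma f_continuous: "1 \<le> n \<Longrightarrow> continuous_on {-H..0} (f n)" "1 \<le> n \<Longrightarrow> f n (-H) = 0" "1 \<le> n \<Longrightarrow> f n 0 = 0"
  using SL by (auto simp: sturm_liouville_def)

lemma f_deriv: "1 \<le> n \<Longrightarrow> z \<in> {-H<..<0} \<Longrightarrow> (f n has_real_derivative deriv (f n) z) (at z)"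
  using SL[of n] by (auto simp: sturm_liouville_def DERIV_deriv_iff_real_differentiable)

lemma rf_deriv:
  assumes "1 \<le> n" "z \<in> {-H<..<0}"
  shows "((\<lambda>y. r y * deriv (f n) y) has_real_derivative - (N\<^sup>2 / (c n)\<^sup>2) * (r z * f n z)) (at z)"
proof -
  have "((\<lambda>y. r y * deriv (f n) y) has_real_derivative deriv (\<lambda>y. r y * deriv (f n) y) z) (at z)"
    using SL[OF assms(1)] assms(2) by (auto simp: sturm_liouville_def DERIV_deriv_iff_real_differentiable)
  moreover have "deriv (\<lambda>y. r y * deriv (f n) y) z = - (N\<^sup>2 / (c n)\<^sup>2) * (r z * f n z)"
  proof -
    have "deriv (\<lambda>y. r y * deriv (f n) y) z + r z * N\<^sup>2 / (c n)\<^sup>2 * f n z = 0"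
      using SL[OF assms(1)] assms(2) by (auto simp: sturm_liouville_def)
    then have "deriv (\<lambda>y. r y * deriv (f n) y) z = - (r z * N\<^sup>2 / (c n)\<^sup>2 * f n z)" by linarith
    then show ?thesis by simp
  qed
  ultimately show ?thesis by simp
qed

lemma f_deriv2:
  assumes "1 \<le> n" "z \<in> {-H<..<0}"
  shows "(deriv (f n) has_real_derivative \<beta> * deriv (f n) z - (N\<^sup>2 / (c n)\<^sup>2) * f n z) (at z)"
proof -
  have r0: "r z \<noteq> 0" using r_pos[OF assms(2)] by simp
  have "((\<lambda>y. r y * deriv (f n) y / r y) has_real_derivative
      ((- (N\<^sup>2 / (c n)\<^sup>2) * (r z * f n z)) * r z - (r z * deriv (f n) z) * (- \<beta> * r z)) / (r z * r z)) (at z)"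
    by (rule DERIV_divide[OF rf_deriv[OF assms] r_deriv[OF assms(2)] r0])
  then have "(deriv (f n) has_real_derivative
      ((- (N\<^sup>2 / (c n)\<^sup>2) * (r z * f n z)) * r z - (r z * deriv (f n) z) * (- \<beta> * r z)) / (r z * r z)) (at z)"
  proof (rule has_field_derivative_transform_within_open[of _ _ _ "{-H<..<0}"])
    show "r y * deriv (f n) y / r y = deriv (f n) y" if "y \<in> {-H<..<0}" for y using r_pos[OF that] by simp
  qed (use assms in auto)
  moreover have "((- (N\<^sup>2 / (c n)\<^sup>2) * (r z * f n z)) * r z - (r z * deriv (f n) z) * (- \<beta> * r z)) / (r z * r z)
     = \<beta> * deriv (f n) z - (N\<^sup>2 / (c n)\<^sup>2) * f n z"
  proof -
    have "(- (N\<^sup>2 / (c n)\<^sup>2) * (r z * f n z)) * r z - (r z * deriv (f n) z) * (- \<beta> * r z)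
      = (\<beta> * deriv (f n) z - (N\<^sup>2 / (c n)\<^sup>2) * f n z) * (r z * r z)"
      by (simp add: algebra_simps)
    then show ?thesis using r0 by simp
  qed
  ultimately show ?thesis by simp
qed

text \<open>The successive derivatives of a mode. With constant \<beta> the Sturm-Liouville problem
  reads f'' = \<beta> f' - (N^2/c^2) f, and differentiating this equation gives the recursion. It
  makes the mode smooth inside the interval, as a factor of a test function must be.\<close>

fun fseq :: "nat \<Rightarrow> nat \<Rightarrow> real \<Rightarrow> real" where
  "fseq n 0 = f n"
| "fseq n (Suc 0) = deriv (f n)"
| "fseq n (Suc (Suc j)) = (\<lambda>z. \<beta> * fseq n (Suc j) z - (N\<^sup>2 / (c n)\<^sup>2) * fseq n j z)"

lemma fseq_deriv:
  assumes "1 \<le> n" "z \<in> {-H<..<0}"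
  shows "(fseq n j has_real_derivative fseq n (Suc j) z) (at z)"
proof -
  have "(fseq n j has_real_derivative fseq n (Suc j) z) (at z) \<and> (fseq n (Suc j) has_real_derivative fseq n (Suc (Suc j)) z) (at z)"
  proof (induction j)
    case 0
    then show ?case using f_deriv[OF assms] f_deriv2[OF assms] by simp
  next
    case (Suc j)
    then have "((\<lambda>z. \<beta> * fseq n (Suc j) z - (N\<^sup>2 / (c n)\<^sup>2) * fseq n j z) has_real_derivative
       \<beta> * fseq n (Suc (Suc j)) z - (N\<^sup>2 / (c n)\<^sup>2) * fseq n (Suc j) z) (at z)"
      by (intro DERIV_diff DERIV_cmult) auto
    with Suc show ?case by simp
  qed
  then show ?thesis by simp
qed

lemma f_bounded: "1 \<le> n \<Longrightarrow> \<exists>B. \<forall>z\<in>{-H..0}. \<bar>f n z\<bar> \<le> B"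
proof -
  assume n: "1 \<le> n"
  have "compact (f n ` {-H..0})" by (rule compact_continuous_image[OF f_continuous(1)[OF n]]) simp
  then obtain M where "\<forall>y\<in>f n ` {-H..0}. norm y \<le> M" using compact_imp_bounded bounded_iff by metis
  then show ?thesis by (intro exI[of _ M]) auto
qed

text \<open>The definition of a mode controls f up to the ends but f' only inside. The bound comes
  from r f': its derivative is a multiple of r f, which is bounded, so r f' is Lipschitz on a
  bounded interval; then r is divided out by its positive lower bound.\<close>

lemma f_deriv_bounded:
  assumes n: "1 \<le> n"
  shows "\<exists>B\<ge>0. \<forall>z\<in>{-H<..<0}. \<bar>deriv (f n) z\<bar> \<le> B"
proof -
  obtain m M where m: "0 < m" "\<And>z. z \<in> {-H<..<0} \<Longrightarrow> m \<le> r z" "\<And>z. z \<in> {-H<..<0} \<Longrightarrow> r z \<le> M"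
    using r_bounds by blast
  obtain B where B: "\<And>z. z \<in> {-H..0} \<Longrightarrow> \<bar>f n z\<bar> \<le> B" using f_bounded[OF n] by blast
  let ?q = "\<lambda>y. r y * deriv (f n) y"
  let ?z = "-H / 2"
  have z0: "?z \<in> {-H<..<0}" using pos by auto
  define L where "L = (N\<^sup>2 / (c n)\<^sup>2) * (M * B)"
  have M0: "0 \<le> M" using m(1) m(2)[OF z0] m(3)[OF z0] by linarith
  have B0: "0 \<le> B" using B[of 0] pos abs_ge_zero order_trans by fastforce
  have q: "\<bar>?q z - ?q ?z\<bar> \<le> L * \<bar>z - ?z\<bar>" if z: "z \<in> {-H<..<0}" for z
  proof -
    have "norm (?q z - ?q ?z) \<le> L * norm (z - ?z)"
    proof (rule field_differentiable_bound[of "{-H<..<0}" ?q "\<lambda>z. - (N\<^sup>2 / (c n)\<^sup>2) * (r z * f n z)"])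
      show "(?q has_field_derivative - (N\<^sup>2 / (c n)\<^sup>2) * (r y * f n y)) (at y within {-H<..<0})" if "y \<in> {-H<..<0}" for y
        by (rule has_field_derivative_at_within[OF rf_deriv[OF n that]])
      show "norm (- (N\<^sup>2 / (c n)\<^sup>2) * (r y * f n y)) \<le> L" if y: "y \<in> {-H<..<0}" for y
      proof -
        have "\<bar>r y\<bar> * \<bar>f n y\<bar> \<le> M * B" using m(3)[OF y] r_pos[OF y] B[of y] y M0 by (intro mult_mono) auto
        then show ?thesis unfolding L_def by (simp add: abs_mult divide_right_mono mult_left_mono)
      qed
    qed (use z z0 in auto)
    then show ?thesis by simp
  qed
  have L0: "0 \<le> L" using M0 B0 by (simp add: L_def)
  define Q where "Q = L * H + \<bar>?q ?z\<bar>"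
  have Q: "\<bar>?q z\<bar> \<le> Q" if z: "z \<in> {-H<..<0}" for z
  proof -
    have "L * \<bar>z - ?z\<bar> \<le> L * H" using z L0 by (intro mult_left_mono) auto
    then show ?thesis using q[OF z] unfolding Q_def by linarith
  qed
  have "\<bar>deriv (f n) z\<bar> \<le> Q / m" if z: "z \<in> {-H<..<0}" for z
  proof -
    have "m * \<bar>deriv (f n) z\<bar> \<le> r z * \<bar>deriv (f n) z\<bar>" using m(2)[OF z] by (intro mult_right_mono) auto
    also have "\<dots> \<le> Q" using Q[OF z] r_pos[OF z] by (simp add: abs_mult)
    finally show ?thesis using m(1) by (simp add: field_simps)
  qed
  moreover have "0 \<le> Q / m" using m(1) Q[OF z0] by (simp add: Q_def L0 pos(1) less_imp_le)
  ultimately show ?thesis by blast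
qed

text \<open>Zero boundary values and a bounded derivative, through the mean value theorem. This
  linear vanishing is what absorbs the derivative of \<open>layer\<close>.\<close>

lemma f_boundary:
  assumes n: "1 \<le> n"
  shows "\<exists>B\<ge>0. \<forall>z\<in>{-H<..<0}. \<bar>f n z\<bar> \<le> B * (z + H) \<and> \<bar>f n z\<bar> \<le> B * (- z)"
proof -
  obtain B where B: "B \<ge> 0" "\<And>z. z \<in> {-H<..<0} \<Longrightarrow> \<bar>deriv (f n) z\<bar> \<le> B" using f_deriv_bounded[OF n] by blast
  have d: "(f n has_derivative (*) (deriv (f n) x)) (at x)" if "-H < x" "x < 0" for x
    using f_deriv[OF n, of x] that by (simp add: has_field_derivative_def)
  have "\<bar>f n z\<bar> \<le> B * (z + H) \<and> \<bar>f n z\<bar> \<le> B * (- z)" if z: "z \<in> {-H<..<0}" for z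
  proof
    have lz: "-H < z" "z < 0" using z by auto
    obtain \<xi> where \<xi>: "-H < \<xi>" "\<xi> < z" "f n z - f n (-H) = deriv (f n) \<xi> * (z - (-H))"
    proof (rule mvt[of "-H" z "f n" "\<lambda>x. (*) (deriv (f n) x)"])
      show "continuous_on {-H..z} (f n)" using f_continuous(1)[OF n] by (rule continuous_on_subset) (use z in auto)
    qed (use lz d in auto)
    then show "\<bar>f n z\<bar> \<le> B * (z + H)"
      using B(2)[of \<xi>] lz f_continuous(2)[OF n] by (simp add: abs_mult mult_right_mono)
    obtain \<xi> where \<xi>: "z < \<xi>" "\<xi> < 0" "f n 0 - f n z = deriv (f n) \<xi> * (0 - z)"
    proof (rule mvt[of z 0 "f n" "\<lambda>x. (*) (deriv (f n) x)"])
      show "continuous_on {z..0} (f n)" using f_continuous(1)[OF n] by (rule continuous_on_subset) (use z in auto)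
    qed (use lz d in auto)
    then have "f n z = deriv (f n) \<xi> * z" using f_continuous(3)[OF n] by simp
    then show "\<bar>f n z\<bar> \<le> B * (- z)"
      using B(2)[of \<xi>] \<xi>(1,2) lz by (simp add: abs_mult mult_right_mono)
  qed
  then show ?thesis using B(1) by blast
qed

lemma f_measurable [measurable]: "1 \<le> n \<Longrightarrow> f n \<in> borel_measurable (vert H)"
  by (rule vert_measurable_continuous, rule continuous_on_subset[OF f_continuous(1)]) auto

lemma df_measurable [measurable]: "1 \<le> n \<Longrightarrow> deriv (f n) \<in> borel_measurable (vert H)"
  by (intro vert_measurable_continuous continuous_at_imp_continuous_on ballI DERIV_isCont[OF f_deriv2])

section \<open>The functions g_n and their orthonormality\<close>

abbreviation "gm \<equiv> g_mode H r c f"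

lemma gm_0: "gm 0 z = (LINT y|vert H. 1 / r y) powr (- 1 / 2) / r z"
  and gm_pos: "1 \<le> n \<Longrightarrow> gm n z = c n * deriv (f n) z"
  by (simp_all add: g_mode_def)

lemma gm_measurable [measurable]: "gm n \<in> borel_measurable (vert H)"
proof (cases "n = 0")
  case True
  have "gm n = (\<lambda>z. (LINT y|vert H. 1 / r y) powr (- 1 / 2) / r z)" using True gm_0 by auto
  then show ?thesis by simp
next
  case False
  then have n: "1 \<le> n" by simp
  then have "gm n = (\<lambda>z. c n * deriv (f n) z)" using gm_pos by auto
  then show ?thesis using df_measurable[OF n] by simp
qed

lemma inv_r_bounded: "\<exists>B. \<forall>z\<in>{-H<..<0}. \<bar>1 / r z\<bar> \<le> B"
proof -
  obtain m where m: "m > 0" "\<And>z. z \<in> {-H<..<0} \<Longrightarrow> m \<le> r z" using density(3) by blast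
  then have "\<bar>1 / r z\<bar> \<le> 1 / m" if "z \<in> {-H<..<0}" for z using that r_pos[OF that] by (simp add: frac_le)
  then show ?thesis by blast
qed

lemma r_bounded: "\<exists>B. \<forall>z\<in>{-H<..<0}. \<bar>r z\<bar> \<le> B"
  using r_bounds r_pos by (metis abs_of_pos)

lemma gm_bounded: "\<exists>B. \<forall>z\<in>{-H<..<0}. \<bar>gm n z\<bar> \<le> B"
proof (cases "n = 0")
  case True
  obtain B where "\<forall>z\<in>{-H<..<0}. \<bar>1 / r z\<bar> \<le> B" using inv_r_bounded by blast
  then have "\<bar>gm n z\<bar> \<le> \<bar>(LINT y|vert H. 1 / r y) powr (- 1 / 2)\<bar> * B" if "z \<in> {-H<..<0}" for z
    using that mult_left_mono[of "\<bar>1 / r z\<bar>" B "\<bar>(LINT y|vert H. 1 / r y) powr (- 1 / 2)\<bar>"] True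
    by (simp add: gm_0 abs_mult)
  then show ?thesis by blast
next
  case False
  then obtain B where "\<forall>z\<in>{-H<..<0}. \<bar>deriv (f n) z\<bar> \<le> B" using f_deriv_bounded[of n] by auto
  then have "\<bar>gm n z\<bar> \<le> \<bar>c n\<bar> * B" if "z \<in> {-H<..<0}" for z
    using that False by (auto simp: gm_pos abs_mult mult_left_mono)
  then show ?thesis by blast
qed

lemma bounded_mult:
  assumes "\<exists>B. \<forall>z\<in>{-H<..<0}. \<bar>a z\<bar> \<le> B" "\<exists>B. \<forall>z\<in>{-H<..<0}. \<bar>b z\<bar> \<le> B"
  shows "\<exists>B. \<forall>z\<in>{-H<..<0}. \<bar>a z * b z :: real\<bar> \<le> B"
proof -
  obtain A where A: "\<forall>z\<in>{-H<..<0}. \<bar>a z\<bar> \<le> A" using assms(1) by blast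
  obtain B where B: "\<forall>z\<in>{-H<..<0}. \<bar>b z\<bar> \<le> B" using assms(2) by blast
  have "\<bar>a z * b z\<bar> \<le> \<bar>A\<bar> * \<bar>B\<bar>" if "z \<in> {-H<..<0}" for z
    unfolding abs_mult using A B that by (intro mult_mono) (auto intro: order_trans[OF _ abs_ge_self])
  then show ?thesis by blast
qed

lemma f_bounded': "1 \<le> n \<Longrightarrow> \<exists>B. \<forall>z\<in>{-H<..<0}. \<bar>f n z\<bar> \<le> B"
  using f_bounded[of n] by fastforce

lemma const_bounded: "\<exists>B. \<forall>z\<in>{-H<..<0}. \<bar>a :: real\<bar> \<le> B"
  by blast

lemma sqint_vertI:
  fixes b :: "real \<Rightarrow> real"
  assumes "b \<in> borel_measurable (vert H)" "\<exists>B. \<forall>z\<in>{-H<..<0}. \<bar>b z\<bar> \<le> B"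
  shows "sqint (vert H) b"
proof -
  obtain B where "\<And>z. z \<in> {-H<..<0} \<Longrightarrow> \<bar>b z\<bar> \<le> B" using assms(2) by blast
  then show ?thesis by (rule sqint_vert_bounded[OF assms(1)])
qed

lemma integrable_vertI:
  assumes "b \<in> borel_measurable (vert H)" "\<exists>B. \<forall>z\<in>{-H<..<0}. \<bar>b z\<bar> \<le> B"
  shows "integrable (vert H) (b :: real \<Rightarrow> real)"
proof -
  interpret finite_measure "vert H" by (rule finite_measure_vert)
  obtain B where "\<forall>z\<in>{-H<..<0}. \<bar>b z\<bar> \<le> B" using assms(2) by blast
  then show ?thesis by (intro integrable_const_bound[of _ B] assms(1)) (auto simp: vert_space)
qed

lemma f_orthonormal:
  assumes "1 \<le> m" "1 \<le> n"
  shows "(LINT z|vert H. r z * N\<^sup>2 * (f m z * f n z)) = (if m = n then 1 else 0)"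
proof -
  have "(LINT z|Nonnegative_Lebesgue_Integration.density (vert H) (\<lambda>z. ennreal (r z * N\<^sup>2)). f m z * f n z) = (if m = n then 1 else 0)"
    using modes assms by (simp add: modes_def orthonormal_basis_def)
  moreover have "(LINT z|Nonnegative_Lebesgue_Integration.density (vert H) (\<lambda>z. ennreal (r z * N\<^sup>2)). f m z * f n z)
     = (LINT z|vert H. (r z * N\<^sup>2) *\<^sub>R (f m z * f n z))"
  proof (rule integral_density)
    show "AE z in vert H. 0 \<le> r z * N\<^sup>2" by (rule AE_I2) (use r_pos in \<open>fastforce simp: vert_space\<close>)
  qed (use assms in measurable)
  ultimately show ?thesis by simp
qed

text \<open>The derivative of r f_m' f_n is integrated over the interval. By the Sturm-Liouville
  equation for f_m one of its two terms is a multiple of r f_m f_n, whose integral is known; the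
  boundary terms vanish, because f_n vanishes at the ends while r f_m' stays bounded.\<close>

lemma df_orthogonal:
  assumes m: "1 \<le> m" and n: "1 \<le> n"
  shows "(LINT z|vert H. r z * (deriv (f m) z * deriv (f n) z)) = (if m = n then 1 / (c m)\<^sup>2 else 0)"
proof -
  note [measurable] = f_measurable[OF m] f_measurable[OF n] df_measurable[OF m] df_measurable[OF n]
  \<comment> \<open>\<open>deriv\<close> carries no information at the end points; with the value 0
    there, G is continuous on the closed interval.\<close>
  define G where "G z = (if z \<in> {-H<..<0} then r z * deriv (f m) z * f n z else 0)" for z
  define G' where "G' z = - (N\<^sup>2 / (c m)\<^sup>2) * (r z * f m z) * f n z + r z * deriv (f m) z * deriv (f n) z" for z
  have dfb: "\<exists>B. \<forall>z\<in>{-H<..<0}. \<bar>deriv (f k) z\<bar> \<le> B" if "1 \<le> k" for k using f_deriv_bounded[OF that] by blast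
  have dG: "(G has_real_derivative G' z) (at z)" if z: "z \<in> {-H<..<0}" for z
  proof -
    have "((\<lambda>z. r z * deriv (f m) z * f n z) has_real_derivative G' z) (at z)"
      unfolding G'_def by (rule DERIV_cong[OF DERIV_mult[OF rf_deriv[OF m z] f_deriv[OF n z]]]) (simp add: mult_ac)
    then show ?thesis
      by (rule has_field_derivative_transform_within_open[of _ _ _ "{-H<..<0}"]) (use z in \<open>auto simp: G_def\<close>)
  qed
  obtain A where A: "\<And>z. z \<in> {-H<..<0} \<Longrightarrow> \<bar>r z * deriv (f m) z\<bar> \<le> A" using bounded_mult[OF r_bounded dfb[OF m]] by blast
  obtain B where B: "B \<ge> 0" "\<And>z. z \<in> {-H<..<0} \<Longrightarrow> \<bar>f n z\<bar> \<le> B * (z + H) \<and> \<bar>f n z\<bar> \<le> B * (- z)" using f_boundary[OF n] by blast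
  have bnd: "\<bar>G z\<bar> \<le> \<bar>A\<bar> * (B * (z + H))" "\<bar>G z\<bar> \<le> \<bar>A\<bar> * (B * (- z))" if "z \<in> {-H..0}" for z
  proof -
    have "\<bar>r z * deriv (f m) z\<bar> * \<bar>f n z\<bar> \<le> \<bar>A\<bar> * (B * (z + H)) \<and> \<bar>r z * deriv (f m) z\<bar> * \<bar>f n z\<bar> \<le> \<bar>A\<bar> * (B * (- z))"
      if z: "z \<in> {-H<..<0}"
      using B(2)[OF z] order_trans[OF A[OF z] abs_ge_self] by (intro conjI mult_mono) auto
    then show "\<bar>G z\<bar> \<le> \<bar>A\<bar> * (B * (z + H))" "\<bar>G z\<bar> \<le> \<bar>A\<bar> * (B * (- z))"
      using that B(1) by (auto simp: G_def abs_mult)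
  qed
  have cG: "continuous_on {-H..0} G"
    unfolding continuous_on_def
  proof
    fix x assume x: "x \<in> {-H..0}"
    consider "x = -H" | "x = 0" | "x \<in> {-H<..<0}" using x by force
    then show "(G \<longlongrightarrow> G x) (at x within {-H..0})"
    proof cases
      case 1
      have l: "((\<lambda>z. \<bar>A\<bar> * (B * (z + H))) \<longlongrightarrow> \<bar>A\<bar> * (B * (-H + H))) (at x within {-H..0})"
        unfolding 1 by (intro tendsto_intros)
      have "(G \<longlongrightarrow> 0) (at x within {-H..0})"
        by (rule Lim_null_comparison[where g="\<lambda>z. \<bar>A\<bar> * (B * (z + H))"])
           (use l bnd in \<open>auto simp: eventually_at_filter intro!: always_eventually\<close>)
      then show ?thesis using 1 by (simp add: G_def)
    next
      case 2
      have l: "((\<lambda>z. \<bar>A\<bar> * (B * (- z))) \<longlongrightarrow> \<bar>A\<bar> * (B * (- 0))) (at x within {-H..0})"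
        unfolding 2 by (intro tendsto_intros)
      have "(G \<longlongrightarrow> 0) (at x within {-H..0})"
        by (rule Lim_null_comparison[where g="\<lambda>z. \<bar>A\<bar> * (B * (- z))"])
           (use l bnd in \<open>auto simp: eventually_at_filter intro!: always_eventually\<close>)
      then show ?thesis using 2 by (simp add: G_def)
    next
      case 3
      then have "isCont G x" using dG DERIV_isCont by blast
      then show ?thesis using continuous_at_imp_continuous_at_within continuous_within by blast
    qed
  qed
  note ib = integrable_vertI[OF _ bounded_mult[OF r_bounded bounded_mult[OF f_bounded'[OF m] f_bounded'[OF n]]]]
    integrable_vertI[OF _ bounded_mult[OF r_bounded bounded_mult[OF dfb[OF m] dfb[OF n]]]]
  have i1: "integrable (vert H) (\<lambda>z. r z * (f m z * f n z))" by (rule ib(1)) measurable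
  have i2: "integrable (vert H) (\<lambda>z. r z * (deriv (f m) z * deriv (f n) z))" by (rule ib(2)) measurable
  have G'_eq: "G' z = (- (N\<^sup>2 / (c m)\<^sup>2)) * (r z * (f m z * f n z)) + r z * (deriv (f m) z * deriv (f n) z)" for z
    by (simp add: G'_def mult_ac)
  have G'b: "\<exists>B. \<forall>z\<in>{-H<..<0}. \<bar>G' z\<bar> \<le> B"
  proof -
    obtain P where P: "\<And>z. z \<in> {-H<..<0} \<Longrightarrow> \<bar>(- (N\<^sup>2 / (c m)\<^sup>2)) * (r z * (f m z * f n z))\<bar> \<le> P"
      using bounded_mult[OF const_bounded bounded_mult[OF r_bounded bounded_mult[OF f_bounded'[OF m] f_bounded'[OF n]]]] by blast
    obtain Q where Q: "\<And>z. z \<in> {-H<..<0} \<Longrightarrow> \<bar>r z * (deriv (f m) z * deriv (f n) z)\<bar> \<le> Q"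
      using bounded_mult[OF r_bounded bounded_mult[OF dfb[OF m] dfb[OF n]]] by blast
    have "\<bar>G' z\<bar> \<le> P + Q" if "z \<in> {-H<..<0}" for z
      unfolding G'_eq using P[OF that] Q[OF that] by linarith
    then show ?thesis by blast
  qed
  then obtain W where W: "\<And>z. z \<in> {-H<..<0} \<Longrightarrow> \<bar>G' z\<bar> \<le> W" by blast
  have "(LINT z|vert H. G' z) = G 0 - G (-H)"
    by (rule vert_FTC[OF pos(1) dG cG _ W]) (simp_all add: G'_def[abs_def])
  then have 0: "(LINT z|vert H. G' z) = 0" by (simp add: G_def)
  have "(LINT z|vert H. G' z) = (- (N\<^sup>2 / (c m)\<^sup>2)) * (LINT z|vert H. r z * (f m z * f n z))
      + (LINT z|vert H. r z * (deriv (f m) z * deriv (f n) z))"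
    unfolding G'_eq using i1 i2 by (subst Bochner_Integration.integral_add) auto
  moreover have "N\<^sup>2 * (LINT z|vert H. r z * (f m z * f n z)) = (if m = n then 1 else 0)"
  proof -
    have "N\<^sup>2 * (LINT z|vert H. r z * (f m z * f n z)) = (LINT z|vert H. N\<^sup>2 * (r z * (f m z * f n z)))"
      by (rule integral_mult_right_zero[symmetric])
    also have "\<dots> = (LINT z|vert H. r z * N\<^sup>2 * (f m z * f n z))" by (simp only: mult_ac)
    finally show ?thesis using f_orthonormal[OF m n] by simp
  qed
  ultimately have "(LINT z|vert H. r z * (deriv (f m) z * deriv (f n) z)) = (1 / (c m)\<^sup>2) * (if m = n then 1 else 0)"
    using 0 by (simp add: field_simps split: if_splits)
  then show ?thesis by simp
qed

lemma df_integral: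
  assumes n: "1 \<le> n" shows "(LINT z|vert H. deriv (f n) z) = 0"
proof -
  obtain B where "\<And>z. z \<in> {-H<..<0} \<Longrightarrow> \<bar>deriv (f n) z\<bar> \<le> B" using f_deriv_bounded[OF n] by blast
  then have "(LINT z|vert H. deriv (f n) z) = f n 0 - f n (-H)"
    by (intro vert_FTC[OF pos(1) f_deriv[OF n] f_continuous(1)[OF n] df_measurable[OF n]])
  then show ?thesis using f_continuous(2,3)[OF n] by simp
qed

text \<open>Since r g_0 is constant, its pairing with g_n reduces to the integral of f_n', that is,
  to boundary values of f_n. For positive indices the factors c_n compensate the 1/c_n^2 of
  \<open>df_orthogonal\<close>.\<close>

lemma gm_orthonormal: "(LINT z|vert H. r z * (gm m z * gm n z)) = (if m = n then 1 else 0)"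
proof -
  define \<alpha> where "\<alpha> = (LINT y|vert H. 1 / r y) powr (- 1 / 2)"
  have g0: "gm 0 z = \<alpha> / r z" for z by (simp add: gm_0 \<alpha>_def)
  have rz: "r z \<noteq> 0" if "z \<in> space (vert H)" for z using r_pos that by (fastforce simp: vert_space)
  have 00: "(LINT z|vert H. r z * (gm 0 z * gm 0 z)) = 1"
  proof -
    have i: "integrable (vert H) (\<lambda>z. 1 / r z)" by (rule integrable_vertI[OF _ inv_r_bounded]) measurable
    obtain m M where M: "0 < m" "\<And>z. z \<in> {-H<..<0} \<Longrightarrow> m \<le> r z \<and> r z \<le> M" using r_bounds by blast
    have M0: "0 < M" using M(1) M(2)[of "-H/2"] pos by auto
    interpret finite_measure "vert H" by (rule finite_measure_vert)
    have "measure (vert H) (space (vert H)) = H"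
    proof -
      have "measure (vert H) {-H<..<0} = measure lborel {-H<..<0}"
        unfolding vert_def by (rule measure_restrict_space) auto
      moreover have "space (vert H) = {-H<..<0}" using vert_space by blast
      ultimately show ?thesis using pos by simp
    qed
    \<comment> \<open>The upper bound \<open>M\<close> of the density makes the integral of 1/r
      positive, so that the power -1/2 is a genuine inverse square root.\<close>
    then have "H * (1 / M) = (LINT z|vert H. 1 / M)" by simp
    also have "\<dots> \<le> (LINT z|vert H. 1 / r z)"
      using M r_pos by (intro integral_mono i) (auto simp: vert_space intro!: divide_left_mono mult_pos_pos M0)
    finally have p: "0 < (LINT z|vert H. 1 / r z)" using pos(1) M0 by (smt (verit) divide_pos_pos mult_pos_pos)
    have "(LINT z|vert H. r z * (gm 0 z * gm 0 z)) = (LINT z|vert H. (\<alpha> * \<alpha>) * (1 / r z))"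
      by (rule LINT_cong) (simp add: g0 rz)
    also have "\<dots> = (\<alpha> * \<alpha>) * (LINT z|vert H. 1 / r z)" by (rule integral_mult_right_zero)
    also have "\<alpha> * \<alpha> = inverse (LINT z|vert H. 1 / r z)"
    proof -
      have "\<alpha> * \<alpha> = (LINT z|vert H. 1 / r z) powr (- 1 / 2 + - 1 / 2)" unfolding \<alpha>_def by (rule powr_add[symmetric])
      also have "- 1 / 2 + - 1 / 2 = (- 1 :: real)" by simp
      finally show ?thesis using p by (simp add: powr_minus)
    qed
    finally show ?thesis using p by simp
  qed
  have 0: "(LINT z|vert H. r z * (gm 0 z * gm n z)) = 0" if n: "1 \<le> n" for n
  proof -
    have "(LINT z|vert H. r z * (gm 0 z * gm n z)) = (LINT z|vert H. (\<alpha> * c n) * deriv (f n) z)"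
      by (rule LINT_cong) (simp add: g0 gm_pos[OF n] rz)
    also have "\<dots> = (\<alpha> * c n) * (LINT z|vert H. deriv (f n) z)" by (rule integral_mult_right_zero)
    finally show ?thesis by (simp add: df_integral[OF n])
  qed
  have 1: "(LINT z|vert H. r z * (gm m z * gm n z)) = (if m = n then 1 else 0)" if m: "1 \<le> m" and n: "1 \<le> n" for m n
  proof -
    have "(LINT z|vert H. r z * (gm m z * gm n z)) = (LINT z|vert H. (c m * c n) * (r z * (deriv (f m) z * deriv (f n) z)))"
      by (rule LINT_cong) (simp add: gm_pos[OF n] gm_pos[OF m])
    also have "\<dots> = (c m * c n) * (LINT z|vert H. r z * (deriv (f m) z * deriv (f n) z))" by (rule integral_mult_right_zero)
    finally show ?thesis using c_pos[OF m] by (cases "m = n") (simp_all add: df_orthogonal[OF m n] df_orthogonal[OF n n] power2_eq_square)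
  qed
  consider "m = 0" "n = 0" | "m = 0" "1 \<le> n" | "1 \<le> m" "n = 0" | "1 \<le> m" "1 \<le> n" by linarith
  then show ?thesis
  proof cases
    case 3
    then show ?thesis using 0[of m] by (simp add: mult.commute[of "gm m _"])
  qed (use 00 0 1 in auto)
qed

end

section \<open>Time dependent functions\<close>

lemma pd_translate: "pd b (\<lambda>x. f (x + a)) x = pd b f (x + a)"
proof (cases "f differentiable (at (x + a))")
  case True
  have "((\<lambda>x. x + a) has_derivative (\<lambda>h. h)) (at x)" by (auto intro!: derivative_eq_intros)
  from has_derivative_compose[of "\<lambda>x. x + a" "\<lambda>h. h" x UNIV f, OF this pd_has_derivative[OF True]]
  show ?thesis by (rule pd_eqI)
next
  case False
  \<comment> \<open>Without differentiability \<open>pd\<close> is a default value chosen by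
    \<open>frechet_derivative\<close>; the choice is the same on both sides because the two
    predicates coincide.\<close>
  have eq: "((\<lambda>x. f (x + a)) has_derivative D) (at x) \<longleftrightarrow> (f has_derivative D) (at (x + a))" for D
  proof
    assume D: "((\<lambda>x. f (x + a)) has_derivative D) (at x)"
    have "((\<lambda>y. y - a) has_derivative (\<lambda>h. h)) (at (x + a))" by (auto intro!: derivative_eq_intros)
    from has_derivative_compose[of "\<lambda>y. y - a" "\<lambda>h. h" "x + a" UNIV "\<lambda>x. f (x + a)" D, OF this] D
    show "(f has_derivative D) (at (x + a))" by simp
  next
    assume D: "(f has_derivative D) (at (x + a))"
    have "((\<lambda>x. x + a) has_derivative (\<lambda>h. h)) (at x)" by (auto intro!: derivative_eq_intros)
    from has_derivative_compose[of "\<lambda>x. x + a" "\<lambda>h. h" x UNIV f D, OF this D]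
    show "((\<lambda>x. f (x + a)) has_derivative D) (at x)" .
  qed
  show ?thesis unfolding pd_def frechet_derivative_def eq by simp
qed

lemma Ck_translate: "Ck k f \<Longrightarrow> Ck k (\<lambda>x. f (x + a))"
proof (induction k arbitrary: f)
  case 0
  then show ?case by (auto intro!: continuous_on_compose2[of UNIV f] continuous_intros)
next
  case (Suc k)
  have "(\<lambda>x. f (x + a)) differentiable (at x)" for x
    by (rule differentiable_compose[where f=f and g="\<lambda>x. x + a"]) (use Suc.prems in auto)
  moreover have "pd b (\<lambda>x. f (x + a)) = (\<lambda>x. pd b f (x + a))" for b using pd_translate by blast
  ultimately show ?case using Suc by simp
qed

lemma linear_Pair0: "linear (\<lambda>x. (0, x))"
  by (simp add: linear_iff)

lemma
  fixes \<phi> :: "'b::euclidean_space \<times> 'a::euclidean_space \<Rightarrow> real"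
  assumes \<phi>: "test_fun \<Omega> \<phi>"
  shows test_fun_section: "test_fun UNIV (\<lambda>x. \<phi> (t, x))"
    and pd_section: "pd b (\<lambda>x. \<phi> (t, x)) x = pd (0, b) \<phi> (t, x)"
proof -
  obtain K where K: "compact K" "K \<subseteq> \<Omega>" "\<And>p. p \<notin> K \<Longrightarrow> \<phi> p = 0" using test_fun_support[OF \<phi>] by blast
  \<comment> \<open>The map from x to (t, x) is only affine; a preliminary translation by (t, 0)
    leaves a linear one.\<close>
  have eq: "(\<lambda>x. \<phi> (t, x)) = (\<lambda>x. (\<lambda>p. \<phi> (p + (t, 0))) (0, x))" by auto
  have C: "Ck k (\<lambda>p. \<phi> (p + (t, 0)))" for k by (rule Ck_translate[OF test_fun_Ck[OF \<phi>]])
  show "test_fun UNIV (\<lambda>x. \<phi> (t, x))"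
  proof (rule test_funI[where K="snd ` K"])
    show "Ck k (\<lambda>x. \<phi> (t, x))" for k unfolding eq by (rule Ck_compose_linear[OF linear_Pair0 C])
    show "compact (snd ` K)" by (rule compact_continuous_image[OF _ K(1)]) (intro continuous_intros)
    show "x \<notin> snd ` K \<Longrightarrow> \<phi> (t, x) = 0" for x using K(3)[of "(t, x)"] by force
  qed auto
  have "pd b (\<lambda>x. (\<lambda>p. \<phi> (p + (t, 0))) (0, x)) x = pd (0, b) (\<lambda>p. \<phi> (p + (t, 0))) (0, x)"
    by (rule pd_compose_linear[OF linear_Pair0]) (use C[of 1] in simp)
  then show "pd b (\<lambda>x. \<phi> (t, x)) x = pd (0, b) \<phi> (t, x)" unfolding eq pd_translate by simp
qed

lemma
  fixes \<theta> :: "'b::euclidean_space \<Rightarrow> real" and \<psi> :: "'a::euclidean_space \<Rightarrow> real"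
  assumes \<theta>: "test_fun A \<theta>" and \<psi>: "test_fun B \<psi>"
  shows test_fun_tensor: "test_fun (A \<times> B) (tensor \<theta> \<psi>)"
    and pd_tensor: "pd (a, b) (tensor \<theta> \<psi>) (t, x) = pd a \<theta> t * \<psi> x + \<theta> t * pd b \<psi> x"
proof -
  obtain K where K: "compact K" "K \<subseteq> A" "\<And>p. p \<notin> K \<Longrightarrow> \<theta> p = 0" using test_fun_support[OF \<theta>] by blast
  obtain L where L: "compact L" "L \<subseteq> B" "\<And>p. p \<notin> L \<Longrightarrow> \<psi> p = 0" using test_fun_support[OF \<psi>] by blast
  have eq: "tensor \<theta> \<psi> = (\<lambda>p. \<theta> (fst p) * \<psi> (snd p))" by (auto simp: tensor_def)
  have C: "Ck k (\<lambda>p::'b \<times> 'a. \<theta> (fst p))" "Ck k (\<lambda>p::'b \<times> 'a. \<psi> (snd p))" for k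
    by (rule Ck_compose_linear[OF linear_fst test_fun_Ck[OF \<theta>]], rule Ck_compose_linear[OF linear_snd test_fun_Ck[OF \<psi>]])
  show "test_fun (A \<times> B) (tensor \<theta> \<psi>)"
  proof (rule test_funI[where K="K \<times> L"])
    show "Ck k (tensor \<theta> \<psi>)" for k unfolding eq by (intro Ck_mult C)
    show "p \<notin> K \<times> L \<Longrightarrow> tensor \<theta> \<psi> p = 0" for p using K(3) L(3) by (cases p) (auto simp: tensor_def)
  qed (use K L in \<open>auto intro: compact_Times\<close>)
  have "pd (a, b) (\<lambda>p. \<theta> (fst p) * \<psi> (snd p)) (t, x) = pd (a, b) (\<lambda>p. \<theta> (fst p)) (t, x) * \<psi> x + \<theta> t * pd (a, b) (\<lambda>p. \<psi> (snd p)) (t, x)"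
    using C[of 1] by (subst pd_mult) auto
  also have "pd (a, b) (\<lambda>p. \<theta> (fst p)) (t, x) = pd a \<theta> t"
    using pd_compose_linear[OF linear_fst, of \<theta> "(t, x)" "(a, b)"] test_fun_differentiable[OF \<theta>] by simp
  also have "pd (a, b) (\<lambda>p. \<psi> (snd p)) (t, x) = pd b \<psi> x"
    using pd_compose_linear[OF linear_snd, of \<psi> "(t, x)" "(a, b)"] test_fun_differentiable[OF \<psi>] by simp
  finally show "pd (a, b) (tensor \<theta> \<psi>) (t, x) = pd a \<theta> t * \<psi> x + \<theta> t * pd b \<psi> x" by (simp add: eq)
qed

lemma pd_0: "f differentiable (at x) \<Longrightarrow> pd 0 f x = 0"
  unfolding pd_def by (rule linear_0[OF linear_frechet_derivative])

text \<open>A tensor product regrouped to match the nesting of the variables (t, (X, z)) on the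
  strip.\<close>

definition tensor3 :: "(real \<times> 'a \<Rightarrow> real) \<Rightarrow> (real \<Rightarrow> real) \<Rightarrow> real \<times> ('a \<times> real) \<Rightarrow> real" where
  "tensor3 \<phi> \<zeta> = (\<lambda>(t, X, z). \<phi> (t, X) * \<zeta> z)"

lemma
  fixes \<phi> :: "real \<times> 'a::euclidean_space \<Rightarrow> real"
  assumes \<phi>: "test_fun (A \<times> UNIV) \<phi>" and \<zeta>: "test_fun B \<zeta>"
  shows test_fun_tensor3: "test_fun (A \<times> (UNIV \<times> B)) (tensor3 \<phi> \<zeta>)"
    and pd_tensor3: "pd (a, v, b) (tensor3 \<phi> \<zeta>) (t, X, z) = pd (a, v) \<phi> (t, X) * \<zeta> z + \<phi> (t, X) * pd b \<zeta> z"
proof -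
  define L where "L = (\<lambda>(t::real, X::'a, z::real). ((t, X), z))"
  have lL: "linear L" by (auto simp: linear_iff L_def)
  have eq: "tensor3 \<phi> \<zeta> = (\<lambda>p. tensor \<phi> \<zeta> (L p))" by (auto simp: tensor3_def tensor_def L_def)
  note t = test_fun_tensor[OF \<phi> \<zeta>]
  obtain K where K: "compact K" "K \<subseteq> (A \<times> UNIV) \<times> B" "\<And>p. p \<notin> K \<Longrightarrow> tensor \<phi> \<zeta> p = 0" using test_fun_support[OF t] by blast
  define L' where "L' = (\<lambda>((t::real, X::'a), z::real). (t, X, z))"
  have L': "continuous_on UNIV L'" unfolding L'_def split_beta by (intro continuous_intros)
  show "test_fun (A \<times> (UNIV \<times> B)) (tensor3 \<phi> \<zeta>)"
  proof (rule test_funI[where K="L' ` K"])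
    show "Ck k (tensor3 \<phi> \<zeta>)" for k unfolding eq by (rule Ck_compose_linear[OF lL test_fun_Ck[OF t]])
    show "compact (L' ` K)" by (rule compact_continuous_image[OF continuous_on_subset[OF L'] K(1)]) auto
    show "L' ` K \<subseteq> A \<times> (UNIV \<times> B)" using K(2) by (auto simp: L'_def)
    show "tensor3 \<phi> \<zeta> p = 0" if "p \<notin> L' ` K" for p
    proof -
      have "L p \<notin> K"
      proof
        assume "L p \<in> K"
        then have "L' (L p) \<in> L' ` K" by (rule imageI)
        with that show False by (cases p) (simp add: L_def L'_def)
      qed
      then show ?thesis unfolding eq by (rule K(3))
    qed
  qed
  have "pd (a, v, b) (tensor3 \<phi> \<zeta>) (t, X, z) = pd (L (a, v, b)) (tensor \<phi> \<zeta>) (L (t, X, z))"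
    unfolding eq by (rule pd_compose_linear[OF lL test_fun_differentiable[OF t]])
  then show "pd (a, v, b) (tensor3 \<phi> \<zeta>) (t, X, z) = pd (a, v) \<phi> (t, X) * \<zeta> z + \<phi> (t, X) * pd b \<zeta> z"
    by (simp add: L_def pd_tensor[OF \<phi> \<zeta>])
qed

lemma test_fun_sqint:
  fixes \<psi> :: "'a::euclidean_space \<Rightarrow> real"
  assumes \<psi>: "test_fun \<Omega> \<psi>" shows "sqint lborel \<psi>"
proof -
  obtain K where K: "compact K" "\<And>x. x \<notin> K \<Longrightarrow> \<psi> x = 0" using test_fun_support[OF \<psi>] by blast
  obtain B where B: "B \<ge> 0" "\<And>x. \<bar>\<psi> x\<bar> \<le> B" using test_fun_bounded[OF \<psi>] by blast
  have "sqint lborel (\<lambda>x. B *\<^sub>R indicator K x :: real)"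
    using K(1) emeasure_bounded_finite[OF compact_imp_bounded[OF K(1)]]
    by (intro sqint_scaleR sqint_indicator) (auto intro: borel_compact)
  then show ?thesis
  proof (rule sqint_bound)
    show "\<psi> \<in> borel_measurable lborel" using test_fun_continuous[OF \<psi>] by (simp add: borel_measurable_continuous_onI)
    show "AE x in lborel. norm (\<psi> x) \<le> norm (B *\<^sub>R indicator K x :: real)"
      by (rule AE_I2) (use B K(2) in \<open>auto simp: indicator_def\<close>)
  qed
qed

lemma integrable_indicator_Icc: "integrable lborel (\<lambda>t::real. C * indicator {a..b} t :: real)"
  using borel_integrable_atLeastAtMost'[of a b "\<lambda>_. C"] by (simp add: set_integrable_def mult.commute)

lemma LINT_indicator_le:
  fixes K T :: real
  assumes "0 \<le> K" shows "(LINT t|lborel. K * indicator {0..T} t) \<le> K * \<bar>T\<bar>"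
proof -
  have "(LINT t|lborel. K * indicator {0..T} t) = K * (LINT t|lborel. indicator {0..T} t)" by (rule integral_mult_right_zero)
  also have "(LINT t|lborel. indicator {0..T} t) = measure lborel {0..T}" by simp
  also have "K * \<dots> \<le> K * \<bar>T\<bar>" by (rule mult_left_mono[OF _ assms]) (cases "0 \<le> T"; simp)
  finally show ?thesis .
qed

lemma contL2_const: "sqint M v \<Longrightarrow> contL2 T M (\<lambda>t. v)"
  by (simp add: contL2_def)

lemma contL2_test_fun:
  fixes \<phi> :: "real \<times> 'a::euclidean_space \<Rightarrow> real"
  assumes \<phi>: "test_fun \<Omega> \<phi>"
  shows "contL2 T lborel (\<lambda>t x. \<phi> (t, x))"
  unfolding contL2_def
proof (intro conjI ballI)
  show s: "sqint lborel (\<lambda>x. \<phi> (t, x))" for t by (rule test_fun_sqint[OF test_fun_section[OF \<phi>]])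
  obtain K where K: "compact K" "\<And>x. x \<notin> K \<Longrightarrow> \<phi> x = 0" using test_fun_support[OF \<phi>] by blast
  obtain B where B: "B \<ge> 0" "\<And>x. \<bar>\<phi> x\<bar> \<le> B" using test_fun_bounded[OF \<phi>] by blast
  have K': "compact (snd ` K)" by (rule compact_continuous_image[OF _ K(1)]) (intro continuous_intros)
  have w: "sqint lborel (\<lambda>x. B * indicator (snd ` K) x :: real)"
    using K' emeasure_bounded_finite[OF compact_imp_bounded[OF K']]
    by (intro sqint_cmult sqint_indicator) (auto intro: borel_compact)
  have m: "(\<lambda>x. \<phi> (t, x)) \<in> borel_measurable lborel" for t using s[of t] by (simp add: sqint_def)
  fix t
  show "((\<lambda>r. nrm lborel (\<lambda>x. \<phi> (r, x) - \<phi> (t, x))) \<longlongrightarrow> 0) (at t within {0..T})"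
    unfolding tendsto_at_iff_sequentially comp_def
  proof (intro allI impI)
    fix X assume X: "X \<longlonglongrightarrow> t"
    show "(\<lambda>n. nrm lborel (\<lambda>x. \<phi> (X n, x) - \<phi> (t, x))) \<longlonglongrightarrow> 0"
    proof (rule nrm_dominated_convergence(3)[where f="\<lambda>n x. \<phi> (X n, x)" and g="\<lambda>x. \<phi> (t, x)", OF m m w])
      show "AE x in lborel. (\<lambda>n. \<phi> (X n, x)) \<longlonglongrightarrow> \<phi> (t, x)"
        by (intro AE_I2 continuous_on_tendsto_compose[OF test_fun_continuous[OF \<phi>]] tendsto_Pair X tendsto_const) auto
      show "AE x in lborel. norm (\<phi> (X n, x)) \<le> B * indicator (snd ` K) x" for n
      proof (rule AE_I2)
        fix x
        show "norm (\<phi> (X n, x)) \<le> B * indicator (snd ` K) x"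
        proof (cases "x \<in> snd ` K")
          case False
          then have "(X n, x) \<notin> K" by force
          then show ?thesis using K(2) B(1) by simp
        qed (use B in simp)
      qed
    qed
  qed
qed

lemma contL2_bounded:
  assumes u: "contL2 T M u"
  shows "\<exists>B\<ge>0. \<forall>t\<in>{0..T}. nrm M (u t) \<le> B"
proof -
  have "continuous_on {0..T} (\<lambda>t. nrm M (u t))"
    unfolding continuous_on_def
  proof
    fix t assume t: "t \<in> {0..T}"
    show "((\<lambda>r. nrm M (u r)) \<longlongrightarrow> nrm M (u t)) (at t within {0..T})"
    proof (rule Lim_null[THEN iffD2], rule Lim_null_comparison)
      show "((\<lambda>r. nrm M (\<lambda>x. u r x - u t x)) \<longlongrightarrow> 0) (at t within {0..T})" using u t by (simp add: contL2_def)
      show "\<forall>\<^sub>F r in at t within {0..T}. norm (nrm M (u r) - nrm M (u t)) \<le> nrm M (\<lambda>x. u r x - u t x)"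
        unfolding eventually_at_filter
        by (intro always_eventually allI impI) (use nrm_diff_ge[OF contL2_sqint[OF u] contL2_sqint[OF u t]] in simp)
    qed
  qed
  then have "compact ((\<lambda>t. nrm M (u t)) ` {0..T})" by (rule compact_continuous_image) simp
  then obtain B where B: "\<forall>y\<in>(\<lambda>t. nrm M (u t)) ` {0..T}. norm y \<le> B" using compact_imp_bounded bounded_iff by metis
  then show ?thesis by (intro exI[of _ "max 0 B"]) (auto simp: le_max_iff_disj)
qed

lemma contL2_ip_continuous:
  assumes u: "contL2 T M u" and v: "contL2 T M v"
  shows "continuous_on {0..T} (\<lambda>t. ip M (u t) (v t))"
  unfolding continuous_on_def
proof
  fix t assume t: "t \<in> {0..T}"
  obtain B where B: "B \<ge> 0" "\<And>t. t \<in> {0..T} \<Longrightarrow> nrm M (v t) \<le> B" using contL2_bounded[OF v] by blast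
  show "((\<lambda>r. ip M (u r) (v r)) \<longlongrightarrow> ip M (u t) (v t)) (at t within {0..T})"
  proof (rule Lim_null[THEN iffD2], rule Lim_null_comparison)
    have "((\<lambda>r. nrm M (\<lambda>x. u r x - u t x)) \<longlongrightarrow> 0) (at t within {0..T})"
      "((\<lambda>r. nrm M (\<lambda>x. v r x - v t x)) \<longlongrightarrow> 0) (at t within {0..T})" using u v t by (simp_all add: contL2_def)
    from tendsto_add[OF tendsto_mult_left_zero[OF this(1), of B] tendsto_mult_right_zero[OF this(2), of "nrm M (u t)"]]
    show "((\<lambda>r. nrm M (\<lambda>x. u r x - u t x) * B + nrm M (u t) * nrm M (\<lambda>x. v r x - v t x)) \<longlongrightarrow> 0) (at t within {0..T})" by simp
    show "\<forall>\<^sub>F r in at t within {0..T}. norm (ip M (u r) (v r) - ip M (u t) (v t)) \<le> nrm M (\<lambda>x. u r x - u t x) * B + nrm M (u t) * nrm M (\<lambda>x. v r x - v t x)"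
      unfolding eventually_at_filter
    proof (intro always_eventually allI impI)
      fix r assume "r \<noteq> t" and r: "r \<in> {0..T}"
      note s = contL2_sqint[OF u r] contL2_sqint[OF u t] contL2_sqint[OF v r] contL2_sqint[OF v t]
      have "ip M (u r) (v r) - ip M (u t) (v t) = ip M (\<lambda>x. u r x - u t x) (v r) + ip M (u t) (\<lambda>x. v r x - v t x)"
        using s by (simp add: ip_diff_left ip_diff_right)
      then have "\<bar>ip M (u r) (v r) - ip M (u t) (v t)\<bar> \<le> \<bar>ip M (\<lambda>x. u r x - u t x) (v r)\<bar> + \<bar>ip M (u t) (\<lambda>x. v r x - v t x)\<bar>"
        by (simp only: abs_triangle_ineq)
      also have "\<dots> \<le> nrm M (\<lambda>x. u r x - u t x) * nrm M (v r) + nrm M (u t) * nrm M (\<lambda>x. v r x - v t x)"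
        by (intro add_mono ip_Cauchy_Schwarz sqint_diff s)
      also have "\<dots> \<le> nrm M (\<lambda>x. u r x - u t x) * B + nrm M (u t) * nrm M (\<lambda>x. v r x - v t x)"
        by (intro add_mono mult_left_mono B r) auto
      finally show "norm (ip M (u r) (v r) - ip M (u t) (v t)) \<le> nrm M (\<lambda>x. u r x - u t x) * B + nrm M (u t) * nrm M (\<lambda>x. v r x - v t x)" by simp
    qed
  qed
qed

lemma contL2_ip_integrable:
  "contL2 T M u \<Longrightarrow> contL2 T M v \<Longrightarrow> set_integrable lborel {0..T} (\<lambda>t. ip M (u t) (v t))"
  by (rule borel_integrable_atLeastAtMost'[OF contL2_ip_continuous])

lemma contL2_slice:
  fixes u :: "real \<Rightarrow> (real ^ 'd) \<times> real \<Rightarrow> real"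
  assumes u: "contL2 T (strip H) u" and b: "sqint (vert H) b"
  shows "contL2 T lborel (\<lambda>t. slice (vert H) b (u t))"
  unfolding contL2_def
proof (intro conjI ballI)
  interpret pair_sigma_finite "lborel :: (real ^ 'd) measure" "vert H" by (rule pair_sigma_finite_strip)
  have su: "sqint (lborel \<Otimes>\<^sub>M vert H) (u q)" if "q \<in> {0..T}" for q
    using contL2_sqint[OF u that] by (simp add: strip_eq_pair)
  show "sqint lborel (slice (vert H) b (u t))" if "t \<in> {0..T}" for t by (rule sqint_slice[OF su[OF that] b])
  fix t assume t: "t \<in> {0..T}"
  show "((\<lambda>r. nrm lborel (\<lambda>x. slice (vert H) b (u r) x - slice (vert H) b (u t) x)) \<longlongrightarrow> 0) (at t within {0..T})"
  proof (rule Lim_null_comparison)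
    show "((\<lambda>r. nrm (strip H) (\<lambda>x. u r x - u t x) * nrm (vert H) b) \<longlongrightarrow> 0) (at t within {0..T})"
      using u t by (intro tendsto_mult_left_zero) (simp add: contL2_def)
    show "\<forall>\<^sub>F r in at t within {0..T}. norm (nrm lborel (\<lambda>x. slice (vert H) b (u r) x - slice (vert H) b (u t) x)) \<le> nrm (strip H) (\<lambda>x. u r x - u t x) * nrm (vert H) b"
      unfolding eventually_at_filter
    proof (intro always_eventually allI impI)
      fix r assume "r \<noteq> t" and r: "r \<in> {0..T}"
      have ae: "AE x in lborel. slice (vert H) b (u r) x - slice (vert H) b (u t) x = slice (vert H) b (\<lambda>x. u r x - u t x) x"
        using sqint_section(1)[OF su[OF r]] sqint_section(1)[OF su[OF t]]
      proof eventually_elim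
        case (elim x)
        show ?case using ip_integrable[OF elim(1) b] ip_integrable[OF elim(2) b]
          by (simp add: slice_def left_diff_distrib)
      qed
      note sd = sqint_diff[OF su[OF r] su[OF t]]
      have "nrm lborel (\<lambda>x. slice (vert H) b (u r) x - slice (vert H) b (u t) x) = nrm lborel (slice (vert H) b (\<lambda>x. u r x - u t x))"
        by (rule nrm_cong_AE[OF _ _ ae])
           (use sqint_slice[OF su[OF r] b] sqint_slice[OF su[OF t] b] sqint_slice[OF sd b] in \<open>auto simp: sqint_def\<close>)
      also have "\<dots> \<le> nrm (strip H) (\<lambda>x. u r x - u t x) * nrm (vert H) b"
        using nrm_slice_le[OF sd b] by (simp add: strip_eq_pair)
      finally show "norm (nrm lborel (\<lambda>x. slice (vert H) b (u r) x - slice (vert H) b (u t) x)) \<le> nrm (strip H) (\<lambda>x. u r x - u t x) * nrm (vert H) b" by simp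
    qed
  qed
qed

lemma regT_eq: "regT T M u \<phi> = (LINT t:{0..T}|lborel. ip M (u t) (\<lambda>x. \<phi> (t, x)))"
  by (simp add: regT_def ip_def)

lemma regT_cong:
  assumes "\<And>t. t \<in> {0..T} \<Longrightarrow> ip M (u t) (\<lambda>x. \<phi> (t, x)) = a t"
  shows "regT T M u \<phi> = (LINT t:{0..T}|lborel. a t)"
  unfolding regT_eq by (rule set_lebesgue_integral_cong) (use assms in auto)

lemma regT_cong_AE:
  assumes "\<And>t. t \<in> {0..T} \<Longrightarrow> sqint M (u t)" "\<And>t. t \<in> {0..T} \<Longrightarrow> u' t \<in> borel_measurable M"
    "\<And>t. t \<in> {0..T} \<Longrightarrow> (\<lambda>x. \<phi> (t, x)) \<in> borel_measurable M"
    "\<And>t. t \<in> {0..T} \<Longrightarrow> AE x in M. u' t x = u t x"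
  shows "regT T M u' \<phi> = regT T M u \<phi>"
  unfolding regT_eq[of T M u] using assms by (intro regT_cong ip_cong_AE) (auto simp: sqint_def)

text \<open>Integrating out z: for a product test function the pairing on the strip becomes one
  between the slice and \<phi>. The product form is required only at heights inside the strip, where
  the derivative of a cut-off mode can be computed.\<close>

lemma regT_tensor3:
  fixes u :: "real \<Rightarrow> (real ^ 'd) \<times> real \<Rightarrow> real"
  assumes u: "contL2 T (strip H) u" and b: "sqint (vert H) b" and \<phi>: "\<And>t. t \<in> {0..T} \<Longrightarrow> sqint lborel (\<lambda>x. \<phi> (t, x))"
    and eq: "\<And>t X z. z \<in> {-H<..<0} \<Longrightarrow> \<Phi> (t, X, z) = \<phi> (t, X) * b z"
  shows "regT T (strip H) u \<Phi> = regT T lborel (\<lambda>t. slice (vert H) b (u t)) \<phi>"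
  unfolding regT_eq[of T lborel]
proof (rule regT_cong)
  fix t assume t: "t \<in> {0..T}"
  interpret pair_sigma_finite "lborel :: (real ^ 'd) measure" "vert H" by (rule pair_sigma_finite_strip)
  have su: "sqint (lborel \<Otimes>\<^sub>M vert H) (u t)" using contL2_sqint[OF u t] by (simp add: strip_eq_pair)
  have "ip (strip H) (u t) (\<lambda>x. \<Phi> (t, x)) = ip (strip H) (u t) (tensor (\<lambda>X. \<phi> (t, X)) b)"
    unfolding ip_def
  proof (rule LINT_cong)
    fix x assume "x \<in> space (strip H :: ((real ^ 'd) \<times> real) measure)"
    then have "snd x \<in> {-H<..<0}" by (auto simp: strip_eq_pair space_pair_measure vert_space)
    then show "u t x \<bullet> \<Phi> (t, x) = u t x \<bullet> tensor (\<lambda>X. \<phi> (t, X)) b x"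
      using eq[of "snd x" t "fst x"] by (simp add: tensor_def split_beta)
  qed
  then show "ip (strip H) (u t) (\<lambda>x. \<Phi> (t, x)) = ip lborel (slice (vert H) b (u t)) (\<lambda>x. \<phi> (t, x))"
    using ip_slice[OF su b \<phi>[OF t]] by (simp add: strip_eq_pair)
qed

lemma ip_slice_diff:
  fixes u :: "(real ^ 'd) \<times> real \<Rightarrow> real"
  assumes u: "sqint (strip H) u" and b: "sqint (vert H) b" "sqint (vert H) b'" and \<psi>: "sqint lborel \<psi>"
  shows "\<bar>ip lborel (slice (vert H) b u) \<psi> - ip lborel (slice (vert H) b' u) \<psi>\<bar>
    \<le> nrm (strip H) u * nrm lborel \<psi> * nrm (vert H) (\<lambda>z. b z - b' z)"
proof -
  interpret pair_sigma_finite "lborel :: (real ^ 'd) measure" "vert H" by (rule pair_sigma_finite_strip)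
  note u' = u[unfolded strip_eq_pair]
  have eq: "tensor \<psi> (\<lambda>z. b z - b' z) = (\<lambda>p. tensor \<psi> b p - tensor \<psi> b' p)"
    by (auto simp: tensor_def right_diff_distrib)
  have "ip lborel (slice (vert H) b u) \<psi> - ip lborel (slice (vert H) b' u) \<psi> = ip (lborel \<Otimes>\<^sub>M vert H) u (tensor \<psi> (\<lambda>z. b z - b' z))"
    unfolding eq ip_slice[OF u' b(1) \<psi>] ip_slice[OF u' b(2) \<psi>]
    by (rule ip_diff_right[symmetric]) (intro sqint_tensor \<psi> b u')+
  also have "\<bar>\<dots>\<bar> \<le> nrm (lborel \<Otimes>\<^sub>M vert H) u * nrm (lborel \<Otimes>\<^sub>M vert H) (tensor \<psi> (\<lambda>z. b z - b' z))"
    by (intro ip_Cauchy_Schwarz u' sqint_tensor \<psi> sqint_diff b)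
  finally show ?thesis by (simp add: nrm_tensor[OF \<psi> sqint_diff[OF b]] strip_eq_pair mult.assoc)
qed

lemma ip_slice_tendsto:
  fixes u :: "(real ^ 'd) \<times> real \<Rightarrow> real"
  assumes u: "sqint (strip H) u" and b: "\<And>k. sqint (vert H) (b k)" "sqint (vert H) b'" and \<psi>: "sqint lborel \<psi>"
    and lim: "(\<lambda>k. nrm (vert H) (\<lambda>z. b k z - b' z)) \<longlonglongrightarrow> 0"
  shows "(\<lambda>k. ip lborel (slice (vert H) (b k) u) \<psi>) \<longlonglongrightarrow> ip lborel (slice (vert H) b' u) \<psi>"
  by (rule Lim_null[THEN iffD2], rule Lim_null_comparison[OF _ tendsto_mult_right_zero[OF lim, of "nrm (strip H) u * nrm lborel \<psi>"]])
     (use ip_slice_diff[OF u b(1) b(2) \<psi>] in simp)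

text \<open>The error at each time is at most the norm of \<open>b k\<close> minus \<open>b'\<close>
  times bounds uniform in t, so the vertical cutoffs may be removed under the time integral.\<close>

lemma regT_slice_tendsto:
  fixes u :: "real \<Rightarrow> (real ^ 'd) \<times> real \<Rightarrow> real"
  assumes u: "contL2 T (strip H) u" and b: "\<And>k. sqint (vert H) (b k)" "sqint (vert H) b'"
    and \<phi>: "contL2 T lborel (\<lambda>t x. \<phi> (t, x))"
    and lim: "(\<lambda>k. nrm (vert H) (\<lambda>z. b k z - b' z)) \<longlonglongrightarrow> 0"
  shows "(\<lambda>k. regT T lborel (\<lambda>t. slice (vert H) (b k) (u t)) \<phi>) \<longlonglongrightarrow> regT T lborel (\<lambda>t. slice (vert H) b' (u t)) \<phi>"
proof -
  obtain A where A: "A \<ge> 0" "\<And>t. t \<in> {0..T} \<Longrightarrow> nrm (strip H) (u t) \<le> A" using contL2_bounded[OF u] by blast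
  obtain B where B: "B \<ge> 0" "\<And>t. t \<in> {0..T} \<Longrightarrow> nrm lborel (\<lambda>x. \<phi> (t, x)) \<le> B"
    using contL2_bounded[OF \<phi>] by blast
  let ?e = "\<lambda>k. nrm (vert H) (\<lambda>z. b k z - b' z)"
  have l: "(\<lambda>k. (A * B * \<bar>T\<bar>) * ?e k) \<longlonglongrightarrow> 0" by (rule tendsto_mult_right_zero[OF lim])
  have "\<forall>\<^sub>F k in sequentially. norm (regT T lborel (\<lambda>t. slice (vert H) (b k) (u t)) \<phi> - regT T lborel (\<lambda>t. slice (vert H) b' (u t)) \<phi>) \<le> (A * B * \<bar>T\<bar>) * ?e k"
  proof (rule always_eventually, rule allI)
    fix k
    let ?d = "\<lambda>t. ip lborel (slice (vert H) (b k) (u t)) (\<lambda>x. \<phi> (t, x)) - ip lborel (slice (vert H) b' (u t)) (\<lambda>x. \<phi> (t, x))"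
    note i1 = contL2_ip_integrable[OF contL2_slice[OF u b(1)] \<phi>, of k] and i2 = contL2_ip_integrable[OF contL2_slice[OF u b(2)] \<phi>]
    have id: "set_integrable lborel {0..T} ?d" by (rule set_integral_diff(1)[OF i1 i2])
    have le: "\<bar>?d t\<bar> \<le> A * B * ?e k" if t: "t \<in> {0..T}" for t
    proof -
      have "\<bar>?d t\<bar> \<le> nrm (strip H) (u t) * nrm lborel (\<lambda>x. \<phi> (t, x)) * ?e k"
        by (rule ip_slice_diff[OF contL2_sqint[OF u t] b contL2_sqint[OF \<phi> t]])
      also have "\<dots> \<le> A * B * ?e k" using A(2)[OF t] B(2)[OF t] A(1) by (intro mult_right_mono mult_mono) auto
      finally show ?thesis .
    qed
    have "regT T lborel (\<lambda>t. slice (vert H) (b k) (u t)) \<phi> - regT T lborel (\<lambda>t. slice (vert H) b' (u t)) \<phi> = (LINT t:{0..T}|lborel. ?d t)"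
      unfolding regT_eq by (rule set_integral_diff(2)[OF i1 i2, symmetric])
    also have "norm \<dots> \<le> (LINT t|lborel. (A * B * ?e k) * indicator {0..T} t)"
      unfolding set_lebesgue_integral_def
    proof (rule order_trans[OF integral_norm_bound integral_mono])
      show "integrable lborel (\<lambda>t. norm (indicator {0..T} t *\<^sub>R ?d t))" using id by (simp only: set_integrable_def integrable_norm)
      show "integrable lborel (\<lambda>t. (A * B * ?e k) * indicator {0..T} t)" by (rule integrable_indicator_Icc)
      show "norm (indicator {0..T} t *\<^sub>R ?d t) \<le> (A * B * ?e k) * indicator {0..T} t" for t
        using le by (auto simp: indicator_def)
    qed
    also have "\<dots> \<le> (A * B * \<bar>T\<bar>) * ?e k"
    proof -
      have K: "0 \<le> A * B * ?e k" by (intro mult_nonneg_nonneg A(1) B(1) nrm_nonneg)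
      have "A * B * ?e k * \<bar>T\<bar> = (A * B * \<bar>T\<bar>) * ?e k" by (simp only: mult_ac)
      with LINT_indicator_le[OF K, of T] show ?thesis by (simp only: )
    qed
    finally show "norm (regT T lborel (\<lambda>t. slice (vert H) (b k) (u t)) \<phi> - regT T lborel (\<lambda>t. slice (vert H) b' (u t)) \<phi>) \<le> (A * B * \<bar>T\<bar>) * ?e k" .
  qed
  from Lim_null_comparison[OF this l] show ?thesis by (rule Lim_null[THEN iffD2])
qed

section \<open>Uniqueness for the modal equations\<close>

lemma Basis_axis: "(Basis :: (real ^ 'd) set) = range (\<lambda>i. axis i 1)"
  by (auto simp: Basis_vec_def)

lemma inj_axis: "inj (\<lambda>i. axis i (1::real))"
  by (simp add: inj_on_def axis_eq_axis)

lemma sum_Basis_axis: "(\<Sum>b\<in>(Basis :: (real ^ 'd) set). F b) = (\<Sum>i\<in>UNIV. F (axis i 1))"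
  unfolding Basis_axis by (subst sum.reindex[OF inj_axis]) simp

lemma axis_Basis: "axis i 1 \<in> (Basis :: (real ^ 'd) set)"
  by (simp add: axis_in_Basis_iff)

lemma
  fixes \<theta> :: "real \<Rightarrow> real" and \<psi> :: "'a::euclidean_space \<Rightarrow> real"
  assumes \<theta>: "test_fun A \<theta>" and \<psi>: "test_fun B \<psi>"
  shows pd_dt_tensor: "pd (1, 0) (tensor \<theta> \<psi>) = tensor (pd 1 \<theta>) \<psi>"
    and pd_dx_tensor: "pd (0, b) (tensor \<theta> \<psi>) = tensor \<theta> (pd b \<psi>)"
  using pd_tensor[OF \<theta> \<psi>] pd_0[OF test_fun_differentiable[OF \<theta>]] pd_0[OF test_fun_differentiable[OF \<psi>]]
  by (simp_all add: fun_eq_iff tensor_def)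

lemma regT_tensor: "regT T M u (tensor \<theta> \<chi>') = (LINT t:{0..T}|lborel. ip M (u t) \<chi>' * \<theta> t)"
proof (rule regT_cong)
  fix t
  have "(\<lambda>x. tensor \<theta> \<chi>' (t, x)) = (\<lambda>x. \<theta> t * \<chi>' x)" by (simp add: tensor_def)
  then show "ip M (u t) (\<lambda>x. tensor \<theta> \<chi>' (t, x)) = ip M (u t) \<chi>' * \<theta> t"
    by (simp only: ip_cmult_right) (rule mult.commute)
qed

lemma LINT_sum:
  fixes F :: "'i \<Rightarrow> real \<Rightarrow> real"
  assumes "\<And>i. i \<in> I \<Longrightarrow> set_integrable lborel A (F i)"
  shows "set_integrable lborel A (\<lambda>t. \<Sum>i\<in>I. F i t)"
    and "(LINT t:A|lborel. (\<Sum>i\<in>I. F i t)) = (\<Sum>i\<in>I. LINT t:A|lborel. F i t)"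
  using assms unfolding set_integrable_def set_lebesgue_integral_def scaleR_sum_right
  by (auto intro: Bochner_Integration.integral_sum)

lemma test_fun_outside: "test_fun \<Omega> \<phi> \<Longrightarrow> x \<notin> \<Omega> \<Longrightarrow> \<phi> x = 0"
  using test_fun_support[of \<Omega> \<phi>] by blast

text \<open>Subtracting a primitive of \<open>b\<close> leaves a continuous function with vanishing
  weak derivative. The constant is identified at t = 0, so the initial value enters although test
  functions vanish near 0.\<close>

lemma weak_ODE:
  fixes a b :: "real \<Rightarrow> real"
  assumes T: "0 < T" and a: "continuous_on {0..T} a" and b: "continuous_on {0..T} b"
    and eq: "\<And>\<theta>. test_fun {0<..<T} \<theta> \<Longrightarrow> (LINT t:{0..T}|lborel. a t * pd 1 \<theta> t) + (LINT t:{0..T}|lborel. b t * \<theta> t) = 0"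
    and t: "t \<in> {0..T}"
  shows "a t = a 0 + integral {0..t} b"
proof -
  define B where "B t = integral {0..t} b" for t
  have cB: "continuous_on {0..T} B"
    unfolding B_def by (rule indefinite_integral_continuous_1[OF integrable_continuous_real[OF b]])
  have dB: "(B has_real_derivative b t) (at t within {0..T})" if "t \<in> {0..T}" for t
    unfolding B_def by (rule integral_has_real_derivative[OF b that])
  have "a t - B t = a 0 - B 0"
  proof (rule du_Bois_Reymond[where a=0 and b=T and h="\<lambda>t. a t - B t" and x=t and y=0])
    show "continuous_on {0..T} (\<lambda>t. a t - B t)" by (intro continuous_on_diff a cB)
    fix \<theta> :: "real \<Rightarrow> real" assume \<theta>: "test_fun {0<..<T} \<theta>"
    have c1: "continuous_on {0..T} \<theta>" using test_fun_continuous[OF \<theta>] by (rule continuous_on_subset) simp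
    have "test_fun {0<..<T} (pd 1 \<theta>)" using test_fun_pd[OF \<theta>, of 1] by simp
    from test_fun_continuous[OF this] have c2: "continuous_on {0..T} (pd 1 \<theta>)" by (rule continuous_on_subset) simp
    have "((\<lambda>t. b t * \<theta> t + B t * pd 1 \<theta> t) has_integral B T * \<theta> T - B 0 * \<theta> 0) {0..T}"
    proof (rule fundamental_theorem_of_calculus)
      fix t assume t: "t \<in> {0..T}"
      have "((\<lambda>t. B t * \<theta> t) has_real_derivative b t * \<theta> t + pd 1 \<theta> t * B t) (at t within {0..T})"
        by (rule DERIV_mult[OF dB[OF t] has_field_derivative_at_within[OF pd_real_has_derivative[OF test_fun_differentiable[OF \<theta>]]]])
      then show "((\<lambda>t. B t * \<theta> t) has_vector_derivative b t * \<theta> t + B t * pd 1 \<theta> t) (at t within {0..T})"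
        by (simp add: has_real_derivative_iff_has_vector_derivative mult.commute)
    qed (use T in simp)
    then have 0: "integral {0..T} (\<lambda>t. b t * \<theta> t + B t * pd 1 \<theta> t) = 0"
      using test_fun_outside[OF \<theta>, of 0] test_fun_outside[OF \<theta>, of T] by (simp add: integral_unique)
    have i: "set_integrable lborel {0..T} (\<lambda>t. b t * \<theta> t)" "set_integrable lborel {0..T} (\<lambda>t. B t * pd 1 \<theta> t)" "set_integrable lborel {0..T} (\<lambda>t. a t * pd 1 \<theta> t)"
      by (intro borel_integrable_atLeastAtMost' continuous_on_mult a b cB c1 c2)+
    have "(LINT t:{0..T}|lborel. b t * \<theta> t) + (LINT t:{0..T}|lborel. B t * pd 1 \<theta> t) = 0"
      using 0 set_borel_integral_eq_integral(2)[OF set_integral_add(1)[OF i(1,2)]] set_integral_add(2)[OF i(1,2)] by simp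
    moreover have "(LINT t:{0..T}|lborel. (a t - B t) * pd 1 \<theta> t) = (LINT t:{0..T}|lborel. a t * pd 1 \<theta> t) - (LINT t:{0..T}|lborel. B t * pd 1 \<theta> t)"
      unfolding left_diff_distrib by (rule set_integral_diff(2)[OF i(3,2)])
    ultimately show "(LINT t:{0..T}|lborel. (a t - B t) * pd 1 \<theta> t) = 0" using eq[OF \<theta>] by simp
  qed (use t T in auto)
  then show ?thesis by (simp add: B_def)
qed

lemma time_integral_tendsto:
  assumes u: "contL2 T M u" and X: "\<And>n. sqint M (X n)" "sqint M Y" "(\<lambda>n. nrm M (\<lambda>x. X n x - Y x)) \<longlonglongrightarrow> 0"
    and \<theta>: "continuous_on {0..T} \<theta>"
  shows "(\<lambda>n. LINT t:{0..T}|lborel. ip M (u t) (X n) * \<theta> t) \<longlonglongrightarrow> (LINT t:{0..T}|lborel. ip M (u t) Y * \<theta> t)"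
proof -
  obtain U where U: "U \<ge> 0" "\<And>t. t \<in> {0..T} \<Longrightarrow> nrm M (u t) \<le> U" using contL2_bounded[OF u] by blast
  have "compact (\<theta> ` {0..T})" by (rule compact_continuous_image[OF \<theta>]) simp
  then obtain Q where Q: "\<forall>y\<in>\<theta> ` {0..T}. norm y \<le> Q" using compact_imp_bounded bounded_iff by metis
  have "convergent (\<lambda>n. nrm M (X n))" using nrm_tendsto[OF X] by (rule convergentI)
  then obtain K where K: "K > 0" "\<And>n. norm (nrm M (X n)) \<le> K" using convergent_imp_Bseq BseqE by metis
  have m: "(\<lambda>t. indicator {0..T} t *\<^sub>R (ip M (u t) Z * \<theta> t)) \<in> borel_measurable lborel" if "sqint M Z" for Z
  proof -
    have "set_integrable lborel {0..T} (\<lambda>t. ip M (u t) Z * \<theta> t)"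
      by (intro borel_integrable_atLeastAtMost' continuous_on_mult contL2_ip_continuous[OF u contL2_const[OF that]] \<theta>)
    then show ?thesis unfolding set_integrable_def by (rule borel_measurable_integrable)
  qed
  show ?thesis
    unfolding set_lebesgue_integral_def
  proof (rule integral_dominated_convergence[where w="\<lambda>t. (U * K * \<bar>Q\<bar>) * indicator {0..T} t"])
    show "integrable lborel (\<lambda>t. (U * K * \<bar>Q\<bar>) * indicator {0..T} t)" by (rule integrable_indicator_Icc)
    show "AE t in lborel. (\<lambda>n. indicator {0..T} t *\<^sub>R (ip M (u t) (X n) * \<theta> t)) \<longlonglongrightarrow> indicator {0..T} t *\<^sub>R (ip M (u t) Y * \<theta> t)"
    proof (rule AE_I2)
      fix t
      show "(\<lambda>n. indicator {0..T} t *\<^sub>R (ip M (u t) (X n) * \<theta> t)) \<longlonglongrightarrow> indicator {0..T} t *\<^sub>R (ip M (u t) Y * \<theta> t)"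
      proof (cases "t \<in> {0..T}")
        case True
        have "(\<lambda>n. ip M (u t) (X n)) \<longlonglongrightarrow> ip M (u t) Y"
          using ip_tendsto[OF X(1,2) contL2_sqint[OF u True] X(3)] by (simp only: ip_commute[of M _ "u t"])
        then show ?thesis by (intro tendsto_intros)
      qed simp
    qed
    show "AE t in lborel. norm (indicator {0..T} t *\<^sub>R (ip M (u t) (X n) * \<theta> t)) \<le> (U * K * \<bar>Q\<bar>) * indicator {0..T} t" for n
    proof (rule AE_I2)
      fix t
      show "norm (indicator {0..T} t *\<^sub>R (ip M (u t) (X n) * \<theta> t)) \<le> (U * K * \<bar>Q\<bar>) * indicator {0..T} t"
      proof (cases "t \<in> {0..T}")
        case True
        have "\<bar>ip M (u t) (X n)\<bar> \<le> nrm M (u t) * nrm M (X n)" by (rule ip_Cauchy_Schwarz[OF contL2_sqint[OF u True] X(1)])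
        also have "\<dots> \<le> U * K" using U(1) U(2)[OF True] K(2)[of n] by (intro mult_mono) auto
        finally have "\<bar>ip M (u t) (X n)\<bar> * \<bar>\<theta> t\<bar> \<le> (U * K) * \<bar>Q\<bar>"
          using Q True by (intro mult_mono) (fastforce intro: order_trans[OF _ abs_ge_self])+
        then show ?thesis using True by (simp add: abs_mult)
      qed simp
    qed
  qed (intro m X)+
qed

text \<open>On the Fourier side, \<open>mass \<kappa>\<close> is the operator \<open>1 - \<kappa> \<Delta>\<close>.\<close>

definition mass :: "real \<Rightarrow> (real ^ 'd \<Rightarrow> complex) \<Rightarrow> real ^ 'd \<Rightarrow> complex" where
  "mass \<kappa> k y = k y - \<kappa> *\<^sub>R (\<Sum>j\<in>UNIV. dk (axis j 1) (dk (axis j 1) k) y)"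

lemma mass_eq: "mass \<kappa> k y = (1 + \<kappa> * (norm y)\<^sup>2) *\<^sub>R k y" for y :: "real ^ 'd"
proof -
  have "dk b (dk b k) y = - complex_of_real ((y \<bullet> b)\<^sup>2) * k y" for b
  proof -
    have "dk b (dk b k) y = (\<i> * \<i>) * (complex_of_real (y \<bullet> b) * complex_of_real (y \<bullet> b) * k y)"
      by (simp only: dk_def mult_ac)
    then show ?thesis by (simp add: power2_eq_square)
  qed
  then have "(\<Sum>j\<in>UNIV. dk (axis j 1) (dk (axis j 1) k) y) = - complex_of_real (\<Sum>j\<in>UNIV. (y \<bullet> axis j 1)\<^sup>2) * k y"
    by (simp add: sum_negf sum_distrib_right)
  also have "(\<Sum>j\<in>UNIV. (y \<bullet> axis j 1)\<^sup>2) = (norm y)\<^sup>2"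
  proof -
    have "y \<bullet> y = (\<Sum>j\<in>UNIV. (y \<bullet> axis j 1)\<^sup>2)"
      unfolding power2_eq_square by (subst euclidean_inner) (rule sum_Basis_axis)
    then show ?thesis by (simp only: power2_norm_eq_inner)
  qed
  finally show ?thesis by (simp add: mass_def scaleR_conv_of_real algebra_simps)
qed

lemma kern_mass: "kern k \<Longrightarrow> kern (mass \<kappa> k)"
  unfolding mass_eq[abs_def] scaleR_conv_of_real by (rule kern_mult) (auto intro!: continuous_intros)

lemma ip_E_mass:
  assumes u: "sqint lborel u" and k: "kern k"
  shows "ip lborel u (E (mass \<kappa> k)) = ip lborel u (E k) - \<kappa> * (\<Sum>j\<in>UNIV. ip lborel u (E (dk (axis j 1) (dk (axis j 1) k))))"
proof -
  let ?D = "\<lambda>j. dk (axis j 1) (dk (axis j 1) k)"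
  have D: "kern (?D j)" for j by (intro kern_dk k)
  have S: "kern (\<lambda>y. \<Sum>j\<in>UNIV. ?D j y)" by (intro kern_sum D)
  have S': "kern (\<lambda>y. \<kappa> *\<^sub>R (\<Sum>j\<in>UNIV. ?D j y))"
    unfolding scaleR_conv_of_real by (rule kern_mult[OF S]) auto
  have "E (mass \<kappa> k) = (\<lambda>x. E k x - \<kappa> * (\<Sum>j\<in>UNIV. E (?D j) x))"
    unfolding mass_def[abs_def] by (simp add: fun_eq_iff E_diff[OF k S'] E_scaleR E_sum[OF D])
  moreover have "ip lborel u (\<lambda>x. E k x - \<kappa> * (\<Sum>j\<in>UNIV. E (?D j) x)) = ip lborel u (E k) - ip lborel u (\<lambda>x. \<kappa> * (\<Sum>j\<in>UNIV. E (?D j) x))"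
    by (intro ip_diff_right u E_sqint k sqint_cmult sqint_sum D)
  moreover have "ip lborel u (\<lambda>x. \<Sum>j\<in>UNIV. E (?D j) x) = (\<Sum>j\<in>UNIV. ip lborel u (E (?D j)))"
    by (intro ip_sum_right u E_sqint D) simp
  ultimately show ?thesis by (simp add: ip_cmult_right)
qed

text \<open>On products \<theta>(t) \<psi>(X) the equations are weak differential equations in time.
  \<open>E_approx\<close> allows \<open>E k\<close> in place of \<psi>, the operator on V being
  absorbed into the kernel as \<open>mass\<close>, and \<open>weak_ODE\<close> integrates in
  time.\<close>

lemma modal_integral_equations:
  fixes V :: "real \<Rightarrow> real ^ 'd \<Rightarrow> real ^ 'd"
  assumes sol: "modal_solution s T N c V0 \<rho>0 V \<rho>" and T: "0 < T" and s: "0 \<le> s"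
    and k: "kern k" and t: "t \<in> {0..T}"
  shows "ip lborel (\<lambda>x. V t x $ i) (E (mass (c\<^sup>2 / N\<^sup>2) k))
      = ip lborel (\<lambda>x. V 0 x $ i) (E (mass (c\<^sup>2 / N\<^sup>2) k)) + integral {0..t} (\<lambda>\<tau>. c * ip lborel (\<rho> \<tau>) (E (dk (axis i 1) k)))"
    and "ip lborel (\<rho> t) (E k)
      = ip lborel (\<rho> 0) (E k) + integral {0..t} (\<lambda>\<tau>. c * (\<Sum>i\<in>UNIV. ip lborel (\<lambda>x. V \<tau> x $ i) (E (dk (axis i 1) k))))"
proof -
  define \<kappa> where "\<kappa> = c\<^sup>2 / N\<^sup>2"
  have V: "contL2 T lborel (\<lambda>t x. V t x $ i)" for i using sol by (intro cont_in_Hs[OF _ s]) (simp add: modal_solution_def)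
  have \<rho>: "contL2 T lborel \<rho>" using sol by (intro cont_in_Hs[OF _ s]) (simp add: modal_solution_def)
  let ?I = "\<lambda>u \<theta> (X :: real ^ 'd \<Rightarrow> real). LINT t:{0..T}|lborel. ip lborel (u t) X * \<theta> t"
  let ?V = "\<lambda>i t x. V t x $ i"
  have weak: "?I (?V i) (pd 1 \<theta>) \<psi> - \<kappa> * (\<Sum>j\<in>UNIV. ?I (?V i) (pd 1 \<theta>) (pd (axis j 1) (pd (axis j 1) \<psi>))) + c * ?I \<rho> \<theta> (pd (axis i 1) \<psi>) = 0"
    "?I \<rho> (pd 1 \<theta>) \<psi> + c * (\<Sum>i\<in>UNIV. ?I (?V i) \<theta> (pd (axis i 1) \<psi>)) = 0"
    if \<theta>: "test_fun {0<..<T} \<theta>" and \<psi>: "test_fun UNIV \<psi>" for \<theta> \<psi> i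
  proof -
    have \<psi>j: "test_fun UNIV (pd (axis j 1) \<psi>)" for j by (rule test_fun_pd[OF \<psi> axis_Basis])
    have \<psi>jj: "test_fun UNIV (pd (axis j 1) (pd (axis j 1) \<psi>))" for j by (rule test_fun_pd[OF \<psi>j axis_Basis])
    note pds = pd_dt_tensor[OF \<theta> \<psi>] pd_dx_tensor[OF \<theta> \<psi>] pd_dx_tensor[OF \<theta> \<psi>j] pd_dt_tensor[OF \<theta> \<psi>jj]
    have tt: "test_fun ({0<..<T} \<times> UNIV) (tensor \<theta> \<psi>)" by (rule test_fun_tensor[OF \<theta> \<psi>])
    have "D dt (regT T lborel (?V i)) (tensor \<theta> \<psi>)
              - c\<^sup>2 / N\<^sup>2 * (\<Sum>j\<in>UNIV. D (dx j) (D (dx j) (D dt (regT T lborel (?V i)))) (tensor \<theta> \<psi>))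
              + c * D (dx i) (regT T lborel \<rho>) (tensor \<theta> \<psi>) = 0"
      "D dt (regT T lborel \<rho>) (tensor \<theta> \<psi>) + c * (\<Sum>i\<in>UNIV. D (dx i) (regT T lborel (?V i)) (tensor \<theta> \<psi>)) = 0"
      using sol tt unfolding modal_solution_def by blast+
    then show "?I (?V i) (pd 1 \<theta>) \<psi> - \<kappa> * (\<Sum>j\<in>UNIV. ?I (?V i) (pd 1 \<theta>) (pd (axis j 1) (pd (axis j 1) \<psi>))) + c * ?I \<rho> \<theta> (pd (axis i 1) \<psi>) = 0"
      "?I \<rho> (pd 1 \<theta>) \<psi> + c * (\<Sum>i\<in>UNIV. ?I (?V i) \<theta> (pd (axis i 1) \<psi>)) = 0"
      unfolding D_def pds regT_tensor by (simp_all add: \<kappa>_def sum_negf)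
  qed
  obtain \<psi> where \<psi>: "\<And>n. test_fun UNIV (\<psi> n)" "\<And>n. sqint lborel (\<psi> n)" "(\<lambda>n. nrm lborel (\<lambda>x. \<psi> n x - E k x)) \<longlonglongrightarrow> 0"
    and \<psi>': "\<And>b n. b \<in> Basis \<Longrightarrow> sqint lborel (pd b (\<psi> n))" "\<And>b. b \<in> Basis \<Longrightarrow> (\<lambda>n. nrm lborel (\<lambda>x. pd b (\<psi> n) x - E (dk b k) x)) \<longlonglongrightarrow> 0"
    and \<psi>'': "\<And>b n. b \<in> Basis \<Longrightarrow> sqint lborel (pd b (pd b (\<psi> n)))" "\<And>b. b \<in> Basis \<Longrightarrow> (\<lambda>n. nrm lborel (\<lambda>x. pd b (pd b (\<psi> n)) x - E (dk b (dk b k)) x)) \<longlonglongrightarrow> 0"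
  proof -
    obtain \<psi> where \<psi>: "\<forall>n. test_fun UNIV (\<psi> n)" "\<forall>n. sqint lborel (\<psi> n)" "(\<lambda>n. nrm lborel (\<lambda>x. \<psi> n x - E k x)) \<longlonglongrightarrow> 0"
      "\<forall>b\<in>Basis. (\<forall>n. sqint lborel (pd b (\<psi> n))) \<and> (\<lambda>n. nrm lborel (\<lambda>x. pd b (\<psi> n) x - E (dk b k) x)) \<longlonglongrightarrow> 0 \<and>
      (\<forall>n. sqint lborel (pd b (pd b (\<psi> n)))) \<and>
      (\<lambda>n. nrm lborel (\<lambda>x. pd b (pd b (\<psi> n)) x - E (dk b (dk b k)) x)) \<longlonglongrightarrow> 0"
      using E_approx[OF k] by (elim exE conjE) (rule that)
    show ?thesis by (rule that[of \<psi>]) (simp_all add: \<psi>)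
  qed
  have lim: "(\<lambda>n. ?I u \<theta> (\<psi> n)) \<longlonglongrightarrow> ?I u \<theta> (E k)"
    "(\<lambda>n. ?I u \<theta> (pd (axis j 1) (\<psi> n))) \<longlonglongrightarrow> ?I u \<theta> (E (dk (axis j 1) k))"
    "(\<lambda>n. ?I u \<theta> (pd (axis j 1) (pd (axis j 1) (\<psi> n)))) \<longlonglongrightarrow> ?I u \<theta> (E (dk (axis j 1) (dk (axis j 1) k)))"
    if "contL2 T lborel u" "continuous_on {0..T} \<theta>" for u \<theta> j
    using that time_integral_tendsto[OF that(1) \<psi>(2) E_sqint[OF k] \<psi>(3) that(2)]
      time_integral_tendsto[OF that(1) \<psi>'(1)[OF axis_Basis] E_sqint[OF kern_dk[OF k]] \<psi>'(2)[OF axis_Basis] that(2)]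
      time_integral_tendsto[OF that(1) \<psi>''(1)[OF axis_Basis] E_sqint[OF kern_dk[OF kern_dk[OF k]]] \<psi>''(2)[OF axis_Basis] that(2)]
    by blast+
  have c\<theta>: "continuous_on {0..T} \<theta>" "continuous_on {0..T} (pd 1 \<theta>)" if \<theta>: "test_fun {0<..<T} \<theta>" for \<theta> :: "real \<Rightarrow> real"
  proof -
    have "test_fun {0<..<T} (pd 1 \<theta>)" using test_fun_pd[OF \<theta>, of 1] by simp
    then show "continuous_on {0..T} \<theta>" "continuous_on {0..T} (pd 1 \<theta>)"
      using test_fun_continuous \<theta> continuous_on_subset by blast+
  qed
  have cV: "continuous_on {0..T} (\<lambda>t. ip lborel (\<lambda>x. V t x $ i) (E m))" if "kern m" for i m
    by (rule contL2_ip_continuous[OF V contL2_const[OF E_sqint[OF that]]])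
  have c\<rho>: "continuous_on {0..T} (\<lambda>t. ip lborel (\<rho> t) (E m))" if "kern m" for m
    by (rule contL2_ip_continuous[OF \<rho> contL2_const[OF E_sqint[OF that]]])
  show "ip lborel (\<lambda>x. V t x $ i) (E (mass (c\<^sup>2 / N\<^sup>2) k))
      = ip lborel (\<lambda>x. V 0 x $ i) (E (mass (c\<^sup>2 / N\<^sup>2) k)) + integral {0..t} (\<lambda>\<tau>. c * ip lborel (\<rho> \<tau>) (E (dk (axis i 1) k)))"
    unfolding \<kappa>_def[symmetric]
  proof (rule weak_ODE[OF T cV[OF kern_mass[OF k]] continuous_on_mult_left[OF c\<rho>[OF kern_dk[OF k]]] _ t])
    fix \<theta> :: "real \<Rightarrow> real" assume \<theta>: "test_fun {0<..<T} \<theta>"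
    have lims: "(\<lambda>n. ?I (?V i) (pd 1 \<theta>) (\<psi> n) - \<kappa> * (\<Sum>j\<in>UNIV. ?I (?V i) (pd 1 \<theta>) (pd (axis j 1) (pd (axis j 1) (\<psi> n)))) + c * ?I \<rho> \<theta> (pd (axis i 1) (\<psi> n)))
      \<longlonglongrightarrow> ?I (?V i) (pd 1 \<theta>) (E k) - \<kappa> * (\<Sum>j\<in>UNIV. ?I (?V i) (pd 1 \<theta>) (E (dk (axis j 1) (dk (axis j 1) k)))) + c * ?I \<rho> \<theta> (E (dk (axis i 1) k))"
      by (intro tendsto_add tendsto_diff tendsto_mult_left tendsto_sum lim V \<rho> c\<theta>(1)[OF \<theta>] c\<theta>(2)[OF \<theta>])
    have 0: "?I (?V i) (pd 1 \<theta>) (E k) - \<kappa> * (\<Sum>j\<in>UNIV. ?I (?V i) (pd 1 \<theta>) (E (dk (axis j 1) (dk (axis j 1) k)))) + c * ?I \<rho> \<theta> (E (dk (axis i 1) k)) = 0"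
      using lims unfolding weak(1)[OF \<theta> \<psi>(1)] by (simp add: LIMSEQ_const_iff)
    have i: "set_integrable lborel {0..T} (\<lambda>t. ip lborel (\<lambda>x. V t x $ i) (E m) * pd 1 \<theta> t)" if "kern m" for m
      by (intro borel_integrable_atLeastAtMost' continuous_on_mult cV that c\<theta>(2)[OF \<theta>])
    note i2 = i[OF kern_dk[OF kern_dk[OF k]]]
    have "(LINT t:{0..T}|lborel. ip lborel (\<lambda>x. V t x $ i) (E (mass \<kappa> k)) * pd 1 \<theta> t)
      = (LINT t:{0..T}|lborel. ip lborel (\<lambda>x. V t x $ i) (E k) * pd 1 \<theta> t - \<kappa> * (\<Sum>j\<in>UNIV. ip lborel (\<lambda>x. V t x $ i) (E (dk (axis j 1) (dk (axis j 1) k))) * pd 1 \<theta> t))"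
      by (rule set_lebesgue_integral_cong)
         (auto simp: ip_E_mass[OF contL2_sqint[OF V] k] left_diff_distrib sum_distrib_right mult.assoc)
    also have "\<dots> = ?I (?V i) (pd 1 \<theta>) (E k) - (LINT t:{0..T}|lborel. \<kappa> * (\<Sum>j\<in>UNIV. ip lborel (\<lambda>x. V t x $ i) (E (dk (axis j 1) (dk (axis j 1) k))) * pd 1 \<theta> t))"
      by (rule set_integral_diff(2)[OF i[OF k] set_integrable_mult_right[OF LINT_sum(1)[OF i2]]])
    also have "\<dots> = ?I (?V i) (pd 1 \<theta>) (E k) - \<kappa> * (\<Sum>j\<in>UNIV. ?I (?V i) (pd 1 \<theta>) (E (dk (axis j 1) (dk (axis j 1) k))))"
      by (simp only: set_integral_mult_right LINT_sum(2)[OF i2])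
    finally show "(LINT t:{0..T}|lborel. ip lborel (\<lambda>x. V t x $ i) (E (mass \<kappa> k)) * pd 1 \<theta> t)
      + (LINT t:{0..T}|lborel. c * ip lborel (\<rho> t) (E (dk (axis i 1) k)) * \<theta> t) = 0"
      using 0 by (simp add: mult.assoc)
  qed
  have cs: "continuous_on {0..T} (\<lambda>t. c * (\<Sum>i\<in>UNIV. ip lborel (\<lambda>x. V t x $ i) (E (dk (axis i 1) k))))"
    by (intro continuous_on_mult_left continuous_on_sum cV kern_dk k)
  show "ip lborel (\<rho> t) (E k)
      = ip lborel (\<rho> 0) (E k) + integral {0..t} (\<lambda>\<tau>. c * (\<Sum>i\<in>UNIV. ip lborel (\<lambda>x. V \<tau> x $ i) (E (dk (axis i 1) k))))"
  proof (rule weak_ODE[OF T c\<rho>[OF k] cs _ t])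
    fix \<theta> :: "real \<Rightarrow> real" assume \<theta>: "test_fun {0<..<T} \<theta>"
    have lims: "(\<lambda>n. ?I \<rho> (pd 1 \<theta>) (\<psi> n) + c * (\<Sum>i\<in>UNIV. ?I (?V i) \<theta> (pd (axis i 1) (\<psi> n))))
      \<longlonglongrightarrow> ?I \<rho> (pd 1 \<theta>) (E k) + c * (\<Sum>i\<in>UNIV. ?I (?V i) \<theta> (E (dk (axis i 1) k)))"
      by (intro tendsto_add tendsto_mult_left tendsto_sum lim V \<rho> c\<theta>(1)[OF \<theta>] c\<theta>(2)[OF \<theta>])
    have 0: "?I \<rho> (pd 1 \<theta>) (E k) + c * (\<Sum>i\<in>UNIV. ?I (?V i) \<theta> (E (dk (axis i 1) k))) = 0"
      using lims unfolding weak(2)[OF \<theta> \<psi>(1)] by (simp add: LIMSEQ_const_iff)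
    have i: "set_integrable lborel {0..T} (\<lambda>t. ip lborel (\<lambda>x. V t x $ i) (E (dk (axis i 1) k)) * \<theta> t)" for i
      by (intro borel_integrable_atLeastAtMost' continuous_on_mult cV kern_dk k c\<theta>(1)[OF \<theta>])
    have "(LINT t:{0..T}|lborel. c * (\<Sum>i\<in>UNIV. ip lborel (\<lambda>x. V t x $ i) (E (dk (axis i 1) k))) * \<theta> t)
      = c * (\<Sum>i\<in>UNIV. ?I (?V i) \<theta> (E (dk (axis i 1) k)))"
      by (simp only: mult.assoc sum_distrib_right set_integral_mult_right LINT_sum(2)[OF i])
    then show "(LINT t:{0..T}|lborel. ip lborel (\<rho> t) (E k) * pd 1 \<theta> t)
      + (LINT t:{0..T}|lborel. c * (\<Sum>i\<in>UNIV. ip lborel (\<lambda>x. V t x $ i) (E (dk (axis i 1) k))) * \<theta> t) = 0"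
      using 0 by simp
  qed
qed

text \<open>One step of the iteration: integration in time turns the n-th term of the exponential
  series into the next one.\<close>

lemma integral_power_bound:
  fixes F :: "real \<Rightarrow> real"
  assumes F: "continuous_on {0..t} F" and t: "0 \<le> t"
    and le: "\<And>\<tau>. \<tau> \<in> {0..t} \<Longrightarrow> \<bar>F \<tau>\<bar> \<le> A * C * ((C * \<tau>) ^ n / fact n)"
  shows "\<bar>integral {0..t} F\<bar> \<le> A * ((C * t) ^ Suc n / fact (Suc n))"
proof -
  have "((\<lambda>\<tau>. A * C * ((C * \<tau>) ^ n / fact n)) has_integral
      A * ((C * t) ^ Suc n / fact (Suc n)) - A * ((C * 0) ^ Suc n / fact (Suc n))) {0..t}"
  proof (rule fundamental_theorem_of_calculus[OF t])
    fix \<tau> :: real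
    have "((\<lambda>\<tau>. (C * \<tau>) ^ Suc n) has_real_derivative real (Suc n) * (C * \<tau>) ^ n * C) (at \<tau> within {0..t})"
    proof -
      have "((\<lambda>\<tau>. C * \<tau>) has_real_derivative C) (at \<tau> within {0..t})" by (auto intro!: derivative_eq_intros)
      from DERIV_power[OF this, of "Suc n"] show ?thesis by (simp add: mult_ac del: of_nat_Suc power_Suc)
    qed
    then have "((\<lambda>\<tau>. A * ((C * \<tau>) ^ Suc n / fact (Suc n))) has_real_derivative A * (real (Suc n) * (C * \<tau>) ^ n * C / fact (Suc n))) (at \<tau> within {0..t})"
      by (intro DERIV_cmult DERIV_cdivide)
    also have "A * (real (Suc n) * (C * \<tau>) ^ n * C / fact (Suc n)) = A * C * ((C * \<tau>) ^ n / fact n)"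
      by (simp add: divide_simps del: of_nat_Suc)
    finally show "((\<lambda>\<tau>. A * ((C * \<tau>) ^ Suc n / fact (Suc n))) has_vector_derivative A * C * ((C * \<tau>) ^ n / fact n)) (at \<tau> within {0..t})"
      by (simp add: has_real_derivative_iff_has_vector_derivative)
  qed
  then have I: "((\<lambda>\<tau>. A * C * ((C * \<tau>) ^ n / fact n)) has_integral A * ((C * t) ^ Suc n / fact (Suc n))) {0..t}" by simp
  have "norm (integral {0..t} F) \<le> integral {0..t} (\<lambda>\<tau>. A * C * ((C * \<tau>) ^ n / fact n))"
    by (rule Henstock_Kurzweil_Integration.integral_norm_bound_integral[OF integrable_continuous_real[OF F] has_integral_integrable[OF I]]) (use le in simp)
  then show ?thesis using integral_unique[OF I] by simp
qed

text \<open>Bernstein's inequality, read on the kernel: on its support the factor of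
  \<open>dk\<close> is at most R.\<close>

lemma nrm_dk_le:
  fixes k :: "'a::euclidean_space \<Rightarrow> complex"
  assumes k: "kern k" and R: "0 \<le> R" "\<And>y. norm y > R \<Longrightarrow> k y = 0" and b: "b \<in> Basis"
  shows "nrm lborel (dk b k) \<le> R * nrm lborel k"
proof -
  have "norm (dk b k y) \<le> norm (R *\<^sub>R k y)" for y
  proof (cases "norm y > R")
    case False
    have "\<bar>y \<bullet> b\<bar> \<le> R" using Basis_le_norm[OF b, of y] False by simp
    then show ?thesis using R(1) by (simp add: dk_def norm_mult mult_right_mono)
  qed (simp add: dk_def R(2))
  then have "nrm lborel (dk b k) \<le> nrm lborel (\<lambda>y. R *\<^sub>R k y)"
    using kern_sqint[OF k] kern_sqint[OF kern_dk[OF k, of b]] by (intro nrm_mono sqint_scaleR) (auto simp: sqint_def)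
  then show ?thesis using R(1) by (simp add: nrm_scaleR)
qed

lemma power_over_fact_tendsto_0: "(\<lambda>n. x ^ n / fact n) \<longlonglongrightarrow> (0::real)"
  using summable_LIMSEQ_zero[OF summable_exp[of x]] by (simp add: divide_inverse mult.commute)

theorem modal_solution_unique:
  fixes V V' :: "real \<Rightarrow> real ^ 'd \<Rightarrow> real ^ 'd"
  assumes sol: "modal_solution s T N c V0 \<rho>0 V \<rho>" and sol': "modal_solution s T N c V0 \<rho>0 V' \<rho>'"
    and T: "0 < T" and s: "0 \<le> s" and t: "t \<in> {0..T}"
  shows "AE X in lborel. V' t X = V t X \<and> \<rho>' t X = \<rho> t X"
proof -
  define \<kappa> where "\<kappa> = c\<^sup>2 / N\<^sup>2"
  have \<kappa>: "0 \<le> \<kappa>" by (simp add: \<kappa>_def)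
  have V: "contL2 T lborel (\<lambda>t x. V t x $ i)" "contL2 T lborel (\<lambda>t x. V' t x $ i)" for i
    using sol sol' by (auto intro!: cont_in_Hs[OF _ s] simp: modal_solution_def)
  have \<rho>: "contL2 T lborel \<rho>" "contL2 T lborel \<rho>'" using sol sol' by (auto intro!: cont_in_Hs[OF _ s] simp: modal_solution_def)
  define a where "a i t k = ip lborel (\<lambda>x. V' t x $ i) (E k) - ip lborel (\<lambda>x. V t x $ i) (E k)" for i t k
  define q where "q t k = ip lborel (\<rho>' t) (E k) - ip lborel (\<rho> t) (E k)" for t k
  note eqs = modal_integral_equations[OF sol T s, folded \<kappa>_def] and eqs' = modal_integral_equations[OF sol' T s, folded \<kappa>_def]
  have ca: "continuous_on {0..T} (\<lambda>t. a i t k)" if "kern k" for i k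
    unfolding a_def by (intro continuous_on_diff contL2_ip_continuous V contL2_const E_sqint that)
  have cq: "continuous_on {0..T} (\<lambda>t. q t k)" if "kern k" for k
    unfolding q_def by (intro continuous_on_diff contL2_ip_continuous \<rho> contL2_const E_sqint that)
  have sub: "{0..t} \<subseteq> {0..T}" if "t \<in> {0..T}" for t using that by auto
  have cE: "continuous_on {0..t} (\<lambda>\<tau>. ip lborel (u \<tau>) (E k))" if "contL2 T lborel u" "kern k" "t \<in> {0..T}" for u t and k :: "real ^ 'd \<Rightarrow> complex"
    by (rule continuous_on_subset[OF contL2_ip_continuous[OF that(1) contL2_const[OF E_sqint[OF that(2)]]] sub[OF that(3)]])
  have t0: "0 \<in> {0..T}" using T by simp
  have init: "ip lborel (\<lambda>x. V' 0 x $ i) (E k) = ip lborel (\<lambda>x. V 0 x $ i) (E k)" "ip lborel (\<rho>' 0) (E k) = ip lborel (\<rho> 0) (E k)"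
    if k: "kern k" for i k
  proof -
    have "AE X in lborel. V 0 X = V0 X \<and> \<rho> 0 X = \<rho>0 X" "AE X in lborel. V' 0 X = V0 X \<and> \<rho>' 0 X = \<rho>0 X"
      using sol sol' by (simp_all add: modal_solution_def)
    then have ae: "AE X in lborel. V' 0 X $ i = V 0 X $ i" "AE X in lborel. \<rho>' 0 X = \<rho> 0 X"
      by (eventually_elim, simp)+
    have m: "(\<lambda>x. V' 0 x $ i) \<in> borel_measurable lborel" "(\<lambda>x. V 0 x $ i) \<in> borel_measurable lborel" "\<rho>' 0 \<in> borel_measurable lborel" "\<rho> 0 \<in> borel_measurable lborel" "E k \<in> borel_measurable lborel"
      using contL2_sqint[OF V(1) t0] contL2_sqint[OF V(2) t0] contL2_sqint[OF \<rho>(1) t0] contL2_sqint[OF \<rho>(2) t0] E_sqint[OF k] by (auto simp: sqint_def)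
    show "ip lborel (\<lambda>x. V' 0 x $ i) (E k) = ip lborel (\<lambda>x. V 0 x $ i) (E k)" "ip lborel (\<rho>' 0) (E k) = ip lborel (\<rho> 0) (E k)"
      using ae m by (auto intro: ip_cong_AE)
  qed
  have A: "a i t (mass \<kappa> k) = integral {0..t} (\<lambda>\<tau>. c * q \<tau> (dk (axis i 1) k))" if k: "kern k" and t: "t \<in> {0..T}" for i k t
  proof -
    have i: "(\<lambda>\<tau>. c * ip lborel (u \<tau>) (E (dk (axis i 1) k))) integrable_on {0..t}" if "contL2 T lborel u" for u
      by (intro integrable_continuous_real continuous_on_mult_left cE[OF that] kern_dk k t)
    show ?thesis
      unfolding a_def q_def right_diff_distrib integral_diff[OF i[OF \<rho>(2)] i[OF \<rho>(1)]]
      using eqs(1)[OF k t] eqs'(1)[OF k t] init(1)[OF kern_mass[OF k]] by simp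
  qed
  have B: "q t k = integral {0..t} (\<lambda>\<tau>. c * (\<Sum>i\<in>UNIV. a i \<tau> (dk (axis i 1) k)))" if k: "kern k" and t: "t \<in> {0..T}" for k t
  proof -
    have i: "(\<lambda>\<tau>. c * (\<Sum>i\<in>UNIV. ip lborel (u i \<tau>) (E (dk (axis i 1) k)))) integrable_on {0..t}" if "\<And>i. contL2 T lborel (u i)" for u
      by (intro integrable_continuous_real continuous_on_mult_left continuous_on_sum cE[OF that] kern_dk k t)
    show ?thesis
      unfolding a_def q_def sum_subtractf right_diff_distrib integral_diff[OF i[OF V(2)] i[OF V(1)]]
      using eqs(2)[OF k t] eqs'(2)[OF k t] init(2)[OF k] by simp
  qed
  \<comment> \<open>The start of the iteration: both differences are bounded by a multiple of the
    norm of the kernel, uniformly in t and in the component.\<close>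
  obtain M where M: "M \<ge> 0" "\<And>i t k. kern k \<Longrightarrow> t \<in> {0..T} \<Longrightarrow> \<bar>a i t k\<bar> \<le> M * nrm lborel k"
    "\<And>t k. kern k \<Longrightarrow> t \<in> {0..T} \<Longrightarrow> \<bar>q t k\<bar> \<le> M * nrm lborel k"
  proof -
    let ?F = "fnorm TYPE(real ^ 'd)"
    have F: "0 \<le> ?F" using fnorm_pos[where 'a="real ^ 'd"] by simp
    have bd: "\<exists>B\<ge>0. \<forall>t\<in>{0..T}. \<forall>k. kern k \<longrightarrow> \<bar>ip lborel (u' t) (E k) - ip lborel (u t) (E k)\<bar> \<le> B * nrm lborel k"
      if u: "contL2 T lborel u" "contL2 T lborel u'" for u u' :: "real \<Rightarrow> real ^ 'd \<Rightarrow> real"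
    proof -
      obtain B where B: "B \<ge> 0" "\<And>t. t \<in> {0..T} \<Longrightarrow> nrm lborel (u t) \<le> B" using contL2_bounded[OF u(1)] by blast
      obtain B' where B': "B' \<ge> 0" "\<And>t. t \<in> {0..T} \<Longrightarrow> nrm lborel (u' t) \<le> B'" using contL2_bounded[OF u(2)] by blast
      have "\<bar>ip lborel (u' t) (E k) - ip lborel (u t) (E k)\<bar> \<le> ((B' + B) * ?F) * nrm lborel k" if t: "t \<in> {0..T}" and k: "kern k" for t k
      proof -
        have "\<bar>ip lborel (u' t) (E k) - ip lborel (u t) (E k)\<bar> \<le> nrm lborel (u' t) * nrm lborel (E k) + nrm lborel (u t) * nrm lborel (E k)"
          using ip_Cauchy_Schwarz[OF contL2_sqint[OF u(1) t] E_sqint[OF k]] ip_Cauchy_Schwarz[OF contL2_sqint[OF u(2) t] E_sqint[OF k]] by linarith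
        also have "\<dots> \<le> B' * (?F * nrm lborel k) + B * (?F * nrm lborel k)"
          by (intro add_mono mult_mono B B' t nrm_E_le[OF k]) auto
        finally show ?thesis by (simp add: algebra_simps)
      qed
      then show ?thesis using B(1) B'(1) F by (intro exI[of _ "(B' + B) * ?F"]) auto
    qed
    have "\<exists>B. \<forall>i. B i \<ge> 0 \<and> (\<forall>t\<in>{0..T}. \<forall>k. kern k \<longrightarrow> \<bar>a i t k\<bar> \<le> B i * nrm lborel k)"
      using choice[of "\<lambda>i B. B \<ge> 0 \<and> (\<forall>t\<in>{0..T}. \<forall>k. kern k \<longrightarrow> \<bar>a i t k\<bar> \<le> B * nrm lborel k)"] bd[OF V] unfolding a_def by blast
    then obtain B where B: "\<And>i. B i \<ge> 0" "\<And>i t k. t \<in> {0..T} \<Longrightarrow> kern k \<Longrightarrow> \<bar>a i t k\<bar> \<le> B i * nrm lborel k" by blast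
    obtain B' where B': "B' \<ge> 0" "\<And>t k. t \<in> {0..T} \<Longrightarrow> kern k \<Longrightarrow> \<bar>q t k\<bar> \<le> B' * nrm lborel k"
      using bd[OF \<rho>] unfolding q_def by blast
    have Bi: "B i \<le> sum B UNIV" for i using B(1) by (intro member_le_sum) auto
    show ?thesis
    proof (rule that[of "sum B UNIV + B'"])
      show "0 \<le> sum B UNIV + B'" using B(1) B'(1) by (intro add_nonneg_nonneg sum_nonneg) auto
      show "\<bar>a i t k\<bar> \<le> (sum B UNIV + B') * nrm lborel k" if "kern k" "t \<in> {0..T}" for i t k
        by (rule order_trans[OF B(2)[OF that(2,1)] mult_right_mono]) (use Bi[of i] B'(1) in auto)
      show "\<bar>q t k\<bar> \<le> (sum B UNIV + B') * nrm lborel k" if "kern k" "t \<in> {0..T}" for t k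
        by (rule order_trans[OF B'(2)[OF that(2,1)] mult_right_mono]) (use sum_nonneg[of UNIV B] B(1) in auto)
    qed
  qed
  have zero: "a i t k = 0 \<and> q t k = 0" if k: "kern k" for i k
  proof -
    obtain R where R: "R \<ge> 0" "\<And>y. norm y > R \<Longrightarrow> k y = 0" using kernE[OF k] by blast
    define d where "d = real CARD('d)"
    have d: "1 \<le> d" unfolding d_def by (simp add: Suc_leI)
    \<comment> \<open>|c| R is the cost of one derivative in the ball of radius R; \<open>d\<close>
      counts the terms of the divergence.\<close>
    define C where "C = \<bar>c\<bar> * R * d"
    have C: "0 \<le> C" "\<bar>c\<bar> * R \<le> C" using R(1) d mult_left_mono[of 1 d "\<bar>c\<bar> * R"] by (auto simp: C_def)
    \<comment> \<open>R is fixed while the kernel \<open>m\<close> varies: the induction step passes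
      to \<open>dk\<close> of \<open>m\<close> and of \<open>m'\<close>, which live in the same ball
      and obey the same bound with the same \<open>C\<close>.\<close>
    have bound: "(\<forall>i. \<bar>a i t m\<bar> \<le> (M * nrm lborel m) * ((C * t) ^ n / fact n)) \<and> \<bar>q t m\<bar> \<le> (M * nrm lborel m) * ((C * t) ^ n / fact n)"
      if "kern m" "\<And>y. norm y > R \<Longrightarrow> m y = 0" "t \<in> {0..T}" for m t n
      using that
    proof (induction n arbitrary: m t)
      case 0
      then show ?case using M by simp
    next
      case (Suc n)
      note m = Suc.prems(1) and t = Suc.prems(3)
      have dkR: "dk b m' y = 0" if "norm y > R" "\<And>x. norm x > R \<Longrightarrow> m' x = 0" for b y :: "real ^ 'd" and m' :: "real ^ 'd \<Rightarrow> complex" using that by (simp add: dk_def)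
      have p: "0 \<le> (C * \<tau>) ^ n / fact n" if "\<tau> \<in> {0..t}" for \<tau> using that C(1) by simp
      have qb: "\<bar>q t m\<bar> \<le> (M * nrm lborel m) * ((C * t) ^ Suc n / fact (Suc n))"
        unfolding B[OF m t]
      proof (rule integral_power_bound)
        show "continuous_on {0..t} (\<lambda>\<tau>. c * (\<Sum>i\<in>UNIV. a i \<tau> (dk (axis i 1) m)))"
          by (rule continuous_on_subset[OF _ sub[OF t]]) (intro continuous_on_mult_left continuous_on_sum ca kern_dk m)
        fix \<tau> assume \<tau>: "\<tau> \<in> {0..t}"
        then have \<tau>': "\<tau> \<in> {0..T}" using t by auto
        have "\<bar>a i \<tau> (dk (axis i 1) m)\<bar> \<le> (M * (R * nrm lborel m)) * ((C * \<tau>) ^ n / fact n)" for i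
        proof -
          have "\<bar>a i \<tau> (dk (axis i 1) m)\<bar> \<le> (M * nrm lborel (dk (axis i 1) m)) * ((C * \<tau>) ^ n / fact n)"
            using Suc.IH[OF kern_dk[OF m] dkR[OF _ Suc.prems(2)] \<tau>'] by blast
          also have "\<dots> \<le> (M * (R * nrm lborel m)) * ((C * \<tau>) ^ n / fact n)"
            by (intro mult_right_mono mult_left_mono nrm_dk_le[OF m R(1) Suc.prems(2) axis_Basis] M(1) p[OF \<tau>])
          finally show ?thesis .
        qed
        then have "\<bar>\<Sum>i\<in>UNIV. a i \<tau> (dk (axis i 1) m)\<bar> \<le> (\<Sum>i\<in>(UNIV :: 'd set). (M * (R * nrm lborel m)) * ((C * \<tau>) ^ n / fact n))"
          by (intro order_trans[OF sum_abs] sum_mono) auto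
        then have "\<bar>c\<bar> * \<bar>\<Sum>i\<in>UNIV. a i \<tau> (dk (axis i 1) m)\<bar> \<le> \<bar>c\<bar> * (d * ((M * (R * nrm lborel m)) * ((C * \<tau>) ^ n / fact n)))"
          by (intro mult_left_mono) (auto simp: d_def)
        then show "\<bar>c * (\<Sum>i\<in>UNIV. a i \<tau> (dk (axis i 1) m))\<bar> \<le> (M * nrm lborel m) * C * ((C * \<tau>) ^ n / fact n)"
          unfolding abs_mult by (simp add: C_def mult_ac)
      qed (use t in auto)
      have ab: "\<bar>a i t m\<bar> \<le> (M * nrm lborel m) * ((C * t) ^ Suc n / fact (Suc n))" for i
      proof -
        \<comment> \<open>The equation for V determines the pairing only with kernels of the form
          \<open>mass \<kappa> k\<close>, so the symbol 1 + \<kappa> |y|^2 is inverted. As it is at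
          least 1, neither norm nor support grows.\<close>
        define m' where "m' y = (1 / (1 + \<kappa> * (norm y)\<^sup>2)) *\<^sub>R m y" for y
        have nz: "1 + \<kappa> * (norm y)\<^sup>2 \<ge> 1" for y :: "real ^ 'd" using \<kappa> by simp
        have m': "kern m'"
          unfolding m'_def[abs_def] scaleR_conv_of_real
        proof (rule kern_mult[OF m], intro continuous_intros ballI)
          show "1 + \<kappa> * (norm y)\<^sup>2 \<noteq> 0" for y :: "real ^ 'd" using nz[of y] by linarith
        qed
        have m'R: "m' y = 0" if "norm y > R" for y :: "real ^ 'd" using Suc.prems(2)[OF that] by (simp add: m'_def)
        have mm: "mass \<kappa> m' = m"
        proof
          fix y :: "real ^ 'd"
          have "1 + \<kappa> * (norm y)\<^sup>2 \<noteq> 0" using nz[of y] by linarith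
          then show "mass \<kappa> m' y = m y" by (simp add: mass_eq m'_def)
        qed
        have "norm (m' y) \<le> norm (m y)" for y
          using nz[of y] mult_right_mono[of "1 / (1 + \<kappa> * (norm y)\<^sup>2)" 1 "norm (m y)"] by (simp add: m'_def)
        then have nm: "nrm lborel m' \<le> nrm lborel m"
          using kern_sqint[OF m] kern_sqint[OF m'] by (intro nrm_mono) (auto simp: sqint_def)
        have "\<bar>a i t (mass \<kappa> m')\<bar> \<le> (M * nrm lborel m) * ((C * t) ^ Suc n / fact (Suc n))"
          unfolding A[OF m' t]
        proof (rule integral_power_bound)
          show "continuous_on {0..t} (\<lambda>\<tau>. c * q \<tau> (dk (axis i 1) m'))"
            by (rule continuous_on_subset[OF _ sub[OF t]]) (intro continuous_on_mult_left cq kern_dk m')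
          fix \<tau> assume \<tau>: "\<tau> \<in> {0..t}"
          then have \<tau>': "\<tau> \<in> {0..T}" using t by auto
          have "\<bar>q \<tau> (dk (axis i 1) m')\<bar> \<le> (M * nrm lborel (dk (axis i 1) m')) * ((C * \<tau>) ^ n / fact n)"
            using Suc.IH[OF kern_dk[OF m'] dkR[OF _ m'R] \<tau>'] by blast
          also have "\<dots> \<le> (M * (R * nrm lborel m')) * ((C * \<tau>) ^ n / fact n)"
            by (intro mult_right_mono mult_left_mono nrm_dk_le[OF m' R(1) m'R axis_Basis] M(1) p[OF \<tau>])
          also have "\<dots> \<le> (M * (R * nrm lborel m)) * ((C * \<tau>) ^ n / fact n)"
            by (intro mult_right_mono mult_left_mono nm M(1) R(1) p[OF \<tau>])
          finally have "\<bar>c\<bar> * \<bar>q \<tau> (dk (axis i 1) m')\<bar> \<le> \<bar>c\<bar> * ((M * (R * nrm lborel m)) * ((C * \<tau>) ^ n / fact n))"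
            by (rule mult_left_mono) simp
          also have "\<dots> = (\<bar>c\<bar> * R) * ((M * nrm lborel m) * ((C * \<tau>) ^ n / fact n))" by (simp only: mult_ac)
          also have "\<dots> \<le> C * ((M * nrm lborel m) * ((C * \<tau>) ^ n / fact n))"
            by (intro mult_right_mono C(2) mult_nonneg_nonneg M(1) p[OF \<tau>]) auto
          finally show "\<bar>c * q \<tau> (dk (axis i 1) m')\<bar> \<le> (M * nrm lborel m) * C * ((C * \<tau>) ^ n / fact n)"
            unfolding abs_mult by (simp only: mult_ac)
        qed (use t in auto)
        then show ?thesis unfolding mm .
      qed
      show ?case using qb ab by blast
    qed
    have lim: "(\<lambda>n. (M * nrm lborel k) * ((C * t) ^ n / fact n)) \<longlonglongrightarrow> 0"
      by (rule tendsto_mult_right_zero[OF power_over_fact_tendsto_0])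
    have "\<bar>a i t k\<bar> \<le> 0" by (rule LIMSEQ_le_const[OF lim]) (use bound[OF k R(2) t] in blast)
    moreover have "\<bar>q t k\<bar> \<le> 0" by (rule LIMSEQ_le_const[OF lim]) (use bound[OF k R(2) t] in blast)
    ultimately show ?thesis by simp
  qed
  have "AE x in lborel. V' t x $ i - V t x $ i = 0" for i
    by (rule E_total[OF sqint_diff[OF contL2_sqint[OF V(2) t] contL2_sqint[OF V(1) t]]])
       (use zero in \<open>simp add: a_def ip_diff_left[OF contL2_sqint[OF V(2) t] contL2_sqint[OF V(1) t] E_sqint]\<close>)
  then have "AE x in lborel. \<forall>i\<in>UNIV. V' t x $ i - V t x $ i = 0" by (intro AE_finite_allI) auto
  moreover have "AE x in lborel. \<rho>' t x - \<rho> t x = 0"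
    by (rule E_total[OF sqint_diff[OF contL2_sqint[OF \<rho>(2) t] contL2_sqint[OF \<rho>(1) t]]])
       (use zero in \<open>simp add: q_def ip_diff_left[OF contL2_sqint[OF \<rho>(2) t] contL2_sqint[OF \<rho>(1) t] E_sqint]\<close>)
  ultimately show ?thesis by eventually_elim (simp add: vec_eq_iff)
qed

section \<open>The equations for the coefficients\<close>

lemma test_fun_cmult:
  assumes "test_fun \<Omega> \<phi>" shows "test_fun \<Omega> (\<lambda>x. a * \<phi> x)"
proof -
  have "test_fun \<Omega> (\<lambda>x. \<phi> x * a)" by (rule test_fun_mult_Ck[OF assms Ck_const])
  then show ?thesis by (simp add: mult.commute)
qed

lemma layer_outside: "z \<notin> {-H<..<0} \<Longrightarrow> layer H n z = 0"
  using test_fun_support[OF test_fun_layer[of H n]] by blast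

lemma test_fun_sqint_vert:
  assumes b: "test_fun \<Omega> b" shows "sqint (vert H) b"
proof -
  obtain B where B: "\<And>z. \<bar>b z\<bar> \<le> B" using test_fun_bounded[OF b] by blast
  have "continuous_on {-H<..<0} b" using test_fun_continuous[OF b] by (rule continuous_on_subset) simp
  from sqint_vert_bounded[OF vert_measurable_continuous[OF this] B] show ?thesis .
qed

lemma slice_cmult: "slice N (\<lambda>z. a * b z) u x = a * slice N b u x"
proof -
  have "slice N (\<lambda>z. a * b z) u x = (LINT z|N. a * (u (x, z) * b z))" by (simp only: slice_def mult_ac)
  then show ?thesis unfolding slice_def by (simp only: integral_mult_right_zero)
qed

lemma regT_cmult: "regT T M (\<lambda>t x. a * u t x) \<phi> = a * regT T M u \<phi>"
  by (simp add: regT_def mult.assoc)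

lemma Basis_dt: "(1, 0) \<in> (Basis :: (real \<times> 'a::euclidean_space) set)"
  by (auto simp: Basis_prod_def)

lemma Basis_dx: "(0, axis i 1) \<in> (Basis :: (real \<times> (real ^ 'd)) set)"
  by (auto simp: Basis_prod_def axis_in_Basis_iff)

section \<open>Cut-off modes as test functions\<close>

context stratification
begin

lemma test_layer_f: "1 \<le> n \<Longrightarrow> test_fun {-H<..<0} (\<lambda>z. layer H k z * f n z)"
  using test_fun_mult_local[where F="fseq n" and j=0, OF fseq_deriv test_fun_layer] by simp

lemma test_layer_df: "1 \<le> n \<Longrightarrow> test_fun {-H<..<0} (\<lambda>z. layer H k z * deriv (f n) z)"
  using test_fun_mult_local[where F="fseq n" and j="Suc 0", OF fseq_deriv test_fun_layer] by simp

lemma inv_r_deriv: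
  assumes z: "z \<in> {-H<..<0}"
  shows "((\<lambda>z. \<beta> ^ j / r z) has_real_derivative \<beta> ^ Suc j / r z) (at z)"
proof -
  have "((\<lambda>z. \<beta> ^ j / r z) has_real_derivative (0 * r z - \<beta> ^ j * (- \<beta> * r z)) / (r z * r z)) (at z)"
    using r_pos[OF z] by (intro DERIV_divide DERIV_const r_deriv[OF z]) auto
  then show ?thesis using r_pos[OF z] by (simp add: mult.commute)
qed

lemma test_mult_r: "test_fun {-H<..<0} \<zeta> \<Longrightarrow> test_fun {-H<..<0} (\<lambda>z. \<zeta> z * r z)"
  using test_fun_mult_local[where F="\<lambda>j z. (- \<beta>) ^ j * r z" and j=0, OF r_powers_deriv] by simp

lemma test_layer_gm: "test_fun {-H<..<0} (\<lambda>z. layer H k z * gm n z)"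
proof (cases "n = 0")
  case True
  have "test_fun {-H<..<0} (\<lambda>z. layer H k z * (\<beta> ^ 0 / r z))"
    by (rule test_fun_mult_local[where F="\<lambda>j z. \<beta> ^ j / r z", OF inv_r_deriv test_fun_layer])
  from test_fun_cmult[OF this, of "(LINT y|vert H. 1 / r y) powr (- 1 / 2)"]
  show ?thesis using True by (simp add: gm_0 mult_ac)
next
  case False
  then have n: "1 \<le> n" by simp
  from test_fun_cmult[OF test_layer_df[OF n, of k], of "c n"] show ?thesis by (simp add: gm_pos[OF n] mult_ac)
qed

lemma test_layer_rgm: "test_fun {-H<..<0} (\<lambda>z. layer H k z * (r z * gm n z))"
  using test_mult_r[OF test_layer_gm[of k n]] by (simp add: mult_ac)

lemma test_layer_rf: "1 \<le> n \<Longrightarrow> test_fun {-H<..<0} (\<lambda>z. layer H k z * (r z * N\<^sup>2 * f n z))"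
  using test_fun_cmult[OF test_mult_r[OF test_layer_f[of n k]], of "N\<^sup>2"] by (simp add: mult_ac)

lemma sqint_gm: "sqint (vert H) (gm n)"
  by (rule sqint_vertI[OF gm_measurable gm_bounded])

lemma sqint_rgm: "sqint (vert H) (\<lambda>z. r z * gm n z)"
  by (rule sqint_vertI[OF _ bounded_mult[OF r_bounded gm_bounded]]) measurable

lemma sqint_f: "1 \<le> n \<Longrightarrow> sqint (vert H) (f n)"
  by (rule sqint_vertI[OF f_measurable f_bounded'])

lemma sqint_df: "1 \<le> n \<Longrightarrow> sqint (vert H) (deriv (f n))"
  using f_deriv_bounded by (intro sqint_vertI[OF df_measurable]) blast+

lemma sqint_rf: "1 \<le> n \<Longrightarrow> sqint (vert H) (\<lambda>z. r z * N\<^sup>2 * f n z)"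
proof -
  assume n: "1 \<le> n"
  note [measurable] = f_measurable[OF n]
  have "sqint (vert H) (\<lambda>z. r z * f n z)"
    by (rule sqint_vertI[OF _ bounded_mult[OF r_bounded f_bounded'[OF n]]]) measurable
  from sqint_cmult[OF this, of "N\<^sup>2"] show ?thesis by (simp add: mult_ac)
qed

lemma pd_layer_f:
  assumes "1 \<le> n" "z \<in> {-H<..<0}"
  shows "pd 1 (\<lambda>z. layer H k z * f n z) z = pd 1 (layer H k) z * f n z + layer H k z * deriv (f n) z"
  by (rule pd_real_deriv, rule DERIV_cong[OF DERIV_mult[OF layer_deriv f_deriv[OF assms]]]) simp

text \<open>The derivative of r g_n: for n = 0 that product is constant, and for n \<ge> 1 this is
  the Sturm-Liouville equation multiplied by c_n.\<close>

definition drgm :: "nat \<Rightarrow> real \<Rightarrow> real" where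
  "drgm n z = (if n = 0 then 0 else - (1 / c n) * (r z * N\<^sup>2 * f n z))"

lemma rgm_deriv:
  assumes z: "z \<in> {-H<..<0}"
  shows "((\<lambda>z. r z * gm n z) has_real_derivative drgm n z) (at z)"
proof (cases "n = 0")
  case True
  have "((\<lambda>z. (LINT y|vert H. 1 / r y) powr (- 1 / 2)) has_real_derivative 0) (at z)" by simp
  then have "((\<lambda>z. r z * gm n z) has_real_derivative 0) (at z)"
    by (rule has_field_derivative_transform_within_open[of _ _ _ "{-H<..<0}"])
       (use z r_pos True in \<open>fastforce simp: gm_0\<close>)+
  then show ?thesis using True by (simp add: drgm_def)
next
  case False
  then have n: "1 \<le> n" by simp
  have eq: "r z * gm n z = c n * (r z * deriv (f n) z)" for z by (simp add: gm_pos[OF n])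
  show ?thesis unfolding eq
    by (rule DERIV_cong[OF DERIV_cmult[OF rf_deriv[OF n z]]])
       (use c_pos[OF n] False in \<open>simp add: drgm_def power2_eq_square\<close>)
qed

lemma sqint_drgm: "sqint (vert H) (drgm n)"
proof (cases "n = 0")
  case True
  then have "drgm n = (\<lambda>z. 0)" by (simp add: drgm_def fun_eq_iff)
  then show ?thesis by simp
next
  case False
  then have "drgm n = (\<lambda>z. - (1 / c n) * (r z * N\<^sup>2 * f n z))" by (simp add: drgm_def fun_eq_iff)
  then show ?thesis using sqint_cmult[OF sqint_rf[of n], of "- (1 / c n)"] False by simp
qed

lemma pd_layer_rgm:
  assumes "z \<in> {-H<..<0}"
  shows "pd 1 (\<lambda>z. layer H k z * (r z * gm n z)) z = pd 1 (layer H k) z * (r z * gm n z) + layer H k z * drgm n z"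
  by (rule pd_real_deriv, rule DERIV_cong[OF DERIV_mult[OF layer_deriv rgm_deriv[OF assms]]]) simp

end

section \<open>The linear equations tested against the modes\<close>

locale euler_solution = stratification +
  fixes T :: real and V :: "real \<Rightarrow> (real ^ 'd) \<times> real \<Rightarrow> real ^ 'd" and w \<rho> P :: "real \<Rightarrow> (real ^ 'd) \<times> real \<Rightarrow> real"
  assumes T: "0 < T"
    and V: "\<And>i. contL2 T (strip H) (\<lambda>t x. V t x $ i)"
    and w: "contL2 T (strip H) w" and \<rho>: "contL2 T (strip H) \<rho>" and P: "contL2 T (strip H) P"
    and equations: "linear_euler T H g r dr V w \<rho> P"
begin

text \<open>Each field is paired with the system dual to the one in which it is expanded. The weight
  moves accordingly: V and w, expanded without the density, are paired with it, while \<rho> and P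
  carry it in the expansion.\<close>

definition "Vm n i t = slice (vert H) (\<lambda>z. r z * gm n z) (\<lambda>x. V t x $ i)"
definition "wm n t = slice (vert H) (\<lambda>z. r z * N\<^sup>2 * f n z) (w t)"
definition "rm n t = slice (vert H) (\<lambda>z. g * f n z) (\<rho> t)"
definition "Pm n t = slice (vert H) (gm n) (P t)"

abbreviation "W \<equiv> regT T (lborel :: (real ^ 'd) measure)"

lemma strip_test:
  assumes "test_fun ({0<..<T} \<times> (UNIV :: (real ^ 'd) set)) \<phi>" "test_fun {-H<..<0} \<zeta>"
  shows "test_fun ({0<..<T} \<times> strip_set H) (tensor3 \<phi> \<zeta>)"
  using test_fun_tensor3[OF assms] by (simp add: strip_set_def)

lemma section_sqint: "test_fun \<Omega> \<phi> \<Longrightarrow> sqint lborel (\<lambda>x. \<phi> (t, x))" for \<phi> :: "real \<times> (real ^ 'd) \<Rightarrow> real"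
  by (rule test_fun_sqint[OF test_fun_section])

context
  fixes \<phi> :: "real \<times> (real ^ 'd) \<Rightarrow> real"
  assumes \<phi>: "test_fun ({0<..<T} \<times> UNIV) \<phi>"
begin

lemma pd_t_tensor3:
  assumes "test_fun {-H<..<0} \<zeta>"
  shows "pd dt (tensor3 \<phi> \<zeta>) (t, X, z) = pd dt \<phi> (t, X) * \<zeta> z"
  using pd_tensor3[OF \<phi> assms, of 1 0 0 t X z] pd_0[OF test_fun_differentiable[OF assms]] by (simp add: zero_prod_def)

lemma pd_x_tensor3:
  assumes "test_fun {-H<..<0} \<zeta>"
  shows "pd (dX i) (tensor3 \<phi> \<zeta>) (t, X, z) = pd (dx i) \<phi> (t, X) * \<zeta> z"
  using pd_tensor3[OF \<phi> assms, of 0 "axis i 1" 0 t X z] pd_0[OF test_fun_differentiable[OF assms]] by simp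

lemma pd_z_tensor3:
  assumes "test_fun {-H<..<0} \<zeta>"
  shows "pd dZ (tensor3 \<phi> \<zeta>) (t, X, z) = \<phi> (t, X) * pd 1 \<zeta> z"
  using pd_tensor3[OF \<phi> assms, of 0 0 1 t X z] pd_0[OF test_fun_differentiable[OF \<phi>], of "(t, X)"] by (simp add: zero_prod_def)

lemma pd_dt: "test_fun ({0<..<T} \<times> UNIV) (pd dt \<phi>)" and pd_dx: "test_fun ({0<..<T} \<times> UNIV) (pd (dx i) \<phi>)"
  by (rule test_fun_pd[OF \<phi> Basis_dt], rule test_fun_pd[OF \<phi> Basis_dx])

text \<open>The test function carries r g_n, so that the coefficient 1/r of the pressure gradient
  leaves g_n, which is dual to the expansion of P. No z-derivative occurs, hence the cutoff simply
  converges in L^2.\<close>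

lemma momentum_horizontal: "W (Vm n i) (pd dt \<phi>) + W (Pm n) (pd (dx i) \<phi>) = 0"
proof -
  let ?Z = "\<lambda>k z. layer H k z * gm n z" and ?X = "\<lambda>k z. layer H k z * (r z * gm n z)"
  note tX = test_layer_rgm[of _ n] and tZ = test_layer_gm[of _ n]
  \<comment> \<open>Outside the interval \<open>r\<close> is not controlled, but there both sides
    vanish because of the factor \<open>layer\<close>.\<close>
  have quot: "(\<lambda>x. (case x of (t, X, z) \<Rightarrow> 1 / r z) * tensor3 \<phi> (?X k) x) = tensor3 \<phi> (?Z k)" for k
  proof
    fix x :: "real \<times> (real ^ 'd) \<times> real"
    obtain t X z where x: "x = (t, X, z)" by (cases x)
    show "(case x of (t, X, z) \<Rightarrow> 1 / r z) * tensor3 \<phi> (?X k) x = tensor3 \<phi> (?Z k) x"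
      using r_pos[of z] layer_outside[of z H k] by (cases "z \<in> {-H<..<0}") (auto simp: x tensor3_def)
  qed
  have "D dt (regT T (strip H) (\<lambda>t x. V t x $ i)) (tensor3 \<phi> (?X k))
      + mult (\<lambda>(t, X, z). 1 / r z) (D (dX i) (regT T (strip H) P)) (tensor3 \<phi> (?X k)) = 0" for k
    using equations strip_test[OF \<phi> tX[of k]] unfolding linear_euler_def by blast
  then have eq: "regT T (strip H) (\<lambda>t x. V t x $ i) (pd dt (tensor3 \<phi> (?X k))) + regT T (strip H) P (pd (dX i) (tensor3 \<phi> (?Z k))) = 0" for k
    unfolding D_def mult_def quot by (simp add: add_eq_0_iff)
  have "regT T (strip H) (\<lambda>t x. V t x $ i) (pd dt (tensor3 \<phi> (?X k))) = W (\<lambda>t. slice (vert H) (?X k) (\<lambda>x. V t x $ i)) (pd dt \<phi>)" for k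
    by (rule regT_tensor3[OF V nrm_layer(1)[OF sqint_rgm] section_sqint[OF pd_dt] pd_t_tensor3[OF tX]])
  moreover have "regT T (strip H) P (pd (dX i) (tensor3 \<phi> (?Z k))) = W (\<lambda>t. slice (vert H) (?Z k) (P t)) (pd (dx i) \<phi>)" for k
    by (rule regT_tensor3[OF P nrm_layer(1)[OF sqint_gm] section_sqint[OF pd_dx] pd_x_tensor3[OF tZ]])
  moreover have "(\<lambda>k. W (\<lambda>t. slice (vert H) (?X k) (\<lambda>x. V t x $ i)) (pd dt \<phi>)) \<longlonglongrightarrow> W (Vm n i) (pd dt \<phi>)"
    unfolding Vm_def[abs_def]
    by (rule regT_slice_tendsto[OF V nrm_layer(1)[OF sqint_rgm] sqint_rgm contL2_test_fun[OF pd_dt] nrm_layer(2)[OF sqint_rgm]])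
  moreover have "(\<lambda>k. W (\<lambda>t. slice (vert H) (?Z k) (P t)) (pd (dx i) \<phi>)) \<longlonglongrightarrow> W (Pm n) (pd (dx i) \<phi>)"
    unfolding Pm_def[abs_def]
    by (rule regT_slice_tendsto[OF P nrm_layer(1)[OF sqint_gm] sqint_gm contL2_test_fun[OF pd_dx] nrm_layer(2)[OF sqint_gm]])
  ultimately have "(\<lambda>k. 0) \<longlonglongrightarrow> W (Vm n i) (pd dt \<phi>) + W (Pm n) (pd (dx i) \<phi>)"
    using tendsto_add[of "\<lambda>k. W (\<lambda>t. slice (vert H) (?X k) (\<lambda>x. V t x $ i)) (pd dt \<phi>)" "W (Vm n i) (pd dt \<phi>)" sequentially
        "\<lambda>k. W (\<lambda>t. slice (vert H) (?Z k) (P t)) (pd (dx i) \<phi>)" "W (Pm n) (pd (dx i) \<phi>)"] eq by simp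
  then show ?thesis by (simp add: LIMSEQ_const_iff)
qed

text \<open>The derivative of the cutoff is paid for by the linear vanishing of f_n at the ends, so
  the cut-off mode converges together with its derivative.\<close>

lemma sqint_pd_layer_f:
  assumes n: "1 \<le> n"
  shows "sqint (vert H) (\<lambda>z. pd 1 (layer H k) z * f n z + layer H k z * deriv (f n) z)"
    and "(\<lambda>k. nrm (vert H) (\<lambda>z. (pd 1 (layer H k) z * f n z + layer H k z * deriv (f n) z) - deriv (f n) z)) \<longlonglongrightarrow> 0"
proof -
  obtain B where B: "\<And>z. z \<in> {-H<..<0} \<Longrightarrow> \<bar>f n z\<bar> \<le> B * (z + H) \<and> \<bar>f n z\<bar> \<le> B * (- z)" using f_boundary[OF n] by blast
  note ld = nrm_layer_deriv[OF f_measurable[OF n] B] and l = nrm_layer[OF sqint_df[OF n]]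
  show "sqint (vert H) (\<lambda>z. pd 1 (layer H k) z * f n z + layer H k z * deriv (f n) z)" for k by (rule sqint_add[OF ld(1) l(1)])
  show "(\<lambda>k. nrm (vert H) (\<lambda>z. (pd 1 (layer H k) z * f n z + layer H k z * deriv (f n) z) - deriv (f n) z)) \<longlonglongrightarrow> 0"
  proof (rule Lim_null_comparison)
    show "(\<lambda>k. nrm (vert H) (\<lambda>z. pd 1 (layer H k) z * f n z) + nrm (vert H) (\<lambda>z. layer H k z * deriv (f n) z - deriv (f n) z)) \<longlonglongrightarrow> 0"
      using tendsto_add[OF ld(2) l(2)] by simp
    show "\<forall>\<^sub>F k in sequentially. norm (nrm (vert H) (\<lambda>z. (pd 1 (layer H k) z * f n z + layer H k z * deriv (f n) z) - deriv (f n) z))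
       \<le> nrm (vert H) (\<lambda>z. pd 1 (layer H k) z * f n z) + nrm (vert H) (\<lambda>z. layer H k z * deriv (f n) z - deriv (f n) z)"
      using nrm_triangle[OF ld(1) sqint_diff[OF l(1) sqint_df[OF n]]] by (simp add: add_diff_eq)
  qed
qed

text \<open>Tested with r N^2 f_n. After division by r the z-derivative of P falls on N^2 f_n and
  produces (N^2/c_n) g_n. The derivative of the cutoff meets f_n, so no boundary values of P
  appear.\<close>

lemma momentum_vertical:
  assumes n: "1 \<le> n"
  shows "W (wm n) (pd dt \<phi>) + (N\<^sup>2 / c n) * W (Pm n) \<phi> = N\<^sup>2 * W (rm n) \<phi>"
proof -
  let ?Z = "\<lambda>k z. N\<^sup>2 * (layer H k z * f n z)" and ?X = "\<lambda>k z. layer H k z * (r z * N\<^sup>2 * f n z)"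
  let ?D = "\<lambda>k z. N\<^sup>2 * (pd 1 (layer H k) z * f n z + layer H k z * deriv (f n) z)"
  let ?R = "\<lambda>k z. layer H k z * (N\<^sup>2 * (g * f n z))"
  note tX = test_layer_rf[OF n] and tZ = test_fun_cmult[OF test_layer_f[OF n], where a="N\<^sup>2"]
  have quot: "(\<lambda>x. (case x of (t, X, z) \<Rightarrow> 1 / r z) * tensor3 \<phi> (?X k) x) = tensor3 \<phi> (?Z k)" for k
  proof
    fix x :: "real \<times> (real ^ 'd) \<times> real"
    obtain t X z where x: "x = (t, X, z)" by (cases x)
    show "(case x of (t, X, z) \<Rightarrow> 1 / r z) * tensor3 \<phi> (?X k) x = tensor3 \<phi> (?Z k) x"
      using r_pos[of z] layer_outside[of z H k] by (cases "z \<in> {-H<..<0}") (auto simp: x tensor3_def)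
  qed
  have "D dt (regT T (strip H) w) (tensor3 \<phi> (?X k))
      + mult (\<lambda>(t, X, z). 1 / r z) (D dZ (regT T (strip H) P)) (tensor3 \<phi> (?X k))
      + regT T (strip H) (\<lambda>t (X, z). \<rho> t (X, z) / r z * g) (tensor3 \<phi> (?X k)) = 0" for k
    using equations strip_test[OF \<phi> tX[of k]] unfolding linear_euler_def by blast
  then have eq: "regT T (strip H) (\<lambda>t (X, z). \<rho> t (X, z) / r z * g) (tensor3 \<phi> (?X k))
     = regT T (strip H) w (pd dt (tensor3 \<phi> (?X k))) + regT T (strip H) P (pd dZ (tensor3 \<phi> (?Z k)))" for k
    unfolding D_def mult_def quot by (simp add: algebra_simps)
  have sR: "sqint (vert H) (\<lambda>z. N\<^sup>2 * (g * f n z))" by (intro sqint_cmult sqint_f n)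
  have sD: "sqint (vert H) (?D k)" for k by (intro sqint_cmult sqint_pd_layer_f(1) n)
  have sD': "sqint (vert H) (\<lambda>z. N\<^sup>2 * deriv (f n) z)" by (intro sqint_cmult sqint_df n)
  have "regT T (strip H) w (pd dt (tensor3 \<phi> (?X k))) = W (\<lambda>t. slice (vert H) (?X k) (w t)) (pd dt \<phi>)" for k
    by (rule regT_tensor3[OF w nrm_layer(1)[OF sqint_rf[OF n]] section_sqint[OF pd_dt] pd_t_tensor3[OF tX]])
  moreover have "regT T (strip H) P (pd dZ (tensor3 \<phi> (?Z k))) = W (\<lambda>t. slice (vert H) (?D k) (P t)) \<phi>" for k
  proof (rule regT_tensor3[OF P sD section_sqint[OF \<phi>]])
    fix t X z assume z: "z \<in> {-H<..<0}"
    have "pd 1 (?Z k) z = ?D k z"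
      using pd_cmult[OF test_fun_differentiable[OF test_layer_f[OF n]], of 1 "N\<^sup>2" k z] pd_layer_f[OF n z] by simp
    then show "pd dZ (tensor3 \<phi> (?Z k)) (t, X, z) = \<phi> (t, X) * ?D k z" by (simp only: pd_z_tensor3[OF tZ])
  qed
  moreover have "regT T (strip H) (\<lambda>t (X, z). \<rho> t (X, z) / r z * g) (tensor3 \<phi> (?X k)) = W (\<lambda>t. slice (vert H) (?R k) (\<rho> t)) \<phi>" for k
  proof -
    have "regT T (strip H) (\<lambda>t (X, z). \<rho> t (X, z) / r z * g) (tensor3 \<phi> (?X k)) = regT T (strip H) \<rho> (tensor3 \<phi> (?R k))"
      unfolding regT_def
    proof (intro set_lebesgue_integral_cong allI impI Bochner_Integration.integral_cong refl)
      fix t x assume "x \<in> space (strip H :: ((real ^ 'd) \<times> real) measure)"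
      then obtain X z where x: "x = (X, z)" "z \<in> {-H<..<0}" by (cases x) (auto simp: strip_eq_pair space_pair_measure vert_space)
      show "(case x of (X, z) \<Rightarrow> \<rho> t (X, z) / r z * g) * tensor3 \<phi> (?X k) (t, x) = \<rho> t x * tensor3 \<phi> (?R k) (t, x)"
        using r_pos[OF x(2)] by (simp add: x tensor3_def)
    qed simp
    also have "\<dots> = W (\<lambda>t. slice (vert H) (?R k) (\<rho> t)) \<phi>"
      by (rule regT_tensor3[OF \<rho> nrm_layer(1)[OF sR] section_sqint[OF \<phi>]]) (simp add: tensor3_def)
    finally show ?thesis .
  qed
  moreover have "(\<lambda>k. W (\<lambda>t. slice (vert H) (?X k) (w t)) (pd dt \<phi>)) \<longlonglongrightarrow> W (wm n) (pd dt \<phi>)"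
    unfolding wm_def[abs_def]
    by (rule regT_slice_tendsto[OF w nrm_layer(1)[OF sqint_rf[OF n]] sqint_rf[OF n] contL2_test_fun[OF pd_dt] nrm_layer(2)[OF sqint_rf[OF n]]])
  moreover have "(\<lambda>k. W (\<lambda>t. slice (vert H) (?D k) (P t)) \<phi>) \<longlonglongrightarrow> W (\<lambda>t. slice (vert H) (\<lambda>z. N\<^sup>2 * deriv (f n) z) (P t)) \<phi>"
  proof (rule regT_slice_tendsto[OF P sD sD' contL2_test_fun[OF \<phi>]])
    have "nrm (vert H) (\<lambda>z. ?D k z - N\<^sup>2 * deriv (f n) z) = N\<^sup>2 * nrm (vert H) (\<lambda>z. (pd 1 (layer H k) z * f n z + layer H k z * deriv (f n) z) - deriv (f n) z)" for k
      using nrm_scaleR[of "vert H" "N\<^sup>2" "\<lambda>z. (pd 1 (layer H k) z * f n z + layer H k z * deriv (f n) z) - deriv (f n) z"]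
      by (simp add: right_diff_distrib)
    then show "(\<lambda>k. nrm (vert H) (\<lambda>z. ?D k z - N\<^sup>2 * deriv (f n) z)) \<longlonglongrightarrow> 0"
      using tendsto_mult_right_zero[OF sqint_pd_layer_f(2)[OF n], of "N\<^sup>2"] by simp
  qed
  moreover have "(\<lambda>k. W (\<lambda>t. slice (vert H) (?R k) (\<rho> t)) \<phi>) \<longlonglongrightarrow> W (\<lambda>t. slice (vert H) (\<lambda>z. N\<^sup>2 * (g * f n z)) (\<rho> t)) \<phi>"
    by (rule regT_slice_tendsto[OF \<rho> nrm_layer(1)[OF sR] sR contL2_test_fun[OF \<phi>] nrm_layer(2)[OF sR]])
  ultimately have lim: "(\<lambda>k. W (\<lambda>t. slice (vert H) (?R k) (\<rho> t)) \<phi>) \<longlonglongrightarrow> W (wm n) (pd dt \<phi>) + W (\<lambda>t. slice (vert H) (\<lambda>z. N\<^sup>2 * deriv (f n) z) (P t)) \<phi>"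
    and lim2: "(\<lambda>k. W (\<lambda>t. slice (vert H) (?R k) (\<rho> t)) \<phi>) \<longlonglongrightarrow> W (\<lambda>t. slice (vert H) (\<lambda>z. N\<^sup>2 * (g * f n z)) (\<rho> t)) \<phi>"
    using tendsto_add[of "\<lambda>k. W (\<lambda>t. slice (vert H) (?X k) (w t)) (pd dt \<phi>)" "W (wm n) (pd dt \<phi>)" sequentially
        "\<lambda>k. W (\<lambda>t. slice (vert H) (?D k) (P t)) \<phi>" "W (\<lambda>t. slice (vert H) (\<lambda>z. N\<^sup>2 * deriv (f n) z) (P t)) \<phi>"] eq by simp_all
  have "W (\<lambda>t. slice (vert H) (\<lambda>z. N\<^sup>2 * (g * f n z)) (\<rho> t)) \<phi> = N\<^sup>2 * W (rm n) \<phi>"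
    unfolding slice_cmult[abs_def, of _ "N\<^sup>2"] rm_def[abs_def] by (rule regT_cmult)
  moreover have "W (\<lambda>t. slice (vert H) (\<lambda>z. N\<^sup>2 * deriv (f n) z) (P t)) \<phi> = (N\<^sup>2 / c n) * W (Pm n) \<phi>"
  proof -
    have eq: "(\<lambda>z. N\<^sup>2 * deriv (f n) z) = (\<lambda>z. (N\<^sup>2 / c n) * gm n z)" using c_pos[OF n] by (simp add: gm_pos[OF n])
    have "slice (vert H) (\<lambda>z. N\<^sup>2 * deriv (f n) z) (P t) = (\<lambda>x. (N\<^sup>2 / c n) * Pm n t x)" for t
      unfolding eq Pm_def by (rule ext) (rule slice_cmult)
    then show ?thesis by (simp only: regT_cmult)
  qed
  ultimately show ?thesis using LIMSEQ_unique[OF lim lim2] by simp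
qed

lemma AE_strip_dr: "AE x in (strip H :: ((real ^ 'd) \<times> real) measure). dr (snd x) = - \<beta> * r (snd x)"
proof -
  interpret pair_sigma_finite "lborel :: (real ^ 'd) measure" "vert H" by (rule pair_sigma_finite_strip)
  obtain A where A: "A \<in> null_sets (vert H)" "{z \<in> space (vert H). \<not> dr z = - \<beta> * r z} \<subseteq> A"
    using dr_eq by (auto simp: eventually_ae_filter)
  have "(UNIV :: (real ^ 'd) set) \<times> A \<in> null_sets (lborel \<Otimes>\<^sub>M vert H)"
    using A(1) by (auto simp: null_sets_def M2.emeasure_pair_measure_Times)
  then show ?thesis unfolding strip_eq_pair
    by (rule AE_I') (use A(2) in \<open>auto simp: space_pair_measure\<close>)
qed

text \<open>Tested with g f_n: as g \<beta> = N^2, the background term g f_n r' equals - r N^2 f_n,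
  which is the dual function for w.\<close>

lemma buoyancy_transport:
  assumes n: "1 \<le> n"
  shows "W (rm n) (pd dt \<phi>) + W (wm n) \<phi> = 0"
proof -
  let ?X = "\<lambda>k z. layer H k z * (g * f n z)"
  let ?R = "\<lambda>k z. - (layer H k z * (r z * N\<^sup>2 * f n z))"
  have tX: "test_fun {-H<..<0} (?X k)" for k
    using test_fun_cmult[OF test_layer_f[OF n, of k], of g] by (simp add: mult_ac)
  have sX: "sqint (vert H) (\<lambda>z. g * f n z)" by (intro sqint_cmult sqint_f n)
  have "D dt (regT T (strip H) \<rho>) (tensor3 \<phi> (?X k)) + regT T (strip H) (\<lambda>t (X, z). w t (X, z) * dr z) (tensor3 \<phi> (?X k)) = 0" for k
    using equations strip_test[OF \<phi> tX[of k]] unfolding linear_euler_def by blast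
  then have eq: "regT T (strip H) \<rho> (pd dt (tensor3 \<phi> (?X k))) = regT T (strip H) (\<lambda>t (X, z). w t (X, z) * dr z) (tensor3 \<phi> (?X k))" for k
    unfolding D_def by (simp add: algebra_simps)
  have "regT T (strip H) \<rho> (pd dt (tensor3 \<phi> (?X k))) = W (\<lambda>t. slice (vert H) (?X k) (\<rho> t)) (pd dt \<phi>)" for k
    by (rule regT_tensor3[OF \<rho> nrm_layer(1)[OF sX] section_sqint[OF pd_dt] pd_t_tensor3[OF tX]])
  moreover have "regT T (strip H) (\<lambda>t (X, z). w t (X, z) * dr z) (tensor3 \<phi> (?X k)) = - W (\<lambda>t. slice (vert H) (\<lambda>z. layer H k z * (r z * N\<^sup>2 * f n z)) (w t)) \<phi>" for k
  proof -
    have m\<Phi>: "(\<lambda>x. tensor3 \<phi> (?X k) (t, x)) \<in> borel_measurable (strip H)" for t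
    proof -
      have "continuous_on UNIV (\<lambda>x. tensor3 \<phi> (?X k) (t, x))"
        by (rule test_fun_continuous[OF test_fun_section[OF strip_test[OF \<phi> tX]]])
      then have "(\<lambda>x. tensor3 \<phi> (?X k) (t, x)) \<in> borel_measurable borel" by (rule borel_measurable_continuous_onI)
      then show ?thesis unfolding strip_def by (intro measurable_restrict_space1) simp
    qed
    have drm [measurable]: "dr \<in> borel_measurable (vert H)" using density(2) by (simp add: W1inf_def Let_def vert_def)
    have "regT T (strip H) (\<lambda>t (X, z). w t (X, z) * dr z) (tensor3 \<phi> (?X k)) = regT T (strip H) w (tensor3 \<phi> (?R k))"
      unfolding regT_def
    proof (intro set_lebesgue_integral_cong allI impI)
      fix t assume t: "t \<in> {0..T}"
      have wm [measurable]: "w t \<in> borel_measurable (strip H)" using contL2_sqint[OF w t] by (simp add: sqint_def)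
      have s2: "(\<lambda>x. snd x) \<in> measurable (strip H) (vert H)" unfolding strip_eq_pair by measurable
      have m1: "(\<lambda>x. dr (snd x)) \<in> borel_measurable (strip H)" "(\<lambda>x. r (snd x)) \<in> borel_measurable (strip H)"
        using measurable_compose[OF s2 drm] measurable_compose[OF s2 r_measurable] by auto
      \<comment> \<open>\<open>dr\<close> is known only almost everywhere, so it is replaced by -
        \<beta> r under the integral over the strip.\<close>
      have A: "(LINT x|strip H. (case x of (X, z) \<Rightarrow> w t (X, z) * dr z) * tensor3 \<phi> (?X k) (t, x))
        = (LINT x|strip H. w t x * (- \<beta> * r (snd x)) * tensor3 \<phi> (?X k) (t, x))"
      proof (rule integral_cong_AE)
        show "(\<lambda>x. (case x of (X, z) \<Rightarrow> w t (X, z) * dr z) * tensor3 \<phi> (?X k) (t, x)) \<in> borel_measurable (strip H)"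
          using borel_measurable_times[OF borel_measurable_times[OF wm m1(1)] m\<Phi>[of t]] by (simp add: split_beta)
        show "(\<lambda>x. w t x * (- \<beta> * r (snd x)) * tensor3 \<phi> (?X k) (t, x)) \<in> borel_measurable (strip H)"
          by (intro borel_measurable_times wm m\<Phi> m1 borel_measurable_const)
        show "AE x in strip H. (case x of (X, z) \<Rightarrow> w t (X, z) * dr z) * tensor3 \<phi> (?X k) (t, x) = w t x * (- \<beta> * r (snd x)) * tensor3 \<phi> (?X k) (t, x)"
          using AE_strip_dr by eventually_elim (simp add: split_beta)
      qed
      have eq: "w t x * (- \<beta> * r (snd x)) * tensor3 \<phi> (?X k) (t, x) = w t x * tensor3 \<phi> (?R k) (t, x)" for x
        using pos by (simp add: tensor3_def split_beta \<beta>_def)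
      show "(LINT x|strip H. (case x of (X, z) \<Rightarrow> w t (X, z) * dr z) * tensor3 \<phi> (?X k) (t, x)) = (LINT x|strip H. w t x * tensor3 \<phi> (?R k) (t, x))"
        unfolding A by (simp only: eq)
    qed simp
    also have "\<dots> = W (\<lambda>t. slice (vert H) (\<lambda>z. (- 1) * (layer H k z * (r z * N\<^sup>2 * f n z))) (w t)) \<phi>"
      by (rule regT_tensor3[OF w sqint_cmult[OF nrm_layer(1)[OF sqint_rf[OF n]]] section_sqint[OF \<phi>]]) (simp add: tensor3_def)
    also have "\<dots> = (- 1) * W (\<lambda>t. slice (vert H) (\<lambda>z. layer H k z * (r z * N\<^sup>2 * f n z)) (w t)) \<phi>"
      unfolding slice_cmult[abs_def, of _ "- 1"] by (rule regT_cmult)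
    finally show ?thesis by simp
  qed
  moreover have "(\<lambda>k. W (\<lambda>t. slice (vert H) (?X k) (\<rho> t)) (pd dt \<phi>)) \<longlonglongrightarrow> W (rm n) (pd dt \<phi>)"
    unfolding rm_def[abs_def]
    by (rule regT_slice_tendsto[OF \<rho> nrm_layer(1)[OF sX] sX contL2_test_fun[OF pd_dt] nrm_layer(2)[OF sX]])
  moreover have "(\<lambda>k. W (\<lambda>t. slice (vert H) (\<lambda>z. layer H k z * (r z * N\<^sup>2 * f n z)) (w t)) \<phi>) \<longlonglongrightarrow> W (wm n) \<phi>"
    unfolding wm_def[abs_def]
    by (rule regT_slice_tendsto[OF w nrm_layer(1)[OF sqint_rf[OF n]] sqint_rf[OF n] contL2_test_fun[OF \<phi>] nrm_layer(2)[OF sqint_rf[OF n]]])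
  ultimately have "(\<lambda>k. W (\<lambda>t. slice (vert H) (?X k) (\<rho> t)) (pd dt \<phi>)) \<longlonglongrightarrow> - W (wm n) \<phi>"
    "(\<lambda>k. W (\<lambda>t. slice (vert H) (?X k) (\<rho> t)) (pd dt \<phi>)) \<longlonglongrightarrow> W (rm n) (pd dt \<phi>)"
    using eq tendsto_minus[of "\<lambda>k. W (\<lambda>t. slice (vert H) (\<lambda>z. layer H k z * (r z * N\<^sup>2 * f n z)) (w t)) \<phi>"] by simp_all
  then show ?thesis using LIMSEQ_unique by fastforce
qed

end

text \<open>The divergence constraint is first localised at a fixed time, because the boundary condition is
  only known for each time separately.\<close>

lemma divergence_tested:
  assumes t: "t \<in> {0..T}" and \<psi>: "test_fun UNIV \<psi>" and \<zeta>: "test_fun {-H<..<0} \<zeta>"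
  shows "(\<Sum>i\<in>UNIV. ip lborel (slice (vert H) \<zeta> (\<lambda>x. V t x $ i)) (pd (axis i 1) \<psi>)) + ip lborel (slice (vert H) (pd 1 \<zeta>) (w t)) \<psi> = 0"
proof -
  let ?a = "\<lambda>t. (\<Sum>i\<in>UNIV. ip lborel (slice (vert H) \<zeta> (\<lambda>x. V t x $ i)) (pd (axis i 1) \<psi>)) + ip lborel (slice (vert H) (pd 1 \<zeta>) (w t)) \<psi>"
  note s\<zeta> = test_fun_sqint_vert[OF \<zeta>] and s\<zeta>' = test_fun_sqint_vert[OF test_fun_pd[OF \<zeta>, of 1, simplified]]
  have t\<psi>i: "test_fun UNIV (pd (axis i 1) \<psi>)" for i by (rule test_fun_pd[OF \<psi>]) (simp add: axis_in_Basis_iff)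
  have cV: "continuous_on {0..T} (\<lambda>t. ip lborel (slice (vert H) \<zeta> (\<lambda>x. V t x $ i)) (pd (axis i 1) \<psi>))" for i
    by (rule contL2_ip_continuous[OF contL2_slice[OF V s\<zeta>] contL2_const[OF test_fun_sqint[OF t\<psi>i]]])
  have cw: "continuous_on {0..T} (\<lambda>t. ip lborel (slice (vert H) (pd 1 \<zeta>) (w t)) \<psi>)"
    by (rule contL2_ip_continuous[OF contL2_slice[OF w s\<zeta>'] contL2_const[OF test_fun_sqint[OF \<psi>]]])
  show "?a t = 0"
  proof (rule du_Bois_Reymond_0[OF _ T _ t])
    show "continuous_on {0..T} ?a" by (intro continuous_on_add continuous_on_sum cV cw)
    fix \<theta> assume \<theta>: "test_fun {0<..<T} \<theta>"
    have \<phi>: "test_fun ({0<..<T} \<times> UNIV) (tensor \<theta> \<psi>)" by (rule test_fun_tensor[OF \<theta> \<psi>])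
    have "(\<Sum>i\<in>UNIV. D (dX i) (regT T (strip H) (\<lambda>t x. V t x $ i)) (tensor3 (tensor \<theta> \<psi>) \<zeta>)) + D dZ (regT T (strip H) w) (tensor3 (tensor \<theta> \<psi>) \<zeta>) = 0"
      using equations strip_test[OF \<phi> \<zeta>] unfolding linear_euler_def by blast
    then have eq: "(\<Sum>i\<in>UNIV. regT T (strip H) (\<lambda>t x. V t x $ i) (pd (dX i) (tensor3 (tensor \<theta> \<psi>) \<zeta>))) + regT T (strip H) w (pd dZ (tensor3 (tensor \<theta> \<psi>) \<zeta>)) = 0"
      unfolding D_def by (simp add: sum_negf)
    have 1: "regT T (strip H) (\<lambda>t x. V t x $ i) (pd (dX i) (tensor3 (tensor \<theta> \<psi>) \<zeta>))
        = (LINT t:{0..T}|lborel. ip lborel (slice (vert H) \<zeta> (\<lambda>x. V t x $ i)) (pd (axis i 1) \<psi>) * \<theta> t)" for i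
    proof -
      have "regT T (strip H) (\<lambda>t x. V t x $ i) (pd (dX i) (tensor3 (tensor \<theta> \<psi>) \<zeta>)) = W (\<lambda>t. slice (vert H) \<zeta> (\<lambda>x. V t x $ i)) (pd (dx i) (tensor \<theta> \<psi>))"
        by (rule regT_tensor3[OF V s\<zeta> section_sqint[OF pd_dx[OF \<phi>]] pd_x_tensor3[OF \<phi> \<zeta>]])
      also have "\<dots> = (LINT t:{0..T}|lborel. ip lborel (slice (vert H) \<zeta> (\<lambda>x. V t x $ i)) (pd (axis i 1) \<psi>) * \<theta> t)"
      proof (rule regT_cong)
        fix t
        have "(\<lambda>x. pd (dx i) (tensor \<theta> \<psi>) (t, x)) = (\<lambda>x. \<theta> t * pd (axis i 1) \<psi> x)"
          using pd_tensor[OF \<theta> \<psi>, of 0 "axis i 1" t] pd_0[OF test_fun_differentiable[OF \<theta>]] by simp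
        then show "ip lborel (slice (vert H) \<zeta> (\<lambda>x. V t x $ i)) (\<lambda>x. pd (dx i) (tensor \<theta> \<psi>) (t, x)) = ip lborel (slice (vert H) \<zeta> (\<lambda>x. V t x $ i)) (pd (axis i 1) \<psi>) * \<theta> t"
          by (simp only: ip_cmult_right mult.commute)
      qed
      finally show ?thesis .
    qed
    have 2: "regT T (strip H) w (pd dZ (tensor3 (tensor \<theta> \<psi>) \<zeta>)) = (LINT t:{0..T}|lborel. ip lborel (slice (vert H) (pd 1 \<zeta>) (w t)) \<psi> * \<theta> t)"
    proof -
      have "regT T (strip H) w (pd dZ (tensor3 (tensor \<theta> \<psi>) \<zeta>)) = W (\<lambda>t. slice (vert H) (pd 1 \<zeta>) (w t)) (tensor \<theta> \<psi>)"
        by (rule regT_tensor3[OF w s\<zeta>' section_sqint[OF \<phi>] pd_z_tensor3[OF \<phi> \<zeta>]])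
      also have "\<dots> = (LINT t:{0..T}|lborel. ip lborel (slice (vert H) (pd 1 \<zeta>) (w t)) \<psi> * \<theta> t)"
        by (rule regT_tensor)
      finally show ?thesis .
    qed
    have c\<theta>: "continuous_on {0..T} \<theta>" using test_fun_continuous[OF \<theta>] by (rule continuous_on_subset) simp
    have i: "set_integrable lborel {0..T} (\<lambda>t. ip lborel (slice (vert H) \<zeta> (\<lambda>x. V t x $ i)) (pd (axis i 1) \<psi>) * \<theta> t)" for i
      by (intro borel_integrable_atLeastAtMost' continuous_on_mult cV c\<theta>)
    have iw: "set_integrable lborel {0..T} (\<lambda>t. ip lborel (slice (vert H) (pd 1 \<zeta>) (w t)) \<psi> * \<theta> t)"
      by (intro borel_integrable_atLeastAtMost' continuous_on_mult cw c\<theta>)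
    have "(LINT t:{0..T}|lborel. ?a t * \<theta> t) = (LINT t:{0..T}|lborel. (\<Sum>i\<in>UNIV. ip lborel (slice (vert H) \<zeta> (\<lambda>x. V t x $ i)) (pd (axis i 1) \<psi>) * \<theta> t) + ip lborel (slice (vert H) (pd 1 \<zeta>) (w t)) \<psi> * \<theta> t)"
      by (simp only: distrib_right sum_distrib_right)
    also have "\<dots> = (LINT t:{0..T}|lborel. (\<Sum>i\<in>UNIV. ip lborel (slice (vert H) \<zeta> (\<lambda>x. V t x $ i)) (pd (axis i 1) \<psi>) * \<theta> t)) + (LINT t:{0..T}|lborel. ip lborel (slice (vert H) (pd 1 \<zeta>) (w t)) \<psi> * \<theta> t)"
      by (rule set_integral_add(2)[OF LINT_sum(1)[OF i] iw])
    also have "(LINT t:{0..T}|lborel. (\<Sum>i\<in>UNIV. ip lborel (slice (vert H) \<zeta> (\<lambda>x. V t x $ i)) (pd (axis i 1) \<psi>) * \<theta> t))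
       = (\<Sum>i\<in>UNIV. LINT t:{0..T}|lborel. ip lborel (slice (vert H) \<zeta> (\<lambda>x. V t x $ i)) (pd (axis i 1) \<psi>) * \<theta> t)"
      by (rule LINT_sum(2)[OF i])
    finally show "(LINT t:{0..T}|lborel. ?a t * \<theta> t) = 0" using eq unfolding 1 2 by simp
  qed
qed

text \<open>Here the z-derivative falls on a cut-off r g_n, which need not vanish at the ends, so
  the derivative of \<open>layer\<close> leaves a term of size one. It is removed by pairing w with
  \<psi> first: the resulting function of z is continuous and vanishes at both ends.\<close>

lemma divergence:
  assumes t: "t \<in> {0..T}" and \<psi>: "test_fun UNIV \<psi>"
  shows "(\<Sum>i\<in>UNIV. ip lborel (Vm n i t) (pd (axis i 1) \<psi>)) + ip lborel (slice (vert H) (drgm n) (w t)) \<psi> = 0"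
proof -
  interpret pair_sigma_finite "lborel :: (real ^ 'd) measure" "vert H" by (rule pair_sigma_finite_strip)
  let ?b = "\<lambda>z. r z * gm n z"
  let ?X = "\<lambda>k z. layer H k z * ?b z"
  have t\<psi>i: "test_fun UNIV (pd (axis i 1) \<psi>)" for i by (rule test_fun_pd[OF \<psi>]) (simp add: axis_in_Basis_iff)
  note s\<psi> = test_fun_sqint[OF \<psi>] and s\<psi>i = test_fun_sqint[OF t\<psi>i]
  have sV: "sqint (strip H) (\<lambda>x. V t x $ i)" for i using contL2_sqint[OF V t] .
  note sw = contL2_sqint[OF w t]
  note sw' = sw[unfolded strip_eq_pair]
  have bb: "\<exists>B. \<forall>z\<in>{-H<..<0}. \<bar>?b z\<bar> \<le> B" by (rule bounded_mult[OF r_bounded gm_bounded])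
  have bm [measurable]: "?b \<in> borel_measurable (vert H)" by measurable
  obtain C where C: "\<And>z. z \<in> {-H<..<0} \<Longrightarrow> \<bar>?b z\<bar> \<le> C" using bb by blast
  have s1: "sqint (vert H) (\<lambda>z. pd 1 (layer H k) z * ?b z)" for k
  proof (rule sqint_vertI)
    obtain B where "\<And>z. \<bar>pd 1 (layer H k) z\<bar> \<le> B" using layer_deriv_bound by blast
    then have "\<exists>B. \<forall>z\<in>{-H<..<0}. \<bar>pd 1 (layer H k) z\<bar> \<le> B" by blast
    from bounded_mult[OF this bb] show "\<exists>B. \<forall>z\<in>{-H<..<0}. \<bar>pd 1 (layer H k) z * ?b z\<bar> \<le> B" .
  qed measurable
  note s2 = nrm_layer(1)[OF sqint_drgm[of n]]
  have split: "ip lborel (slice (vert H) (pd 1 (?X k)) (w t)) \<psi>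
     = ip lborel (slice (vert H) (\<lambda>z. pd 1 (layer H k) z * ?b z) (w t)) \<psi> + ip lborel (slice (vert H) (\<lambda>z. layer H k z * drgm n z) (w t)) \<psi>" for k
  proof -
    have sp: "sqint (vert H) (pd 1 (?X k))"
    proof -
      have "test_fun {-H<..<0} (pd 1 (?X k))" using test_fun_pd[OF test_layer_rgm[of k n], of 1] by simp
      then show ?thesis by (rule test_fun_sqint_vert)
    qed
    have "ip lborel (slice (vert H) (pd 1 (?X k)) (w t)) \<psi> = (LINT z|vert H. pd 1 (?X k) z * ip lborel (\<lambda>x. w t (x, z)) \<psi>)"
      by (rule ip_slice'[OF sw' sp s\<psi>])
    also have "\<dots> = (LINT z|vert H. (pd 1 (layer H k) z * ?b z) * ip lborel (\<lambda>x. w t (x, z)) \<psi> + (layer H k z * drgm n z) * ip lborel (\<lambda>x. w t (x, z)) \<psi>)"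
      by (rule LINT_cong) (use pd_layer_rgm in \<open>simp add: vert_space distrib_right\<close>)
    also have "\<dots> = (LINT z|vert H. (pd 1 (layer H k) z * ?b z) * ip lborel (\<lambda>x. w t (x, z)) \<psi>) + (LINT z|vert H. (layer H k z * drgm n z) * ip lborel (\<lambda>x. w t (x, z)) \<psi>)"
      by (rule Bochner_Integration.integral_add[OF integrable_slice'[OF sw' s1 s\<psi>] integrable_slice'[OF sw' s2 s\<psi>]])
    finally show ?thesis by (simp only: ip_slice'[OF sw' s1 s\<psi>] ip_slice'[OF sw' s2 s\<psi>])
  qed
  have "zero_trace H (w t)" using equations t by (simp add: linear_euler_def)
  then obtain h where h: "continuous_on {-H..0} h" "h (-H) = 0" "h 0 = 0"
    "AE z in vert H. reg lborel (\<lambda>X. w t (X, z)) \<psi> = h z" using \<psi> unfolding zero_trace_def by blast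
  \<comment> \<open>For this \<psi> and this t, the trace condition represents the pairing of w with
    \<psi> by a continuous \<open>h\<close> at almost every height, which is enough under the
    integral.\<close>
  have bdry: "ip lborel (slice (vert H) (\<lambda>z. pd 1 (layer H k) z * ?b z) (w t)) \<psi> = (LINT z|vert H. pd 1 (layer H k) z * ?b z * h z)" for k
    unfolding ip_slice'[OF sw' s1 s\<psi>]
  proof (rule integral_cong_AE)
    show "(\<lambda>z. pd 1 (layer H k) z * ?b z * ip lborel (\<lambda>x. w t (x, z)) \<psi>) \<in> borel_measurable (vert H)"
      by (rule borel_measurable_integrable[OF integrable_slice'[OF sw' s1 s\<psi>]])
    have [measurable]: "h \<in> borel_measurable (vert H)"
      by (rule vert_measurable_continuous, rule continuous_on_subset[OF h(1)]) auto
    show "(\<lambda>z. pd 1 (layer H k) z * ?b z * h z) \<in> borel_measurable (vert H)" by measurable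
    show "AE z in vert H. pd 1 (layer H k) z * ?b z * ip lborel (\<lambda>x. w t (x, z)) \<psi> = pd 1 (layer H k) z * ?b z * h z"
      using h(4) by eventually_elim (simp add: reg_def ip_def)
  qed
  have 0: "(\<Sum>i\<in>UNIV. ip lborel (slice (vert H) (?X k) (\<lambda>x. V t x $ i)) (pd (axis i 1) \<psi>))
     + ((LINT z|vert H. pd 1 (layer H k) z * ?b z * h z) + ip lborel (slice (vert H) (\<lambda>z. layer H k z * drgm n z) (w t)) \<psi>) = 0" for k
    using divergence_tested[OF t \<psi> test_layer_rgm[of k n]] unfolding split bdry .
  have "(\<lambda>k. (\<Sum>i\<in>UNIV. ip lborel (slice (vert H) (?X k) (\<lambda>x. V t x $ i)) (pd (axis i 1) \<psi>))
     + ((LINT z|vert H. pd 1 (layer H k) z * ?b z * h z) + ip lborel (slice (vert H) (\<lambda>z. layer H k z * drgm n z) (w t)) \<psi>))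
    \<longlonglongrightarrow> (\<Sum>i\<in>UNIV. ip lborel (Vm n i t) (pd (axis i 1) \<psi>)) + (0 + ip lborel (slice (vert H) (drgm n) (w t)) \<psi>)"
    unfolding Vm_def
    by (intro tendsto_add tendsto_sum ip_slice_tendsto[OF sV nrm_layer(1)[OF sqint_rgm] sqint_rgm s\<psi>i nrm_layer(2)[OF sqint_rgm]]
       ip_slice_tendsto[OF sw s2 sqint_drgm s\<psi> nrm_layer(2)[OF sqint_drgm]] layer_deriv_boundary[OF pos(1) h(1-3) bm C])
  then show ?thesis unfolding 0 by (simp add: LIMSEQ_const_iff)
qed

lemma divergence_0:
  assumes t: "t \<in> {0..T}" and \<psi>: "test_fun UNIV \<psi>"
  shows "(\<Sum>i\<in>UNIV. ip lborel (Vm 0 i t) (pd (axis i 1) \<psi>)) = 0"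
proof -
  have "slice (vert H) (drgm 0) (w t) = (\<lambda>x. 0)" by (simp add: slice_def drgm_def fun_eq_iff)
  then show ?thesis using divergence[OF t \<psi>, of 0] by (simp add: ip_def)
qed

text \<open>Multiplying the constraint by c_n cancels the 1/c_n in \<open>drgm\<close>, and the
  coefficient of w remains.\<close>

lemma divergence_n:
  assumes t: "t \<in> {0..T}" and \<psi>: "test_fun UNIV \<psi>" and n: "1 \<le> n"
  shows "ip lborel (wm n t) \<psi> = c n * (\<Sum>i\<in>UNIV. ip lborel (Vm n i t) (pd (axis i 1) \<psi>))"
proof -
  have "slice (vert H) (drgm n) (w t) = (\<lambda>x. (- (1 / c n)) *\<^sub>R wm n t x)"
  proof -
    have "drgm n = (\<lambda>z. - (1 / c n) * (r z * N\<^sup>2 * f n z))" using n by (simp add: drgm_def fun_eq_iff)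
    then show ?thesis by (simp only: slice_cmult[abs_def] wm_def real_scaleR_def)
  qed
  then have "ip lborel (slice (vert H) (drgm n) (w t)) \<psi> = (- (1 / c n)) * ip lborel (wm n t) \<psi>"
    by (simp only: ip_scaleR_left)
  then have "c n * ip lborel (slice (vert H) (drgm n) (w t)) \<psi> = - ip lborel (wm n t) \<psi>" using c_pos[OF n] by simp
  moreover have "(\<Sum>i\<in>UNIV. ip lborel (Vm n i t) (pd (axis i 1) \<psi>)) = - ip lborel (slice (vert H) (drgm n) (w t)) \<psi>"
    using divergence[OF t \<psi>, of n] by linarith
  ultimately show ?thesis by simp
qed

lemma curl_initial:
  assumes curl: "curl_free H (V 0)" and \<psi>: "test_fun UNIV \<psi>"
  shows "ip lborel (Vm n j 0) (pd (axis i 1) \<psi>) = ip lborel (Vm n i 0) (pd (axis j 1) \<psi>)"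
proof -
  interpret pair_sigma_finite "lborel :: (real ^ 'd) measure" "vert H" by (rule pair_sigma_finite_strip)
  let ?X = "\<lambda>k z. layer H k z * (r z * gm n z)"
  have t\<psi>i: "test_fun UNIV (pd (axis i 1) \<psi>)" for i by (rule test_fun_pd[OF \<psi>]) (simp add: axis_in_Basis_iff)
  note s\<psi>i = test_fun_sqint[OF t\<psi>i]
  have t0: "0 \<in> {0..T}" using T by simp
  have sV: "sqint (strip H) (\<lambda>x. V 0 x $ i)" for i using contL2_sqint[OF V t0] .
  note sX = nrm_layer(1)[OF sqint_rgm[of n]]
  have red: "reg (strip H) (\<lambda>x. V 0 x $ m) (pd (axis l 1, 0) (tensor \<psi> (?X k))) = ip lborel (slice (vert H) (?X k) (\<lambda>x. V 0 x $ m)) (pd (axis l 1) \<psi>)" for k l m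
  proof -
    have "pd (axis l 1, 0) (tensor \<psi> (?X k)) = tensor (pd (axis l 1) \<psi>) (?X k)"
      using pd_tensor[OF \<psi> test_layer_rgm[of k n], of "axis l 1" 0] pd_0[OF test_fun_differentiable[OF test_layer_rgm[of k n]]]
      by (simp add: fun_eq_iff tensor_def)
    then show ?thesis
      using ip_slice[OF sV[unfolded strip_eq_pair] sX s\<psi>i] by (simp add: reg_def ip_def strip_eq_pair)
  qed
  have t: "test_fun (strip_set H) (tensor \<psi> (?X k))" for k
    using test_fun_tensor[OF \<psi> test_layer_rgm[of k n]] by (simp add: strip_set_def)
  have "D (axis i 1, 0) (reg (strip H) (\<lambda>x. V 0 x $ j)) (tensor \<psi> (?X k)) - D (axis j 1, 0) (reg (strip H) (\<lambda>x. V 0 x $ i)) (tensor \<psi> (?X k)) = 0" for k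
    using curl t[of k] unfolding curl_free_def by blast
  then have eq: "ip lborel (slice (vert H) (?X k) (\<lambda>x. V 0 x $ j)) (pd (axis i 1) \<psi>) = ip lborel (slice (vert H) (?X k) (\<lambda>x. V 0 x $ i)) (pd (axis j 1) \<psi>)" for k
    unfolding D_def red by simp
  have l: "(\<lambda>k. ip lborel (slice (vert H) (?X k) (\<lambda>x. V 0 x $ m)) (pd (axis l 1) \<psi>)) \<longlonglongrightarrow> ip lborel (Vm n m 0) (pd (axis l 1) \<psi>)" for l m
    unfolding Vm_def by (rule ip_slice_tendsto[OF sV sX sqint_rgm s\<psi>i nrm_layer(2)[OF sqint_rgm]])
  show ?thesis by (rule LIMSEQ_unique[OF l]) (unfold eq, rule l)
qed

end

section \<open>Elimination of pressure and vertical velocity, and the mode n = 0\<close>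

locale irrotational_solution = euler_solution H g N r dr c f T V w \<rho> P
  for H g N r dr c f T and V :: "real \<Rightarrow> (real ^ 'd) \<times> real \<Rightarrow> real ^ 'd" and w \<rho> P +
  assumes curl: "curl_free H (V 0)"
begin

lemma contL2_Vm: "contL2 T lborel (Vm n i)"
  unfolding Vm_def[abs_def] by (rule contL2_slice[OF V sqint_rgm])

lemma contL2_wm: "1 \<le> n \<Longrightarrow> contL2 T lborel (wm n)"
  unfolding wm_def[abs_def] by (rule contL2_slice[OF w sqint_rf])

lemma contL2_rm: "1 \<le> n \<Longrightarrow> contL2 T lborel (rm n)"
  unfolding rm_def[abs_def] by (rule contL2_slice[OF \<rho> sqint_cmult[OF sqint_f]])

lemma contL2_Pm: "contL2 T lborel (Pm n)"
  unfolding Pm_def[abs_def] by (rule contL2_slice[OF P sqint_gm])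

lemma curl_free_modes:
  assumes t: "t \<in> {0..T}" and \<psi>: "test_fun UNIV \<psi>"
  shows "ip lborel (Vm n j t) (pd (axis i 1) \<psi>) = ip lborel (Vm n i t) (pd (axis j 1) \<psi>)"
proof -
  have \<psi>i: "test_fun UNIV (pd (axis i 1) \<psi>)" for i by (rule test_fun_pd[OF \<psi> axis_Basis])
  let ?h = "\<lambda>t. ip lborel (Vm n j t) (pd (axis i 1) \<psi>) - ip lborel (Vm n i t) (pd (axis j 1) \<psi>)"
  have c: "continuous_on {0..T} (\<lambda>t. ip lborel (Vm n m t) (pd (axis l 1) \<psi>))" for l m
    by (rule contL2_ip_continuous[OF contL2_Vm contL2_const[OF test_fun_sqint[OF \<psi>i]]])
  have "?h t = ?h 0"
  proof (rule du_Bois_Reymond[where a=0 and b=T and h="?h" and x=t and y=0])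
    show "continuous_on {0..T} ?h" by (intro continuous_on_diff c)
    fix \<theta> :: "real \<Rightarrow> real" assume \<theta>: "test_fun {0<..<T} \<theta>"
    have "test_fun {0<..<T} (pd 1 \<theta>)" using test_fun_pd[OF \<theta>, of 1] by simp
    from test_fun_continuous[OF this] have c\<theta>: "continuous_on {0..T} (pd 1 \<theta>)" by (rule continuous_on_subset) simp
    \<comment> \<open>The two components carry the pressure against the two mixed second derivatives
      of \<psi>; as these agree, it drops out of the difference.\<close>
    have comm: "pd (axis j 1) (pd (axis i 1) \<psi>) = pd (axis i 1) (pd (axis j 1) \<psi>)"
      by (rule pd_commute[OF test_fun_Ck[OF \<psi>] axis_Basis axis_Basis])
    have "W (Vm n l) (tensor (pd 1 \<theta>) (pd (axis m 1) \<psi>)) + W (Pm n) (tensor \<theta> (pd (axis l 1) (pd (axis m 1) \<psi>))) = 0" for l m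
      using momentum_horizontal[OF test_fun_tensor[OF \<theta> \<psi>i], of n l m] by (simp only: pd_dt_tensor[OF \<theta> \<psi>i] pd_dx_tensor[OF \<theta> \<psi>i])
    from this[of j i] this[of i j]
    have "W (Vm n j) (tensor (pd 1 \<theta>) (pd (axis i 1) \<psi>)) = W (Vm n i) (tensor (pd 1 \<theta>) (pd (axis j 1) \<psi>))"
      unfolding comm by linarith
    moreover have i: "set_integrable lborel {0..T} (\<lambda>t. ip lborel (Vm n m t) (pd (axis l 1) \<psi>) * pd 1 \<theta> t)" for l m
      by (intro borel_integrable_atLeastAtMost' continuous_on_mult c c\<theta>)
    ultimately show "(LINT t:{0..T}|lborel. ?h t * pd 1 \<theta> t) = 0"
      unfolding regT_tensor left_diff_distrib set_integral_diff(2)[OF i i] by simp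
  qed (use t T in auto)
  then show ?thesis using curl_initial[OF curl \<psi>, of n j i] by simp
qed

context
  fixes \<phi> :: "real \<times> (real ^ 'd) \<Rightarrow> real"
  assumes \<phi>: "test_fun ({0<..<T} \<times> UNIV) \<phi>"
begin

lemma section_dx: "(\<lambda>x. pd (dx i) \<phi> (t, x)) = pd (axis i 1) (\<lambda>x. \<phi> (t, x))"
  using pd_section[OF \<phi>] by (simp add: fun_eq_iff)

lemma W_curl: "W (Vm n j) (pd (dx i) \<phi>) = W (Vm n i) (pd (dx j) \<phi>)"
  unfolding regT_eq section_dx
  by (rule set_lebesgue_integral_cong) (simp_all add: curl_free_modes[OF _ test_fun_section[OF \<phi>], of _ n j i])

lemma W_divergence:
  assumes n: "1 \<le> n"
  shows "W (wm n) \<phi> = c n * (\<Sum>i\<in>UNIV. W (Vm n i) (pd (dx i) \<phi>))"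
proof -
  have i: "set_integrable lborel {0..T} (\<lambda>t. ip lborel (Vm n i t) (\<lambda>x. pd (dx i) \<phi> (t, x)))" for i
    by (rule contL2_ip_integrable[OF contL2_Vm contL2_test_fun[OF test_fun_pd[OF \<phi> Basis_dx]]])
  have "W (wm n) \<phi> = (LINT t:{0..T}|lborel. c n * (\<Sum>i\<in>UNIV. ip lborel (Vm n i t) (\<lambda>x. pd (dx i) \<phi> (t, x))))"
    by (rule regT_cong) (simp only: section_dx divergence_n[OF _ test_fun_section[OF \<phi>] n])
  also have "\<dots> = c n * (\<Sum>i\<in>UNIV. W (Vm n i) (pd (dx i) \<phi>))"
    unfolding regT_eq by (simp only: set_integral_mult_right LINT_sum(2)[OF i])
  finally show ?thesis .
qed

lemma mode_w: "1 \<le> n \<Longrightarrow> W (wm n) \<phi> = - c n * (\<Sum>i\<in>UNIV. D (dx i) (W (Vm n i)) \<phi>)"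
  by (simp add: W_divergence D_def sum_negf)

lemma mode_density: "1 \<le> n \<Longrightarrow> D dt (W (rm n)) \<phi> + c n * (\<Sum>i\<in>UNIV. D (dx i) (W (Vm n i)) \<phi>) = 0"
  using buoyancy_transport[OF \<phi>, of n] W_divergence[of n] by (simp add: D_def sum_negf)

lemma mode_P:
  assumes n: "1 \<le> n"
  shows "W (Pm n) \<phi> = c n * W (rm n) \<phi> + c n / N\<^sup>2 * D dt (W (wm n)) \<phi>"
proof -
  have "(N\<^sup>2 / c n) * W (Pm n) \<phi> = N\<^sup>2 * W (rm n) \<phi> - W (wm n) (pd dt \<phi>)"
    using momentum_vertical[OF \<phi> n] by linarith
  then show ?thesis using c_pos[OF n] pos(3) by (simp add: D_def field_simps)
qed

end

text \<open>The pressure in the i-th component is eliminated by the vertical momentum equation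
  tested with the i-th derivative of \<phi>. Its term in w becomes, by the divergence relation, a
  sum of third derivatives paired with the components V_j; exchanging i and j by irrotationality
  turns this sum into the Laplacian of the time derivative of V_i.\<close>

lemma mode_velocity:
  assumes \<phi>: "test_fun ({0<..<T} \<times> (UNIV :: (real ^ 'd) set)) \<phi>" and n: "1 \<le> n"
  shows "D dt (W (Vm n i)) \<phi> - (c n)\<^sup>2 / N\<^sup>2 * (\<Sum>j\<in>UNIV. D (dx j) (D (dx j) (D dt (W (Vm n i)))) \<phi>)
    + c n * D (dx i) (W (rm n)) \<phi> = 0"
proof -
  let ?i = "pd (dx i) \<phi>" and ?t = "pd dt \<phi>"
  have \<phi>t: "test_fun ({0<..<T} \<times> UNIV) ?t" and \<phi>i: "test_fun ({0<..<T} \<times> UNIV) (pd (dx j) \<phi>)" for j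
    by (rule test_fun_pd[OF \<phi> Basis_dt], rule test_fun_pd[OF \<phi> Basis_dx])
  have \<phi>it: "test_fun ({0<..<T} \<times> UNIV) (pd dt ?i)" by (rule test_fun_pd[OF \<phi>i Basis_dt])
  have \<phi>tj: "test_fun ({0<..<T} \<times> UNIV) (pd (dx j) ?t)" for j by (rule test_fun_pd[OF \<phi>t Basis_dx])
  define S where "S = (\<Sum>j\<in>UNIV. W (Vm n i) (pd dt (pd (dx j) (pd (dx j) \<phi>))))"
  have "pd (dx j) (pd dt ?i) = pd (dx i) (pd (dx j) ?t)" for j
    using pd_commute[OF test_fun_Ck[OF \<phi>] Basis_dt Basis_dx, of i] pd_commute[OF test_fun_Ck[OF \<phi>t] Basis_dx Basis_dx, of j i] by simp
  moreover have "pd (dx j) (pd (dx j) ?t) = pd dt (pd (dx j) (pd (dx j) \<phi>))" for j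
    using pd_commute[OF test_fun_Ck[OF \<phi>] Basis_dt Basis_dx, of j] pd_commute[OF test_fun_Ck[OF \<phi>i] Basis_dt Basis_dx, of j j] by simp
  ultimately have "W (Vm n j) (pd (dx j) (pd dt ?i)) = W (Vm n i) (pd dt (pd (dx j) (pd (dx j) \<phi>)))" for j
    using W_curl[OF \<phi>tj[of j], of n j i] by simp
  then have w: "W (wm n) (pd dt ?i) = c n * S" using W_divergence[OF \<phi>it n] by (simp add: S_def)
  have "(N\<^sup>2 / c n) * W (Pm n) ?i = N\<^sup>2 * W (rm n) ?i - c n * S"
    using momentum_vertical[OF \<phi>i n, of i] w by linarith
  then have "W (Pm n) ?i = c n * W (rm n) ?i - (c n)\<^sup>2 / N\<^sup>2 * S"
    using c_pos[OF n] pos(3) by (simp add: field_simps power2_eq_square)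
  moreover have "W (Vm n i) ?t + W (Pm n) ?i = 0" by (rule momentum_horizontal[OF \<phi>])
  ultimately have "- W (Vm n i) ?t + (c n)\<^sup>2 / N\<^sup>2 * S - c n * W (rm n) ?i = 0" by linarith
  then show ?thesis by (simp add: D_def S_def sum_negf)
qed

text \<open>Summing the horizontal momentum equations tested with the derivatives of \<psi>, the
  velocity terms add up to the divergence of V_0, which is 0. Hence P_0 is weakly harmonic, at every
  time by continuity.\<close>

lemma pressure_0:
  assumes t: "t \<in> {0..T}" shows "AE X in lborel. Pm 0 t X = 0"
proof (rule L2_Laplace_eq_0[OF contL2_sqint[OF contL2_Pm t]])
  fix \<psi> :: "real ^ 'd \<Rightarrow> real" assume \<psi>: "test_fun UNIV \<psi>"
  have \<psi>i: "test_fun UNIV (pd (axis i 1) \<psi>)" for i by (rule test_fun_pd[OF \<psi> axis_Basis])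
  have \<psi>ii: "test_fun UNIV (pd (axis i 1) (pd (axis i 1) \<psi>))" for i by (rule test_fun_pd[OF \<psi>i axis_Basis])
  have cP: "continuous_on {0..T} (\<lambda>t. ip lborel (Pm 0 t) (pd (axis i 1) (pd (axis i 1) \<psi>)))" for i
    by (rule contL2_ip_continuous[OF contL2_Pm contL2_const[OF test_fun_sqint[OF \<psi>ii]]])
  have cV: "continuous_on {0..T} (\<lambda>t. ip lborel (Vm 0 i t) (pd (axis i 1) \<psi>))" for i
    by (rule contL2_ip_continuous[OF contL2_Vm contL2_const[OF test_fun_sqint[OF \<psi>i]]])
  have "(\<Sum>i\<in>UNIV. ip lborel (Pm 0 t) (pd (axis i 1) (pd (axis i 1) \<psi>))) = 0"
  proof (rule du_Bois_Reymond_0[where h="\<lambda>t. \<Sum>i\<in>UNIV. ip lborel (Pm 0 t) (pd (axis i 1) (pd (axis i 1) \<psi>))", OF _ T _ t])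
    show "continuous_on {0..T} (\<lambda>t. \<Sum>i\<in>UNIV. ip lborel (Pm 0 t) (pd (axis i 1) (pd (axis i 1) \<psi>)))" by (intro continuous_on_sum cP)
    fix \<theta> :: "real \<Rightarrow> real" assume \<theta>: "test_fun {0<..<T} \<theta>"
    have c1: "continuous_on {0..T} \<theta>" using test_fun_continuous[OF \<theta>] by (rule continuous_on_subset) simp
    have "test_fun {0<..<T} (pd 1 \<theta>)" using test_fun_pd[OF \<theta>, of 1] by simp
    from test_fun_continuous[OF this] have c2: "continuous_on {0..T} (pd 1 \<theta>)" by (rule continuous_on_subset) simp
    let ?P = "\<lambda>i t. ip lborel (Pm 0 t) (pd (axis i 1) (pd (axis i 1) \<psi>)) * \<theta> t" and ?V = "\<lambda>i t. ip lborel (Vm 0 i t) (pd (axis i 1) \<psi>) * pd 1 \<theta> t"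
    have iP: "set_integrable lborel {0..T} (?P i)" and iV: "set_integrable lborel {0..T} (?V i)" for i
      by (intro borel_integrable_atLeastAtMost' continuous_on_mult cP cV c1 c2)+
    have "(LINT t:{0..T}|lborel. ?V i t) + (LINT t:{0..T}|lborel. ?P i t) = 0" for i
      using momentum_horizontal[OF test_fun_tensor[OF \<theta> \<psi>i], of 0 i i]
      by (simp only: pd_dt_tensor[OF \<theta> \<psi>i] pd_dx_tensor[OF \<theta> \<psi>i] regT_tensor)
    then have "(\<Sum>i\<in>UNIV. (LINT t:{0..T}|lborel. ?V i t) + (LINT t:{0..T}|lborel. ?P i t)) = 0" by simp
    then have "(\<Sum>i\<in>UNIV. LINT t:{0..T}|lborel. ?V i t) + (\<Sum>i\<in>UNIV. LINT t:{0..T}|lborel. ?P i t) = 0" by (simp only: sum.distrib)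
    moreover have "(\<Sum>i\<in>UNIV. LINT t:{0..T}|lborel. ?V i t) = (LINT t:{0..T}|lborel. (\<Sum>i\<in>UNIV. ?V i t))"
      by (rule LINT_sum(2)[OF iV, symmetric])
    moreover have "(LINT t:{0..T}|lborel. (\<Sum>i\<in>UNIV. ?V i t)) = (LINT t:{0..T}|lborel. 0)"
      by (rule set_lebesgue_integral_cong) (simp_all add: sum_distrib_right[symmetric] divergence_0[OF _ \<psi>])
    moreover have "(LINT t:{0..T}|lborel. (\<Sum>i\<in>UNIV. ip lborel (Pm 0 t) (pd (axis i 1) (pd (axis i 1) \<psi>))) * \<theta> t) = (\<Sum>i\<in>UNIV. LINT t:{0..T}|lborel. ?P i t)"
      unfolding sum_distrib_right by (rule LINT_sum(2)[OF iP])
    ultimately show "(LINT t:{0..T}|lborel. (\<Sum>i\<in>UNIV. ip lborel (Pm 0 t) (pd (axis i 1) (pd (axis i 1) \<psi>))) * \<theta> t) = 0"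
      by (simp add: set_lebesgue_integral_def)
  qed
  then show "(\<Sum>b\<in>Basis. ip lborel (Pm 0 t) (pd b (pd b \<psi>))) = 0" by (simp only: sum_Basis_axis)
qed

text \<open>Irrotationality exchanges the indices so that the Laplacian of one component becomes a
  derivative of the divergence of V_0, which vanishes.\<close>

lemma velocity_0:
  assumes t: "t \<in> {0..T}" shows "AE X in lborel. Vm 0 i t X = 0"
proof (rule L2_Laplace_eq_0[OF contL2_sqint[OF contL2_Vm t]])
  fix \<psi> :: "real ^ 'd \<Rightarrow> real" assume \<psi>: "test_fun UNIV \<psi>"
  have \<psi>i: "test_fun UNIV (pd (axis i 1) \<psi>)" for i by (rule test_fun_pd[OF \<psi> axis_Basis])
  have "ip lborel (Vm 0 i t) (pd (axis j 1) (pd (axis j 1) \<psi>)) = ip lborel (Vm 0 j t) (pd (axis j 1) (pd (axis i 1) \<psi>))" for j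
    using curl_free_modes[OF t \<psi>i[of j], of 0 j i] pd_commute[OF test_fun_Ck[OF \<psi>] axis_Basis axis_Basis, of i j] by simp
  then show "(\<Sum>b\<in>Basis. ip lborel (Vm 0 i t) (pd b (pd b \<psi>))) = 0"
    using divergence_0[OF t \<psi>i[of i]] by (simp add: sum_Basis_axis)
qed

end

section \<open>Summability of the coefficients\<close>

lemma Bessel_inequality:
  assumes F: "finite F" and e: "\<And>n. n \<in> F \<Longrightarrow> sqint M (e n)" and u: "sqint M u"
    and o: "\<And>m n. m \<in> F \<Longrightarrow> n \<in> F \<Longrightarrow> ip M (e m) (e n) = (if m = n then 1 else 0)"
  shows "(\<Sum>n\<in>F. (ip M u (e n))\<^sup>2) \<le> (nrm M u)\<^sup>2"
proof -
  define S where "S = (\<lambda>x. \<Sum>n\<in>F. ip M u (e n) *\<^sub>R e n x)"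
  have s: "sqint M (\<lambda>x. ip M u (e n) *\<^sub>R e n x)" if "n \<in> F" for n by (rule sqint_scaleR[OF e[OF that]])
  have S: "sqint M S" unfolding S_def by (rule sqint_sum[OF s])
  have r: "ip M v S = (\<Sum>n\<in>F. ip M u (e n) * ip M v (e n))" if "sqint M v" for v
    unfolding S_def using ip_sum_right[OF F s that] by (simp add: ip_scaleR_right)
  have "ip M S (e m) = ip M u (e m)" if m: "m \<in> F" for m
  proof -
    have "ip M S (e m) = (\<Sum>n\<in>F. ip M u (e n) * ip M (e m) (e n))" using r[OF e[OF m]] by (simp add: ip_commute)
    also have "\<dots> = (\<Sum>n\<in>F. if n = m then ip M u (e n) else 0)" by (rule sum.cong) (auto simp: o m)
    also have "\<dots> = ip M u (e m)" using F m by simp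
    finally show ?thesis .
  qed
  then have SS: "(nrm M S)\<^sup>2 = (\<Sum>n\<in>F. (ip M u (e n))\<^sup>2)"
    unfolding ip_self[symmetric] r[OF S] by (simp add: power2_eq_square)
  then have "nrm M S * nrm M S = ip M u S" using r[OF u] by (simp add: power2_eq_square)
  also have "\<dots> \<le> nrm M u * nrm M S" using ip_Cauchy_Schwarz[OF u S] by linarith
  finally have "nrm M S \<le> nrm M u" using nrm_nonneg[of M S] nrm_nonneg[of M u]
    by (metis less_eq_real_def mult_right_le_imp_le)
  then show ?thesis unfolding SS[symmetric] by (intro power_mono) auto
qed

text \<open>The bounded factor \<open>q\<close> of the dual functions is moved onto
  \<open>v\<close>. Bessel's inequality for q v in the vertical variable holds at almost every X
  with a bound free of the number of terms, and is then integrated in X.\<close>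

lemma summable_slices:
  fixes v :: "(real ^ 'd) \<times> real \<Rightarrow> real"
  assumes v: "sqint (strip H) v" and e: "\<And>n. sqint (vert H) (e n)"
    and o: "\<And>m n. ip (vert H) (e m) (e n) = (if m = n then 1 else 0)"
    and q: "q \<in> borel_measurable (vert H)" "\<And>z. z \<in> {-H<..<0} \<Longrightarrow> \<bar>q z\<bar> \<le> B"
    and b: "\<And>n. sqint (vert H) (b n)" "\<And>n z. z \<in> {-H<..<0} \<Longrightarrow> b n z = q z * e n z"
  shows "summable (\<lambda>n. (nrm lborel (slice (vert H) (b n) v))\<^sup>2)"
proof (rule summableI_nonneg_bounded)
  interpret pair_sigma_finite "lborel :: (real ^ 'd) measure" "vert H" by (rule pair_sigma_finite_strip)
  note v' = v[unfolded strip_eq_pair]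
  have sl: "slice (vert H) (b n) v x = ip (vert H) (\<lambda>z. q z *\<^sub>R v (x, z)) (e n)" for n x
    unfolding slice_def ip_def
    by (rule LINT_cong) (simp add: b(2) vert_space)
  have ae: "AE x in lborel. (\<Sum>n<N. (slice (vert H) (b n) v x)\<^sup>2) \<le> B\<^sup>2 * (nrm (vert H) (\<lambda>z. v (x, z)))\<^sup>2" for N
    using sqint_section(1)[OF v']
  proof eventually_elim
    case (elim x)
    have qb: "AE z in vert H. \<bar>q z\<bar> \<le> B" by (rule AE_I2) (simp add: q(2) vert_space)
    note bm = sqint_bounded_mult[OF elim q(1) qb]
    have "(\<Sum>n<N. (slice (vert H) (b n) v x)\<^sup>2) \<le> (nrm (vert H) (\<lambda>z. q z *\<^sub>R v (x, z)))\<^sup>2"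
      unfolding sl by (rule Bessel_inequality) (simp_all add: e o bm(1)[simplified])
    also have "\<dots> \<le> (\<bar>B\<bar> * nrm (vert H) (\<lambda>z. v (x, z)))\<^sup>2" by (intro power_mono bm(2)) simp
    finally show ?case by (simp add: power_mult_distrib)
  qed
  have i: "integrable lborel (\<lambda>x. (slice (vert H) (b n) v x)\<^sup>2)" for n
    using sqint_slice[OF v' b(1)] by (simp add: sqint_def)
  show "(\<Sum>n<N. (nrm lborel (slice (vert H) (b n) v))\<^sup>2) \<le> B\<^sup>2 * (nrm (strip H) v)\<^sup>2" for N
  proof -
    have "(\<Sum>n<N. (nrm lborel (slice (vert H) (b n) v))\<^sup>2) = (LINT x|lborel. (\<Sum>n<N. (slice (vert H) (b n) v x)\<^sup>2))"
      using i by (simp add: nrm_power2)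
    also have "\<dots> \<le> (LINT x|lborel. B\<^sup>2 * (nrm (vert H) (\<lambda>z. v (x, z)))\<^sup>2)"
      by (rule integral_mono_AE[OF _ _ ae]) (use i sqint_section(2)[OF v'] in auto)
    also have "\<dots> = B\<^sup>2 * (nrm (strip H) v)\<^sup>2" using sqint_section(3)[OF v'] by (simp add: strip_eq_pair)
    finally show ?thesis .
  qed
qed simp

lemma summable_Hs_norm:
  fixes u :: "(real ^ 'd) \<times> real \<Rightarrow> real"
  assumes u: "Hs0 H s u" and e: "\<And>n. sqint (vert H) (e n)"
    and o: "\<And>m n. ip (vert H) (e m) (e n) = (if m = n then 1 else 0)"
    and q: "q \<in> borel_measurable (vert H)" "\<And>z. z \<in> {-H<..<0} \<Longrightarrow> \<bar>q z\<bar> \<le> B"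
    and b: "\<And>n. sqint (vert H) (b n)" "\<And>n z. z \<in> {-H<..<0} \<Longrightarrow> b n z = q z * e n z"
    and a: "\<And>n. a n \<in> borel_measurable lborel" "\<And>n. AE x in lborel. a n x = slice (vert H) (b n) u x"
  shows "summable (\<lambda>n. (Hs_norm s (a n))\<^sup>2)"
proof -
  obtain v where v: "is_Lambda_strip H s u v" using u by (auto simp: Hs0_def)
  have "sqint (strip H) v" using v by (simp add: is_Lambda_strip_def L2_iff_sqint)
  moreover have "Hs_norm s (a n) = nrm lborel (slice (vert H) (b n) v)" for n
    by (rule Hs_norm_eq[OF is_Lambda_cong_AE[OF is_Lambda_slice[OF v b(1)] a]])
  ultimately show ?thesis using summable_slices[OF _ e o q b] by simp
qed

lemma expansion_cong_AE:
  assumes ex: "expansion H k e u a" and ae: "AE x in strip H. u' x = u x"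
  shows "expansion H k e u' a"
proof -
  have "(\<integral>\<^sup>+x. ennreal ((norm (F x - u' x))\<^sup>2) \<partial>strip H) = (\<integral>\<^sup>+x. ennreal ((norm (F x - u x))\<^sup>2) \<partial>strip H)" for F :: "_ \<Rightarrow> real"
    by (rule nn_integral_cong_AE) (use ae in eventually_elim, simp)
  then show ?thesis using ex by (simp add: expansion_def L2_tendsto_def)
qed

section \<open>Dual systems and their unweighted forms\<close>

context stratification
begin

lemma dual_V: "(LINT z|vert H. gm j z * (r z * gm n z)) = (if j = n then 1 else 0)"
  using gm_orthonormal[of j n] by (simp only: mult_ac)

lemma dual_P: "(LINT z|vert H. (r z * gm j z) * gm n z) = (if j = n then 1 else 0)"
  using gm_orthonormal[of j n] by (simp only: mult_ac)

lemma dual_w: "1 \<le> j \<Longrightarrow> 1 \<le> n \<Longrightarrow> (LINT z|vert H. f j z * (r z * N\<^sup>2 * f n z)) = (if j = n then 1 else 0)"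
  using f_orthonormal[of j n] by (simp only: mult_ac)

lemma dual_rho:
  assumes "1 \<le> j" "1 \<le> n"
  shows "(LINT z|vert H. (1 / g * r z * N\<^sup>2 * f j z) * (g * f n z)) = (if j = n then 1 else 0)"
proof -
  have "(1 / g * r z * N\<^sup>2 * f j z) * (g * f n z) = r z * N\<^sup>2 * (f j z * f n z)" for z using pos(2) by simp
  then show ?thesis using f_orthonormal[OF assms] by simp
qed

lemma sqint_density_mode: "1 \<le> n \<Longrightarrow> sqint (vert H) (\<lambda>z. 1 / g * r z * N\<^sup>2 * f n z)"
  using sqint_cmult[OF sqint_rf, of n "1 / g"] by (simp add: mult.assoc)

lemma sqrt_r_measurable [measurable]: "(\<lambda>z. sqrt (r z)) \<in> borel_measurable (vert H)"
  by measurable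

lemma sqrt_r_bounded: "\<exists>B. \<forall>z\<in>{-H<..<0}. \<bar>sqrt (r z)\<bar> \<le> B" "\<exists>B. \<forall>z\<in>{-H<..<0}. \<bar>1 / sqrt (r z)\<bar> \<le> B"
proof -
  obtain m M where m: "0 < m" "\<And>z. z \<in> {-H<..<0} \<Longrightarrow> m \<le> r z" "\<And>z. z \<in> {-H<..<0} \<Longrightarrow> r z \<le> M"
    using r_bounds by blast
  have "\<bar>sqrt (r z)\<bar> \<le> sqrt M \<and> \<bar>1 / sqrt (r z)\<bar> \<le> 1 / sqrt m" if "z \<in> {-H<..<0}" for z
    using m(1) m(2)[OF that] m(3)[OF that] r_pos[OF that] by (auto intro!: divide_left_mono mult_pos_pos)
  then show "\<exists>B. \<forall>z\<in>{-H<..<0}. \<bar>sqrt (r z)\<bar> \<le> B" "\<exists>B. \<forall>z\<in>{-H<..<0}. \<bar>1 / sqrt (r z)\<bar> \<le> B" by blast+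
qed

text \<open>The square root of the weight turns orthonormality in a weighted space into
  orthonormality on the interval with Lebesgue measure. Each dual function is such a function times
  a bounded factor: sqrt r for V, N sqrt r for w and g / (N sqrt r) for \<rho>.\<close>

definition "gm_half n z = sqrt (r z) * gm n z"
definition "f_half n z = sqrt (r z) * (N * f n z)"

lemma gm_half:
  shows "sqint (vert H) (gm_half n)" "ip (vert H) (gm_half m) (gm_half n) = (if m = n then 1 else 0)"
proof -
  show "sqint (vert H) (gm_half n)" unfolding gm_half_def[abs_def]
    by (rule sqint_vertI[OF _ bounded_mult[OF sqrt_r_bounded(1) gm_bounded]]) measurable
  have "ip (vert H) (gm_half m) (gm_half n) = (LINT z|vert H. r z * (gm m z * gm n z))"
    unfolding ip_def
  proof (rule LINT_cong)
    fix z assume "z \<in> space (vert H)"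
    then have "sqrt (r z) * sqrt (r z) = r z" using r_pos[of z] by (simp add: vert_space)
    moreover have "gm_half m z \<bullet> gm_half n z = (sqrt (r z) * sqrt (r z)) * (gm m z * gm n z)" by (simp add: gm_half_def)
    ultimately show "gm_half m z \<bullet> gm_half n z = r z * (gm m z * gm n z)" by simp
  qed
  then show "ip (vert H) (gm_half m) (gm_half n) = (if m = n then 1 else 0)" by (simp add: gm_orthonormal)
qed

lemma f_half:
  assumes n: "1 \<le> n"
  shows "sqint (vert H) (f_half n)" "1 \<le> m \<Longrightarrow> ip (vert H) (f_half m) (f_half n) = (if m = n then 1 else 0)"
proof -
  note [measurable] = f_measurable[OF n]
  show "sqint (vert H) (f_half n)" unfolding f_half_def[abs_def]
    by (rule sqint_vertI[OF _ bounded_mult[OF sqrt_r_bounded(1) bounded_mult[OF const_bounded f_bounded'[OF n]]]]) measurable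
  assume m: "1 \<le> m"
  have "ip (vert H) (f_half m) (f_half n) = (LINT z|vert H. r z * N\<^sup>2 * (f m z * f n z))"
    unfolding ip_def
  proof (rule LINT_cong)
    fix z assume "z \<in> space (vert H)"
    then have "sqrt (r z) * sqrt (r z) = r z" using r_pos[of z] by (simp add: vert_space)
    moreover have "f_half m z \<bullet> f_half n z = (sqrt (r z) * sqrt (r z)) * N\<^sup>2 * (f m z * f n z)"
      by (simp add: f_half_def power2_eq_square)
    ultimately show "f_half m z \<bullet> f_half n z = r z * N\<^sup>2 * (f m z * f n z)" by simp
  qed
  then show "ip (vert H) (f_half m) (f_half n) = (if m = n then 1 else 0)" by (simp add: f_orthonormal[OF m n])
qed

lemma summable_Hs_norm_V:
  fixes u :: "(real ^ 'd) \<times> real \<Rightarrow> real"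
  assumes "Hs0 H s u" "\<And>n. a n \<in> borel_measurable lborel"
    "\<And>n. AE x in lborel. a n x = slice (vert H) (\<lambda>z. r z * gm (Suc n) z) u x"
  shows "summable (\<lambda>n. (Hs_norm s (a n))\<^sup>2)"
proof -
  obtain B where B: "\<And>z. z \<in> {-H<..<0} \<Longrightarrow> \<bar>sqrt (r z)\<bar> \<le> B" using sqrt_r_bounded(1) by blast
  show ?thesis
  proof (rule summable_Hs_norm[where e="\<lambda>n. gm_half (Suc n)" and b="\<lambda>n z. r z * gm (Suc n) z", OF assms(1) gm_half(1) _ sqrt_r_measurable B sqint_rgm _ assms(2,3)])
    show "ip (vert H) (gm_half (Suc m)) (gm_half (Suc n)) = (if m = n then 1 else 0)" for m n by (simp add: gm_half(2))
    show "r z * gm (Suc n) z = sqrt (r z) * gm_half (Suc n) z" if "z \<in> {-H<..<0}" for n z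
      using r_pos[OF that] by (simp add: gm_half_def mult.assoc[symmetric])
  qed
qed

lemma summable_Hs_norm_f:
  fixes u :: "(real ^ 'd) \<times> real \<Rightarrow> real"
  assumes u: "Hs0 H s u" "\<And>n. a n \<in> borel_measurable lborel" "\<And>n. AE x in lborel. a n x = slice (vert H) (b n) u x"
    and b: "\<And>n. sqint (vert H) (b n)" "\<And>n z. z \<in> {-H<..<0} \<Longrightarrow> b n z = q z * f_half (Suc n) z"
    and q: "q \<in> borel_measurable (vert H)" "\<exists>B. \<forall>z\<in>{-H<..<0}. \<bar>q z\<bar> \<le> B"
  shows "summable (\<lambda>n. (Hs_norm s (a n))\<^sup>2)"
proof -
  obtain B where B: "\<And>z. z \<in> {-H<..<0} \<Longrightarrow> \<bar>q z\<bar> \<le> B" using q(2) by blast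
  show ?thesis
    by (rule summable_Hs_norm[where e="\<lambda>n. f_half (Suc n)", OF u(1) f_half(1) _ q(1) B b u(2,3)]) (simp_all add: f_half(2))
qed

lemma summable_Hs_norm_w:
  fixes u :: "(real ^ 'd) \<times> real \<Rightarrow> real"
  assumes "Hs0 H s u" "\<And>n. a n \<in> borel_measurable lborel"
    "\<And>n. AE x in lborel. a n x = slice (vert H) (\<lambda>z. r z * N\<^sup>2 * f (Suc n) z) u x"
  shows "summable (\<lambda>n. (Hs_norm s (a n))\<^sup>2)"
proof (rule summable_Hs_norm_f[OF assms])
  show "sqint (vert H) (\<lambda>z. r z * N\<^sup>2 * f (Suc n) z)" for n by (rule sqint_rf) simp
  show "r z * N\<^sup>2 * f (Suc n) z = (sqrt (r z) * N) * f_half (Suc n) z" if "z \<in> {-H<..<0}" for n z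
  proof -
    have "(sqrt (r z) * N) * f_half (Suc n) z = (sqrt (r z) * sqrt (r z)) * N\<^sup>2 * f (Suc n) z"
      by (simp only: f_half_def power2_eq_square mult_ac)
    then show ?thesis using r_pos[OF that] by simp
  qed
  show "\<exists>B. \<forall>z\<in>{-H<..<0}. \<bar>sqrt (r z) * N\<bar> \<le> B" by (rule bounded_mult[OF sqrt_r_bounded(1) const_bounded])
qed measurable

lemma summable_Hs_norm_rho:
  fixes u :: "(real ^ 'd) \<times> real \<Rightarrow> real"
  assumes "Hs0 H s u" "\<And>n. a n \<in> borel_measurable lborel"
    "\<And>n. AE x in lborel. a n x = slice (vert H) (\<lambda>z. g * f (Suc n) z) u x"
  shows "summable (\<lambda>n. (Hs_norm s (a n))\<^sup>2)"
proof (rule summable_Hs_norm_f[OF assms])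
  show "sqint (vert H) (\<lambda>z. g * f (Suc n) z)" for n by (intro sqint_cmult sqint_f) simp
  show "g * f (Suc n) z = (1 / sqrt (r z) * (g / N)) * f_half (Suc n) z" if "z \<in> {-H<..<0}" for n z
    using r_pos[OF that] pos(3) by (simp add: f_half_def)
  show "\<exists>B. \<forall>z\<in>{-H<..<0}. \<bar>1 / sqrt (r z) * (g / N)\<bar> \<le> B" by (rule bounded_mult[OF sqrt_r_bounded(2) const_bounded])
qed measurable

end

theorem proposition2:
  fixes H g N s T :: real
    and r dr :: "real \<Rightarrow> real"
    and c :: "nat \<Rightarrow> real" and f :: "nat \<Rightarrow> real \<Rightarrow> real"
    and V :: "real \<Rightarrow> (real ^ 'd) \<times> real \<Rightarrow> real ^ 'd"
    and w \<rho> P :: "real \<Rightarrow> (real ^ 'd) \<times> real \<Rightarrow> real"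
    and V0 :: "(real ^ 'd) \<times> real \<Rightarrow> real ^ 'd" and w0 \<rho>0 :: "(real ^ 'd) \<times> real \<Rightarrow> real"
    and Vn :: "nat \<Rightarrow> real \<Rightarrow> real ^ 'd \<Rightarrow> real ^ 'd"
    and wn \<rho>n Pn :: "nat \<Rightarrow> real \<Rightarrow> real ^ 'd \<Rightarrow> real"
    and V0n :: "nat \<Rightarrow> real ^ 'd \<Rightarrow> real ^ 'd" and \<rho>0n :: "nat \<Rightarrow> real ^ 'd \<Rightarrow> real"
  assumes dim: "CARD('d) = 1 \<or> CARD('d) = 2"
    and pos: "0 < H" "0 < g" "0 < N" "0 < T" "0 \<le> s"
    \<comment> \<open>the background density, given by its continuous representative\<close>
    and density: "continuous_on {-H..0} r" "W1inf (-H) 0 r dr" "\<exists>m>0. \<forall>z\<in>{-H<..<0}. m \<le> r z"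
    and buoyancy: "AE z in vert H. - g * dr z / r z = N\<^sup>2"
    and modes: "modes H r N c f"
    and V_cont: "\<And>i. cont_in T (Hs0 H s) (Hs0_norm H s) (\<lambda>t x. V t x $ i)"
    and w_cont: "cont_in T (Hs0 H s) (Hs0_norm H s) w"
    and \<rho>_cont: "cont_in T (Hs0 H s) (Hs0_norm H s) \<rho>"
    \<comment> \<open>the additive function of time in the pressure is fixed by square integrability\<close>
    and P_cont: "cont_in T (L2 (strip H)) (L2norm (strip H)) P"
    and equations: "linear_euler T H g r dr V w \<rho> P"
    and initial: "AE x in strip H. V 0 x = V0 x \<and> w 0 x = w0 x \<and> \<rho> 0 x = \<rho>0 x"
    and irrotational: "curl_free H (V 0)"
    and V_modes: "\<And>t i. t \<in> {0..T} \<Longrightarrow>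
      expansion H 0 (g_mode H r c f) (\<lambda>x. V t x $ i) (\<lambda>n X. Vn n t X $ i)"
    and w_modes: "\<And>t. t \<in> {0..T} \<Longrightarrow> expansion H 1 f (w t) (\<lambda>n. wn n t)"
    and P_modes: "\<And>t. t \<in> {0..T} \<Longrightarrow>
      expansion H 0 (\<lambda>n z. r z * g_mode H r c f n z) (P t) (\<lambda>n. Pn n t)"
    and \<rho>_modes: "\<And>t. t \<in> {0..T} \<Longrightarrow>
      expansion H 1 (\<lambda>n z. 1 / g * r z * N\<^sup>2 * f n z) (\<rho> t) (\<lambda>n. \<rho>n n t)"
    and V0_modes: "\<And>i. expansion H 0 (g_mode H r c f) (\<lambda>x. V0 x $ i) (\<lambda>n X. V0n n X $ i)"
    and \<rho>0_modes: "expansion H 1 (\<lambda>n z. 1 / g * r z * N\<^sup>2 * f n z) \<rho>0 \<rho>0n"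
  shows "(\<forall>n\<ge>1.
            modal_solution s T N (c n) (V0n n) (\<rho>0n n) (Vn n) (\<rho>n n) \<and>
            (\<forall>V' \<rho>'. modal_solution s T N (c n) (V0n n) (\<rho>0n n) V' \<rho>' \<longrightarrow>
               (\<forall>t\<in>{0..T}. AE X in lborel. V' t X = Vn n t X \<and> \<rho>' t X = \<rho>n n t X)) \<and>
            (\<forall>\<phi>. test_fun ({0<..<T} \<times> UNIV) \<phi> \<longrightarrow>
               regT T lborel (wn n) \<phi>
                 = - c n * (\<Sum>i\<in>UNIV. D (dx i) (regT T lborel (\<lambda>t X. Vn n t X $ i)) \<phi>) \<and>
               regT T lborel (Pn n) \<phi>
                 = c n * regT T lborel (\<rho>n n) \<phi> + c n / N\<^sup>2 * D dt (regT T lborel (wn n)) \<phi>))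
       \<and> (\<forall>t\<in>{0..T}. AE X in lborel. Pn 0 t X = 0 \<and> Vn 0 t X = 0)
       \<and> (\<forall>t\<in>{0..T}.
            (\<forall>n\<ge>1. Hs s (\<rho>n n t) \<and> (\<forall>i. Hs s (\<lambda>X. Vn n t X $ i)) \<and> Hs s (wn n t)) \<and>
            summable (\<lambda>n. (Hs_norm s (\<rho>n (Suc n) t))\<^sup>2
               + (\<Sum>i\<in>UNIV. (Hs_norm s (\<lambda>X. Vn (Suc n) t X $ i))\<^sup>2)
               + (Hs_norm s (wn (Suc n) t))\<^sup>2))"
proof -
  note V = cont_in_Hs0[OF V_cont pos(5)] and w = cont_in_Hs0[OF w_cont pos(5)]
    and \<rho> = cont_in_Hs0[OF \<rho>_cont pos(5)] and P = cont_in_L2[OF P_cont]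
  interpret S: irrotational_solution H g N r dr c f T V w \<rho> P
    by unfold_locales (fact pos density buoyancy modes V w \<rho> P equations irrotational)+
  have t0: "0 \<in> {0..T}" using pos(4) by simp
  \<comment> \<open>Biorthogonality forces the given coefficients to be slices against the dual
    functions, almost everywhere at each time. The equations, proved for the slices, are transferred
    back below.\<close>
  note Vc = expansion_coefficient[OF V_modes contL2_sqint[OF V] S.sqint_gm S.sqint_rgm le0 S.dual_V]
  note wc = expansion_coefficient[OF w_modes contL2_sqint[OF w] S.sqint_f S.sqint_rf _ S.dual_w]
  note Pc = expansion_coefficient[OF P_modes contL2_sqint[OF P] S.sqint_rgm S.sqint_gm le0 S.dual_P]
  note \<rho>c = expansion_coefficient[OF \<rho>_modes contL2_sqint[OF \<rho>] S.sqint_density_mode sqint_cmult[OF S.sqint_f] _ S.dual_rho]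
  have V_eq: "AE X in lborel. Vn n t X $ i = S.Vm n i t X" "sqint lborel (\<lambda>X. Vn n t X $ i)" if "t \<in> {0..T}" for n t i
    unfolding S.Vm_def using Vc[OF that that] by simp_all
  have P_eq: "AE X in lborel. Pn n t X = S.Pm n t X" "sqint lborel (Pn n t)" if "t \<in> {0..T}" for n t
    unfolding S.Pm_def using Pc[OF that that] by simp_all
  have w_eq: "AE X in lborel. wn n t X = S.wm n t X" "sqint lborel (wn n t)" if "1 \<le> n" "t \<in> {0..T}" for n t
    unfolding S.wm_def using wc[OF that(2) that(2) _ that(1) that(1) _ that(1)] by simp_all
  have \<rho>_eq: "AE X in lborel. \<rho>n n t X = S.rm n t X" "sqint lborel (\<rho>n n t)" if "1 \<le> n" "t \<in> {0..T}" for n t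
    unfolding S.rm_def using \<rho>c[OF that(2) that(2) _ that(1) that(1) _ that(1)] by simp_all
  \<comment> \<open>Coefficient and slice agree at each t off a null set that depends on t; the
    iterated integral in \<open>regT\<close> looks at one time after the other, so this
    suffices.\<close>
  have regT: "regT T lborel u' \<phi> = regT T lborel u \<phi>"
    if "test_fun ({0<..<T} \<times> UNIV) \<phi>" "contL2 T lborel u"
      "\<And>t. t \<in> {0..T} \<Longrightarrow> AE X in lborel. u' t X = u t X" "\<And>t. t \<in> {0..T} \<Longrightarrow> sqint lborel (u' t)"
    for u u' :: "real \<Rightarrow> real ^ 'd \<Rightarrow> real" and \<phi>
  proof (rule regT_cong_AE)
    show "u' t \<in> borel_measurable lborel" if "t \<in> {0..T}" for t using \<open>\<And>t. t \<in> {0..T} \<Longrightarrow> sqint lborel (u' t)\<close>[OF that] by (simp add: sqint_def)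
    show "(\<lambda>x. \<phi> (t, x)) \<in> borel_measurable lborel" for t using S.section_sqint[OF that(1), of t] by (simp add: sqint_def)
  qed (use that contL2_sqint[OF that(2)] in blast)+
  note regT_V = regT[OF _ S.contL2_Vm V_eq] and regT_P = regT[OF _ S.contL2_Pm P_eq]
  have regT_w: "regT T lborel (wn n) \<phi> = S.W (S.wm n) \<phi>" if "test_fun ({0<..<T} \<times> UNIV) \<phi>" "1 \<le> n" for n \<phi>
    by (rule regT[OF that(1) S.contL2_wm[OF that(2)] w_eq(1)[OF that(2)] w_eq(2)[OF that(2)]])
  have regT_\<rho>: "regT T lborel (\<rho>n n) \<phi> = S.W (S.rm n) \<phi>" if "test_fun ({0<..<T} \<times> UNIV) \<phi>" "1 \<le> n" for n \<phi>
    by (rule regT[OF that(1) S.contL2_rm[OF that(2)] \<rho>_eq(1)[OF that(2)] \<rho>_eq(2)[OF that(2)]])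
  have sol: "modal_solution s T N (c n) (V0n n) (\<rho>0n n) (Vn n) (\<rho>n n)" if n: "1 \<le> n" for n
    unfolding modal_solution_def
  proof (intro conjI allI impI)
    show "cont_in T (Hs s) (Hs_norm s) (\<lambda>t X. Vn n t X $ i)" for i
      using cont_in_slice[OF V_cont S.sqint_rgm pos(5) V_eq(2) V_eq(1)[unfolded S.Vm_def]] .
    show "cont_in T (Hs s) (Hs_norm s) (\<rho>n n)"
      using cont_in_slice[OF \<rho>_cont sqint_cmult[OF S.sqint_f[OF n]] pos(5) \<rho>_eq(2)[OF n] \<rho>_eq(1)[OF n, unfolded S.rm_def]] .
    fix \<phi> :: "real \<times> (real ^ 'd) \<Rightarrow> real" assume \<phi>: "test_fun ({0<..<T} \<times> UNIV) \<phi>"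
    note t = test_fun_pd[OF \<phi> Basis_dt] test_fun_pd[OF \<phi> Basis_dx]
      test_fun_pd[OF test_fun_pd[OF test_fun_pd[OF \<phi> Basis_dx] Basis_dx] Basis_dt]
    show "D dt (regT T lborel (\<lambda>t X. Vn n t X $ i)) \<phi>
              - (c n)\<^sup>2 / N\<^sup>2 * (\<Sum>j\<in>UNIV. D (dx j) (D (dx j) (D dt (regT T lborel (\<lambda>t X. Vn n t X $ i)))) \<phi>)
              + c n * D (dx i) (regT T lborel (\<rho>n n)) \<phi> = 0" for i
      using S.mode_velocity[OF \<phi> n, of i] unfolding D_def by (simp only: regT_V[OF t(1)] regT_V[OF t(3)] regT_\<rho>[OF t(2) n])
    show "D dt (regT T lborel (\<rho>n n)) \<phi> + c n * (\<Sum>i\<in>UNIV. D (dx i) (regT T lborel (\<lambda>t X. Vn n t X $ i)) \<phi>) = 0"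
      using S.mode_density[OF \<phi> n] unfolding D_def by (simp only: regT_V[OF t(2)] regT_\<rho>[OF t(1) n])
  next
    have iV: "AE x in strip H. V 0 x $ i = V0 x $ i" for i using initial by eventually_elim simp
    have i\<rho>: "AE x in strip H. \<rho> 0 x = \<rho>0 x" using initial by eventually_elim simp
    \<comment> \<open>The initial data are prescribed almost everywhere, so the expansion of V0 is
      first read as an expansion of V at time 0, whose coefficients are the slices.\<close>
    have v0: "AE X in lborel. V0n n X $ i = S.Vm n i 0 X" for i
      unfolding S.Vm_def
      by (rule expansion_coefficient(1)[OF expansion_cong_AE[OF V0_modes iV] contL2_sqint[OF V t0] S.sqint_gm S.sqint_rgm le0 S.dual_V])
    have "AE X in lborel. Vn n 0 X $ i = V0n n X $ i" for i using v0[of i] V_eq(1)[OF t0, of n i] by eventually_elim simp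
    then have "AE X in lborel. \<forall>i\<in>UNIV. Vn n 0 X $ i = V0n n X $ i" by (intro AE_finite_allI) auto
    moreover have "AE X in lborel. \<rho>0n n X = S.rm n 0 X"
      unfolding S.rm_def
      by (rule expansion_coefficient(1)[OF expansion_cong_AE[OF \<rho>0_modes i\<rho>] contL2_sqint[OF \<rho> t0] S.sqint_density_mode sqint_cmult[OF S.sqint_f[OF n]] n S.dual_rho[OF _ n]])
    ultimately show "AE X in lborel. Vn n 0 X = V0n n X \<and> \<rho>n n 0 X = \<rho>0n n X"
      using \<rho>_eq(1)[OF n t0] by eventually_elim (simp add: vec_eq_iff)
  qed
  have A: "\<forall>n\<ge>1.
            modal_solution s T N (c n) (V0n n) (\<rho>0n n) (Vn n) (\<rho>n n) \<and>
            (\<forall>V' \<rho>'. modal_solution s T N (c n) (V0n n) (\<rho>0n n) V' \<rho>' \<longrightarrow>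
               (\<forall>t\<in>{0..T}. AE X in lborel. V' t X = Vn n t X \<and> \<rho>' t X = \<rho>n n t X)) \<and>
            (\<forall>\<phi>. test_fun ({0<..<T} \<times> UNIV) \<phi> \<longrightarrow>
               regT T lborel (wn n) \<phi>
                 = - c n * (\<Sum>i\<in>UNIV. D (dx i) (regT T lborel (\<lambda>t X. Vn n t X $ i)) \<phi>) \<and>
               regT T lborel (Pn n) \<phi>
                 = c n * regT T lborel (\<rho>n n) \<phi> + c n / N\<^sup>2 * D dt (regT T lborel (wn n)) \<phi>)"
  proof (intro allI impI conjI ballI)
    fix n :: nat assume n: "1 \<le> n"
    show "modal_solution s T N (c n) (V0n n) (\<rho>0n n) (Vn n) (\<rho>n n)" by (rule sol[OF n])
    show "AE X in lborel. V' t X = Vn n t X \<and> \<rho>' t X = \<rho>n n t X"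
      if "modal_solution s T N (c n) (V0n n) (\<rho>0n n) V' \<rho>'" "t \<in> {0..T}" for V' \<rho>' t
      by (rule modal_solution_unique[OF sol[OF n] that(1) pos(4,5) that(2)])
    fix \<phi> :: "real \<times> (real ^ 'd) \<Rightarrow> real" assume \<phi>: "test_fun ({0<..<T} \<times> UNIV) \<phi>"
    note t = test_fun_pd[OF \<phi> Basis_dt] test_fun_pd[OF \<phi> Basis_dx]
    show "regT T lborel (wn n) \<phi> = - c n * (\<Sum>i\<in>UNIV. D (dx i) (regT T lborel (\<lambda>t X. Vn n t X $ i)) \<phi>)"
      using S.mode_w[OF \<phi> n] unfolding D_def by (simp only: regT_V[OF t(2)] regT_w[OF \<phi> n])
    show "regT T lborel (Pn n) \<phi> = c n * regT T lborel (\<rho>n n) \<phi> + c n / N\<^sup>2 * D dt (regT T lborel (wn n)) \<phi>"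
      using S.mode_P[OF \<phi> n] unfolding D_def by (simp only: regT_P[OF \<phi>] regT_\<rho>[OF \<phi> n] regT_w[OF t(1) n])
  qed
  have B: "AE X in lborel. Pn 0 t X = 0 \<and> Vn 0 t X = 0" if t: "t \<in> {0..T}" for t
  proof -
    have "AE X in lborel. Vn 0 t X $ i = 0" for i using V_eq(1)[OF t, of 0 i] S.velocity_0[OF t, of i] by eventually_elim simp
    then have "AE X in lborel. \<forall>i\<in>UNIV. Vn 0 t X $ i = 0" by (intro AE_finite_allI) auto
    then show ?thesis using P_eq(1)[OF t, of 0] S.pressure_0[OF t] by eventually_elim (simp add: vec_eq_iff)
  qed
  have C: "(\<forall>n\<ge>1. Hs s (\<rho>n n t) \<and> (\<forall>i. Hs s (\<lambda>X. Vn n t X $ i)) \<and> Hs s (wn n t)) \<and>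
            summable (\<lambda>n. (Hs_norm s (\<rho>n (Suc n) t))\<^sup>2
               + (\<Sum>i\<in>UNIV. (Hs_norm s (\<lambda>X. Vn (Suc n) t X $ i))\<^sup>2)
               + (Hs_norm s (wn (Suc n) t))\<^sup>2)" if t: "t \<in> {0..T}" for t
  proof (intro conjI allI impI)
    have h: "Hs0 H s (\<lambda>x. V t x $ i)" "Hs0 H s (w t)" "Hs0 H s (\<rho> t)" for i
      using V_cont w_cont \<rho>_cont t by (auto simp: cont_in_def)
    have m: "(\<lambda>X. Vn n t X $ i) \<in> borel_measurable lborel" "1 \<le> n \<Longrightarrow> wn n t \<in> borel_measurable lborel"
      "1 \<le> n \<Longrightarrow> \<rho>n n t \<in> borel_measurable lborel" for n i
      using V_eq(2)[OF t] w_eq(2)[OF _ t] \<rho>_eq(2)[OF _ t] by (auto simp: sqint_def)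
    show "Hs s (\<rho>n n t)" if n: "1 \<le> n" for n
      by (rule Hs0_slice(1)[OF h(3) sqint_cmult[OF S.sqint_f[OF n]] m(3)[OF n] \<rho>_eq(1)[OF n t, unfolded S.rm_def]])
    show "Hs s (\<lambda>X. Vn n t X $ i)" for n i
      by (rule Hs0_slice(1)[OF h(1) S.sqint_rgm m(1) V_eq(1)[OF t, unfolded S.Vm_def]])
    show "Hs s (wn n t)" if n: "1 \<le> n" for n
      by (rule Hs0_slice(1)[OF h(2) S.sqint_rf[OF n] m(2)[OF n] w_eq(1)[OF n t, unfolded S.wm_def]])
    have n1: "1 \<le> Suc n" for n by simp
    show "summable (\<lambda>n. (Hs_norm s (\<rho>n (Suc n) t))\<^sup>2 + (\<Sum>i\<in>UNIV. (Hs_norm s (\<lambda>X. Vn (Suc n) t X $ i))\<^sup>2) + (Hs_norm s (wn (Suc n) t))\<^sup>2)"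
      by (intro summable_add summable_sum
          S.summable_Hs_norm_rho[OF h(3) m(3)[OF n1] \<rho>_eq(1)[OF n1 t, unfolded S.rm_def]]
          S.summable_Hs_norm_V[OF h(1) m(1) V_eq(1)[OF t, unfolded S.Vm_def]]
          S.summable_Hs_norm_w[OF h(2) m(2)[OF n1] w_eq(1)[OF n1 t, unfolded S.wm_def]])
  qed
  show ?thesis
  proof (intro conjI[OF A conjI] ballI)
    show "AE X in lborel. Pn 0 t X = 0 \<and> Vn 0 t X = 0" if "t \<in> {0..T}" for t by (rule B[OF that])
  qed (rule C)
qed

end
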